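(* Let $1\le m'\le m\le r$ and $1\le d<r$ be integers, let $n=(m-1)r+d$, $k=(m'-1)r+d$, let $u=(s_1s_2\cdots s_r)^{m-1}s_1\cdots s_d$ and let $\mathbf i=(1,\dots,r,\,1,\dots,r,\,\dots,\,1,\dots,r,\,1,\dots,d)$ ($m-1$ full cycles $1,\dots,r$, followed by $1,\dots,d$) be its reduced word, so that $i_k=i_n=d$ and the $k$-th letter belongs to the $m'$-th cycle. Let $\mathbf Y=(Y_{1,1},\dots,Y_{1,r},\dots,Y_{m-1,1},\dots,Y_{m-1,r},Y_{m,1},\dots,Y_{m,d})\in(\mathbb C^\times)^n$. Then $$\Delta^L(k;\mathbf i)(\mathbf Y)=\sum_{( * )}2^{C[\{k^{(s)}_i\}]}\prod_{i=1}^{d}\prod_{s=1}^{m-m'}B\bigl(m-l^{(s)}_i,\,k^{(s)}_i\bigr),$$ where $$l^{(s)}_i:=\begin{cases}k^{(s)}_i+s-i-1 & \text{if } k^{(s)}_i\in\{1,2,\dots,r\},\\ s-i+r & \text{if } k^{(s)}_i\in\{0,\overline r,\overline{r-1},\dots,\overline 1\},\end{cases}$$ $$C[\{k^{(s)}_i\}]:=\#\{j\in[1,d-1]\mid k^{(t)}_{j+1}=0,\ k^{(t+1)}_{j+1}\ne 0\text{ and }k^{(t)}_j\neq 0\text{ for some }t\in[1,m-m']\}$$ (for $t=m-m'$ the condition $k^{(t+1)}_{j+1}\neq0$ is regarded as satisfied), and the sum runs over all families $(k^{(s)}_i)_{1\le i\le d,\ 1\le s\le m-m'}$ of elements of $J=\{1,\dots,r,0,\overline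 r,\dots,\overline 1\}$ satisfying the following conditions $( * )$, with respect to the total order $1<2<\cdots<r<0<\overline r<\cdots<\overline 2<\overline 1$: 1. $1\le k^{(s)}_1\le k^{(s)}_2\le\cdots\le k^{(s)}_d\le\overline 1$ for every $s$, and $k^{(s)}_i=k^{(s)}_{i+1}$ if and only if $k^{(s)}_i=k^{(s)}_{i+1}=0$; 2. $1\le k^{(1)}_i\le\cdots\le k^{(m-m')}_i\le m'+i$ for $1\le i\le d$ with $i\le r-m'$; 3. $1\le k^{(1)}_i\le\cdots\le k^{(m-m')}_i\le\overline 1$ for $r-m'+1\le i\le d$; 4. $k^{(s)}_i<k^{(s+1)}_{i+1}$ for $1\le i\le d-1$, $1\le s\le m-m'-1$.
   Context: Let $G$ be the simply connected simple algebraic group over $\mathbb C$ of type $\mathrm B_r$, $B,B_-$ opposite Borel subgroups, $N\subset B$, $N_-\subset B_-$ their unipotent radicals, $H=B\cap B_-$, $W=\mathrm{Norm}_G(H)/H$ the Weyl group with simple reflections $s_1,\dots,s_r$. Chevalley generators $e_i,f_i$ and simple coroots $h_i$ ($1\le i\le r$) of $\mathrm{Lie}(G)$ are taken for the Cartan matrix $a_{ij}=\alpha_j(h_i)$ with $a_{ii}=2$, $a_{ij}=-1$ if $|i-j|=1$ and $(i,j)\ne(r,r-1)$, $a_{r,r-1}=-2$, and $a_{ij}=0$ otherwise ($\alpha_r$ is the short simple root). $\Lambda_i$ is the $i$-th fundamental weight. Put $x_i(t)=\exp(te_i)$, $y_i(t)=\exp(tf_i)$, $\alpha_i^\vee(t)=t^{h_i}$,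 $x_{-i}(t)=y_i(t)\alpha_i^\vee(t^{-1})$ and $\overline{s_i}=x_i(-1)y_i(1)x_i(-1)$; for a reduced expression $w=s_{j_1}\cdots s_{j_p}$ put $\overline w=\overline{s_{j_1}}\cdots\overline{s_{j_p}}$. Generalized minor: for $x\in G_0=N_-HN$ write $x=[x]_-[x]_0[x]_+$ with $[x]_-\in N_-$, $[x]_0\in H$, $[x]_+\in N$. For $w\in W$, $\Delta_{w\Lambda_i,\Lambda_i}$ is the regular function on $G$ whose restriction to $\overline wG_0$ is $x\mapsto([\overline w^{-1}x]_0)^{\Lambda_i}$. For a reduced word $\mathbf i=(i_1,\dots,i_n)$ and $1\le k\le n$ put $u_{\le k}=s_{i_1}\cdots s_{i_k}$, $\Delta(k;\mathbf i)=\Delta_{u_{\le k}\Lambda_{i_k},\Lambda_{i_k}}$, and $x^L_{\mathbf i}(t_1,\dots,t_n)=x_{-i_1}(t_1)\cdots x_{-i_n}(t_n)$. Define $\Delta^L(k;\mathbf i)(\mathbf Y)=\Delta(k;\mathbf i)(x^L_{\mathbf i}(\mathbf Y))$, where the entries of $\mathbf Y$ are inserted in the listed order as $t_1,\dots,t_n$. Laurent monomials: $$B(l,k):=\begin{cases}\frac{Y_{l,k-1}}{Y_{l,k}}&1\le k\le r-1,\\ \frac{Y_{l,r-1}}{Y_{l,r}^2}&k=r,\\ \frac{Y_{l,r}}{Y_{l+1,r}}&k=0,\\ \frac{Y_{l,r}^2}{Y_{l+1,r-1}}&k=\overline r,\\ \frac{Y_{l,|k|}}{Y_{l+1,|k|-1}}&\overline{r-1}\le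 k\le\overline 1,\end{cases}$$ where $|\overline j|=|j|=j$ for $1\le j\le r$, with the convention $Y_{s,0}=1$. Empty products equal $1$ (and for $m=m'$ the sum has the single term given by the empty family). $[1,l]=\{1,\dots,l\}$. *)

theory Defs
  imports "HOL-Analysis.Analysis" "HOL-Algebra.Generated_Groups"
begin

section \<open>Linear algebraic groups over the complex numbers\<close>

definition GL :: "(complex^'n^'n) monoid" where
  "GL = \<lparr>carrier = {g. invertible g}, mult = (**), one = mat 1\<rparr>"

definition cscale :: "complex \<Rightarrow> complex^'n^'n \<Rightarrow> complex^'n^'n" where
  "cscale c A = (\<chi> i j. c * A $ i $ j)"

definition lie_bracket :: "complex^'n^'n \<Rightarrow> complex^'n^'n \<Rightarrow> complex^'n^'n" where
  "lie_bracket A B = A ** B - B ** A"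

definition mexp :: "complex^'n^'n \<Rightarrow> complex^'n^'n" where
  "mexp A = (\<Sum>k. (1 / fact k) *\<^sub>R (((**) A) ^^ k) (mat 1))"

definition mprod :: "(complex^'n^'n) list \<Rightarrow> complex^'n^'n" where
  "mprod As = foldr (**) As (mat 1)"

inductive_set poly_funs :: "(complex^'n^'n \<Rightarrow> complex) set" where
  const: "(\<lambda>_. c) \<in> poly_funs"
| entry: "(\<lambda>A. A $ i $ j) \<in> poly_funs"
| add: "p \<in> poly_funs \<Longrightarrow> q \<in> poly_funs \<Longrightarrow> (\<lambda>A. p A + q A) \<in> poly_funs"
| mult: "p \<in> poly_funs \<Longrightarrow> q \<in> poly_funs \<Longrightarrow> (\<lambda>A. p A * q A) \<in> poly_funs"

definition linear_algebraic_group :: "(complex^'n^'n) set \<Rightarrow> bool" where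
  "linear_algebraic_group G \<longleftrightarrow> subgroup G GL \<and>
     (\<exists>P \<subseteq> poly_funs. G = {g. invertible g \<and> (\<forall>p\<in>P. p g = 0)})"

text \<open>Elements of the coordinate ring, extended by \<open>undefined\<close> off \<open>G\<close> so that
  two regular functions are equal as soon as they agree on \<open>G\<close>.\<close>

definition regular_functions :: "(complex^'n^'n) set \<Rightarrow> (complex^'n^'n \<Rightarrow> complex) set" where
  "regular_functions G = {restrict (\<lambda>g. p g / det g ^ k) G | p k. p \<in> poly_funs}"

definition Lie :: "(complex^'n^'n) set \<Rightarrow> (complex^'n^'n) set" where
  "Lie G = {X. \<forall>t. mexp (cscale t X) \<in> G}"

text \<open>For complex algebraic groups, connectedness in the Zariski and in the Euclidean topology
  agree; likewise, for semisimple groups, the root-datum and the topological notions of being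
  simply connected agree.  The Euclidean topology is the one of \<open>complex^'n^'n\<close>.\<close>

definition simple_algebraic_group :: "(complex^'n^'n) set \<Rightarrow> bool" where
  "simple_algebraic_group G \<longleftrightarrow>
     linear_algebraic_group G \<and> connected G \<and> \<not> comm_group (GL\<lparr>carrier := G\<rparr>) \<and>
     (\<forall>K. linear_algebraic_group K \<and> connected K \<and> normal K (GL\<lparr>carrier := G\<rparr>)
          \<longrightarrow> K = {mat 1} \<or> K = G)"

section \<open>Chevalley generators of type B\<close>

definition cartan_B :: "nat \<Rightarrow> nat \<Rightarrow> nat \<Rightarrow> int" where
  "cartan_B r i j =
     (if i = j then 2
      else if i = r \<and> j + 1 = r then - 2
      else if i = j + 1 \<or> j = i + 1 then - 1
      else 0)"

inductive_set lie_generated :: "(complex^'n^'n) set \<Rightarrow> (complex^'n^'n) set"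
  for S :: "(complex^'n^'n) set" where
  zero: "0 \<in> lie_generated S"
| base: "X \<in> S \<Longrightarrow> X \<in> lie_generated S"
| add: "X \<in> lie_generated S \<Longrightarrow> Z \<in> lie_generated S \<Longrightarrow> X + Z \<in> lie_generated S"
| scale: "X \<in> lie_generated S \<Longrightarrow> cscale c X \<in> lie_generated S"
| bracket: "X \<in> lie_generated S \<Longrightarrow> Z \<in> lie_generated S \<Longrightarrow> lie_bracket X Z \<in> lie_generated S"

definition chevalley_generators_B ::
  "nat \<Rightarrow> (complex^'n^'n) set \<Rightarrow> (nat \<Rightarrow> complex^'n^'n) \<Rightarrow> (nat \<Rightarrow> complex^'n^'n)
    \<Rightarrow> (nat \<Rightarrow> complex^'n^'n) \<Rightarrow> bool" where
  "chevalley_generators_B r G e f h \<longleftrightarrow>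
     (\<forall>i\<in>{1..r}. e i \<in> Lie G \<and> f i \<in> Lie G \<and> h i \<in> Lie G) \<and>
     (\<forall>i\<in>{1..r}. \<forall>j\<in>{1..r}.
        lie_bracket (h i) (h j) = 0 \<and>
        lie_bracket (h i) (e j) = cscale (of_int (cartan_B r i j)) (e j) \<and>
        lie_bracket (h i) (f j) = cscale (- of_int (cartan_B r i j)) (f j) \<and>
        lie_bracket (e i) (f j) = (if i = j then h i else 0) \<and>
        (i \<noteq> j \<longrightarrow>
           (lie_bracket (e i) ^^ nat (1 - cartan_B r i j)) (e j) = 0 \<and>
           (lie_bracket (f i) ^^ nat (1 - cartan_B r i j)) (f j) = 0)) \<and>
     Lie G = lie_generated (e ` {1..r} \<union> f ` {1..r})"

text \<open>With \<open>E = e\<close> this is \<open>x\<^sub>i(t)\<close>, with \<open>E = f\<close> it is \<open>y\<^sub>i(t)\<close>.\<close>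

definition one_param :: "(nat \<Rightarrow> complex^'n^'n) \<Rightarrow> nat \<Rightarrow> complex \<Rightarrow> complex^'n^'n" where
  "one_param E i t = mexp (cscale t (E i))"

text \<open>\<open>t^(h i)\<close> for \<open>t \<noteq> 0\<close>; the branch of the logarithm is irrelevant because
  the eigenvalues of \<open>h i\<close> are integers.\<close>

definition coroot_hom :: "(nat \<Rightarrow> complex^'n^'n) \<Rightarrow> nat \<Rightarrow> complex \<Rightarrow> complex^'n^'n" where
  "coroot_hom h i t = mexp (cscale (Ln t) (h i))"

text \<open>\<open>x\<^bsub>-i\<^esub>(t)\<close>\<close>

definition x_minus ::
  "(nat \<Rightarrow> complex^'n^'n) \<Rightarrow> (nat \<Rightarrow> complex^'n^'n) \<Rightarrow> nat \<Rightarrow> complex \<Rightarrow> complex^'n^'n" where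
  "x_minus f h i t = one_param f i t ** coroot_hom h i (inverse t)"

definition simple_lift ::
  "(nat \<Rightarrow> complex^'n^'n) \<Rightarrow> (nat \<Rightarrow> complex^'n^'n) \<Rightarrow> nat \<Rightarrow> complex^'n^'n" where
  "simple_lift e f i = one_param e i (- 1) ** one_param f i 1 ** one_param e i (- 1)"

text \<open>The lift of the Weyl group element with reduced expression \<open>js\<close>.\<close>

definition weyl_lift ::
  "(nat \<Rightarrow> complex^'n^'n) \<Rightarrow> (nat \<Rightarrow> complex^'n^'n) \<Rightarrow> nat list \<Rightarrow> complex^'n^'n" where
  "weyl_lift e f js = mprod (map (simple_lift e f) js)"

text \<open>The unipotent radicals of the opposite Borel subgroups attached to the Chevalley generators:
  \<open>N = unipotent_part r e\<close> and \<open>N\<^sub>- = unipotent_part r f\<close>.\<close>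

definition unipotent_part :: "nat \<Rightarrow> (nat \<Rightarrow> complex^'n^'n) \<Rightarrow> (complex^'n^'n) set" where
  "unipotent_part r E = generate GL {one_param E i t | i t. i \<in> {1..r}}"

definition torus_elt ::
  "nat \<Rightarrow> (nat \<Rightarrow> complex^'n^'n) \<Rightarrow> (nat \<Rightarrow> complex) \<Rightarrow> complex^'n^'n" where
  "torus_elt r h t = mprod (map (\<lambda>j. coroot_hom h j (t j)) [1..<r+1])"

text \<open>The maximal torus \<open>H\<close>: in a semisimple group it is the product of the
  images of the simple coroots.\<close>

definition torus :: "nat \<Rightarrow> (nat \<Rightarrow> complex^'n^'n) \<Rightarrow> (complex^'n^'n) set" where
  "torus r h = {torus_elt r h t | t. \<forall>j\<in>{1..r}. t j \<noteq> 0}"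

text \<open>The character \<open>a \<mapsto> a^(\<Lambda>\<^sub>i)\<close> of \<open>H\<close>, determined by
  \<open>\<Lambda>\<^sub>i(h\<^sub>j) = \<delta>\<^sub>i\<^sub>j\<close>.\<close>

definition fund_char :: "nat \<Rightarrow> (nat \<Rightarrow> complex^'n^'n) \<Rightarrow> nat \<Rightarrow> complex^'n^'n \<Rightarrow> complex" where
  "fund_char r h i a =
     (THE c. \<exists>t. (\<forall>j\<in>{1..r}. t j \<noteq> 0) \<and> a = torus_elt r h t \<and> c = t i)"

section \<open>Generalized minors\<close>

definition G0 ::
  "nat \<Rightarrow> (nat \<Rightarrow> complex^'n^'n) \<Rightarrow> (nat \<Rightarrow> complex^'n^'n) \<Rightarrow> (nat \<Rightarrow> complex^'n^'n)
    \<Rightarrow> (complex^'n^'n) set" where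
  "G0 r e f h =
     {n ** a ** n' | n a n'. n \<in> unipotent_part r f \<and> a \<in> torus r h \<and> n' \<in> unipotent_part r e}"

text \<open>\<open>[x]\<^sub>0\<close> for \<open>x\<close> in \<open>G0\<close>\<close>

definition torus_component ::
  "nat \<Rightarrow> (nat \<Rightarrow> complex^'n^'n) \<Rightarrow> (nat \<Rightarrow> complex^'n^'n) \<Rightarrow> (nat \<Rightarrow> complex^'n^'n)
    \<Rightarrow> complex^'n^'n \<Rightarrow> complex^'n^'n" where
  "torus_component r e f h x =
     (THE a. a \<in> torus r h \<and>
        (\<exists>n\<in>unipotent_part r f. \<exists>n'\<in>unipotent_part r e. x = n ** a ** n'))"

text \<open>\<open>\<Delta>\<close> with indices \<open>w \<Lambda>\<^sub>i\<close>, \<open>\<Lambda>\<^sub>i\<close>, where \<open>w\<close> is given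
  by a reduced expression \<open>js\<close>.\<close>

definition gen_minor ::
  "nat \<Rightarrow> (complex^'n^'n) set \<Rightarrow> (nat \<Rightarrow> complex^'n^'n) \<Rightarrow> (nat \<Rightarrow> complex^'n^'n)
    \<Rightarrow> (nat \<Rightarrow> complex^'n^'n) \<Rightarrow> nat list \<Rightarrow> nat \<Rightarrow> complex^'n^'n \<Rightarrow> complex" where
  "gen_minor r G e f h js i =
     (THE F. F \<in> regular_functions G \<and>
        (\<forall>x \<in> (**) (weyl_lift e f js) ` G0 r e f h.
           F x = fund_char r h i (torus_component r e f h (matrix_inv (weyl_lift e f js) ** x))))"

text \<open>\<open>\<Delta>(k; is)\<close>; the letters of a word are counted from 1 in the mathematics
  and from 0 by \<open>(!)\<close>.\<close>

definition Delta ::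
  "nat \<Rightarrow> (complex^'n^'n) set \<Rightarrow> (nat \<Rightarrow> complex^'n^'n) \<Rightarrow> (nat \<Rightarrow> complex^'n^'n)
    \<Rightarrow> (nat \<Rightarrow> complex^'n^'n) \<Rightarrow> nat \<Rightarrow> nat list \<Rightarrow> complex^'n^'n \<Rightarrow> complex" where
  "Delta r G e f h k is = gen_minor r G e f h (take k is) (is ! (k - 1))"

definition xL ::
  "(nat \<Rightarrow> complex^'n^'n) \<Rightarrow> (nat \<Rightarrow> complex^'n^'n) \<Rightarrow> nat list \<Rightarrow> complex list
    \<Rightarrow> complex^'n^'n" where
  "xL f h is ts = mprod (map2 (x_minus f h) is ts)"

definition DeltaL ::
  "nat \<Rightarrow> (complex^'n^'n) set \<Rightarrow> (nat \<Rightarrow> complex^'n^'n) \<Rightarrow> (nat \<Rightarrow> complex^'n^'n)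
    \<Rightarrow> (nat \<Rightarrow> complex^'n^'n) \<Rightarrow> nat \<Rightarrow> nat list \<Rightarrow> complex list \<Rightarrow> complex" where
  "DeltaL r G e f h k is ts = Delta r G e f h k is (xL f h is ts)"

section \<open>The word and the Laurent monomials\<close>

definition cyc_word :: "nat \<Rightarrow> nat \<Rightarrow> nat \<Rightarrow> nat list" where
  "cyc_word r m d = concat (replicate (m - 1) [1..<r+1]) @ [1..<d+1]"

text \<open>The first index of \<open>Y\<close> is an integer because it is computed by subtraction below.\<close>

definition Y_indices :: "nat \<Rightarrow> nat \<Rightarrow> nat \<Rightarrow> (int \<times> nat) list" where
  "Y_indices r m d =
     [(int l, j). l \<leftarrow> [1..<m], j \<leftarrow> [1..<r+1]] @ [(int m, j). j \<leftarrow> [1..<d+1]]"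

datatype letter = Unbarred nat | Zero | Barred nat

definition letters :: "nat \<Rightarrow> letter set" where
  "letters r = Unbarred ` {1..r} \<union> {Zero} \<union> Barred ` {1..r}"

text \<open>The position of a letter in \<open>1 < \<dots> < r < 0 < r-bar < \<dots> < 1-bar\<close>.\<close>

fun pos :: "nat \<Rightarrow> letter \<Rightarrow> nat" where
  "pos r (Unbarred k) = k"
| "pos r Zero = r + 1"
| "pos r (Barred k) = 2 * r + 2 - k"

definition letter_le :: "nat \<Rightarrow> letter \<Rightarrow> letter \<Rightarrow> bool" where
  "letter_le r a b \<longleftrightarrow> pos r a \<le> pos r b"

definition letter_less :: "nat \<Rightarrow> letter \<Rightarrow> letter \<Rightarrow> bool" where
  "letter_less r a b \<longleftrightarrow> pos r a < pos r b"

definition Yv :: "(int \<Rightarrow> nat \<Rightarrow> complex) \<Rightarrow> int \<Rightarrow> nat \<Rightarrow> complex" where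
  "Yv Y s j = (if j = 0 then 1 else Y s j)"

fun Bmon :: "nat \<Rightarrow> (int \<Rightarrow> nat \<Rightarrow> complex) \<Rightarrow> int \<Rightarrow> letter \<Rightarrow> complex" where
  "Bmon r Y l (Unbarred k) =
     (if k = r then Yv Y l (r - 1) / (Yv Y l r)^2 else Yv Y l (k - 1) / Yv Y l k)"
| "Bmon r Y l Zero = Yv Y l r / Yv Y (l + 1) r"
| "Bmon r Y l (Barred k) =
     (if k = r then (Yv Y l r)^2 / Yv Y (l + 1) (r - 1) else Yv Y l k / Yv Y (l + 1) (k - 1))"

section \<open>The index set of the sum\<close>

text \<open>A family \<open>k\<close> is a function of the pair \<open>(i, s)\<close> of its lower and its
  upper index.\<close>

fun lshift :: "nat \<Rightarrow> letter \<Rightarrow> nat \<Rightarrow> nat \<Rightarrow> int" where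
  "lshift r (Unbarred k) i s = int k + int s - int i - 1"
| "lshift r Zero i s = int s - int i + int r"
| "lshift r (Barred k) i s = int s - int i + int r"

text \<open>The bounds by the least letter \<open>1\<close> and the greatest letter \<open>1-bar\<close> are
  part of \<open>k (i, s) \<in> letters r\<close>.\<close>

definition admissible_families :: "nat \<Rightarrow> nat \<Rightarrow> nat \<Rightarrow> nat \<Rightarrow> (nat \<times> nat \<Rightarrow> letter) set" where
  "admissible_families r m m' d =
     {k \<in> ({1..d} \<times> {1..m - m'}) \<rightarrow>\<^sub>E letters r.
        (\<forall>s\<in>{1..m - m'}. \<forall>i\<in>{1..<d}.
           letter_le r (k (i, s)) (k (i + 1, s)) \<and>
           (k (i, s) = k (i + 1, s) \<longleftrightarrow> k (i, s) = Zero \<and> k (i + 1, s) = Zero)) \<and>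
        (\<forall>i\<in>{1..d}. i \<le> r - m' \<longrightarrow>
           (\<forall>s\<in>{1..<m - m'}. letter_le r (k (i, s)) (k (i, s + 1))) \<and>
           (m' < m \<longrightarrow> letter_le r (k (i, m - m')) (Unbarred (m' + i)))) \<and>
        (\<forall>i\<in>{r - m' + 1..d}.
           \<forall>s\<in>{1..<m - m'}. letter_le r (k (i, s)) (k (i, s + 1))) \<and>
        (\<forall>i\<in>{1..<d}. \<forall>s\<in>{1..<m - m'}. letter_less r (k (i, s)) (k (i + 1, s + 1)))}"

definition C_exp :: "nat \<Rightarrow> nat \<Rightarrow> nat \<Rightarrow> (nat \<times> nat \<Rightarrow> letter) \<Rightarrow> nat" where
  "C_exp m m' d k =
     card {j \<in> {1..d - 1}. \<exists>t\<in>{1..m - m'}.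
        k (j + 1, t) = Zero \<and> (t < m - m' \<longrightarrow> k (j + 1, t + 1) \<noteq> Zero) \<and> k (j, t) \<noteq> Zero}"

end

theory Submission
  imports Defs "HOL-Complex_Analysis.Complex_Analysis" "HOL-Combinatorics.Permutations"
begin

text \<open>For \<open>d < r\<close> the module with highest weight \<open>\<Lambda>\<^sub>d\<close> is the \<open>d\<close>-th exterior power of the vector
  representation of dimension \<open>2 r + 1\<close>, so the generalized minor is a minor of a matrix of that size, with
  columns \<open>1, \<dots>, d\<close> and with rows determined by the Weyl group element. The sum over families of
  letters is then the expansion of this minor over non-intersecting particles.

  The group is only given as a group of matrices, so the vector representation has to be found first. On the
  Lie algebra it is the map \<open>theta\<close> that sends iterated brackets of the generators to the same brackets of
  explicit operators; a grading argument (\<open>pair_zero_unique\<close>) shows that it is well defined. The group is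
  generated by its one-parameter subgroups (\<open>connected_group_generated\<close>), hence it consists of products over
  words in the generators, and a word acts on the vector representation by \<open>vw\<close>. That minors of size at most
  \<open>r\<close> are regular functions of the group element follows from the conjugation formula \<open>theta_gw\<close>: products
  of pairs of matrix entries that are antisymmetrized in a pair of dual columns are matrix coefficients of the
  adjoint representation, and Laplace expansion along all pairs of dual columns recovers the entries
  themselves (\<open>regular_word_psi\<close>). Such a minor has the values that define the generalized minor on a
  translate of the big cell, which is dense (\<open>big_cell_dense\<close>); this gives \<open>gen_minor_eq\<close>.

  In the vector representation \<open>x\<^bsub>-i\<^esub>(t)\<close> only involves adjacent positions. Factors for letters that
  differ by at least \<open>2\<close> commute, which permits to collect the factors with indices \<open>(l, j)\<close> according to
  \<open>c = l + j\<close> (\<open>vw_slices\<close>). The product over one such antidiagonal sends the basis vector at \<open>a\<close> to a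
  multiple of a sum over all positions from \<open>a\<close> on, with coefficients that do not depend on \<open>a\<close>, up to a
  factor \<open>2\<close> for \<open>a = r + 1\<close>. Subtracting multiples of neighbouring columns therefore cuts the \<open>i\<close>-th sum at
  the start of the next one, and the minor becomes a sum over \<open>d\<close> particles that move to the right without
  meeting (\<open>minor_eq_path_sum\<close>). The \<open>i\<close>-th particle starts at \<open>i\<close>, is at rest for \<open>c > m + i\<close>, and has
  reached its final position for \<open>c \<le> m' + i\<close>; its positions in between are the letters
  \<open>k\<^sub>i\<^sup>(\<^sup>1\<^sup>), k\<^sub>i\<^sup>(\<^sup>2\<^sup>), \<dots>\<close>, and non-intersection is the list of inequalities
  between letters. The weight that a particle collects at a position is the Laurent monomial \<open>B\<close>
  (\<open>letter_weight\<close>), the weights of particles that have arrived cancel between neighbours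
  (\<open>telescope_prod\<close>), and the factors \<open>2\<close> give the power of \<open>2\<close> (\<open>zero_weight\<close>).\<close>

no_notation fps_nth (infixl "$" 75)

section \<open>Exponentials of complex matrices\<close>

lemma cscale_nth [simp]: "cscale c A $ i $ j = c * A $ i $ j"
  by (simp add: cscale_def)

lemma matrix_mult_nth: "((A::complex^'n^'n) ** B) $ i $ j = (\<Sum>k\<in>UNIV. A $ i $ k * B $ k $ j)"
  by (simp add: matrix_matrix_mult_def)

lemma matrix_eqI: "(\<And>i j. A $ i $ j = B $ i $ j) \<Longrightarrow> (A::complex^'n^'n) = B"
  by (simp add: vec_eq_iff)

lemma cscale_mult_left: "cscale c A ** B = cscale c (A ** B)"
  by (rule matrix_eqI) (simp add: matrix_mult_nth sum_distrib_left mult.assoc)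

lemma cscale_mult_right: "A ** cscale c B = cscale c (A ** B)"
  by (rule matrix_eqI) (simp add: matrix_mult_nth sum_distrib_left mult.left_commute)

lemma cscale_cscale [simp]: "cscale a (cscale b A) = cscale (a * b) A"
  by (rule matrix_eqI) simp

lemma cscale_one [simp]: "cscale 1 A = A"
  by (rule matrix_eqI) simp

lemma cscale_zero [simp]: "cscale 0 A = 0"
  by (rule matrix_eqI) simp

lemma cscale_zero_right [simp]: "cscale c 0 = 0"
  by (rule matrix_eqI) simp

lemma cscale_add: "cscale c (A + B) = cscale c A + cscale c B"
  by (rule matrix_eqI) (simp add: algebra_simps)

lemma cscale_diff: "cscale c (A - B) = cscale c A - cscale c B"
  by (rule matrix_eqI) (simp add: algebra_simps)

lemma cscale_add_left: "cscale (a + b) A = cscale a A + cscale b A"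
  by (rule matrix_eqI) (simp add: algebra_simps)

lemma cscale_of_real: "cscale (of_real t) A = t *\<^sub>R A"
  by (rule matrix_eqI) (simp only: cscale_nth vector_scaleR_component, simp add: scaleR_conv_of_real)

lemma matrix_diff_ldistrib: "(A::complex^'n^'n) ** ((B::complex^'n^'n) - C) = A ** B - A ** C"
  by (rule matrix_eqI) (simp add: matrix_mult_nth algebra_simps sum_subtractf)

lemma matrix_diff_rdistrib: "((B::complex^'n^'n) - C) ** (A::complex^'n^'n) = B ** A - C ** A"
  by (rule matrix_eqI) (simp add: matrix_mult_nth algebra_simps sum_subtractf)

lemma matrix_zero_left [simp]: "(0::complex^'n^'n) ** (A::complex^'n^'n) = 0"
  by (rule matrix_eqI) (simp add: matrix_mult_nth)

lemma matrix_zero_right [simp]: "(A::complex^'n^'n) ** (0::complex^'n^'n) = 0"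
  by (rule matrix_eqI) (simp add: matrix_mult_nth)

lemma matrix_add_rdistrib: "((B::complex^'n^'n) + C) ** (A::complex^'n^'n) = B ** A + C ** A"
  by (rule matrix_eqI) (simp add: matrix_mult_nth algebra_simps sum.distrib)

lemmas matrix_ring_simps = matrix_mul_assoc matrix_diff_ldistrib matrix_diff_rdistrib
  matrix_add_ldistrib matrix_add_rdistrib cscale_mult_left cscale_mult_right
  cscale_add cscale_diff

definition mpow :: "complex^'n^'n \<Rightarrow> nat \<Rightarrow> complex^'n^'n" where
  "mpow A k = ((**) A ^^ k) (mat 1)"

lemma mpow_0 [simp]: "mpow A 0 = mat 1"
  by (simp add: mpow_def)

lemma mpow_Suc: "mpow A (Suc k) = A ** mpow A k"
  by (simp add: mpow_def)

lemma mpow_intertwine: "(A::complex^'n^'n) ** (S::complex^'n^'n) = S ** B \<Longrightarrow> mpow A k ** S = S ** mpow B k"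
proof (induction k)
  case (Suc k)
  have "mpow A (Suc k) ** S = A ** (S ** mpow B k)"
    using Suc by (simp add: mpow_Suc matrix_mul_assoc[symmetric])
  also have "\<dots> = S ** mpow B (Suc k)"
    using Suc.prems by (simp add: mpow_Suc matrix_mul_assoc)
  finally show ?case .
qed simp

lemma mpow_cscale: "mpow (cscale t A) k = cscale (t ^ k) (mpow A k)"
  by (induction k) (simp_all add: mpow_Suc cscale_mult_left cscale_mult_right mult.commute)

lemma mpow_entry_bound:
  fixes A :: "complex^'n^'n"
  assumes "\<And>i j. norm (A $ i $ j) \<le> a"
  shows "norm (mpow A k $ i $ j) \<le> (real CARD('n) * a) ^ k"
proof (induction k arbitrary: i j)
  case 0
  then show ?case by (simp add: mat_def)
next
  case (Suc k)
  have a0: "a \<ge> 0" using norm_ge_zero order_trans assms by blast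
  have "norm (mpow A (Suc k) $ i $ j) \<le> (\<Sum>l\<in>UNIV. norm (A $ i $ l * mpow A k $ l $ j))"
    unfolding mpow_Suc matrix_mult_nth by (rule norm_sum)
  also have "\<dots> \<le> (\<Sum>l\<in>(UNIV::'n set). a * (real CARD('n) * a) ^ k)"
    by (rule sum_mono) (auto simp: norm_mult intro!: mult_mono assms Suc a0)
  also have "\<dots> = (real CARD('n) * a) ^ Suc k" by simp
  finally show ?case .
qed

definition entry_bound :: "complex^'n^'n \<Rightarrow> real" where
  "entry_bound A = (\<Sum>i\<in>UNIV. \<Sum>j\<in>UNIV. norm (A $ i $ j))"

lemma entry_le_entry_bound: "norm (A $ i $ j) \<le> entry_bound A"
proof -
  have "norm (A $ i $ j) \<le> (\<Sum>j\<in>UNIV. norm (A $ i $ j))"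
    by (rule member_le_sum) auto
  also have "\<dots> \<le> entry_bound A"
    unfolding entry_bound_def
    by (rule member_le_sum[where f = "\<lambda>i. \<Sum>j\<in>UNIV. norm (A $ i $ j)"]) (auto intro: sum_nonneg)
  finally show ?thesis .
qed

lemma summable_exp_bound: "summable (\<lambda>k. (c::real) ^ k / fact k)"
  using summable_exp[of c] by (simp add: field_simps)

lemma mexp_entry_summable: "summable (\<lambda>k. norm (mpow A k $ i $ j / fact k))"
  for A :: "complex^'n^'n"
proof (rule summable_comparison_test'[OF summable_exp_bound[of "real CARD('n) * entry_bound A"]])
  fix k :: nat
  show "norm (norm (mpow A k $ i $ j / fact k)) \<le> (real CARD('n) * entry_bound A) ^ k / fact k"
    using mpow_entry_bound[OF entry_le_entry_bound, of A k i j]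
    by (simp add: norm_divide divide_right_mono)
qed

lemma mexp_entry_sums: "(\<lambda>k. mpow A k $ i $ j / fact k) sums (mexp A $ i $ j)"
proof -
  define E where "E = (\<chi> i j. \<Sum>k. mpow A k $ i $ j / fact k)"
  have e: "(\<lambda>k. mpow A k $ i $ j / fact k) sums (E $ i $ j)" for i j
    using summable_norm_cancel[OF mexp_entry_summable[of A i j]]
    by (simp add: E_def summable_sums)
  have "(\<lambda>k. (1 / fact k) *\<^sub>R mpow A k) sums E"
    unfolding sums_def
  proof (intro vec_tendstoI)
    fix i j
    have "((\<lambda>n. \<Sum>k<n. mpow A k $ i $ j / fact k) \<longlonglongrightarrow> E $ i $ j)"
      using e[of i j] by (simp add: sums_def)
    then show "(\<lambda>n. (\<Sum>k<n. (1 / fact k) *\<^sub>R mpow A k) $ i $ j) \<longlonglongrightarrow> E $ i $ j"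
      by (simp add: scaleR_conv_of_real[where 'a = complex])
  qed
  then have "mexp A = E"
    unfolding mexp_def mpow_def[symmetric] by (simp add: sums_unique[symmetric])
  with e show ?thesis by simp
qed

lemma mexp_intertwine:
  fixes A S B :: "complex^'n^'n"
  assumes "A ** S = S ** B"
  shows "mexp A ** S = S ** mexp B"
proof (rule matrix_eqI)
  fix i j
  have "(\<lambda>k. \<Sum>l\<in>UNIV. mpow A k $ i $ l / fact k * S $ l $ j) sums
      (\<Sum>l\<in>UNIV. mexp A $ i $ l * S $ l $ j)"
    by (intro sums_sum sums_mult2 mexp_entry_sums)
  moreover have "(\<lambda>k. \<Sum>l\<in>UNIV. S $ i $ l * (mpow B k $ l $ j / fact k)) sums
      (\<Sum>l\<in>UNIV. S $ i $ l * mexp B $ l $ j)"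
    by (intro sums_sum sums_mult mexp_entry_sums)
  moreover have "(\<Sum>l\<in>UNIV. mpow A k $ i $ l / fact k * S $ l $ j) =
      (\<Sum>l\<in>UNIV. S $ i $ l * (mpow B k $ l $ j / fact k))" for k
    using arg_cong[OF mpow_intertwine[OF assms, of k], of "\<lambda>M. M $ i $ j / fact k"]
    by (simp add: matrix_mult_nth sum_divide_distrib)
  ultimately show "(mexp A ** S) $ i $ j = (S ** mexp B) $ i $ j"
    by (simp add: matrix_mult_nth sums_unique2)
qed

lemma mexp_zero [simp]: "mexp (0::complex^'n^'n) = mat 1"
proof (rule matrix_eqI)
  fix i j
  have *: "mpow (0::complex^'n^'n) k = (if k = 0 then mat 1 else 0)" for k
    by (cases k) (auto simp: mpow_Suc)
  have "(\<lambda>k. mpow (0::complex^'n^'n) k $ i $ j / fact k) sums (mat 1 $ i $ j)"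
  proof -
    have "(\<lambda>k. mpow (0::complex^'n^'n) k $ i $ j / fact k) = (\<lambda>k. if k = 0 then mat 1 $ i $ j else 0)"
      by (auto simp: *)
    then show ?thesis using sums_single[of 0 "\<lambda>k. mat 1 $ i $ j :: complex"] by simp
  qed
  then show "mexp 0 $ i $ j = mat 1 $ i $ j"
    using mexp_entry_sums sums_unique2 by blast
qed

text \<open>Entrywise complex derivatives of matrix-valued functions; they are the tool by which every
  identity between exponentials below is obtained: both sides agree at one point, and a suitable
  quotient of them has derivative zero.\<close>

definition has_matrix_derivative ::
  "(complex \<Rightarrow> complex^'n^'n) \<Rightarrow> complex^'n^'n \<Rightarrow> complex \<Rightarrow> bool" where
  "has_matrix_derivative F D t \<longleftrightarrow>
     (\<forall>i j. ((\<lambda>t. F t $ i $ j) has_field_derivative D $ i $ j) (at t))"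

lemma has_matrix_derivative_mult:
  assumes "has_matrix_derivative F D t" "has_matrix_derivative F' D' t"
  shows "has_matrix_derivative (\<lambda>t. F t ** F' t) (D ** F' t + F t ** D') t"
  unfolding has_matrix_derivative_def
proof (intro allI)
  fix i j
  have "((\<lambda>t. \<Sum>k\<in>UNIV. F t $ i $ k * F' t $ k $ j) has_field_derivative
      (\<Sum>k\<in>UNIV. F t $ i $ k * D' $ k $ j + D $ i $ k * F' t $ k $ j)) (at t)"
    using assms unfolding has_matrix_derivative_def
    by (intro DERIV_sum DERIV_mult'[where f="\<lambda>t. F t $ _ $ _"]) auto
  then show "((\<lambda>t. (F t ** F' t) $ i $ j) has_field_derivative (D ** F' t + F t ** D') $ i $ j) (at t)"
    by (simp add: matrix_mult_nth sum.distrib add.commute)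
qed

lemma has_matrix_derivative_const: "has_matrix_derivative (\<lambda>_. A) 0 t"
  by (simp add: has_matrix_derivative_def)

lemma has_matrix_derivative_cscale:
  assumes "(g has_field_derivative g') (at t)" "has_matrix_derivative F D t"
  shows "has_matrix_derivative (\<lambda>t. cscale (g t) (F t)) (cscale g' (F t) + cscale (g t) D) t"
  using assms unfolding has_matrix_derivative_def
  by (auto intro!: derivative_eq_intros simp: algebra_simps)

lemma has_matrix_derivative_chain:
  assumes "has_matrix_derivative F D (g t)" "(g has_field_derivative g') (at t)"
  shows "has_matrix_derivative (\<lambda>t. F (g t)) (cscale g' D) t"
  unfolding has_matrix_derivative_def
proof (intro allI)
  fix i j
  have "((\<lambda>t. F t $ i $ j) has_field_derivative D $ i $ j) (at (g t))"
    using assms(1) by (simp add: has_matrix_derivative_def)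
  from DERIV_chain2[OF this assms(2)]
  show "((\<lambda>t. F (g t) $ i $ j) has_field_derivative cscale g' D $ i $ j) (at t)"
    by (simp add: mult.commute)
qed

lemma has_matrix_derivative_zero_constant:
  assumes "convex S" "open S" "\<And>t. t \<in> S \<Longrightarrow> has_matrix_derivative F 0 t" "a \<in> S" "b \<in> S"
  shows "F a = F b"
proof (rule matrix_eqI)
  fix i j
  have "((\<lambda>t. F t $ i $ j) has_field_derivative 0) (at t within S)" if "t \<in> S" for t
    using assms(3)[OF that] unfolding has_matrix_derivative_def
    by (auto intro: has_field_derivative_at_within)
  then obtain c where "\<And>t. t \<in> S \<Longrightarrow> F t $ i $ j = c"
    using has_field_derivative_zero_constant[OF assms(1), of "\<lambda>t. F t $ i $ j"] by auto
  then show "F a $ i $ j = F b $ i $ j" using assms by simp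
qed

definition expt :: "complex^'n^'n \<Rightarrow> complex \<Rightarrow> complex^'n^'n" where
  "expt X t = mexp (cscale t X)"

lemma expt_0 [simp]: "expt X 0 = mat 1"
  by (simp add: expt_def)

lemma expt_entry_sums: "(\<lambda>k. mpow X k $ i $ j / fact k * t ^ k) sums (expt X t $ i $ j)"
  using mexp_entry_sums[of "cscale t X" i j] by (simp add: expt_def mpow_cscale mult.commute)

lemma expt_intertwine: "(A::complex^'n^'n) ** (S::complex^'n^'n) = S ** B \<Longrightarrow> expt A t ** S = S ** expt B t"
  unfolding expt_def by (rule mexp_intertwine) (simp add: cscale_mult_left cscale_mult_right)

lemma expt_commute: "expt X t ** X = X ** expt X t"
  by (rule expt_intertwine) simp

lemma has_matrix_derivative_expt: "has_matrix_derivative (expt X) (X ** expt X t) t"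
  unfolding has_matrix_derivative_def
proof (intro allI)
  fix i j
  define c where "c = (\<lambda>k. mpow X k $ i $ j / fact k)"
  have s: "summable (\<lambda>n. c n * y ^ n)" for y
    unfolding c_def using expt_entry_sums sums_summable by blast
  have eq: "expt X y $ i $ j = (\<Sum>n. c n * y ^ n)" for y
    unfolding c_def using expt_entry_sums sums_unique by blast
  have d: "diffs c n = mpow X (Suc n) $ i $ j / fact n" for n
    unfolding diffs_def c_def by (simp add: field_simps del: of_nat_Suc)
  have "(\<lambda>n. \<Sum>l\<in>UNIV. X $ i $ l * (mpow X n $ l $ j / fact n * t ^ n)) sums
      (\<Sum>l\<in>UNIV. X $ i $ l * expt X t $ l $ j)"
    by (intro sums_sum sums_mult expt_entry_sums)
  also have "(\<lambda>n. \<Sum>l\<in>UNIV. X $ i $ l * (mpow X n $ l $ j / fact n * t ^ n)) = (\<lambda>n. diffs c n * t ^ n)"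
    by (simp add: d mpow_Suc matrix_mult_nth sum_divide_distrib sum_distrib_right mult.assoc)
  finally have D: "(\<Sum>n. diffs c n * t ^ n) = (X ** expt X t) $ i $ j"
    by (simp add: sums_unique[symmetric] matrix_mult_nth)
  show "((\<lambda>t. expt X t $ i $ j) has_field_derivative (X ** expt X t) $ i $ j) (at t)"
    using termdiffs_strong_converges_everywhere[OF s, of t] unfolding D eq .
qed

lemma has_matrix_derivative_expt_chain:
  "(g has_field_derivative g') (at t) \<Longrightarrow>
     has_matrix_derivative (\<lambda>t. expt X (g t)) (cscale g' (X ** expt X (g t))) t"
  by (rule has_matrix_derivative_chain[OF has_matrix_derivative_expt])

lemma expt_add: "expt X (s + t) = expt X s ** expt X t"
proof -
  let ?F = "\<lambda>u. expt X u ** expt X (s + t - u)"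
  have "has_matrix_derivative ?F 0 u" for u
  proof -
    have "has_matrix_derivative (\<lambda>u. expt X (s + t - u)) (cscale (-1) (X ** expt X (s + t - u))) u"
      by (rule has_matrix_derivative_expt_chain) (auto intro!: derivative_eq_intros)
    from has_matrix_derivative_mult[OF has_matrix_derivative_expt[of X u] this]
    show ?thesis
      by (simp add: matrix_ring_simps expt_commute) (simp add: cscale_def vec_eq_iff has_matrix_derivative_def)
  qed
  from has_matrix_derivative_zero_constant[OF convex_UNIV open_UNIV this, of 0 s]
  show ?thesis by simp
qed

lemma expt_minus [simp]: "expt X t ** expt X (- t) = mat 1" "expt X (- t) ** expt X t = mat 1"
  using expt_add[of X t "-t"] expt_add[of X "-t" t] by simp_all

lemma expt_cancel [simp]: "A ** expt X t ** expt X (- t) = A" "A ** expt X (- t) ** expt X t = A"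
  by (simp_all flip: matrix_mul_assoc)

lemma expt_commuting:
  assumes "X ** Z = Z ** X"
  shows "expt X s ** expt Z t = expt Z t ** expt X s"
proof -
  have "expt Z t ** X = X ** expt Z t" by (rule expt_intertwine) (simp add: assms)
  then show ?thesis by (intro expt_intertwine) simp
qed

text \<open>The adjoint action on an eigenvector of \<open>ad X\<close>.\<close>

lemma expt_eigen:
  assumes "lie_bracket X Z = cscale c Z"
  shows "expt X t ** Z = cscale (exp (t * c)) (Z ** expt X t)"
proof -
  let ?F = "\<lambda>t. cscale (exp (- (t * c))) (expt X t ** Z ** expt X (- t))"
  have XZ: "X ** Z = Z ** X + cscale c Z"
    using assms by (simp add: lie_bracket_def algebra_simps)
  have "has_matrix_derivative ?F 0 t" for t
  proof -
    have 1: "has_matrix_derivative (\<lambda>t. expt X t ** Z) (X ** expt X t ** Z) t"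
      using has_matrix_derivative_mult[OF has_matrix_derivative_expt has_matrix_derivative_const] by simp
    have 2: "has_matrix_derivative (\<lambda>t. expt X (- t)) (cscale (-1) (X ** expt X (- t))) t"
      by (rule has_matrix_derivative_expt_chain) (auto intro!: derivative_eq_intros)
    have 3: "((\<lambda>t. exp (- (t * c))) has_field_derivative - c * exp (- (t * c))) (at t)"
      by (auto intro!: derivative_eq_intros)
    have "X ** expt X t ** Z ** expt X (- t) =
        expt X t ** (Z ** X + cscale c Z) ** expt X (- t)"
      unfolding XZ[symmetric] by (simp add: expt_commute matrix_mul_assoc)
    then show ?thesis
      using has_matrix_derivative_cscale[OF 3 has_matrix_derivative_mult[OF 1 2]]
      by (simp add: matrix_ring_simps)
        (simp add: has_matrix_derivative_def vec_eq_iff algebra_simps)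
  qed
  from has_matrix_derivative_zero_constant[OF convex_UNIV open_UNIV this, of 0 t]
  have "cscale (exp (- (t * c))) (expt X t ** Z ** expt X (- t)) = Z" by simp
  then have "cscale (exp (t * c)) (cscale (exp (- (t * c))) (expt X t ** Z ** expt X (- t)) ** expt X t)
      = cscale (exp (t * c)) (Z ** expt X t)" by simp
  then show ?thesis
    by (simp add: cscale_mult_left flip: exp_add)
qed

lemma expt_conj:
  fixes g g' :: "complex^'n^'n"
  assumes "g' ** g = mat 1" "g ** g' = mat 1"
  shows "expt (g ** X ** g') t = g ** expt X t ** g'"
proof -
  have "expt (g ** X ** g') t ** g = g ** expt X t"
    by (rule expt_intertwine) (simp add: assms flip: matrix_mul_assoc)
  then have "expt (g ** X ** g') t ** g ** g' = g ** expt X t ** g'" by simp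
  then show ?thesis by (simp add: assms flip: matrix_mul_assoc)
qed

lemma holomorphic_expt_entry: "(\<lambda>t. expt X (g t) $ i $ j) holomorphic_on S"
  if "g holomorphic_on S"
proof -
  have "(\<lambda>t. expt X t $ i $ j) holomorphic_on UNIV"
    using has_matrix_derivative_expt[of X] unfolding has_matrix_derivative_def holomorphic_on_def
    using field_differentiable_at_within field_differentiable_def by blast
  from holomorphic_on_compose[OF that holomorphic_on_subset[OF this subset_UNIV]]
  show ?thesis by (simp add: o_def)
qed

section \<open>Generation of a connected group by one-parameter subgroups\<close>

subsection \<open>Continuity and differentiability of the exponential\<close>

lemma norm_entry_le: "norm ((A::complex^'n^'n) $ i $ j) \<le> norm A"
  by (meson Finite_Cartesian_Product.norm_nth_le order_trans)

lemma norm_le_entries: "norm (A::complex^'n^'n) \<le> entry_bound A"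
proof -
  have "norm A \<le> (\<Sum>i\<in>UNIV. norm (A $ i))"
    by (simp add: norm_vec_def L2_set_le_sum)
  also have "\<dots> \<le> entry_bound A"
    unfolding entry_bound_def by (intro sum_mono) (simp add: norm_vec_def L2_set_le_sum)
  finally show ?thesis .
qed

lemma continuous_on_matrix:
  assumes "\<And>i j. continuous_on S (\<lambda>x. F x $ i $ j)"
  shows "continuous_on S (F :: 'a::topological_space \<Rightarrow> complex^'n^'n)"
  using assms unfolding continuous_on_def by (auto intro!: vec_tendstoI)

lemma bounded_bilinear_matrix_mult: "bounded_bilinear ((**) :: complex^'n^'n \<Rightarrow> complex^'n^'n \<Rightarrow> complex^'n^'n)"
  unfolding bilinear_conv_bounded_bilinear[symmetric] bilinear_def
  by (auto intro!: linearI matrix_eqI simp: matrix_mult_nth sum.distrib algebra_simps scaleR_sum_right)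

lemma continuous_on_mpow: "continuous_on UNIV (\<lambda>A::complex^'n^'n. mpow A k)"
  by (induction k) (auto simp: mpow_Suc intro!: bounded_bilinear.continuous_on[OF bounded_bilinear_matrix_mult])

lemma continuous_on_mexp: "continuous_on S (mexp :: complex^'n^'n \<Rightarrow> _)"
proof (rule continuous_on_subset[OF _ subset_UNIV], rule continuous_on_matrix)
  fix i j :: 'n
  have "continuous_on (ball 0 R) (\<lambda>A::complex^'n^'n. mexp A $ i $ j)" for R
  proof -
    have "uniform_limit (ball 0 R) (\<lambda>n A. \<Sum>k<n. mpow A k $ i $ j / fact k)
        (\<lambda>A. \<Sum>k. mpow A k $ i $ j / fact k) sequentially"
    proof (rule Weierstrass_m_test[OF _ summable_exp_bound[of "real CARD('n) * R"]])
      fix k and A :: "complex^'n^'n" assume "A \<in> ball 0 R"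
      then have "norm (A $ a $ b) \<le> R" for a b
        using norm_entry_le[of A a b] by simp
      from mpow_entry_bound[OF this, of k i j]
      show "norm (mpow A k $ i $ j / fact k) \<le> (real CARD('n) * R) ^ k / fact k"
        by (simp add: norm_divide divide_right_mono)
    qed
    moreover have "continuous_on (ball 0 R) (\<lambda>A::complex^'n^'n. \<Sum>k<n. mpow A k $ i $ j / fact k)" for n
      by (intro continuous_intros continuous_on_subset[OF continuous_on_mpow]) auto
    ultimately have "continuous_on (ball 0 R) (\<lambda>A::complex^'n^'n. \<Sum>k. mpow A k $ i $ j / fact k)"
      by (intro uniform_limit_theorem) auto
    then show ?thesis
      by (simp add: sums_unique[OF mexp_entry_sums, symmetric])
  qed
  then have "continuous (at A) (\<lambda>A::complex^'n^'n. mexp A $ i $ j)" for A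
    using continuous_on_eq_continuous_at[OF open_ball, of 0 "norm A + 1"] by force
  then show "continuous_on UNIV (\<lambda>A::complex^'n^'n. mexp A $ i $ j)"
    using continuous_at_imp_continuous_on by blast
qed

text \<open>The terms of order at least two of the exponential series.\<close>

lemma mexp_entry_remainder:
  fixes A :: "complex^'n^'n"
  assumes "norm A \<le> 1"
  shows "norm ((mexp A - mat 1 - A) $ i $ j) \<le> norm A ^ 2 * exp (real CARD('n))"
proof -
  let ?c = "real CARD('n)"
  let ?f = "\<lambda>k. mpow A k $ i $ j / fact k"
  have "(\<lambda>k. ?f (k + 2)) sums (mexp A $ i $ j - (\<Sum>k<2. ?f k))"
    using sums_split_initial_segment[OF mexp_entry_sums[of A i j], of 2] .
  moreover have "mpow A (Suc 0) = A" by (simp add: mpow_Suc)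
  ultimately have s: "(\<lambda>k. ?f (k + 2)) sums ((mexp A - mat 1 - A) $ i $ j)"
    by (simp add: numeral_2_eq_2 lessThan_Suc algebra_simps)
  have e: "(\<lambda>k. norm A ^ 2 * (?c ^ k / fact k)) sums (norm A ^ 2 * exp ?c)"
    using sums_mult[OF exp_converges[of ?c], of "norm A ^ 2"] by (simp add: field_simps)
  have b: "norm (?f (k + 2)) \<le> norm A ^ 2 * (?c ^ (k + 2) / fact (k + 2))" for k
  proof -
    have "norm (mpow A (k + 2) $ i $ j) \<le> (?c * norm A) ^ (k + 2)"
      by (rule mpow_entry_bound) (rule norm_entry_le)
    also have "\<dots> = norm A ^ 2 * (?c ^ (k + 2) * norm A ^ k)"
      by (simp add: power_mult_distrib power_add power2_eq_square mult_ac)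
    also have "\<dots> \<le> norm A ^ 2 * (?c ^ (k + 2) * 1)"
      by (intro mult_left_mono power_le_one assms) auto
    finally show ?thesis by (simp add: norm_divide divide_right_mono del: fact_Suc)
  qed
  have e2: "summable (\<lambda>k. norm A ^ 2 * (?c ^ (k + 2) / fact (k + 2)))"
    using summable_ignore_initial_segment[OF sums_summable[OF e], of 2] by simp
  have "norm ((mexp A - mat 1 - A) $ i $ j) \<le> (\<Sum>k. norm A ^ 2 * (?c ^ (k + 2) / fact (k + 2)))"
    unfolding sums_unique[OF s] by (rule norm_suminf_le[OF b e2])
  also have "\<dots> = (norm A ^ 2 * exp ?c) - (\<Sum>k<2. norm A ^ 2 * (?c ^ k / fact k))"
    using suminf_minus_initial_segment[OF sums_summable[OF e], of 2] sums_unique[OF e] by simp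
  also have "\<dots> \<le> norm A ^ 2 * exp ?c"
    by (simp add: sum_nonneg)
  finally show ?thesis .
qed

lemma has_derivative_mexp_0: "(mexp has_derivative (\<lambda>A. A)) (at (0::complex^'n^'n))"
proof (rule has_derivativeI_sandwich[where e = 1 and s = UNIV])
  let ?n = "real CARD('n)"
  let ?C = "(\<Sum>i\<in>(UNIV::'n set). \<Sum>j\<in>(UNIV::'n set). exp ?n)"
  show "norm (mexp y - mexp 0 - (y - 0)) / norm (y - 0) \<le> norm y * ?C"
    if "y \<noteq> 0" "dist y 0 < 1" for y :: "complex^'n^'n"
  proof -
    have "norm (mexp y - mexp 0 - (y - 0)) \<le> entry_bound (mexp y - mat 1 - y)"
      using norm_le_entries[of "mexp y - mat 1 - y"] by simp
    also have "\<dots> \<le> (\<Sum>i\<in>(UNIV::'n set). \<Sum>j\<in>(UNIV::'n set). norm y ^ 2 * exp ?n)"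
      unfolding entry_bound_def using that by (intro sum_mono mexp_entry_remainder) auto
    also have "\<dots> = norm y ^ 2 * ?C" by simp
    finally show ?thesis using that by (simp add: field_simps power2_eq_square)
  qed
  show "((\<lambda>y::complex^'n^'n. norm y * ?C) \<longlongrightarrow> 0) (at 0)"
    by (intro tendsto_mult_left_zero tendsto_norm_zero) simp
qed (auto intro: bounded_linear_ident)

subsection \<open>Linear algebraic groups as sets of matrices\<close>

lemma group_GL: "group (GL :: (complex^'n^'n) monoid)"
proof (rule groupI)
  fix x :: "complex^'n^'n" assume "x \<in> carrier GL"
  then obtain y where "x ** y = mat 1" "y ** x = mat 1" by (auto simp: GL_def invertible_def)
  then show "\<exists>y\<in>carrier GL. y \<otimes>\<^bsub>GL\<^esub> x = \<one>\<^bsub>GL\<^esub>"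
    by (auto simp: GL_def invertible_def intro!: bexI[of _ y])
qed (auto simp: GL_def matrix_mul_assoc invertible_mult intro: invertible_def[THEN iffD2] exI[of _ "mat 1"])

lemma subgroup_GL_one: "subgroup G GL \<Longrightarrow> mat 1 \<in> G"
  using subgroup.one_closed[of G GL] by (simp add: GL_def)

lemma subgroup_GL_mult: "subgroup G GL \<Longrightarrow> a \<in> G \<Longrightarrow> b \<in> G \<Longrightarrow> a ** b \<in> G"
  using subgroup.m_closed[of G GL a b] by (simp add: GL_def)

lemma subgroup_GL_inverse:
  assumes "subgroup G GL" "a \<in> G"
  obtains b where "b \<in> G" "a ** b = mat 1" "b ** a = mat 1"
proof
  have a: "a \<in> carrier GL" by (rule subgroup.mem_carrier[OF assms])
  show "inv\<^bsub>GL\<^esub> a \<in> G" by (rule subgroup.m_inv_closed[OF assms])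
  show "a ** inv\<^bsub>GL\<^esub> a = mat 1" "inv\<^bsub>GL\<^esub> a ** a = mat 1"
    using group.r_inv[OF group_GL a] group.l_inv[OF group_GL a] by (simp_all add: GL_def)
qed

lemma poly_funs_continuous: "p \<in> poly_funs \<Longrightarrow> continuous_on UNIV p"
proof (induction rule: poly_funs.induct)
  case (entry i j)
  show ?case by (intro continuous_on_component continuous_on_id)
next
  case (add p q)
  then show ?case by (intro continuous_on_add)
next
  case (mult p q)
  then show ?case by (intro continuous_on_mult)
qed (rule continuous_on_const)

lemma poly_funs_holomorphic:
  assumes "p \<in> poly_funs" "\<And>i j. (\<lambda>t. F t $ i $ j) holomorphic_on S"
  shows "(\<lambda>t. p (F t)) holomorphic_on S"
  using assms(1)
proof (induction rule: poly_funs.induct)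
  case (entry i j)
  show ?case by (rule assms(2))
next
  case (add p q)
  then show ?case by (intro holomorphic_on_add)
next
  case (mult p q)
  then show ?case by (intro holomorphic_on_mult)
qed (rule holomorphic_on_const)

lemma invertible_expt: "invertible (expt X t)"
  unfolding invertible_def by (intro exI[of _ "expt X (- t)"]) simp

text \<open>A polynomial that vanishes on \<open>exp (t X)\<close> for real \<open>t \<ge> 0\<close> is, as
  an entire function of \<open>t\<close>, identically zero.\<close>

lemma expt_in_algebraic_group:
  assumes "linear_algebraic_group G" "\<And>t::real. t \<ge> 0 \<Longrightarrow> expt X (of_real t) \<in> G"
  shows "expt X z \<in> G"
proof -
  obtain P where P: "P \<subseteq> poly_funs" "G = {g. invertible g \<and> (\<forall>p\<in>P. p g = 0)}"
    using assms unfolding linear_algebraic_group_def by auto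
  have "invertible (expt X z)" by (rule invertible_expt)
  moreover have "p (expt X z) = 0" if "p \<in> P" for p
  proof -
    let ?U = "of_real ` {0<..<(1::real)} :: complex set"
    have hol: "(\<lambda>t. p (expt X t)) holomorphic_on UNIV"
      by (rule poly_funs_holomorphic[where F = "expt X"])
        (use that P(1) holomorphic_expt_entry[OF holomorphic_on_ident, where X = X and S = UNIV] in auto)
    have lim: "(0::complex) islimpt ?U"
      unfolding islimpt_sequential
    proof (intro exI conjI allI)
      show "complex_of_real (inverse (real (Suc (Suc n)))) \<in> ?U - {0}" for n
        by (intro DiffI imageI) (auto simp del: of_nat_Suc simp: inverse_less_1_iff)
      show "(\<lambda>n. complex_of_real (inverse (real (Suc (Suc n))))) \<longlonglongrightarrow> 0"
        using tendsto_of_real[OF LIMSEQ_Suc[OF LIMSEQ_inverse_real_of_nat]] by (simp only: of_real_0)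
    qed
    have zero: "p (expt X u) = 0" if u: "u \<in> ?U" for u
    proof -
      obtain t :: real where "u = of_real t" "0 < t" using u by auto
      then have "expt X u \<in> G" using assms(2)[of t] by simp
      then show ?thesis using P(2) \<open>p \<in> P\<close> by simp
    qed
    show ?thesis
      using Conformal_Mappings.analytic_continuation[OF hol open_UNIV connected_UNIV subset_UNIV UNIV_I lim zero UNIV_I] .
  qed
  ultimately show ?thesis by (simp add: P)
qed

lemma Lie_iff: "X \<in> Lie G \<longleftrightarrow> (\<forall>t. expt X t \<in> G)"
  by (simp add: Lie_def expt_def)

lemma Lie_conj:
  assumes "subgroup G GL" "g \<in> G" "g' \<in> G" "g ** g' = mat 1" "g' ** g = mat 1" "X \<in> Lie G"
  shows "g ** X ** g' \<in> Lie G"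
  using assms by (auto simp: Lie_iff expt_conj intro!: subgroup_GL_mult)

subsection \<open>The Lie algebra as a span of conjugates\<close>

lemma lie_bracket_cscale_left: "lie_bracket (cscale c X) Z = cscale c (lie_bracket X Z)"
  by (simp add: lie_bracket_def matrix_ring_simps)

lemma lie_bracket_add_left: "lie_bracket (X + X') Z = lie_bracket X Z + lie_bracket X' Z"
  by (simp add: lie_bracket_def matrix_ring_simps)

lemma lie_bracket_jacobi:
  "lie_bracket (lie_bracket X X') Z = lie_bracket X (lie_bracket X' Z) - lie_bracket X' (lie_bracket X Z)"
  by (simp add: lie_bracket_def matrix_ring_simps)

definition conjugates :: "(complex^'n^'n) set \<Rightarrow> (complex^'n^'n) set \<Rightarrow> (complex^'n^'n) set" where
  "conjugates K E = {g ** cscale c X ** g' | g g' c X.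
     g \<in> K \<and> g' \<in> K \<and> X \<in> E \<and> g ** g' = mat 1 \<and> g' ** g = mat 1}"

lemma linear_conj: "linear (\<lambda>Z. (g::complex^'n^'n) ** Z ** (g'::complex^'n^'n))"
  by (rule linear_compose[unfolded o_def, of "\<lambda>Z. g ** Z" "\<lambda>Z. Z ** g'"])
    (rule bounded_linear.linear[OF bounded_bilinear.bounded_linear_right[OF bounded_bilinear_matrix_mult]]
       bounded_linear.linear[OF bounded_bilinear.bounded_linear_left[OF bounded_bilinear_matrix_mult]])+

text \<open>The span is only a real one; it is stable under complex scalars because the generating set is.\<close>

lemma cscale_span_conjugates:
  assumes "Z \<in> span (conjugates K E)"
  shows "cscale c Z \<in> span (conjugates K E)"
proof -
  have "linear (cscale c)"
    by (rule linearI) (auto intro!: matrix_eqI simp: cscale_add algebra_simps)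
  then have "cscale c ` span (conjugates K E) = span (cscale c ` conjugates K E)"
    by (rule linear_span_image[symmetric])
  also have "\<dots> \<subseteq> span (conjugates K E)"
  proof (rule span_mono, rule image_subsetI)
    fix W assume "W \<in> conjugates K E"
    then obtain g g' b X where W: "W = g ** cscale b X ** g'" "g \<in> K" "g' \<in> K" "X \<in> E"
      "g ** g' = mat 1" "g' ** g = mat 1" unfolding conjugates_def by auto
    then have "cscale c W = g ** cscale (c * b) X ** g'" by (simp add: matrix_ring_simps)
    then show "cscale c W \<in> conjugates K E" using W unfolding conjugates_def by blast
  qed
  finally show ?thesis using assms by blast
qed

lemma conj_span_conjugates:
  assumes "\<And>a b. a \<in> K \<Longrightarrow> b \<in> K \<Longrightarrow> a ** b \<in> K" "k \<in> K" "k' \<in> K" "k ** k' = mat 1" "k' ** k = mat 1"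
    and "Z \<in> span (conjugates K E)"
  shows "k ** Z ** k' \<in> span (conjugates K E)"
proof -
  let ?c = "\<lambda>Z. k ** Z ** k'"
  have "?c ` span (conjugates K E) = span (?c ` conjugates K E)"
    by (rule linear_span_image[OF linear_conj, symmetric])
  also have "\<dots> \<subseteq> span (conjugates K E)"
  proof (rule span_mono, rule image_subsetI)
    fix W assume "W \<in> conjugates K E"
    then obtain g g' b X where W: "W = g ** cscale b X ** g'" "g \<in> K" "g' \<in> K" "X \<in> E"
      "g ** g' = mat 1" "g' ** g = mat 1" unfolding conjugates_def by auto
    have "k ** W ** k' = (k ** g) ** cscale b X ** (g' ** k')" using W by (simp add: matrix_mul_assoc)
    moreover have "(k ** g) ** (g' ** k') = k ** (g ** g') ** k'" "(g' ** k') ** (k ** g) = g' ** (k' ** k) ** g"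
      by (simp_all add: matrix_mul_assoc)
    ultimately show "k ** W ** k' \<in> conjugates K E"
      using W assms unfolding conjugates_def
      by (intro CollectI exI[of _ "k ** g"] exI[of _ "g' ** k'"] exI[of _ b] exI[of _ X]) auto
  qed
  finally show ?thesis using assms by blast
qed

text \<open>The bracket is the derivative of the conjugates at \<open>t = 0\<close>, and subspaces are closed.\<close>

lemma bracket_in_invariant_subspace:
  fixes X Z :: "complex^'n^'n"
  assumes V: "subspace V" and inv: "\<And>t. expt X t ** Z ** expt X (- t) \<in> V" and Z: "Z \<in> V"
  shows "lie_bracket X Z \<in> V"
proof -
  let ?H = "\<lambda>t. expt X t ** Z ** expt X (- t)"
  have "has_matrix_derivative ?H (X ** Z - Z ** X) 0"
  proof -
    have 1: "has_matrix_derivative (\<lambda>t. expt X t ** Z) (X ** Z) 0"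
      using has_matrix_derivative_mult[OF has_matrix_derivative_expt[of X 0] has_matrix_derivative_const[of Z]] by simp
    have 2: "has_matrix_derivative (\<lambda>t. expt X (- t)) (cscale (-1) X) 0"
      using has_matrix_derivative_expt_chain[OF DERIV_minus[OF DERIV_ident], of X 0] by simp
    show ?thesis
      using has_matrix_derivative_mult[OF 1 2]
      by (simp add: matrix_ring_simps) (simp add: has_matrix_derivative_def)
  qed
  then have D: "((\<lambda>t. (?H t $ i $ j - Z $ i $ j) / t) \<longlongrightarrow> lie_bracket X Z $ i $ j) (at 0)" for i j
    unfolding has_matrix_derivative_def DERIV_def lie_bracket_def by simp
  have fl: "filterlim (\<lambda>n. of_real (1 / real (Suc n)) :: complex) (at 0) sequentially"
    unfolding filterlim_at using LIMSEQ_inverse_real_of_nat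
    by (auto simp: inverse_eq_divide intro!: tendsto_of_real_iff[THEN iffD2, of _ 0, simplified] simp del: of_real_divide of_nat_Suc)
  let ?Q = "\<lambda>n. real (Suc n) *\<^sub>R (?H (of_real (1 / real (Suc n))) - Z)"
  have "?Q \<longlonglongrightarrow> lie_bracket X Z"
  proof (intro vec_tendstoI)
    fix i j
    show "(\<lambda>n. ?Q n $ i $ j) \<longlonglongrightarrow> lie_bracket X Z $ i $ j"
      using filterlim_compose[OF D fl, of i j]
      by (simp add: scaleR_conv_of_real[where 'a=complex] mult.commute)
  qed
  moreover have "?Q n \<in> V" for n
    by (intro subspace_scale[OF V] subspace_diff[OF V] inv Z)
  moreover have "closed V" using V by (rule closed_subspace)
  ultimately show ?thesis using closed_sequentially[of V ?Q] by blast
qed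

text \<open>The real span of the conjugates is invariant under conjugation by \<open>exp (t X)\<close> for
  every generator \<open>X\<close>, hence under bracketing with generators; by the Jacobi identity it is
  then stable under bracketing with all elements that the generators generate.\<close>

lemma lie_generated_in_span_conjugates:
  assumes K: "\<And>a b. a \<in> K \<Longrightarrow> b \<in> K \<Longrightarrow> a ** b \<in> K" "mat 1 \<in> K"
    and E: "\<And>X t. X \<in> E \<Longrightarrow> expt X t \<in> K"
    and "X \<in> lie_generated E"
  shows "X \<in> span (conjugates K E)"
proof -
  let ?V = "span (conjugates K E)"
  have "X \<in> ?V \<and> (\<forall>Z\<in>?V. lie_bracket X Z \<in> ?V)"
    using assms(4)
  proof (induction rule: lie_generated.induct)
    case zero
    then show ?case by (simp add: lie_bracket_def span_zero)
  next
    case (base X)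
    have "X = mat 1 ** cscale 1 X ** mat 1" by simp
    then have "X \<in> conjugates K E" using base K unfolding conjugates_def
      by (intro CollectI exI[of _ "mat 1"] exI[of _ 1] exI[of _ X] conjI) auto
    moreover have "lie_bracket X Z \<in> ?V" if "Z \<in> ?V" for Z
      using that K(1) E base
      by (intro bracket_in_invariant_subspace conj_span_conjugates) auto
    ultimately show ?case by (auto intro: span_base)
  next
    case (add X Z)
    then show ?case by (auto simp: lie_bracket_add_left intro: span_add)
  next
    case (scale X c)
    then show ?case by (auto simp: lie_bracket_cscale_left intro: cscale_span_conjugates)
  next
    case (bracket X Z)
    then show ?case by (auto simp: lie_bracket_jacobi intro: span_diff)
  qed
  then show ?thesis by blast
qed


lemma expt_conjugates:
  assumes K: "\<And>a b. a \<in> K \<Longrightarrow> b \<in> K \<Longrightarrow> a ** b \<in> K"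
    and E: "\<And>X t. X \<in> E \<Longrightarrow> expt X t \<in> K" and "Z \<in> conjugates K E"
  shows "expt Z t \<in> K"
proof -
  obtain g g' c X where Z: "Z = g ** cscale c X ** g'" "g \<in> K" "g' \<in> K" "X \<in> E"
    "g ** g' = mat 1" "g' ** g = mat 1" using assms(3) unfolding conjugates_def by auto
  have "expt Z t = g ** expt X (t * c) ** g'"
    using Z by (simp add: expt_conj) (simp add: expt_def)
  then show ?thesis using Z K E by auto
qed

lemma mexp_nat_multiple: "mexp (real k *\<^sub>R A) \<in> G" if "subgroup G GL" "mexp A \<in> G"
proof (induction k)
  case 0
  then show ?case using subgroup_GL_one that by simp
next
  case (Suc k)
  have "mexp (real (Suc k) *\<^sub>R A) = expt A 1 ** expt A (of_real (real k))"
    unfolding expt_add[symmetric] by (simp add: expt_def flip: cscale_of_real)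
  then show ?case
    using Suc subgroup_GL_mult[OF that(1)] that(2) by (simp add: expt_def flip: cscale_of_real)
qed

text \<open>If exponentials of small vectors \<open>u n\<close> lie in \<open>G\<close> and the directions of
  these vectors converge, then the limit direction belongs to the Lie algebra:
  \<open>exp (t U)\<close> is the limit of suitable powers of \<open>exp (u n)\<close>.\<close>

lemma limit_direction_in_Lie:
  fixes u :: "nat \<Rightarrow> complex^'n^'n"
  assumes G: "linear_algebraic_group G"
    and u: "u \<longlonglongrightarrow> 0" "\<And>n. u n \<noteq> 0" "\<And>n. mexp (u n) \<in> G"
    and U: "(\<lambda>n. (1 / norm (u n)) *\<^sub>R u n) \<longlonglongrightarrow> U"
  shows "U \<in> Lie G"
  unfolding Lie_iff
proof (rule allI, rule expt_in_algebraic_group[OF G])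
  fix t :: real assume t: "t \<ge> 0"
  have sub: "subgroup G GL" using G by (simp add: linear_algebraic_group_def)
  obtain P where P: "P \<subseteq> poly_funs" "G = {g. invertible g \<and> (\<forall>p\<in>P. p g = 0)}"
    using G unfolding linear_algebraic_group_def by auto
  define N where "N n = nat \<lfloor>t / norm (u n)\<rfloor>" for n
  have un: "(\<lambda>n. norm (u n)) \<longlonglongrightarrow> 0" using u(1) by (rule tendsto_norm_zero)
  have N: "t - norm (u n) \<le> real (N n) * norm (u n)" "real (N n) * norm (u n) \<le> t" for n
  proof -
    have p: "norm (u n) > 0" using u(2) by simp
    have "real (N n) = of_int \<lfloor>t / norm (u n)\<rfloor>" unfolding N_def using t p by simp
    then have "t / norm (u n) - 1 \<le> real (N n)" "real (N n) \<le> t / norm (u n)"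
      by linarith+
    then show "t - norm (u n) \<le> real (N n) * norm (u n)" "real (N n) * norm (u n) \<le> t"
      using p by (simp_all add: field_simps)
  qed
  have "(\<lambda>n. real (N n) * norm (u n)) \<longlonglongrightarrow> t"
  proof (rule tendsto_sandwich[of "\<lambda>n. t - norm (u n)" _ _ "\<lambda>_. t"])
    show "(\<lambda>n. t - norm (u n)) \<longlonglongrightarrow> t" using tendsto_diff[OF tendsto_const un, of t] by simp
  qed (use N in auto)
  from tendsto_scaleR[OF this U]
  have "(\<lambda>n. real (N n) *\<^sub>R u n) \<longlonglongrightarrow> t *\<^sub>R U" using u(2) by simp
  then have "(\<lambda>n. mexp (real (N n) *\<^sub>R u n)) \<longlonglongrightarrow> mexp (t *\<^sub>R U)"
    using continuous_on_tendsto_compose[OF continuous_on_mexp[of UNIV]] by auto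
  then have lim: "(\<lambda>n. mexp (real (N n) *\<^sub>R u n)) \<longlonglongrightarrow> expt U (of_real t)"
    by (simp add: expt_def cscale_of_real)
  have "invertible (expt U (of_real t))" by (rule invertible_expt)
  moreover have "p (expt U (of_real t)) = 0" if "p \<in> P" for p
  proof -
    have "(\<lambda>n. p (mexp (real (N n) *\<^sub>R u n))) \<longlonglongrightarrow> p (expt U (of_real t))"
      using continuous_on_tendsto_compose[OF poly_funs_continuous lim, of p] P that by auto
    moreover have "p (mexp (real (N n) *\<^sub>R u n)) = 0" for n
      using mexp_nat_multiple[OF sub u(3)] P that by blast
    ultimately show ?thesis by (simp add: LIMSEQ_const_iff)
  qed
  ultimately show "expt U (of_real t) \<in> G" by (simp add: P)
qed

text \<open>In coordinates \<open>(\<Prod> exp (c b A) b) exp (\<pi> A)\<close> of the second kind near the identity, where the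
  \<open>b\<close> are conjugates of generators and \<open>\<pi>\<close> projects to a complement of the Lie algebra, an
  element of \<open>G\<close> close to \<open>1\<close> must have \<open>\<pi> A = 0\<close>.\<close>

lemma near_identity_generated:
  fixes G K E :: "(complex^'n^'n) set"
  assumes G: "linear_algebraic_group G" and KG: "K \<subseteq> G" and EG: "E \<subseteq> Lie G"
    and K: "\<And>a b. a \<in> K \<Longrightarrow> b \<in> K \<Longrightarrow> a ** b \<in> K" "mat 1 \<in> K"
    and E: "\<And>X t. X \<in> E \<Longrightarrow> expt X t \<in> K"
    and gen: "Lie G \<subseteq> lie_generated E"
  shows "\<exists>\<epsilon>>0. \<forall>g\<in>G. dist g (mat 1) < \<epsilon> \<longrightarrow> g \<in> K"
proof (rule ccontr)
  assume neg: "\<not> ?thesis"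
  have sub: "subgroup G GL" using G by (simp add: linear_algebraic_group_def)
  obtain B where B: "B \<subseteq> conjugates K E" "independent B" "conjugates K E \<subseteq> span B"
    by (rule maximal_independent_subset[of "conjugates K E"])
  obtain B' where B': "B \<subseteq> B'" "independent B'" "UNIV \<subseteq> span B'"
    by (rule maximal_independent_subset_extend[OF subset_UNIV B(2)])
  have fin: "finite B'" using B'(2) by (rule independent_imp_finite)
  define c where "c b A = representation B' A b" for b A
  have inspan: "A \<in> span B'" for A using B' by auto
  have lin: "linear (c b)" for b
    by (rule linearI) (simp_all add: c_def inspan real_vector.representation_add[OF B'(2)]
        real_vector.representation_scale[OF B'(2)])
  have sum_c: "(\<Sum>b\<in>B'. c b A *\<^sub>R b) = A" for A
    unfolding c_def using real_vector.sum_representation_eq[OF B'(2) inspan fin] by blast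
  define \<pi> where "\<pi> A = (\<Sum>b\<in>B' - B. c b A *\<^sub>R b)" for A
  have lin_pi: "linear \<pi>"
    unfolding \<pi>_def by (intro linear_compose_sum ballI)
      (auto intro!: linearI simp: linear_add[OF lin] linear_scale[OF lin] algebra_simps)
  have cont_pi: "continuous_on UNIV \<pi>"
    by (rule linear_continuous_on_compose[OF continuous_on_id lin_pi])
  have c_pi: "c b (\<pi> A) = 0" if "b \<in> B" for b A
  proof -
    have "c b (\<pi> A) = (\<Sum>b'\<in>B' - B. c b' A * c b b')"
      unfolding \<pi>_def by (simp add: linear_sum[OF lin] linear_scale[OF lin])
    also have "\<dots> = 0"
      using that B' by (intro sum.neutral) (auto simp: c_def real_vector.representation_basis[OF B'(2)])
    finally show ?thesis .
  qed
  obtain bs where bs: "set bs = B" "distinct bs"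
    using finite_distinct_list finite_subset[OF B'(1) fin] by blast
  define prd where "prd bs A = foldr (\<lambda>b M. mexp (c b A *\<^sub>R b) ** M) bs (mat 1)" for bs A
  have cont_c: "continuous_on UNIV (c b)" for b by (rule linear_continuous_on_compose[OF continuous_on_id lin])
  have der_c: "((\<lambda>A. mexp (c b A *\<^sub>R b)) has_derivative (\<lambda>A. c b A *\<^sub>R b)) (at 0)" for b
  proof -
    have "((\<lambda>A. c b A *\<^sub>R b) has_derivative (\<lambda>A. c b A *\<^sub>R b)) (at 0)"
      by (rule linear_imp_has_derivative) (auto intro!: linearI simp: linear_add[OF lin] linear_scale[OF lin] algebra_simps)
    from has_derivative_compose[OF this, of mexp "\<lambda>A. A"]
    show ?thesis using has_derivative_mexp_0 by (simp add: linear_0[OF lin])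
  qed
  have prd0: "prd l 0 = mat 1" for l
    by (induction l) (simp_all add: prd_def linear_0[OF lin])
  have prd_cont: "continuous_on UNIV (prd l)" for l
  proof (induction l)
    case (Cons b l)
    have "continuous_on UNIV (\<lambda>A. mexp (c b A *\<^sub>R b))"
      by (rule continuous_on_compose2[OF continuous_on_mexp[of UNIV]]) (auto intro!: continuous_intros cont_c)
    from bounded_bilinear.continuous_on[OF bounded_bilinear_matrix_mult this Cons]
    show ?case by (simp add: prd_def)
  qed (simp add: prd_def)
  have prd_der: "distinct l \<Longrightarrow> (prd l has_derivative (\<lambda>A. \<Sum>b\<in>set l. c b A *\<^sub>R b)) (at 0)" for l
  proof (induction l)
    case Nil
    then show ?case by (simp add: prd_def[abs_def])
  next
    case (Cons b l)
    from bounded_bilinear.FDERIV[OF bounded_bilinear_matrix_mult der_c[of b] Cons.IH] Cons.prems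
    have "((\<lambda>A. mexp (c b A *\<^sub>R b) ** prd l A) has_derivative
        (\<lambda>A. (\<Sum>b\<in>set l. c b A *\<^sub>R b) + c b A *\<^sub>R b)) (at 0)"
      by (simp add: prd0 linear_0[OF lin])
    moreover have "prd (b # l) = (\<lambda>A. mexp (c b A *\<^sub>R b) ** prd l A)"
      by (simp add: prd_def[abs_def])
    ultimately show ?case using Cons.prems by (simp add: add.commute)
  qed
  have prd_K: "prd l A \<in> K" if "set l \<subseteq> B" for l A
    using that
  proof (induction l)
    case (Cons b l)
    have "mexp (c b A *\<^sub>R b) = expt b (of_real (c b A))" by (simp add: expt_def cscale_of_real)
    then have "mexp (c b A *\<^sub>R b) \<in> K" using expt_conjugates[OF K(1) E, where Z = b and t = "of_real (c b A)"] B(1) Cons.prems by auto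
    then show ?case using Cons K by (auto simp: prd_def)
  qed (simp add: prd_def K)
  define \<Psi> where "\<Psi> A = prd bs A ** mexp (\<pi> A)" for A
  have "continuous_on UNIV \<Psi>"
    unfolding \<Psi>_def
    by (intro bounded_bilinear.continuous_on[OF bounded_bilinear_matrix_mult] prd_cont
        continuous_on_compose2[OF continuous_on_mexp[of UNIV]] linear_continuous_on_compose[OF continuous_on_id lin_pi]) auto
  moreover have "(\<Psi> has_derivative id) (at 0)"
  proof -
    have "(\<pi> has_derivative \<pi>) (at 0)" by (rule linear_imp_has_derivative[OF lin_pi])
    from has_derivative_compose[OF this, of mexp "\<lambda>A. A"]
    have "((\<lambda>A. mexp (\<pi> A)) has_derivative \<pi>) (at 0)"
      using has_derivative_mexp_0 by (simp add: linear_0[OF lin_pi])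
    from bounded_bilinear.FDERIV[OF bounded_bilinear_matrix_mult prd_der[OF bs(2)] this]
    have "(\<Psi> has_derivative (\<lambda>A. \<pi> A + (\<Sum>b\<in>B. c b A *\<^sub>R b))) (at 0)"
      unfolding \<Psi>_def by (simp add: prd0 linear_0[OF lin_pi] bs)
    moreover have "\<pi> A + (\<Sum>b\<in>B. c b A *\<^sub>R b) = A" for A
      unfolding \<pi>_def using sum.subset_diff[OF B'(1) fin, of "\<lambda>b. c b A *\<^sub>R b"] sum_c by simp
    ultimately show ?thesis by (simp add: id_def)
  qed
  ultimately have open_img: "\<Psi> 0 \<in> interior (\<Psi> ` ball 0 \<delta>)" if "\<delta> > 0" for \<delta>
    using that by (intro sussmann_open_mapping[of UNIV \<Psi> 0 id id]) auto
  have \<Psi>0: "\<Psi> 0 = mat 1" by (simp add: \<Psi>_def prd0 linear_0[OF lin_pi])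
  have "\<exists>A. norm A < \<delta> \<and> \<Psi> A \<in> G \<and> \<Psi> A \<notin> K" if d: "\<delta> > 0" for \<delta>
  proof -
    obtain \<epsilon> where "\<epsilon> > 0" "ball (mat 1) \<epsilon> \<subseteq> \<Psi> ` ball 0 \<delta>"
      using open_img[OF d] unfolding \<Psi>0 mem_interior by blast
    moreover from this obtain g where "g \<in> G" "dist g (mat 1) < \<epsilon>" "g \<notin> K" using neg by blast
    ultimately have "g \<in> \<Psi> ` ball 0 \<delta>" by (auto simp: dist_commute)
    with \<open>g \<in> G\<close> \<open>g \<notin> K\<close> show ?thesis by auto
  qed
  then have "\<forall>n. \<exists>A. norm A < 1 / real (Suc n) \<and> \<Psi> A \<in> G \<and> \<Psi> A \<notin> K" by simp
  from choice[OF this] obtain A where "\<forall>n. norm (A n) < 1 / real (Suc n) \<and> \<Psi> (A n) \<in> G \<and> \<Psi> (A n) \<notin> K" ..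
  then have A: "norm (A n) < 1 / real (Suc n)" "\<Psi> (A n) \<in> G" "\<Psi> (A n) \<notin> K" for n by simp_all
  define u where "u n = \<pi> (A n)" for n
  have "A \<longlonglongrightarrow> 0"
  proof (rule metric_LIMSEQ_I)
    fix \<epsilon> :: real assume "\<epsilon> > 0"
    then obtain k where k: "inverse (real (Suc k)) < \<epsilon>" using reals_Archimedean by blast
    have "norm (A n) < \<epsilon>" if "n \<ge> k" for n
    proof -
      have "1 / real (Suc n) \<le> inverse (real (Suc k))" using that by (simp add: inverse_eq_divide frac_le)
      with A(1)[of n] k show ?thesis by linarith
    qed
    then show "\<exists>no. \<forall>n\<ge>no. dist (A n) 0 < \<epsilon>" by (auto simp: dist_norm)
  qed
  then have u0: "u \<longlonglongrightarrow> 0"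
    using continuous_on_tendsto_compose[OF cont_pi, of A 0 sequentially]
    by (simp add: u_def[abs_def] linear_0[OF lin_pi])
  have une: "u n \<noteq> 0" for n
  proof
    assume "u n = 0"
    then have "\<Psi> (A n) = prd bs (A n)" by (simp add: \<Psi>_def u_def)
    then show False using A(3)[of n] prd_K[of bs "A n"] bs(1) by simp
  qed
  have uG: "mexp (u n) \<in> G" for n
  proof -
    have "prd bs (A n) \<in> G" using prd_K[of bs] bs KG by blast
    then obtain q where "q \<in> G" "q ** prd bs (A n) = mat 1" using subgroup_GL_inverse[OF sub] by metis
    then have "mexp (u n) = q ** \<Psi> (A n)" by (simp add: \<Psi>_def u_def matrix_mul_assoc)
    then show ?thesis using subgroup_GL_mult[OF sub \<open>q \<in> G\<close> A(2)] by simp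
  qed
  have "compact (sphere (0::complex^'n^'n) 1)" by simp
  moreover have "(1 / norm (u n)) *\<^sub>R u n \<in> sphere 0 1" for n using une by simp
  ultimately obtain U \<rho> where U: "U \<in> sphere 0 1" "strict_mono \<rho>"
    "((\<lambda>n. (1 / norm (u n)) *\<^sub>R u n) \<circ> \<rho>) \<longlonglongrightarrow> U"
    unfolding compact_def by meson
  have "U \<in> Lie G"
    using U une uG LIMSEQ_subseq_LIMSEQ[OF u0 U(2)]
    by (intro limit_direction_in_Lie[OF G, of "u \<circ> \<rho>"]) (auto simp: o_def)
  then have "U \<in> span (conjugates K E)"
    using lie_generated_in_span_conjugates[OF K E] gen by blast
  also have "\<dots> \<subseteq> span B" using span_mono[OF B(3)] by (simp add: span_span)
  finally have UB: "U \<in> span B" .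
  have "c b U = 0" for b
  proof (cases "b \<in> B")
    case True
    have "(\<lambda>n. c b (((\<lambda>n. (1 / norm (u n)) *\<^sub>R u n) \<circ> \<rho>) n)) \<longlonglongrightarrow> c b U"
      using continuous_on_tendsto_compose[OF cont_c U(3)] by auto
    moreover have "c b (((\<lambda>n. (1 / norm (u n)) *\<^sub>R u n) \<circ> \<rho>) n) = 0" for n
      using c_pi[OF True] by (simp add: linear_scale[OF lin] u_def)
    ultimately show ?thesis by (simp add: LIMSEQ_const_iff)
  next
    case False
    have "representation B' U = representation B U"
      using real_vector.representation_extend[OF B'(2) UB B'(1)] .
    then show ?thesis using False real_vector.representation_ne_zero[of B U b] by (auto simp: c_def)
  qed
  then have "U = 0" using sum_c[of U] by simp
  with U(1) show False by simp
qed

text \<open>A subgroup that contains a neighbourhood of the identity is open, and a connected group has no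
  proper open subgroup.\<close>

theorem connected_group_generated:
  fixes G K E :: "(complex^'n^'n) set"
  assumes G: "linear_algebraic_group G" "connected G" and KG: "K \<subseteq> G" and EG: "E \<subseteq> Lie G"
    and K: "\<And>a b. a \<in> K \<Longrightarrow> b \<in> K \<Longrightarrow> a ** b \<in> K" "mat 1 \<in> K"
      "\<And>a b. a \<in> K \<Longrightarrow> b ** a = mat 1 \<Longrightarrow> b \<in> K"
    and E: "\<And>X t. X \<in> E \<Longrightarrow> expt X t \<in> K"
    and gen: "Lie G \<subseteq> lie_generated E"
  shows "K = G"
proof
  have sub: "subgroup G GL" using G by (simp add: linear_algebraic_group_def)
  obtain \<epsilon> where \<epsilon>: "\<epsilon> > 0" "\<And>g. g \<in> G \<Longrightarrow> dist g (mat 1) < \<epsilon> \<Longrightarrow> g \<in> K"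
    using near_identity_generated[OF G(1) KG EG K(1,2) E gen] by blast
  define R where "R a b \<longleftrightarrow> (\<exists>k\<in>K. b = a ** k)" for a b :: "complex^'n^'n"
  show "G \<subseteq> K"
  proof
    fix g assume g: "g \<in> G"
    have "R (mat 1) g"
    proof (rule connected_equivalence_relation[OF G(2) subgroup_GL_one[OF sub] g])
      fix x y assume "R x y" "x \<in> G" "y \<in> G"
      then obtain k where k: "k \<in> K" "y = x ** k" by (auto simp: R_def)
      obtain k' where "k ** k' = mat 1" "k' ** k = mat 1" using subgroup_GL_inverse[OF sub] k KG by blast
      then show "R y x" using k K(3) unfolding R_def
        by (intro bexI[of _ k']) (auto simp flip: matrix_mul_assoc)
    next
      fix x y z assume "R x y" "R y z"
      then show "R x z" using K(1) by (auto simp: R_def simp flip: matrix_mul_assoc)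
    next
      fix a assume a: "a \<in> G"
      obtain a' where a': "a' \<in> G" "a ** a' = mat 1" "a' ** a = mat 1" using subgroup_GL_inverse[OF sub a] by blast
      let ?T = "G \<inter> (\<lambda>x. a' ** x) -` ball (mat 1) \<epsilon>"
      have "continuous_on G (\<lambda>x. a' ** x)"
        by (intro bounded_bilinear.continuous_on[OF bounded_bilinear_matrix_mult] continuous_intros)
      then have "openin (top_of_set G) ?T" by (rule continuous_openin_preimage_gen) simp
      moreover have "a \<in> ?T" using a a' \<epsilon> by simp
      moreover have "R a x" if "x \<in> ?T" for x
      proof -
        have "a' ** x \<in> K" using that subgroup_GL_mult[OF sub a'(1)] \<epsilon>(2) by (auto simp: dist_commute)
        then show ?thesis using a' unfolding R_def by (intro bexI[of _ "a' ** x"]) (auto simp: matrix_mul_assoc)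
      qed
      ultimately show "\<exists>T. openin (top_of_set G) T \<and> a \<in> T \<and> (\<forall>x\<in>T. R a x)" by blast
    qed
    then show "g \<in> K" by (auto simp: R_def)
  qed
qed (rule KG)

section \<open>Words in the Chevalley generators\<close>

lemma mprod_Nil [simp]: "mprod [] = mat 1"
  by (simp add: mprod_def)

lemma mprod_Cons [simp]: "mprod (A # As) = A ** mprod As"
  by (simp add: mprod_def)

lemma mprod_append: "mprod (As @ Bs) = mprod As ** mprod Bs"
  by (induction As) (simp_all add: matrix_mul_assoc)

text \<open>The derivative of \<open>expt X (- c) Z(c) expt X c\<close> is zero.\<close>

lemma expt_adjoint_flow:
  assumes "\<And>c. has_matrix_derivative Z (lie_bracket X (Z c)) c"
  shows "expt X c ** Z 0 = Z c ** expt X c"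
proof -
  let ?F = "\<lambda>c. expt X (- c) ** Z c ** expt X c"
  have "has_matrix_derivative ?F 0 t" for t
  proof -
    have 1: "has_matrix_derivative (\<lambda>c. expt X (- c)) (cscale (-1) (X ** expt X (- t))) t"
      using has_matrix_derivative_expt_chain[OF DERIV_minus[OF DERIV_ident], of X t] by simp
    have "expt X (- t) ** X = X ** expt X (- t)" by (rule expt_commute)
    then show ?thesis
      using has_matrix_derivative_mult[OF has_matrix_derivative_mult[OF 1 assms[of t]] has_matrix_derivative_expt[of X t]]
      by (simp add: lie_bracket_def matrix_ring_simps) (simp add: has_matrix_derivative_def)
  qed
  from has_matrix_derivative_zero_constant[OF convex_UNIV open_UNIV this, of 0 c]
  have "Z 0 = expt X (- c) ** Z c ** expt X c" by simp
  then have "expt X c ** Z 0 = expt X c ** (expt X (- c) ** (Z c ** expt X c))"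
    by (simp add: matrix_mul_assoc)
  then show ?thesis by (simp add: matrix_mul_assoc)
qed

text \<open>Exponentiating the eigenvalue equation for conjugation by \<open>expt X s\<close>.\<close>

lemma expt_eigen_expt:
  assumes "lie_bracket X Z = cscale c Z"
  shows "expt X s ** expt Z t = expt Z (exp (s * c) * t) ** expt X s"
proof -
  have "cscale (exp (s * c)) Z ** expt X s = expt X s ** Z"
    using expt_eigen[OF assms, of s] by (simp add: cscale_mult_left)
  then have "cscale (exp (s * c) * t) Z ** expt X s = expt X s ** cscale t Z"
    by (metis cscale_cscale cscale_mult_left cscale_mult_right mult.commute)
  from mexp_intertwine[OF this] show ?thesis by (simp add: expt_def)
qed

text \<open>The factorization of \<open>x(s) y(t)\<close> in \<open>SL\<^sub>2\<close>, with \<open>1 + s t = exp L\<close>. In this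
  parametrization both sides are entire in \<open>L\<close>, and both satisfy \<open>A' = (exp L / s) A f\<close>.\<close>

lemma sl2_factorization:
  assumes he: "lie_bracket h e = cscale 2 e" and hf: "lie_bracket h f = cscale (- 2) f"
    and ef: "lie_bracket e f = h" and s: "s \<noteq> 0"
  shows "expt e s ** expt f ((exp L - 1) / s) =
      expt f ((1 - exp (- L)) / s) ** expt h L ** expt e (s * exp (- L))"
proof -
  have xf: "expt e c ** f = (f + cscale c h - cscale (c ^ 2) e) ** expt e c" for c
  proof -
    let ?Z = "\<lambda>c. f + cscale c h - cscale (c ^ 2) e"
    have eh: "e ** h = h ** e - cscale 2 e" using he by (simp add: lie_bracket_def algebra_simps)
    have "has_matrix_derivative ?Z (lie_bracket e (?Z c)) c" for c
    proof -
      have "lie_bracket e (?Z c) = h - cscale (2 * c) e"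
        using ef by (simp add: lie_bracket_def matrix_ring_simps eh)
          (simp add: vec_eq_iff algebra_simps)
      then show ?thesis
        unfolding has_matrix_derivative_def
        by (auto intro!: derivative_eq_intros)
    qed
    from expt_adjoint_flow[of ?Z, OF this] show ?thesis by simp
  qed
  let ?a = "\<lambda>L. (1 - exp (- L)) / s" and ?g = "\<lambda>L. (exp L - 1) / s" and ?c = "\<lambda>L. s * exp (- L)"
  let ?B = "\<lambda>L. expt f (?a L) ** expt h L ** expt e (?c L)"
  have B: "has_matrix_derivative ?B (cscale (exp L / s) (?B L ** f)) L" for L
  proof -
    let ?y = "expt f (?a L)" and ?H = "expt h L" and ?x = "expt e (?c L)"
    let ?M1 = "?y ** f ** ?H ** ?x" and ?M2 = "?y ** ?H ** h ** ?x" and ?M3 = "?y ** ?H ** e ** ?x"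
    have 1: "has_matrix_derivative (\<lambda>L. expt f (?a L)) (cscale (exp (- L) / s) (f ** ?y)) L"
      using s by (intro has_matrix_derivative_expt_chain) (auto intro!: derivative_eq_intros)
    have 2: "has_matrix_derivative (\<lambda>L. expt e (?c L)) (cscale (- s * exp (- L)) (e ** ?x)) L"
      by (intro has_matrix_derivative_expt_chain) (auto intro!: derivative_eq_intros)
    have E: "exp (L * (- 2)) = exp (- L) * exp (- L)" by (simp add: mult.commute flip: exp_add)
    have "?B L ** f = ?y ** ?H ** ((f + cscale (?c L) h - cscale (?c L ^ 2) e) ** ?x)"
      unfolding xf[of "?c L", symmetric] by (simp add: matrix_mul_assoc)
    also have "\<dots> = ?y ** (?H ** f) ** ?x + cscale (?c L) ?M2 - cscale (?c L ^ 2) ?M3"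
      by (simp add: matrix_ring_simps)
    also have "?y ** (?H ** f) ** ?x = cscale (exp (- L) * exp (- L)) ?M1"
      unfolding expt_eigen[OF hf] E by (simp add: matrix_ring_simps)
    finally have Bf: "cscale (exp L / s) (?B L ** f) =
        cscale (exp L / s) (cscale (exp (- L) * exp (- L)) ?M1 + cscale (?c L) ?M2 - cscale (?c L ^ 2) ?M3)"
      by (rule arg_cong)
    have hM: "?y ** ?H ** h = ?y ** h ** ?H"
      by (simp only: matrix_mul_assoc[symmetric] expt_commute)
    have "(cscale (exp (- L) / s) (f ** ?y) ** ?H + ?y ** (h ** ?H)) ** ?x +
        (?y ** ?H) ** cscale (- s * exp (- L)) (e ** ?x) =
        cscale (exp (- L) / s) ?M1 + ?M2 + cscale (- s * exp (- L)) ?M3"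
      by (simp add: matrix_ring_simps expt_commute hM)
    also have "\<dots> = cscale (exp L / s) (?B L ** f)"
      unfolding Bf using s by (intro matrix_eqI) (simp add: exp_minus field_simps power2_eq_square)
    finally have eq: "(cscale (exp (- L) / s) (f ** ?y) ** ?H + ?y ** (h ** ?H)) ** ?x +
        (?y ** ?H) ** cscale (- s * exp (- L)) (e ** ?x) = cscale (exp L / s) (?B L ** f)" .
    show ?thesis
      using has_matrix_derivative_mult[OF has_matrix_derivative_mult[OF 1 has_matrix_derivative_expt[of h L]] 2]
      unfolding eq .
  qed
  let ?F = "\<lambda>L. ?B L ** expt f (- ?g L)"
  have "has_matrix_derivative ?F 0 L" for L
  proof -
    have 1: "has_matrix_derivative (\<lambda>L. expt f (- ?g L)) (cscale (- (exp L / s)) (f ** expt f (- ?g L))) L"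
      using s by (intro has_matrix_derivative_expt_chain) (auto intro!: derivative_eq_intros)
    have z: "cscale (exp L / s) (?B L ** f) ** expt f (- ?g L) +
        ?B L ** cscale (- (exp L / s)) (f ** expt f (- ?g L)) = 0"
      by (simp only: cscale_mult_left cscale_mult_right matrix_mul_assoc) (simp add: vec_eq_iff)
    show ?thesis using has_matrix_derivative_mult[OF B[of L] 1] unfolding z .
  qed
  from has_matrix_derivative_zero_constant[OF convex_UNIV open_UNIV this, of 0 L]
  have "expt e s = ?B L ** expt f (- ?g L)" by simp
  then have "expt e s ** expt f (?g L) = ?B L ** (expt f (- ?g L) ** expt f (?g L))"
    by (simp only: matrix_mul_assoc)
  then show ?thesis by simp
qed

text \<open>Solving the factorization for \<open>expt h L\<close> gives an expression that depends on \<open>L\<close> only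
  through \<open>exp L\<close>. This is the integrality of the eigenvalues of \<open>h\<close>.\<close>

lemma sl2_torus_periodic:
  assumes he: "lie_bracket h e = cscale 2 e" and hf: "lie_bracket h f = cscale (- 2) f"
    and ef: "lie_bracket e f = h" and "exp L = exp M"
  shows "expt h L = expt h M"
proof -
  have *: "expt h L = expt f (- (1 - exp (- L))) ** (expt e 1 ** expt f (exp L - 1)) ** expt e (- exp (- L))" for L
  proof -
    have "expt e 1 ** expt f (exp L - 1) = expt f (1 - exp (- L)) ** expt h L ** expt e (exp (- L))"
      using sl2_factorization[OF he hf ef, of 1 L] by simp
    then have "expt f (- (1 - exp (- L))) ** (expt e 1 ** expt f (exp L - 1)) ** expt e (- exp (- L)) =
       (expt f (- (1 - exp (- L))) ** expt f (1 - exp (- L))) ** expt h L ** (expt e (exp (- L)) ** expt e (- exp (- L)))"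
      by (simp only: matrix_mul_assoc)
    then show ?thesis by (simp only: expt_minus) simp
  qed
  show ?thesis unfolding *[of L] *[of M] using assms(4) by (simp add: exp_minus)
qed

text \<open>A letter is a factor \<open>x\<^sub>i(t)\<close>, \<open>y\<^sub>i(t)\<close> or \<open>exp (t
  h\<^sub>i)\<close>. Words of letters can be evaluated both in the group and in the vector representation,
  so that the two can be compared before the representation is known to factor through the group.\<close>

datatype gen = GE nat complex | GF nat complex | GH nat complex

fun gen_index :: "gen \<Rightarrow> nat" where
  "gen_index (GE i t) = i" | "gen_index (GF i t) = i" | "gen_index (GH i t) = i"

fun gen_inverse :: "gen \<Rightarrow> gen" where
  "gen_inverse (GE i t) = GE i (- t)" | "gen_inverse (GF i t) = GF i (- t)" | "gen_inverse (GH i t) = GH i (- t)"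

fun gen_scale :: "complex \<Rightarrow> gen \<Rightarrow> gen" where
  "gen_scale z (GE i t) = GE i (z * t)" | "gen_scale z (GF i t) = GF i (z * t)" | "gen_scale z (GH i t) = GH i (z * t)"

definition Egens :: "nat \<Rightarrow> gen set" where "Egens r = {GE i t | i t. i \<in> {1..r}}"
definition Fgens :: "nat \<Rightarrow> gen set" where "Fgens r = {GF i t | i t. i \<in> {1..r}}"
definition Hgens :: "nat \<Rightarrow> gen set" where "Hgens r = {GH i t | i t. i \<in> {1..r}}"

definition all_gens :: "nat \<Rightarrow> gen set" where "all_gens r = {g. gen_index g \<in> {1..r}}"

lemma gens_subset: "Egens r \<subseteq> all_gens r" "Fgens r \<subseteq> all_gens r" "Hgens r \<subseteq> all_gens r"
  by (auto simp: Egens_def Fgens_def Hgens_def all_gens_def)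

locale chevalley_matrices =
  fixes r :: nat and e f h :: "nat \<Rightarrow> complex^'n^'n"
  assumes rank: "2 \<le> r"
    and hh: "i \<in> {1..r} \<Longrightarrow> j \<in> {1..r} \<Longrightarrow> lie_bracket (h i) (h j) = 0"
    and he: "i \<in> {1..r} \<Longrightarrow> j \<in> {1..r} \<Longrightarrow> lie_bracket (h i) (e j) = cscale (of_int (cartan_B r i j)) (e j)"
    and hf: "i \<in> {1..r} \<Longrightarrow> j \<in> {1..r} \<Longrightarrow> lie_bracket (h i) (f j) = cscale (- of_int (cartan_B r i j)) (f j)"
    and ef: "i \<in> {1..r} \<Longrightarrow> j \<in> {1..r} \<Longrightarrow> lie_bracket (e i) (f j) = (if i = j then h i else 0)"
begin

fun gmat :: "gen \<Rightarrow> complex^'n^'n" where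
  "gmat (GE i t) = expt (e i) t" | "gmat (GF i t) = expt (f i) t" | "gmat (GH i t) = expt (h i) t"

definition gw :: "gen list \<Rightarrow> complex^'n^'n" where
  "gw w = mprod (map gmat w)"

lemma gw_Nil [simp]: "gw [] = mat 1"
  by (simp add: gw_def)

lemma gw_Cons [simp]: "gw (g # w) = gmat g ** gw w"
  by (simp add: gw_def)

lemma gw_append: "gw (v @ w) = gw v ** gw w"
  by (simp add: gw_def mprod_append)

lemma gmat_inverse: "gmat g ** gmat (gen_inverse g) = mat 1" "gmat (gen_inverse g) ** gmat g = mat 1"
  by (cases g; simp)+

definition winv :: "gen list \<Rightarrow> gen list" where "winv w = rev (map gen_inverse w)"

lemma winv_Cons: "winv (g # w) = winv w @ [gen_inverse g]"
  by (simp add: winv_def)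

lemma gw_winv: "gw w ** gw (winv w) = mat 1" "gw (winv w) ** gw w = mat 1"
proof (induction w)
  case (Cons g w)
  have "gw (g # w) ** gw (winv (g # w)) = gmat g ** (gw w ** gw (winv w)) ** gmat (gen_inverse g)"
    by (simp add: winv_Cons gw_append matrix_mul_assoc)
  then show "gw (g # w) ** gw (winv (g # w)) = mat 1" using Cons by (simp add: gmat_inverse)
  have "gw (winv (g # w)) ** gw (g # w) = gw (winv w) ** (gmat (gen_inverse g) ** gmat g) ** gw w"
    by (simp add: winv_Cons gw_append matrix_mul_assoc)
  then show "gw (winv (g # w)) ** gw (g # w) = mat 1" using Cons by (simp add: gmat_inverse)
qed (simp_all add: winv_def)

lemma gen_inverse_in: "gen_inverse g \<in> Egens r \<longleftrightarrow> g \<in> Egens r" "gen_inverse g \<in> Fgens r \<longleftrightarrow> g \<in> Fgens r"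
  "gen_inverse g \<in> Hgens r \<longleftrightarrow> g \<in> Hgens r" "gen_inverse g \<in> all_gens r \<longleftrightarrow> g \<in> all_gens r"
  by (cases g; auto simp: Egens_def Fgens_def Hgens_def all_gens_def)+

lemma winv_in: "set (winv w) \<subseteq> Egens r \<longleftrightarrow> set w \<subseteq> Egens r" "set (winv w) \<subseteq> Fgens r \<longleftrightarrow> set w \<subseteq> Fgens r"
  "set (winv w) \<subseteq> Hgens r \<longleftrightarrow> set w \<subseteq> Hgens r" "set (winv w) \<subseteq> all_gens r \<longleftrightarrow> set w \<subseteq> all_gens r"
  by (auto simp: winv_def gen_inverse_in subset_eq)

lemma gw_inverse_unique: "A ** gw w = mat 1 \<Longrightarrow> A = gw (winv w)"
proof -
  assume a: "A ** gw w = mat 1"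
  have "A = A ** (gw w ** gw (winv w))" by (simp add: gw_winv)
  then show ?thesis using a by (simp add: matrix_mul_assoc)
qed

lemma gw_intertwine:
  assumes "\<And>g. g \<in> S \<Longrightarrow> \<exists>g'\<in>S. gmat g ** A = A ** gmat g'" "set w \<subseteq> S"
  shows "\<exists>w'. set w' \<subseteq> S \<and> gw w ** A = A ** gw w'"
  using assms(2)
proof (induction w)
  case Nil
  then show ?case by (intro exI[of _ "[]"]) simp
next
  case (Cons g w)
  then obtain w' where w': "set w' \<subseteq> S" "gw w ** A = A ** gw w'" by auto
  obtain g' where g': "g' \<in> S" "gmat g ** A = A ** gmat g'" using assms(1) Cons.prems by auto
  have "gw (g # w) ** A = gmat g ** (gw w ** A)" by (simp add: matrix_mul_assoc)
  also have "\<dots> = gmat g ** A ** gw w'" by (simp add: w' matrix_mul_assoc)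
  also have "\<dots> = A ** gw (g' # w')" by (simp add: g' matrix_mul_assoc)
  finally show ?case using w' g' by (intro exI[of _ "g' # w'"]) simp
qed

lemma expt_move_left:
  assumes "lie_bracket X Z = cscale c Z"
  shows "expt Z t ** expt X s = expt X s ** expt Z (exp (- s * c) * t)"
proof -
  have "expt X s ** expt Z (exp (- s * c) * t) = expt Z (exp (s * c) * (exp (- s * c) * t)) ** expt X s"
    by (rule expt_eigen_expt[OF assms])
  also have "exp (s * c) * (exp (- s * c) * t) = t" by (simp flip: mult.assoc exp_add)
  finally show ?thesis by simp
qed

lemma gw_E_torus:
  assumes "set v \<subseteq> Egens r" "i \<in> {1..r}"
  shows "\<exists>v'. set v' \<subseteq> Egens r \<and> gw v ** expt (h i) s = expt (h i) s ** gw v'"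
proof (rule gw_intertwine[OF _ assms(1)])
  fix g assume "g \<in> Egens r"
  then obtain j t where g: "g = GE j t" "j \<in> {1..r}" by (auto simp: Egens_def)
  show "\<exists>g'\<in>Egens r. gmat g ** expt (h i) s = expt (h i) s ** gmat g'"
    using g expt_move_left[OF he[OF assms(2) g(2)], of t s]
    by (intro bexI[of _ "GE j (exp (- s * of_int (cartan_B r i j)) * t)"]) (auto simp: Egens_def)
qed

lemma gw_F_torus:
  assumes "set v \<subseteq> Fgens r" "i \<in> {1..r}"
  shows "\<exists>v'. set v' \<subseteq> Fgens r \<and> gw v ** expt (h i) s = expt (h i) s ** gw v'"
proof (rule gw_intertwine[OF _ assms(1)])
  fix g assume "g \<in> Fgens r"
  then obtain j t where g: "g = GF j t" "j \<in> {1..r}" by (auto simp: Fgens_def)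
  show "\<exists>g'\<in>Fgens r. gmat g ** expt (h i) s = expt (h i) s ** gmat g'"
    using g expt_move_left[OF hf[OF assms(2) g(2)], of t s]
    by (intro bexI[of _ "GF j (exp (- s * (- of_int (cartan_B r i j))) * t)"]) (auto simp: Fgens_def)
qed

lemma gw_move_H:
  assumes "\<And>i s v. set v \<subseteq> S \<Longrightarrow> i \<in> {1..r} \<Longrightarrow> \<exists>v'. set v' \<subseteq> S \<and> gw v ** expt (h i) s = expt (h i) s ** gw v'"
    and "set w \<subseteq> Hgens r" "set v \<subseteq> S"
  shows "\<exists>v'. set v' \<subseteq> S \<and> gw v ** gw w = gw w ** gw v'"
  using assms(2,3)
proof (induction w arbitrary: v)
  case Nil
  then show ?case by auto
next
  case (Cons g w)
  then obtain i s where g: "g = GH i s" "i \<in> {1..r}" by (auto simp: Hgens_def)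
  obtain v1 where v1: "set v1 \<subseteq> S" "gw v ** expt (h i) s = expt (h i) s ** gw v1"
    using assms(1)[OF Cons.prems(2) g(2)] by blast
  obtain v' where v': "set v' \<subseteq> S" "gw v1 ** gw w = gw w ** gw v'"
    using Cons.IH[OF _ v1(1)] Cons.prems(1) by auto
  have "gw v ** gw (g # w) = gw v ** expt (h i) s ** gw w" by (simp add: g matrix_mul_assoc)
  also have "\<dots> = expt (h i) s ** (gw v1 ** gw w)" by (simp add: v1 matrix_mul_assoc)
  also have "\<dots> = gw (g # w) ** gw v'" by (simp add: v' g matrix_mul_assoc)
  finally show ?case using v' by blast
qed

lemmas gw_EH = gw_move_H[OF gw_E_torus] and gw_FH = gw_move_H[OF gw_F_torus]

lemma gw_HF:
  assumes "set w \<subseteq> Hgens r" "set v \<subseteq> Fgens r"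
  shows "\<exists>v'. set v' \<subseteq> Fgens r \<and> gw w ** gw v = gw v' ** gw w"
proof -
  obtain v' where v': "set v' \<subseteq> Fgens r" "gw v ** gw (winv w) = gw (winv w) ** gw v'"
    using gw_FH[of "winv w" v] assms winv_in by auto
  have "gw w ** gw v = gw w ** (gw v ** gw (winv w)) ** gw w"
    by (simp add: gw_winv flip: matrix_mul_assoc)
  also have "\<dots> = gw w ** gw (winv w) ** gw v' ** gw w"
    by (simp add: v' matrix_mul_assoc)
  finally show ?thesis using v' by (auto simp: gw_winv)
qed

subsection \<open>The big cell\<close>

definition big_cell :: "(complex^'n^'n) set" where
  "big_cell = {gw u ** gw w ** gw v | u w v. set u \<subseteq> Fgens r \<and> set w \<subseteq> Hgens r \<and> set v \<subseteq> Egens r}"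

lemma sl2_relations:
  assumes "i \<in> {1..r}"
  shows "lie_bracket (h i) (e i) = cscale 2 (e i)" "lie_bracket (h i) (f i) = cscale (- 2) (f i)"
    "lie_bracket (e i) (f i) = h i"
  using he[OF assms assms] hf[OF assms assms] ef[OF assms assms] by (simp_all add: cartan_B_def)

text \<open>For small \<open>t\<close> the factor \<open>y\<^sub>i(t)\<close> can be moved to the left through a product of elements
  \<open>x\<^sub>j(s)\<close>: it commutes with those for \<open>j \<noteq> i\<close>, and those for \<open>j = i\<close> are handled by the
  factorization in \<open>SL\<^sub>2\<close>, which turns \<open>t\<close> into \<open>t / (1 + s t)\<close>.\<close>

lemma move_f_left:
  assumes "set v \<subseteq> Egens r" "i \<in> {1..r}"
  shows "\<exists>\<delta>>0. \<forall>t. norm t < \<delta> \<longrightarrow> (\<exists>t' w v'. set w \<subseteq> Hgens r \<and> set v' \<subseteq> Egens r \<and>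
      gw v ** expt (f i) t = expt (f i) t' ** gw w ** gw v')"
  using assms(1)
proof (induction v rule: rev_induct)
  case Nil
  have "\<exists>t' w v'. set w \<subseteq> Hgens r \<and> set v' \<subseteq> Egens r \<and>
      gw [] ** expt (f i) t = expt (f i) t' ** gw w ** gw v'" for t
    by (intro exI[of _ t] exI[of _ "[]"]) simp
  then show ?case by (intro exI[of _ 1]) simp
next
  case (snoc g v)
  then obtain \<delta> where \<delta>: "\<delta> > 0" "\<And>t. norm t < \<delta> \<Longrightarrow> \<exists>t' w v'. set w \<subseteq> Hgens r \<and> set v' \<subseteq> Egens r \<and>
      gw v ** expt (f i) t = expt (f i) t' ** gw w ** gw v'" by auto
  obtain j s where g: "g = GE j s" "j \<in> {1..r}" using snoc.prems by (auto simp: Egens_def)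
  show ?case
  proof (cases "j = i \<and> s \<noteq> 0")
    case False
    have comm: "expt (e j) s ** expt (f i) t = expt (f i) t ** expt (e j) s" for t
    proof (cases "s = 0")
      case False
      with \<open>\<not> (j = i \<and> s \<noteq> 0)\<close> have "lie_bracket (e j) (f i) = 0" using ef[OF g(2) assms(2)] by simp
      then show ?thesis by (intro expt_commuting) (simp add: lie_bracket_def)
    qed simp
    show ?thesis
    proof (intro exI[of _ \<delta>] conjI allI impI \<delta>(1))
      fix t :: complex assume "norm t < \<delta>"
      then obtain t' w v' where *: "set w \<subseteq> Hgens r" "set v' \<subseteq> Egens r"
          "gw v ** expt (f i) t = expt (f i) t' ** gw w ** gw v'" using \<delta>(2) by blast
      have "gw (v @ [g]) ** expt (f i) t = gw v ** (expt (e j) s ** expt (f i) t)"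
        by (simp add: gw_append g matrix_mul_assoc)
      also have "\<dots> = gw v ** expt (f i) t ** expt (e j) s" by (simp add: comm matrix_mul_assoc)
      also have "\<dots> = expt (f i) t' ** gw w ** gw (v' @ [g])"
        by (simp add: * gw_append g matrix_mul_assoc)
      finally show "\<exists>t' w v'. set w \<subseteq> Hgens r \<and> set v' \<subseteq> Egens r \<and>
          gw (v @ [g]) ** expt (f i) t = expt (f i) t' ** gw w ** gw v'"
        using * snoc.prems by (intro exI[of _ t'] exI[of _ w] exI[of _ "v' @ [g]"]) simp
    qed
  next
    case True
    then have ji: "j = i" and s: "s \<noteq> 0" by auto
    show ?thesis
    proof (intro exI[of _ "min (\<delta> / 2) (1 / (2 * norm s))"] conjI allI impI)
      show "0 < min (\<delta> / 2) (1 / (2 * norm s))" using \<delta>(1) s by simp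
      fix t :: complex assume t: "norm t < min (\<delta> / 2) (1 / (2 * norm s))"
      define L where "L = Ln (1 + s * t)"
      have "norm (s * t) < 1 / 2" using t s by (simp add: norm_mult field_simps)
      moreover have "1 \<le> norm (1 + s * t) + norm (s * t)"
        using norm_triangle_ineq4[of "1 + s * t" "s * t"] by simp
      ultimately have n: "norm (1 + s * t) > 1 / 2" by linarith
      then have nz: "1 + s * t \<noteq> 0" by auto
      then have L: "exp L = 1 + s * t" "exp (- L) = 1 / (1 + s * t)"
        by (simp_all add: L_def exp_minus divide_inverse)
      define t1 where "t1 = t / (1 + s * t)"
      have t1_eq: "1 - 1 / (1 + s * t) = s * t1" using nz by (simp add: t1_def field_simps)
      have t1: "(1 - exp (- L)) / s = t1" "(exp L - 1) / s = t"
        using s by (simp_all add: L t1_eq)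
      have "norm t1 \<le> norm t / (1 / 2)"
        unfolding t1_def norm_divide using n by (intro divide_left_mono) auto
      then have "norm t1 < \<delta>" using t by simp
      then obtain t' w v' where *: "set w \<subseteq> Hgens r" "set v' \<subseteq> Egens r"
          "gw v ** expt (f i) t1 = expt (f i) t' ** gw w ** gw v'" using \<delta>(2) by blast
      obtain v'' where v'': "set v'' \<subseteq> Egens r" "gw v' ** expt (h i) L = expt (h i) L ** gw v''"
        using gw_E_torus[OF *(2) assms(2)] by blast
      let ?c = "s * exp (- L)"
      have sl2: "expt (e i) s ** expt (f i) t = expt (f i) t1 ** expt (h i) L ** expt (e i) ?c"
        using sl2_factorization[OF sl2_relations[OF assms(2)] s, of L] unfolding t1 .
      have "gw (v @ [g]) ** expt (f i) t = gw v ** (expt (e i) s ** expt (f i) t)"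
        by (simp add: gw_append g ji matrix_mul_assoc)
      also have "\<dots> = gw v ** expt (f i) t1 ** expt (h i) L ** expt (e i) ?c"
        by (simp only: sl2 matrix_mul_assoc)
      also have "\<dots> = expt (f i) t' ** gw w ** (gw v' ** expt (h i) L) ** expt (e i) ?c"
        by (simp only: * matrix_mul_assoc)
      also have "\<dots> = expt (f i) t' ** gw (w @ [GH i L]) ** gw (v'' @ [GE i ?c])"
        by (simp add: v'' gw_append matrix_mul_assoc)
      finally show "\<exists>t' w v'. set w \<subseteq> Hgens r \<and> set v' \<subseteq> Egens r \<and>
          gw (v @ [g]) ** expt (f i) t = expt (f i) t' ** gw w ** gw v'"
        using * v'' assms(2)
        by (intro exI[of _ t'] exI[of _ "w @ [GH i L]"] exI[of _ "v'' @ [GE i ?c]"])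
          (auto simp: Egens_def Hgens_def)
    qed
  qed
qed

text \<open>The parameter is restricted to a neighbourhood of \<open>0\<close> because \<open>1 + s
  t\<close> must not vanish in the factorization.\<close>

lemma big_cell_f:
  assumes "x \<in> big_cell" "i \<in> {1..r}"
  shows "\<exists>\<delta>>0. \<forall>t. norm t < \<delta> \<longrightarrow> x ** expt (f i) t \<in> big_cell"
proof -
  obtain u w v where x: "x = gw u ** gw w ** gw v" "set u \<subseteq> Fgens r" "set w \<subseteq> Hgens r" "set v \<subseteq> Egens r"
    using assms(1) by (auto simp: big_cell_def)
  obtain \<delta> where \<delta>: "\<delta> > 0" "\<And>t. norm t < \<delta> \<Longrightarrow> \<exists>t' w v'. set w \<subseteq> Hgens r \<and> set v' \<subseteq> Egens r \<and>
      gw v ** expt (f i) t = expt (f i) t' ** gw w ** gw v'" using move_f_left[OF x(4) assms(2)] by blast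
  show ?thesis
  proof (intro exI[of _ \<delta>] conjI allI impI \<delta>(1))
    fix t :: complex assume "norm t < \<delta>"
    then obtain t' w' v' where *: "set w' \<subseteq> Hgens r" "set v' \<subseteq> Egens r"
      "gw v ** expt (f i) t = expt (f i) t' ** gw w' ** gw v'" using \<delta>(2) by blast
    have "set [GF i t'] \<subseteq> Fgens r" using assms(2) by (auto simp: Fgens_def)
    then obtain u' where u': "set u' \<subseteq> Fgens r" "gw w ** gw [GF i t'] = gw u' ** gw w"
      using gw_HF[OF x(3)] by blast
    have "x ** expt (f i) t = gw u ** gw w ** (gw v ** expt (f i) t)" by (simp only: x matrix_mul_assoc)
    also have "\<dots> = gw u ** (gw w ** gw [GF i t']) ** gw w' ** gw v'" by (simp add: * matrix_mul_assoc)
    also have "\<dots> = gw (u @ u') ** gw (w @ w') ** gw v'" unfolding u' by (simp add: gw_append matrix_mul_assoc)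
    finally show "x ** expt (f i) t \<in> big_cell"
      unfolding big_cell_def using u' x *
      by (intro CollectI exI[of _ "u @ u'"] exI[of _ "w @ w'"] exI[of _ v']) simp
  qed
qed

lemma big_cell_e:
  assumes "x \<in> big_cell" "i \<in> {1..r}"
  shows "x ** expt (e i) t \<in> big_cell"
proof -
  obtain u w v where x: "x = gw u ** gw w ** gw v" "set u \<subseteq> Fgens r" "set w \<subseteq> Hgens r" "set v \<subseteq> Egens r"
    using assms(1) by (auto simp: big_cell_def)
  then have "x ** expt (e i) t = gw u ** gw w ** gw (v @ [GE i t])" by (simp add: gw_append matrix_mul_assoc)
  then show ?thesis unfolding big_cell_def using x assms(2)
    by (intro CollectI exI[of _ u] exI[of _ w] exI[of _ "v @ [GE i t]"]) (auto simp: Egens_def)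
qed

lemma one_in_big_cell: "mat 1 \<in> big_cell"
  unfolding big_cell_def by (intro CollectI exI[of _ "[]"]) simp

text \<open>A polynomial that vanishes on a translate of the big cell vanishes on the translate of the
  whole group: as a function of the parameter of a single factor \<open>y\<^sub>i(t)\<close> it is entire and vanishes
  near \<open>0\<close>.\<close>

lemma big_cell_dense:
  assumes p: "p \<in> poly_funs" "\<And>x. x \<in> big_cell \<Longrightarrow> p (A ** x) = 0" and z: "set z \<subseteq> Egens r \<union> Fgens r"
  shows "p (A ** gw z) = 0"
proof -
  have "\<forall>x\<in>big_cell. p (A ** x ** gw z) = 0" using z
  proof (induction z)
    case Nil
    then show ?case using p(2) by simp
  next
    case (Cons g z)
    show ?case
    proof
      fix x assume x: "x \<in> big_cell"
      consider i t where "g = GE i t" "i \<in> {1..r}" | i t where "g = GF i t" "i \<in> {1..r}"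
        using Cons.prems by (auto simp: Egens_def Fgens_def)
      then show "p (A ** x ** gw (g # z)) = 0"
      proof cases
        case 1
        have "p (A ** (x ** expt (e i) t) ** gw z) = 0" using Cons big_cell_e[OF x 1(2), of t] by simp
        then show ?thesis by (simp add: 1 matrix_mul_assoc)
      next
        case 2
        obtain \<delta> where \<delta>: "\<delta> > 0" "\<And>t. norm t < \<delta> \<Longrightarrow> x ** expt (f i) t \<in> big_cell"
          using big_cell_f[OF x 2(2)] by blast
        define B where "B = A ** x"
        have entry: "(\<lambda>t. (B ** expt (f i) t ** gw z) $ a $ b) holomorphic_on UNIV" for a b
          unfolding matrix_mult_nth
          by (intro holomorphic_on_sum holomorphic_on_mult holomorphic_on_const
              holomorphic_expt_entry holomorphic_on_ident)
        have hol: "(\<lambda>t. p (B ** expt (f i) t ** gw z)) holomorphic_on UNIV"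
          by (rule poly_funs_holomorphic[where F = "\<lambda>t. B ** expt (f i) t ** gw z", OF p(1) entry])
        have zero: "p (B ** expt (f i) s ** gw z) = 0" if "s \<in> ball 0 \<delta>" for s
        proof -
          have "p (A ** (x ** expt (f i) s) ** gw z) = 0" using Cons \<delta>(2)[of s] that by simp
          then show ?thesis by (simp add: B_def matrix_mul_assoc)
        qed
        have "p (B ** expt (f i) t ** gw z) = 0"
          using analytic_continuation_open[OF open_ball open_UNIV _ connected_UNIV subset_UNIV hol
              holomorphic_on_const[of 0 UNIV], of 0 \<delta> t] zero \<delta>(1) by simp
        then show ?thesis by (simp add: 2 B_def matrix_mul_assoc)
      qed
    qed
  qed
  from bspec[OF this one_in_big_cell] show ?thesis by simp
qed

subsection \<open>Uniqueness of the torus component\<close>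

end

lemma cartan_B_sum:
  assumes "j \<in> {1..r}"
  shows "(\<Sum>i\<in>{1..r}. c i * of_int (cartan_B r i j)) =
     2 * c j - (if 1 < j then c (j - 1) else 0) -
     (if j < r then (if j + 1 = r then 2 else 1) * c (j + 1) else (0::complex))"
proof -
  have "(\<Sum>i\<in>{1..r}. c i * of_int (cartan_B r i j)) =
      (\<Sum>i\<in>{1..r}. (if i = j then 2 * c i else 0) - (if i = j - 1 then c i else 0) -
        (if i = j + 1 then (if i = r then 2 else 1) * c i else 0))"
    using assms by (intro sum.cong) (auto simp: cartan_B_def)
  also have "\<dots> = (if j \<in> {1..r} then 2 * c j else 0) - (if j - 1 \<in> {1..r} then c (j - 1) else 0) -
      (if j + 1 \<in> {1..r} then (if j + 1 = r then 2 else 1) * c (j + 1) else 0)"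
    by (simp only: sum_subtractf sum.delta finite_atLeastAtMost)
  finally show ?thesis using assms by (auto simp del: of_nat_Suc)
qed

text \<open>The Cartan matrix is invertible: the relations for \<open>j = 1, 2, \<dots>\<close> express
  \<open>c j\<close> as \<open>j * c 1\<close>, and the last one then forces \<open>c 1 = 0\<close>.\<close>

lemma cartan_B_kernel:
  assumes r: "2 \<le> r" and z: "\<And>j. j \<in> {1..r} \<Longrightarrow> (\<Sum>i\<in>{1..r}. c i * of_int (cartan_B r i j)) = (0::complex)"
    and i: "i \<in> {1..r}"
  shows "c i = 0"
proof -
  have eq: "2 * c j = (if 1 < j then c (j - 1) else 0) + (if j < r then (if j + 1 = r then 2 else 1) * c (j + 1) else 0)"
    if "j \<in> {1..r}" for j using z[OF that] unfolding cartan_B_sum[OF that] by (simp add: algebra_simps)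
  have lin: "c j = of_nat j * c 1 \<and> (j + 1 < r \<longrightarrow> c (j + 1) = of_nat (j + 1) * c 1)" if "1 \<le> j" "j < r" for j
    using that
  proof (induction j rule: dec_induct)
    case base
    show ?case using eq[of 1] r by auto
  next
    case (step j)
    then show ?case using eq[of "j + 1"] by (auto simp: algebra_simps)
  qed
  have l: "c (r - 1) = of_nat (r - 1) * c 1" using lin[of "r - 1"] r by simp
  have a: "2 * c r = c (r - 1)" using eq[of r] r by simp
  have b: "2 * c (r - 1) = of_nat (r - 2) * c 1 + 2 * c r"
    using eq[of "r - 1"] r lin[of "r - 2"] by (cases "r = 2") (auto simp: numeral_2_eq_2)
  define n where "n = (of_nat (r - 2) :: complex)"
  have "of_nat (r - 1) = n + 1" using r by (simp add: of_nat_diff n_def)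
  then have l': "c (r - 1) = (n + 1) * c 1" using l by simp
  have "2 * ((n + 1) * c 1) = n * c 1 + (n + 1) * c 1" using b unfolding a l' n_def .
  then have "c 1 = 0" by algebra
  then show ?thesis using i lin[of i] a l by (cases "i = r") auto
qed

text \<open>The coefficients of an element of the Cartan subalgebra on which all simple roots take the value
  \<open>1\<close>.\<close>

definition rho_coeff :: "nat \<Rightarrow> nat \<Rightarrow> complex" where
  "rho_coeff r j = (if j < r then of_nat j * (2 * of_nat r + 1 - of_nat j) / 2 else of_nat r * (of_nat r + 1) / 4)"

lemma rho_coeff_sum:
  assumes r: "2 \<le> r" and j: "j \<in> {1..r}"
  shows "(\<Sum>i\<in>{1..r}. rho_coeff r i * of_int (cartan_B r i j)) = 1"
proof -
  obtain k where k: "j = Suc k" using j by (cases j) auto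
  consider "j = r" | "j + 1 = r" | "j + 1 < r" using j by fastforce
  then show ?thesis
    unfolding cartan_B_sum[OF j] using r j k
    by cases (auto simp: rho_coeff_def field_simps)
qed

context chevalley_matrices
begin

definition rho :: "complex^'n^'n" where
  "rho = (\<Sum>i\<in>{1..r}. cscale (rho_coeff r i) (h i))"

lemma lie_bracket_sum_left: "lie_bracket (\<Sum>i\<in>I. F i) Z = (\<Sum>i\<in>I. lie_bracket (F i) Z)"
  by (induction I rule: infinite_finite_induct) (simp_all add: lie_bracket_add_left, simp_all add: lie_bracket_def)

lemma cscale_sum_left: "(\<Sum>i\<in>I. cscale (c i) Z) = cscale (\<Sum>i\<in>I. c i) Z"
  by (induction I rule: infinite_finite_induct) (simp_all add: cscale_add_left)

lemma weight_bracket: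
  assumes "j \<in> {1..r}"
  shows "lie_bracket (\<Sum>i\<in>{1..r}. cscale (c i) (h i)) (e j) = cscale (\<Sum>i\<in>{1..r}. c i * of_int (cartan_B r i j)) (e j)"
    "lie_bracket (\<Sum>i\<in>{1..r}. cscale (c i) (h i)) (f j) = cscale (- (\<Sum>i\<in>{1..r}. c i * of_int (cartan_B r i j))) (f j)"
    "lie_bracket (\<Sum>i\<in>{1..r}. cscale (c i) (h i)) (h j) = 0"
  using assms by (simp_all add: lie_bracket_sum_left lie_bracket_cscale_left he hf hh cscale_sum_left flip: sum_negf)

lemma rho_bracket:
  assumes "j \<in> {1..r}"
  shows "lie_bracket rho (e j) = cscale 1 (e j)" "lie_bracket rho (f j) = cscale (- 1) (f j)" "lie_bracket rho (h j) = 0"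
  unfolding rho_def weight_bracket[OF assms] rho_coeff_sum[OF rank assms] by simp_all

lemma rho_scales:
  "set v \<subseteq> Egens r \<Longrightarrow> expt rho s ** gw v = gw (map (gen_scale (exp s)) v) ** expt rho s"
  "set u \<subseteq> Fgens r \<Longrightarrow> expt rho s ** gw u = gw (map (gen_scale (exp (- s))) u) ** expt rho s"
  "set w \<subseteq> Hgens r \<Longrightarrow> expt rho s ** gw w = gw w ** expt rho s"
proof -
  have step: "A ** (B ** C) = (B' ** C') ** A" if "A ** B = B' ** A" "A ** C = C' ** A"
    for A B C B' C' :: "complex^'n^'n"
  proof -
    have "A ** (B ** C) = B' ** A ** C" by (simp only: that(1) matrix_mul_assoc)
    also have "\<dots> = B' ** (A ** C)" by (simp only: matrix_mul_assoc)
    also have "\<dots> = (B' ** C') ** A" by (simp only: that(2) matrix_mul_assoc)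
    finally show ?thesis .
  qed
  show "set v \<subseteq> Egens r \<Longrightarrow> expt rho s ** gw v = gw (map (gen_scale (exp s)) v) ** expt rho s"
  proof (induction v)
    case (Cons g v)
    then obtain j t where g: "g = GE j t" "j \<in> {1..r}" by (auto simp: Egens_def)
    then show ?case
      using step[OF expt_eigen_expt[OF rho_bracket(1)[OF g(2)], of s t] Cons.IH] Cons.prems by simp
  qed simp
  show "set u \<subseteq> Fgens r \<Longrightarrow> expt rho s ** gw u = gw (map (gen_scale (exp (- s))) u) ** expt rho s"
  proof (induction u)
    case (Cons g u)
    then obtain j t where g: "g = GF j t" "j \<in> {1..r}" by (auto simp: Fgens_def)
    then show ?case
      using step[OF expt_eigen_expt[OF rho_bracket(2)[OF g(2)], of s t] Cons.IH] Cons.prems by simp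
  qed simp
  show "set w \<subseteq> Hgens r \<Longrightarrow> expt rho s ** gw w = gw w ** expt rho s"
  proof (induction w)
    case (Cons g w)
    then obtain j t where g: "g = GH j t" "j \<in> {1..r}" by (auto simp: Hgens_def)
    have "expt rho s ** expt (h j) t = expt (h j) t ** expt rho s"
      by (rule expt_commuting) (use rho_bracket(3)[OF g(2)] in \<open>simp add: lie_bracket_def\<close>)
    from step[OF this Cons.IH] show ?case using Cons.prems g by simp
  qed simp
qed

lemma holomorphic_gw_scale: "(\<lambda>z. gw (map (gen_scale z) v) $ a $ b) holomorphic_on UNIV"
proof (induction v arbitrary: a)
  case (Cons g v)
  have "(\<lambda>z. gmat (gen_scale z g) $ a $ c) holomorphic_on UNIV" for c
    by (cases g) (auto intro!: holomorphic_expt_entry holomorphic_on_mult holomorphic_on_ident holomorphic_on_const)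
  then show ?case
    using Cons.IH by (auto simp: matrix_mult_nth intro!: holomorphic_on_sum holomorphic_on_mult)
qed simp

lemma gw_scale_0: "gw (map (gen_scale 0) v) = mat 1"
proof (induction v)
  case (Cons g v)
  then show ?case by (cases g) auto
qed simp

text \<open>Conjugation by the cocharacter of \<open>rho\<close> multiplies the parameters in \<open>N\<close> by \<open>z\<close> and those in
  \<open>N\<^sub>-\<close> by \<open>1 / z\<close>. If \<open>n\<^sub>- a = n\<^sub>+\<close>, the resulting entire function of \<open>z\<close> has the limit \<open>a\<close> at
  infinity and the value \<open>1\<close> at \<open>0\<close>, so \<open>a = 1\<close> by Liouville's theorem.\<close>

lemma torus_part_trivial:
  assumes "set u \<subseteq> Fgens r" "set w \<subseteq> Hgens r" "set v \<subseteq> Egens r" and eq: "gw u ** gw w = gw v"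
  shows "gw w = mat 1"
proof (rule matrix_eqI)
  fix a b
  let ?Q = "\<lambda>z. gw (map (gen_scale z) v)" and ?R = "\<lambda>z. gw (map (gen_scale z) u)"
  have QR: "?Q z = ?R (inverse z) ** gw w" if "z \<noteq> 0" for z
  proof -
    define s where "s = Ln z"
    have z: "exp s = z" "exp (- s) = inverse z" using that by (simp_all add: s_def exp_minus)
    have "?Q z ** expt rho s = expt rho s ** gw v" using rho_scales(1)[OF assms(3), of s] z by simp
    also have "\<dots> = expt rho s ** gw u ** gw w" by (simp add: eq[symmetric] matrix_mul_assoc)
    also have "\<dots> = ?R (inverse z) ** (expt rho s ** gw w)"
      using rho_scales(2)[OF assms(1), of s] z by (simp add: matrix_mul_assoc)
    also have "\<dots> = ?R (inverse z) ** gw w ** expt rho s"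
      using rho_scales(3)[OF assms(2), of s] by (simp add: matrix_mul_assoc)
    finally have "?Q z ** expt rho s ** expt rho (- s) = ?R (inverse z) ** gw w ** expt rho s ** expt rho (- s)"
      by simp
    then show ?thesis by simp
  qed
  have "((\<lambda>z. (?R (inverse z) ** gw w) $ a $ b) \<longlongrightarrow> (?R 0 ** gw w) $ a $ b) at_infinity"
    unfolding matrix_mult_nth
  proof (intro tendsto_sum tendsto_mult tendsto_const)
    fix c
    have "isCont (\<lambda>z. ?R z $ a $ c) 0"
      using holomorphic_on_imp_continuous_on[OF holomorphic_gw_scale[of u a c]]
      by (simp add: continuous_on_eq_continuous_at)
    from isCont_tendsto_compose[OF this tendsto_inverse_0]
    show "((\<lambda>z. ?R (inverse z) $ a $ c) \<longlongrightarrow> ?R 0 $ a $ c) at_infinity" .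
  qed
  moreover have "eventually (\<lambda>z::complex. z \<noteq> 0) at_infinity"
    unfolding eventually_at_infinity by (intro exI[of _ 1]) auto
  then have "eventually (\<lambda>z. (?R (inverse z) ** gw w) $ a $ b = ?Q z $ a $ b) at_infinity"
    by eventually_elim (simp add: QR)
  ultimately have "((\<lambda>z. ?Q z $ a $ b) \<longlongrightarrow> gw w $ a $ b) at_infinity"
    by (simp add: gw_scale_0 tendsto_cong)
  from Liouville_weak[OF holomorphic_gw_scale this, of 0]
  show "gw w $ a $ b = mat 1 $ a $ b" by (simp add: gw_scale_0)
qed

text \<open>Two factorizations of the same element are compared by moving the unipotent factors to opposite
  sides.\<close>

lemma torus_part_unique:
  assumes "set u1 \<subseteq> Fgens r" "set w1 \<subseteq> Hgens r" "set v1 \<subseteq> Egens r"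
    and "set u2 \<subseteq> Fgens r" "set w2 \<subseteq> Hgens r" "set v2 \<subseteq> Egens r"
    and eq: "gw u1 ** gw w1 ** gw v1 = gw u2 ** gw w2 ** gw v2"
  shows "gw w1 = gw w2"
proof -
  have "set (winv w2) \<subseteq> Hgens r" "set (winv u2 @ u1) \<subseteq> Fgens r" using assms winv_in by auto
  then obtain u' where u': "set u' \<subseteq> Fgens r" "gw (winv w2) ** gw (winv u2 @ u1) = gw u' ** gw (winv w2)"
    using gw_HF by blast
  have "gw u' ** gw (winv w2 @ w1) = gw u' ** gw (winv w2) ** gw w1"
    by (simp add: gw_append matrix_mul_assoc)
  also have "\<dots> = gw (winv w2) ** gw (winv u2) ** (gw u1 ** gw w1 ** gw v1) ** gw (winv v1)"
    unfolding u'(2)[symmetric] by (simp add: gw_append gw_winv flip: matrix_mul_assoc)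
  also have "\<dots> = gw (winv w2) ** (gw (winv u2) ** gw u2) ** gw w2 ** gw v2 ** gw (winv v1)"
    unfolding eq by (simp add: matrix_mul_assoc)
  also have "\<dots> = gw (v2 @ winv v1)" by (simp add: gw_winv gw_append)
  finally have "gw (winv w2 @ w1) = mat 1"
    using u' assms winv_in by (intro torus_part_trivial[of u' _ "v2 @ winv v1"]) auto
  then have "gw w2 ** (gw (winv w2) ** gw w1) = gw w2" by (simp add: gw_append)
  then show ?thesis by (simp add: matrix_mul_assoc gw_winv)
qed

end

section \<open>The vector representation\<close>

type_synonym vect = "nat \<Rightarrow> complex"

text \<open>The standard module of dimension \<open>2 r + 1\<close>; the basis vector at position \<open>k\<close> belongs to the
  letter with \<open>pos\<close> equal to \<open>k\<close>. Vectors are functions on \<open>nat\<close>, so that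
  operators compose associatively without side conditions on dimensions.\<close>

text \<open>The zero weight vector is normalized so that lowering operators have coefficient
  \<open>1\<close> when they lead to it and \<open>2\<close> when they leave it.\<close>

definition mult_B :: "nat \<Rightarrow> nat \<Rightarrow> complex" where
  "mult_B r i = (if i = r then 2 else 1)"

definition opE :: "nat \<Rightarrow> nat \<Rightarrow> vect \<Rightarrow> vect" where
  "opE r i x k = (if k = i then mult_B r i * x (i + 1) else if k = 2 * r + 1 - i then x (2 * r + 2 - i) else 0)"

definition opF :: "nat \<Rightarrow> nat \<Rightarrow> vect \<Rightarrow> vect" where
  "opF r i x k = (if k = i + 1 then x i else if k = 2 * r + 2 - i then mult_B r i * x (2 * r + 1 - i) else 0)"

definition weight :: "nat \<Rightarrow> nat \<Rightarrow> nat \<Rightarrow> complex" where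
  "weight r i k = mult_B r i * ((if k = i then 1 else 0) - (if k = i + 1 then 1 else 0)
     + (if k = 2 * r + 1 - i then 1 else 0) - (if k = 2 * r + 2 - i then 1 else 0))"

definition opH :: "nat \<Rightarrow> nat \<Rightarrow> vect \<Rightarrow> vect" where
  "opH r i x k = weight r i k * x k"

definition oadd :: "(vect \<Rightarrow> vect) \<Rightarrow> (vect \<Rightarrow> vect) \<Rightarrow> vect \<Rightarrow> vect" where
  "oadd A B = (\<lambda>x k. A x k + B x k)"

definition oscale :: "complex \<Rightarrow> (vect \<Rightarrow> vect) \<Rightarrow> vect \<Rightarrow> vect" where
  "oscale c A = (\<lambda>x k. c * A x k)"

definition ozero :: "vect \<Rightarrow> vect" where
  "ozero = (\<lambda>x k. 0)"

definition obr :: "(vect \<Rightarrow> vect) \<Rightarrow> (vect \<Rightarrow> vect) \<Rightarrow> vect \<Rightarrow> vect" where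
  "obr A B = (\<lambda>x k. A (B x) k - B (A x) k)"

definition olin :: "nat \<Rightarrow> (vect \<Rightarrow> vect) \<Rightarrow> bool" where
  "olin N Z \<longleftrightarrow> (\<forall>x y. Z (\<lambda>k. x k + y k) = (\<lambda>k. Z x k + Z y k)) \<and>
     (\<forall>c x. Z (\<lambda>k. c * x k) = (\<lambda>k. c * Z x k)) \<and>
     (\<forall>x k. k \<notin> {1..N} \<longrightarrow> Z x k = 0) \<and>
     (\<forall>x y. (\<forall>k\<in>{1..N}. x k = y k) \<longrightarrow> Z x = Z y)"

lemma olin_add: "olin N Z \<Longrightarrow> Z (\<lambda>k. x k + y k) = (\<lambda>k. Z x k + Z y k)"
  and olin_scale: "olin N Z \<Longrightarrow> Z (\<lambda>k. c * x k) = (\<lambda>k. c * Z x k)"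
  and olin_outside: "olin N Z \<Longrightarrow> k \<notin> {1..N} \<Longrightarrow> Z x k = 0"
  and olin_cong: "olin N Z \<Longrightarrow> (\<And>k. k \<in> {1..N} \<Longrightarrow> x k = y k) \<Longrightarrow> Z x = Z y"
  unfolding olin_def by blast+

lemma olin_diff: "olin N Z \<Longrightarrow> Z (\<lambda>k. x k - y k) = (\<lambda>k. Z x k - Z y k)"
  using olin_add[of N Z x "\<lambda>k. (-1) * y k"] olin_scale[of N Z "-1" y] by simp

lemma olin_sum:
  assumes "olin N Z" "finite I"
  shows "Z (\<lambda>k. \<Sum>i\<in>I. c i * F i k) = (\<lambda>k. \<Sum>i\<in>I. c i * Z (F i) k)"
  using assms(2)
proof (induction I rule: finite_induct)
  case empty
  then show ?case using olin_scale[OF assms(1), of 0 "\<lambda>_. 0"] by simp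
next
  case (insert i I)
  then show ?case using olin_add[OF assms(1), of "\<lambda>k. c i * F i k" "\<lambda>k. \<Sum>i\<in>I. c i * F i k"]
      olin_scale[OF assms(1)] by simp
qed

definition delta :: "nat \<Rightarrow> vect" where
  "delta p = (\<lambda>k. if k = p then 1 else 0)"

lemma olin_expand:
  assumes "olin N Z"
  shows "Z x k = (\<Sum>q\<in>{1..N}. x q * Z (delta q) k)"
proof -
  have "Z x = Z (\<lambda>k. \<Sum>q\<in>{1..N}. x q * delta q k)"
    by (rule olin_cong[OF assms]) (simp add: delta_def if_distrib cong: if_cong)
  then show ?thesis by (simp add: olin_sum[OF assms])
qed

lemma olin_oadd: "olin N A \<Longrightarrow> olin N B \<Longrightarrow> olin N (oadd A B)"
  unfolding olin_def oadd_def by (simp add: algebra_simps) metis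

lemma olin_oscale: "olin N A \<Longrightarrow> olin N (oscale c A)"
  unfolding olin_def oscale_def by (simp add: algebra_simps) metis

lemma olin_ozero: "olin N ozero"
  unfolding olin_def ozero_def by simp

lemma olin_obr:
  assumes "olin N A" "olin N B"
  shows "olin N (obr A B)"
proof -
  have "obr A B x = obr A B y" if "\<forall>k\<in>{1..N}. x k = y k" for x y
    using olin_cong[OF assms(1), of x y] olin_cong[OF assms(2), of x y] that by (simp add: obr_def)
  then show ?thesis using assms
    unfolding olin_def[of _ "obr A B"] by (auto simp: obr_def olin_add olin_scale olin_outside algebra_simps)
qed

text \<open>Linearity is needed because operators are arbitrary functions on vectors.\<close>

lemma obr_jacobi:
  assumes "olin N A" "olin N B" "olin N C"
  shows "obr A (obr B C) = oadd (obr (obr A B) C) (obr B (obr A C))"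
  using assms by (intro ext) (simp add: obr_def oadd_def olin_diff)

lemma obr_oadd: "olin N A \<Longrightarrow> obr A (oadd B C) = oadd (obr A B) (obr A C)"
  by (intro ext) (simp add: obr_def oadd_def olin_add)

lemma obr_oscale: "olin N A \<Longrightarrow> obr A (oscale c B) = oscale c (obr A B)"
  by (intro ext) (simp add: obr_def oscale_def olin_scale algebra_simps)

lemma obr_ozero: "olin N A \<Longrightarrow> obr A ozero = ozero"
  using olin_scale[of N A 0 "\<lambda>_. 0"] by (intro ext) (simp add: obr_def ozero_def)

lemma oscale_left: "olin N C \<Longrightarrow> obr (oscale c B) C = oscale c (obr B C)"
  by (intro ext) (simp add: obr_def oscale_def olin_scale algebra_simps)

context
  fixes r i :: nat
  assumes i: "i \<in> {1..r}"
begin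

lemma olin_opE: "olin (2 * r + 1) (opE r i)"
proof -
  have "opE r i x = opE r i y" if "\<forall>k\<in>{1..2 * r + 1}. x k = y k" for x y
  proof -
    have "i + 1 \<in> {1..2 * r + 1}" "2 * r + 2 - i \<in> {1..2 * r + 1}" using i by auto
    then have "x (i + 1) = y (i + 1)" "x (2 * r + 2 - i) = y (2 * r + 2 - i)" using that by blast+
    then show ?thesis by (intro ext) (simp add: opE_def)
  qed
  then show ?thesis using i unfolding olin_def by (auto simp: opE_def fun_eq_iff algebra_simps)
qed

lemma olin_opF: "olin (2 * r + 1) (opF r i)"
proof -
  have "opF r i x = opF r i y" if "\<forall>k\<in>{1..2 * r + 1}. x k = y k" for x y
  proof -
    have "i \<in> {1..2 * r + 1}" "2 * r + 1 - i \<in> {1..2 * r + 1}" using i by auto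
    then have "x i = y i" "x (2 * r + 1 - i) = y (2 * r + 1 - i)" using that by blast+
    then show ?thesis by (intro ext) (simp add: opF_def)
  qed
  then show ?thesis using i unfolding olin_def by (auto simp: opF_def fun_eq_iff algebra_simps)
qed

lemma olin_opH: "olin (2 * r + 1) (opH r i)"
proof -
  have w: "weight r i k = 0" if "k \<notin> {1..2 * r + 1}" for k using that i by (auto simp: weight_def)
  have "opH r i x = opH r i y" if "\<forall>k\<in>{1..2 * r + 1}. x k = y k" for x y
    using that w by (intro ext) (auto simp: opH_def)
  then show ?thesis using w unfolding olin_def by (auto simp: opH_def fun_eq_iff algebra_simps)
qed

end

lemma opEF:
  assumes i: "i \<in> {1..r}" and j: "j \<in> {1..r}"
  shows "obr (opE r i) (opF r j) = (if i = j then opH r i else ozero)"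
proof (intro ext)
  fix x k
  have 1: "opF r j x (i + 1) = (if i = j then x i else 0)"
    and 2: "opF r j x (2 * r + 2 - i) = (if i = j then mult_B r i * x (2 * r + 1 - i) else 0)"
    and 3: "opE r i x j = (if i = j then mult_B r i * x (i + 1) else 0)"
    and 4: "opE r i x (2 * r + 1 - j) = (if i = j then x (2 * r + 2 - i) else 0)"
    using i j by (auto simp: opE_def opF_def)
  have "obr (opE r i) (opF r j) x k =
      (if k = i then mult_B r i * opF r j x (i + 1) else if k = 2 * r + 1 - i then opF r j x (2 * r + 2 - i) else 0) -
      (if k = j + 1 then opE r i x j else if k = 2 * r + 2 - j then mult_B r j * opE r i x (2 * r + 1 - j) else 0)"
    unfolding obr_def by (simp only: opE_def[of r i "opF r j x"] opF_def[of r j "opE r i x"])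
  also have "\<dots> = (if i = j then opH r i else ozero) x k"
  proof (cases "i = j")
    case True
    define q where "q = 2 * r + 1 - i"
    have q: "2 * r + 1 - i = q" "2 * r + 2 - i = q + 1" "q \<noteq> i" "q + 1 \<noteq> i" using i by (auto simp: q_def)
    show ?thesis
      unfolding 1 2 3 4 unfolding True[symmetric] opH_def weight_def q(1,2) using q(3,4) by simp
  next
    case False
    then show ?thesis unfolding 1 2 3 4 by (simp add: ozero_def)
  qed
  finally show "obr (opE r i) (opF r j) x k = (if i = j then opH r i else ozero) x k" .
qed

lemma weight_cartan:
  assumes i: "i \<in> {1..r}" and j: "j \<in> {1..r}"
  shows "weight r i j - weight r i (j + 1) = of_int (cartan_B r i j)"
    "weight r i (2 * r + 1 - j) - weight r i (2 * r + 2 - j) = of_int (cartan_B r i j)"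
proof -
  define p q where "p = 2 * r + 1 - i" and "q = 2 * r + 1 - j"
  have q: "2 * r + 1 - j = q" "2 * r + 2 - j = q + 1" "j + q = 2 * r + 1" using j by (auto simp: q_def)
  have p: "2 * r + 1 - i = p" "2 * r + 2 - i = p + 1" "i + p = 2 * r + 1" using i by (auto simp: p_def)
  consider "i = j" "i < r" | "i = j" "i = r" | "i = j + 1" "i < r" | "i = j + 1" "i = r" | "j = i + 1"
    | "i \<noteq> j" "i \<noteq> j + 1" "j \<noteq> i + 1" using i by force
  then show "weight r i j - weight r i (j + 1) = of_int (cartan_B r i j)"
    "weight r i (2 * r + 1 - j) - weight r i (2 * r + 2 - j) = of_int (cartan_B r i j)"
    unfolding weight_def p q cartan_B_def mult_B_def using i j p(3) q(3) by (cases; simp)+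
qed

lemma opHE:
  assumes i: "i \<in> {1..r}" and j: "j \<in> {1..r}"
  shows "obr (opH r i) (opE r j) = oscale (of_int (cartan_B r i j)) (opE r j)"
proof (intro ext)
  fix x k
  define q where "q = 2 * r + 1 - j"
  have q: "2 * r + 1 - j = q" "2 * r + 2 - j = q + 1" using j by (auto simp: q_def)
  have w: "weight r i j = weight r i (j + 1) + of_int (cartan_B r i j)"
    "weight r i q = weight r i (q + 1) + of_int (cartan_B r i j)"
    using weight_cartan[OF assms] unfolding q by (simp_all add: algebra_simps)
  show "obr (opH r i) (opE r j) x k = oscale (of_int (cartan_B r i j)) (opE r j) x k"
    unfolding obr_def opE_def opH_def oscale_def q by (auto simp: w algebra_simps)
qed

lemma opHF:
  assumes i: "i \<in> {1..r}" and j: "j \<in> {1..r}"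
  shows "obr (opH r i) (opF r j) = oscale (- of_int (cartan_B r i j)) (opF r j)"
proof (intro ext)
  fix x k
  define q where "q = 2 * r + 1 - j"
  have q: "2 * r + 1 - j = q" "2 * r + 2 - j = q + 1" using j by (auto simp: q_def)
  have w: "weight r i j = weight r i (j + 1) + of_int (cartan_B r i j)"
    "weight r i q = weight r i (q + 1) + of_int (cartan_B r i j)"
    using weight_cartan[OF assms] unfolding q by (simp_all add: algebra_simps)
  show "obr (opH r i) (opF r j) x k = oscale (- of_int (cartan_B r i j)) (opF r j) x k"
    unfolding obr_def opF_def opH_def oscale_def q by (auto simp: w algebra_simps)
qed

definition strictly_upper :: "(vect \<Rightarrow> vect) \<Rightarrow> bool" where
  "strictly_upper Z \<longleftrightarrow> (\<forall>x p. (\<forall>q>p. x q = 0) \<longrightarrow> Z x p = 0)"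

definition strictly_lower :: "(vect \<Rightarrow> vect) \<Rightarrow> bool" where
  "strictly_lower Z \<longleftrightarrow> (\<forall>x p. (\<forall>q<p. x q = 0) \<longrightarrow> Z x p = 0)"

lemma strictly_upper_closed:
  "strictly_upper A \<Longrightarrow> strictly_upper B \<Longrightarrow> strictly_upper (oadd A B)"
  "strictly_upper A \<Longrightarrow> strictly_upper (oscale c A)"
  "strictly_upper ozero"
proof -
  show "strictly_upper A \<Longrightarrow> strictly_upper B \<Longrightarrow> strictly_upper (oadd A B)"
    by (simp add: strictly_upper_def oadd_def)
  show "strictly_upper A \<Longrightarrow> strictly_upper (oscale c A)"
    by (simp add: strictly_upper_def oscale_def)
  show "strictly_upper ozero"
    by (simp add: strictly_upper_def ozero_def)
qed

lemma strictly_upper_obr: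
  assumes "strictly_upper A" "strictly_upper B"
  shows "strictly_upper (obr A B)"
  unfolding strictly_upper_def
proof (intro allI impI)
  fix x :: vect and p assume x: "\<forall>q>p. x q = 0"
  have "A x q = 0" "B x q = 0" if "q > p" for q
    using assms that x unfolding strictly_upper_def by (meson less_trans)+
  then have "A (B x) p = 0" "B (A x) p = 0"
    using assms unfolding strictly_upper_def by blast+
  then show "obr A B x p = 0" by (simp add: obr_def)
qed

lemma strictly_lower_closed:
  "strictly_lower A \<Longrightarrow> strictly_lower B \<Longrightarrow> strictly_lower (oadd A B)"
  "strictly_lower A \<Longrightarrow> strictly_lower (oscale c A)"
  "strictly_lower ozero"
proof -
  show "strictly_lower A \<Longrightarrow> strictly_lower B \<Longrightarrow> strictly_lower (oadd A B)"
    by (simp add: strictly_lower_def oadd_def)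
  show "strictly_lower A \<Longrightarrow> strictly_lower (oscale c A)"
    by (simp add: strictly_lower_def oscale_def)
  show "strictly_lower ozero"
    by (simp add: strictly_lower_def ozero_def)
qed

lemma strictly_lower_obr:
  assumes "strictly_lower A" "strictly_lower B"
  shows "strictly_lower (obr A B)"
  unfolding strictly_lower_def
proof (intro allI impI)
  fix x :: vect and p assume x: "\<forall>q<p. x q = 0"
  have "A x q = 0" "B x q = 0" if "q < p" for q
    using assms that x unfolding strictly_lower_def by (meson less_trans)+
  then have "A (B x) p = 0" "B (A x) p = 0"
    using assms unfolding strictly_lower_def by blast+
  then show "obr A B x p = 0" by (simp add: obr_def)
qed

lemma strictly_upper_opE: "i \<in> {1..r} \<Longrightarrow> strictly_upper (opE r i)"
  unfolding strictly_upper_def opE_def by auto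

lemma strictly_lower_opF: "i \<in> {1..r} \<Longrightarrow> strictly_lower (opF r i)"
  unfolding strictly_lower_def opF_def by auto

text \<open>The basis vectors form a single string from the highest to the lowest weight vector.\<close>

lemma opF_delta:
  assumes "1 \<le> p" "p \<le> 2 * r"
  shows "\<exists>i\<in>{1..r}. \<exists>c. c \<noteq> 0 \<and> delta (p + 1) = (\<lambda>k. c * opF r i (delta p) k)"
proof (cases "p \<le> r")
  case True
  then show ?thesis using assms
    by (intro bexI[of _ p] exI[of _ 1]) (auto simp: opF_def delta_def fun_eq_iff)
next
  case False
  then show ?thesis using assms
    by (intro bexI[of _ "2 * r + 1 - p"] exI[of _ "1 / mult_B r (2 * r + 1 - p)"])
       (auto simp: opF_def delta_def fun_eq_iff mult_B_def)
qed

lemma opE_delta: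
  assumes "1 \<le> p" "p \<le> 2 * r"
  shows "\<exists>i\<in>{1..r}. \<exists>c. c \<noteq> 0 \<and> delta p = (\<lambda>k. c * opE r i (delta (p + 1)) k)"
proof (cases "p \<le> r")
  case True
  then show ?thesis using assms
    by (intro bexI[of _ p] exI[of _ "1 / mult_B r p"]) (auto simp: opE_def delta_def fun_eq_iff mult_B_def)
next
  case False
  then show ?thesis using assms
    by (intro bexI[of _ "2 * r + 1 - p"] exI[of _ 1])
       (auto simp: opE_def delta_def fun_eq_iff)
qed

lemma olin_eq_ozeroI:
  assumes "olin N Z" "\<And>p. p \<in> {1..N} \<Longrightarrow> Z (delta p) = (\<lambda>_. 0)"
  shows "Z = ozero"
proof (intro ext)
  fix x k
  show "Z x k = ozero x k" unfolding olin_expand[OF assms(1), of x k] using assms(2) by (simp add: ozero_def)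
qed

text \<open>An operator that commutes with the lowering operators is determined by its value on the first
  basis vector, and strict triangularity makes this value zero.\<close>

lemma strictly_upper_commuting_zero:
  assumes Z: "olin (2 * r + 1) Z" "strictly_upper Z" and c: "\<And>i. i \<in> {1..r} \<Longrightarrow> obr (opF r i) Z = ozero"
  shows "Z = ozero"
proof (rule olin_eq_ozeroI[OF Z(1)])
  fix p assume "p \<in> {1..2 * r + 1}"
  then have "1 \<le> p" "p \<le> 2 * r + 1" by auto
  then show "Z (delta p) = (\<lambda>_. 0)"
  proof (induction p rule: dec_induct)
    case base
    show ?case
    proof
      fix k
      show "Z (delta 1) k = 0"
        using Z(2) olin_outside[OF Z(1), of k] unfolding strictly_upper_def
        by (cases "k = 0") (auto simp: delta_def)
    qed
  next
    case (step p)
    then obtain i c where ic: "i \<in> {1..r}" "delta (p + 1) = (\<lambda>k. c * opF r i (delta p) k)"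
      using opF_delta[of p r] by auto
    have "opF r i (Z (delta p)) k - Z (opF r i (delta p)) k = 0" for k
      using fun_cong[OF fun_cong[OF c[OF ic(1)], of "delta p"], of k] by (simp add: obr_def ozero_def)
    moreover have "Z (delta p) = (\<lambda>_. 0)" using step by simp
    moreover have "opF r i (\<lambda>_. 0) k = 0" for k by (simp add: opF_def)
    ultimately have "Z (opF r i (delta p)) = (\<lambda>_. 0)" by (intro ext) simp
    then show ?case using ic olin_scale[OF Z(1), of c] by simp
  qed
qed

text \<open>The mirror image, with the raising operators and the last basis vector.\<close>

lemma strictly_lower_commuting_zero:
  assumes Z: "olin (2 * r + 1) Z" "strictly_lower Z" and c: "\<And>i. i \<in> {1..r} \<Longrightarrow> obr (opE r i) Z = ozero"
  shows "Z = ozero"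
proof (rule olin_eq_ozeroI[OF Z(1)])
  fix p assume "p \<in> {1..2 * r + 1}"
  then have "1 \<le> p" "p \<le> 2 * r + 1" by auto
  from this(2,1) show "Z (delta p) = (\<lambda>_. 0)"
  proof (induction p rule: inc_induct)
    case base
    show ?case
    proof
      fix k
      show "Z (delta (2 * r + 1)) k = 0"
        using Z(2) olin_outside[OF Z(1), of k] unfolding strictly_lower_def
        by (cases "k > 2 * r + 1") (auto simp: delta_def)
    qed
  next
    case (step p)
    then obtain i c where ic: "i \<in> {1..r}" "delta p = (\<lambda>k. c * opE r i (delta (p + 1)) k)"
      using opE_delta[of p r] by auto
    have "opE r i (Z (delta (p + 1))) k - Z (opE r i (delta (p + 1))) k = 0" for k
      using fun_cong[OF fun_cong[OF c[OF ic(1)], of "delta (p + 1)"], of k] by (simp add: obr_def ozero_def)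
    moreover have "Z (delta (p + 1)) = (\<lambda>_. 0)" using step by simp
    moreover have "opE r i (\<lambda>_. 0) k = 0" for k by (simp add: opE_def)
    ultimately have "Z (opE r i (delta (p + 1))) = (\<lambda>_. 0)" by (intro ext) simp
    then show ?case using ic olin_scale[OF Z(1), of c] by simp
  qed
qed

section \<open>Comparing the Lie algebra with the vector representation\<close>

lemma lie_bracket_add_right: "lie_bracket X (Z + Z') = lie_bracket X Z + lie_bracket X Z'"
  by (simp add: lie_bracket_def matrix_ring_simps)

lemma lie_bracket_cscale_right: "lie_bracket X (cscale c Z) = cscale c (lie_bracket X Z)"
  by (simp add: lie_bracket_def matrix_ring_simps)

lemma lie_bracket_zero_right [simp]: "lie_bracket X 0 = 0"
  by (simp add: lie_bracket_def)

lemma lie_bracket_jacobi_right: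
  "lie_bracket A (lie_bracket B C) = lie_bracket (lie_bracket A B) C + lie_bracket B (lie_bracket A C)"
  by (simp add: lie_bracket_def matrix_ring_simps)

lemma lie_bracket_swap: "lie_bracket A B = cscale (- 1) (lie_bracket B A)"
  by (simp add: lie_bracket_def vec_eq_iff)

lemma obr_swap: "obr A B = oscale (- 1) (obr B A)"
  by (simp add: obr_def oscale_def)

text \<open>One of the two halves of a triangular decomposition, for pairs of a matrix and an operator on
  the vector representation. The roles of \<open>(a, A)\<close> and \<open>(b, B)\<close> are played by the raising and the
  lowering generators, in either order.\<close>

locale half_grading =
  fixes r :: nat and a b h :: "nat \<Rightarrow> complex^'n^'n" and A B H :: "nat \<Rightarrow> vect \<Rightarrow> vect"
    and \<sigma> \<tau> :: complex and tri :: "(vect \<Rightarrow> vect) \<Rightarrow> bool"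
  assumes lin: "i \<in> {1..r} \<Longrightarrow> olin (2 * r + 1) (A i)" "i \<in> {1..r} \<Longrightarrow> olin (2 * r + 1) (B i)"
      "i \<in> {1..r} \<Longrightarrow> olin (2 * r + 1) (H i)"
    and ha: "i \<in> {1..r} \<Longrightarrow> j \<in> {1..r} \<Longrightarrow> lie_bracket (h i) (a j) = cscale (\<tau> * of_int (cartan_B r i j)) (a j)"
    and HA: "i \<in> {1..r} \<Longrightarrow> j \<in> {1..r} \<Longrightarrow> obr (H i) (A j) = oscale (\<tau> * of_int (cartan_B r i j)) (A j)"
    and ba: "i \<in> {1..r} \<Longrightarrow> j \<in> {1..r} \<Longrightarrow> lie_bracket (b i) (a j) = (if i = j then cscale \<sigma> (h i) else 0)"
    and BA: "i \<in> {1..r} \<Longrightarrow> j \<in> {1..r} \<Longrightarrow> obr (B i) (A j) = (if i = j then oscale \<sigma> (H i) else ozero)"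
    and tri: "i \<in> {1..r} \<Longrightarrow> tri (A i)" "tri Z \<Longrightarrow> tri W \<Longrightarrow> tri (oadd Z W)" "tri Z \<Longrightarrow> tri (oscale c Z)"
      "tri ozero" "tri Z \<Longrightarrow> tri W \<Longrightarrow> tri (obr Z W)"
    and tri_zero: "olin (2 * r + 1) Z \<Longrightarrow> tri Z \<Longrightarrow> (\<And>i. i \<in> {1..r} \<Longrightarrow> obr (B i) Z = ozero) \<Longrightarrow> Z = ozero"
begin

inductive half :: "nat \<Rightarrow> complex^'n^'n \<Rightarrow> (vect \<Rightarrow> vect) \<Rightarrow> bool" where
  zero: "half (Suc k) 0 ozero"
| base: "i \<in> {1..r} \<Longrightarrow> half (Suc 0) (a i) (A i)"
| step: "i \<in> {1..r} \<Longrightarrow> half k X Z \<Longrightarrow> half (Suc k) (lie_bracket (a i) X) (obr (A i) Z)"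
| add: "half k X Z \<Longrightarrow> half k Y W \<Longrightarrow> half k (X + Y) (oadd Z W)"
| scale: "half k X Z \<Longrightarrow> half k (cscale c X) (oscale c Z)"

definition cartan_part :: "complex^'n^'n \<Rightarrow> (vect \<Rightarrow> vect) \<Rightarrow> bool" where
  "cartan_part X Z \<longleftrightarrow> (\<exists>c. X = (\<Sum>i\<in>{1..r}. cscale (c i) (h i)) \<and> Z = (\<lambda>x k. \<Sum>i\<in>{1..r}. c i * H i x k))"

lemma half_pos: "half k X Z \<Longrightarrow> 0 < k"
  by (induction rule: half.induct) auto

lemma half_olin: "half k X Z \<Longrightarrow> olin (2 * r + 1) Z"
  by (induction rule: half.induct) (blast intro: lin olin_ozero olin_obr olin_oadd olin_oscale)+

lemma half_tri: "half k X Z \<Longrightarrow> tri Z"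
  by (induction rule: half.induct) (blast intro: tri)+

lemma half_h: "half k X Z \<Longrightarrow> j \<in> {1..r} \<Longrightarrow> half k (lie_bracket (h j) X) (obr (H j) Z)"
proof (induction rule: half.induct)
  case (zero k)
  then show ?case using half.zero[of k] by (simp add: obr_ozero[OF lin(3)])
next
  case (base i)
  then show ?case using half.scale[OF half.base] by (simp add: ha HA)
next
  case (step i k X Z)
  have "half (Suc k) (lie_bracket (lie_bracket (h j) (a i)) X) (obr (obr (H j) (A i)) Z)"
    using half.scale[OF half.step[OF step(1,2)]] step
    by (simp add: ha HA lie_bracket_cscale_left oscale_left[OF half_olin])
  moreover have "half (Suc k) (lie_bracket (a i) (lie_bracket (h j) X)) (obr (A i) (obr (H j) Z))"
    using half.step step by blast
  ultimately show ?case
    unfolding lie_bracket_jacobi_right[of "h j"] obr_jacobi[OF lin(3)[OF step.prems] lin(1)[OF step(1)] half_olin[OF step(2)]]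
    by (rule half.add)
next
  case (add k X Z Y W)
  then show ?case by (simp add: lie_bracket_add_right obr_oadd[OF lin(3)] half.add)
next
  case (scale k X Z c)
  then show ?case by (simp add: lie_bracket_cscale_right obr_oscale[OF lin(3)] half.scale)
qed

text \<open>Bracketing with a generator turns \<open>\<Sum> c\<^sub>i h\<^sub>i\<close> into a multiple of
  the generator, with the same factor on both sides.\<close>

lemma cartan_part_a:
  assumes "cartan_part X Z" "i \<in> {1..r}"
  shows "half (Suc 0) (lie_bracket (a i) X) (obr (A i) Z)"
proof -
  obtain c where c: "X = (\<Sum>j\<in>{1..r}. cscale (c j) (h j))" "Z = (\<lambda>x k. \<Sum>j\<in>{1..r}. c j * H j x k)"
    using assms(1) unfolding cartan_part_def by blast
  let ?s = "- (\<Sum>j\<in>{1..r}. c j * (\<tau> * of_int (cartan_B r j i)))"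
  have "lie_bracket (a i) X = cscale ?s (a i)"
  proof -
    have sum: "lie_bracket (\<Sum>j\<in>I. cscale (c j) (h j)) (a i) = (\<Sum>j\<in>I. lie_bracket (cscale (c j) (h j)) (a i))" for I
      by (induction I rule: infinite_finite_induct) (simp_all add: lie_bracket_add_left, simp_all add: lie_bracket_def)
    have "lie_bracket X (a i) = (\<Sum>j\<in>{1..r}. cscale (c j * (\<tau> * of_int (cartan_B r j i))) (a i))"
      unfolding c sum using assms(2) by (intro sum.cong refl) (simp add: lie_bracket_cscale_left ha)
    also have "\<dots> = cscale (\<Sum>j\<in>{1..r}. c j * (\<tau> * of_int (cartan_B r j i))) (a i)"
      by (intro matrix_eqI) (simp add: sum_distrib_right)
    finally show ?thesis unfolding lie_bracket_swap[of "a i"] by simp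
  qed
  moreover have "obr (A i) Z = oscale ?s (A i)"
  proof (intro ext)
    fix x k
    have "A i (Z x) k = (\<Sum>j\<in>{1..r}. c j * A i (H j x) k)"
      unfolding c by (simp add: olin_sum[OF lin(1)[OF assms(2)]])
    then have "obr (A i) Z x k = (\<Sum>j\<in>{1..r}. c j * (A i (H j x) k - H j (A i x) k))"
      by (simp add: obr_def c sum_subtractf algebra_simps)
    also have "\<dots> = (\<Sum>j\<in>{1..r}. c j * - (\<tau> * of_int (cartan_B r j i) * A i x k))"
    proof (intro sum.cong refl)
      fix j assume j: "j \<in> {1..r}"
      have "H j (A i x) k - A i (H j x) k = \<tau> * of_int (cartan_B r j i) * A i x k"
        using fun_cong[OF fun_cong[OF HA[OF j assms(2)], of x], of k] by (simp add: obr_def oscale_def)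
      then have "A i (H j x) k - H j (A i x) k = - (\<tau> * of_int (cartan_B r j i) * A i x k)"
        by (metis minus_diff_eq)
      then show "c j * (A i (H j x) k - H j (A i x) k) = c j * - (\<tau> * of_int (cartan_B r j i) * A i x k)"
        by simp
    qed
    also have "\<dots> = ?s * A i x k"
      unfolding sum_negf[symmetric] sum_distrib_right by (intro sum.cong refl) (simp add: algebra_simps)
    finally show "obr (A i) Z x k = oscale ?s (A i) x k" by (simp add: oscale_def)
  qed
  ultimately show ?thesis using half.scale[OF half.base[OF assms(2)]] by simp
qed

lemma cartan_part_add: "cartan_part X Z \<Longrightarrow> cartan_part Y W \<Longrightarrow> cartan_part (X + Y) (oadd Z W)"
proof -
  assume "cartan_part X Z" "cartan_part Y W"
  then obtain c c' where "X = (\<Sum>i\<in>{1..r}. cscale (c i) (h i))" "Z = (\<lambda>x k. \<Sum>i\<in>{1..r}. c i * H i x k)"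
    "Y = (\<Sum>i\<in>{1..r}. cscale (c' i) (h i))" "W = (\<lambda>x k. \<Sum>i\<in>{1..r}. c' i * H i x k)"
    unfolding cartan_part_def by blast
  then show ?thesis unfolding cartan_part_def
    by (intro exI[of _ "\<lambda>i. c i + c' i"]) (simp add: cscale_add_left sum.distrib oadd_def distrib_right)
qed

lemma cartan_part_scale: "cartan_part X Z \<Longrightarrow> cartan_part (cscale d X) (oscale d Z)"
proof -
  assume "cartan_part X Z"
  then obtain c where "X = (\<Sum>i\<in>{1..r}. cscale (c i) (h i))" "Z = (\<lambda>x k. \<Sum>i\<in>{1..r}. c i * H i x k)"
    unfolding cartan_part_def by blast
  moreover have "cscale d (\<Sum>i\<in>I. cscale (c i) (h i)) = (\<Sum>i\<in>I. cscale (d * c i) (h i))" for I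
    by (induction I rule: infinite_finite_induct) (simp_all add: cscale_add)
  ultimately show ?thesis unfolding cartan_part_def
    by (intro exI[of _ "\<lambda>i. d * c i"]) (simp add: oscale_def sum_distrib_left mult.assoc)
qed

lemma cartan_part_h: "i \<in> {1..r} \<Longrightarrow> cartan_part (h i) (H i)"
  unfolding cartan_part_def
proof (intro exI[of _ "\<lambda>j. if j = i then 1 else 0"] conjI)
  assume i: "i \<in> {1..r}"
  have "(\<Sum>j\<in>{1..r}. cscale (if j = i then 1 else 0) (h j)) = (\<Sum>j\<in>{1..r}. if j = i then h j else 0)"
    by (intro sum.cong refl) auto
  then show "h i = (\<Sum>j\<in>{1..r}. cscale (if j = i then 1 else 0) (h j))" using i by simp
  have "(\<Sum>j\<in>{1..r}. (if j = i then 1 else 0) * H j x k) = (\<Sum>j\<in>{1..r}. if j = i then H j x k else 0)" for x k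
    by (intro sum.cong refl) auto
  then show "H i = (\<lambda>x k. \<Sum>j\<in>{1..r}. (if j = i then 1 else 0) * H j x k)" using i by simp
qed

lemma cartan_part_zero: "cartan_part 0 ozero"
  unfolding cartan_part_def by (intro exI[of _ "\<lambda>_. 0"]) (simp add: ozero_def)

definition lower_target :: "nat \<Rightarrow> complex^'n^'n \<Rightarrow> (vect \<Rightarrow> vect) \<Rightarrow> bool" where
  "lower_target k X Z \<longleftrightarrow> (if k = 0 then cartan_part X Z else half k X Z)"

lemma lower_target_a: "lower_target k X Z \<Longrightarrow> i \<in> {1..r} \<Longrightarrow> half (Suc k) (lie_bracket (a i) X) (obr (A i) Z)"
  unfolding lower_target_def by (cases "k = 0") (auto intro: cartan_part_a half.step)

text \<open>By the Jacobi identity: \<open>b\<^sub>i\<close> either meets the outermost raising generator,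
  which leaves a torus element acting on something of lower degree, or passes through it.\<close>

lemma half_b: "half k X Z \<Longrightarrow> i \<in> {1..r} \<Longrightarrow> lower_target (k - 1) (lie_bracket (b i) X) (obr (B i) Z)"
proof (induction rule: half.induct)
  case (zero k)
  then show ?case using half.zero[of "k - 1"] cartan_part_zero
    by (auto simp: lower_target_def obr_ozero[OF lin(2)])
next
  case (base j)
  then show ?case using cartan_part_scale[OF cartan_part_h] cartan_part_zero by (auto simp: lower_target_def ba BA)
next
  case (step j k X Z)
  have k: "k > 0" using half_pos step by blast
  have 1: "half k (lie_bracket (lie_bracket (b i) (a j)) X) (obr (obr (B i) (A j)) Z)"
  proof (cases "i = j")
    case True
    then show ?thesis using half.scale[OF half_h[OF step(2)]] step
      by (simp add: ba BA lie_bracket_cscale_left oscale_left[OF half_olin])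
  next
    case False
    moreover have "lie_bracket 0 X = 0" by (simp add: lie_bracket_def)
    moreover have "obr ozero Z = ozero"
      using olin_scale[OF half_olin[OF step(2)], of 0 "\<lambda>_. 0"] by (intro ext) (simp add: obr_def ozero_def)
    ultimately show ?thesis using half.zero[of "k - 1"] step k by (simp add: ba BA)
  qed
  have 2: "half k (lie_bracket (a j) (lie_bracket (b i) X)) (obr (A j) (obr (B i) Z))"
    using lower_target_a[OF step.IH] step k by simp
  show ?case using half.add[OF 1 2] k
    unfolding lie_bracket_jacobi_right[of "b i"] obr_jacobi[OF lin(2)[OF step.prems] lin(1)[OF step(1)] half_olin[OF step(2)]]
    by (simp add: lower_target_def)
next
  case (add k X Z Y W)
  then show ?case
    by (auto simp: lower_target_def lie_bracket_add_right obr_oadd[OF lin(2)] intro: half.add cartan_part_add split: if_splits)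
next
  case (scale k X Z c)
  then show ?case
    by (auto simp: lower_target_def lie_bracket_cscale_right obr_oscale[OF lin(2)] intro: half.scale cartan_part_scale split: if_splits)
qed

text \<open>Induction on the degree: bracketing with the \<open>b\<^sub>i\<close> lowers the degree, so the
  operator commutes with all \<open>B\<^sub>i\<close>, and a strictly triangular operator with this property
  vanishes.\<close>

lemma half_zero_unique:
  assumes zero: "\<And>Z. cartan_part 0 Z \<Longrightarrow> Z = ozero"
  shows "half k 0 Z \<Longrightarrow> Z = ozero"
proof (induction k arbitrary: Z rule: less_induct)
  case (less k)
  have "obr (B i) Z = ozero" if "i \<in> {1..r}" for i
    using half_b[OF less.prems that] zero less.IH[of "k - 1"] half_pos[OF less.prems]
    by (auto simp: lower_target_def split: if_splits)
  then show ?case using tri_zero half_olin half_tri less.prems by blast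
qed

lemma half_eigen:
  assumes rho: "\<And>i. i \<in> {1..r} \<Longrightarrow> lie_bracket \<rho> (a i) = cscale \<tau> (a i)"
  shows "half k X Z \<Longrightarrow> lie_bracket \<rho> X = cscale (of_nat k * \<tau>) X"
proof (induction rule: half.induct)
  case (step i k X Z)
  have "lie_bracket \<rho> (lie_bracket (a i) X) = cscale \<tau> (lie_bracket (a i) X) + cscale (of_nat k * \<tau>) (lie_bracket (a i) X)"
    unfolding lie_bracket_jacobi_right[of \<rho>] rho[OF step(1)] step.IH lie_bracket_cscale_left lie_bracket_cscale_right ..
  then show ?case by (simp add: distrib_right flip: cscale_add_left)
qed (auto simp: rho lie_bracket_add_right lie_bracket_cscale_right cscale_add mult.commute)

end

text \<open>Eigenvectors for different eigenvalues are linearly independent.\<close>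

lemma eigen_separation:
  assumes "finite I" "\<And>k. k \<in> I \<Longrightarrow> lie_bracket \<rho> (X k) = cscale (of_int k) (X k)" "(\<Sum>k\<in>I. X k) = 0"
  shows "\<forall>k\<in>I. X (k::int) = 0"
  using assms
proof (induction I arbitrary: X rule: finite_induct)
  case (insert k0 I)
  have br_sum: "lie_bracket \<rho> (\<Sum>k\<in>J. X k) = (\<Sum>k\<in>J. lie_bracket \<rho> (X k))" for J
    by (induction J rule: infinite_finite_induct) (simp_all add: lie_bracket_add_right)
  let ?Y = "\<lambda>k. cscale (of_int (k - k0)) (X k)"
  have "(\<Sum>k\<in>I. ?Y k) = (\<Sum>k\<in>insert k0 I. lie_bracket \<rho> (X k) - cscale (of_int k0) (X k))"
  proof -
    have "?Y k = lie_bracket \<rho> (X k) - cscale (of_int k0) (X k)" if "k \<in> insert k0 I" for k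
      unfolding insert.prems(1)[OF that] by (simp add: vec_eq_iff algebra_simps)
    then have "(\<Sum>k\<in>insert k0 I. ?Y k) = (\<Sum>k\<in>insert k0 I. lie_bracket \<rho> (X k) - cscale (of_int k0) (X k))"
      by (intro sum.cong refl)
    then show ?thesis using insert.hyps by simp
  qed
  also have "\<dots> = lie_bracket \<rho> (\<Sum>k\<in>insert k0 I. X k) - cscale (of_int k0) (\<Sum>k\<in>insert k0 I. X k)"
  proof -
    have "cscale c (\<Sum>k\<in>J. X k) = (\<Sum>k\<in>J. cscale c (X k))" for c J
      by (induction J rule: infinite_finite_induct) (simp_all add: cscale_add)
    then show ?thesis unfolding br_sum by (simp only: sum_subtractf)
  qed
  also have "\<dots> = 0" unfolding insert.prems(2) by simp
  finally have "\<forall>k\<in>I. ?Y k = 0"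
    by (intro insert.IH) (auto simp: insert.prems(1) lie_bracket_cscale_right mult.commute)
  then have I: "X k = 0" if "k \<in> I" for k
    using that insert.hyps by (auto simp: vec_eq_iff)
  then have "X k0 = 0" using insert.prems(2) insert.hyps by simp
  then show ?case using I by simp
qed simp

context chevalley_matrices
begin

sublocale pos: half_grading r e f h "opE r" "opF r" "opH r" "- 1" 1 strictly_upper
proof
  fix i j assume ij: "i \<in> {1..r}" "j \<in> {1..r}"
  show "lie_bracket (h i) (e j) = cscale (1 * of_int (cartan_B r i j)) (e j)" by (simp add: he[OF ij])
  show "obr (opH r i) (opE r j) = oscale (1 * of_int (cartan_B r i j)) (opE r j)" by (simp add: opHE[OF ij])
  show "lie_bracket (f i) (e j) = (if i = j then cscale (- 1) (h i) else 0)"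
    unfolding lie_bracket_swap[of "f i"] ef[OF ij(2,1)] by auto
  show "obr (opF r i) (opE r j) = (if i = j then oscale (- 1) (opH r i) else ozero)"
    unfolding obr_swap[of "opF r i"] opEF[OF ij(2,1)] by (auto simp: oscale_def ozero_def)
qed (blast intro: olin_opE olin_opF olin_opH strictly_upper_opE strictly_upper_closed strictly_upper_obr
    strictly_upper_commuting_zero)+

sublocale neg: half_grading r f e h "opF r" "opE r" "opH r" 1 "- 1" strictly_lower
proof
  fix i j assume ij: "i \<in> {1..r}" "j \<in> {1..r}"
  show "lie_bracket (h i) (f j) = cscale (- 1 * of_int (cartan_B r i j)) (f j)" by (simp add: hf[OF ij])
  show "obr (opH r i) (opF r j) = oscale (- 1 * of_int (cartan_B r i j)) (opF r j)" by (simp add: opHF[OF ij])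
  show "lie_bracket (e i) (f j) = (if i = j then cscale 1 (h i) else 0)" by (simp add: ef[OF ij])
  show "obr (opE r i) (opF r j) = (if i = j then oscale 1 (opH r i) else ozero)"
    unfolding opEF[OF ij] by (auto simp: oscale_def)
qed (blast intro: olin_opE olin_opF olin_opH strictly_lower_opF strictly_lower_closed strictly_lower_obr
    strictly_lower_commuting_zero)+

text \<open>Pairs of degree \<open>k\<close> with respect to \<open>rho\<close>: raising for \<open>k >
  0\<close>, lowering for \<open>k < 0\<close>, in the Cartan subalgebra for \<open>k = 0\<close>.\<close>

definition grd :: "int \<Rightarrow> complex^'n^'n \<Rightarrow> (vect \<Rightarrow> vect) \<Rightarrow> bool" where
  "grd k X Z \<longleftrightarrow> (if k > 0 then pos.half (nat k) X Z else if k < 0 then neg.half (nat (- k)) X Z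
     else pos.cartan_part X Z)"

lemma grd_e:
  assumes "grd k X Z" "i \<in> {1..r}"
  shows "grd (k + 1) (lie_bracket (e i) X) (obr (opE r i) Z)"
proof -
  consider "k > 0" | "k = 0" | "k < 0" by linarith
  then show ?thesis
  proof cases
    case 1
    then have "nat (k + 1) = Suc (nat k)" by simp
    then show ?thesis using 1 assms pos.half.step[OF assms(2)] by (simp add: grd_def)
  next
    case 2
    then show ?thesis using assms pos.cartan_part_a by (simp add: grd_def)
  next
    case 3
    then have n: "nat (- k) - 1 = nat (- (k + 1))" by simp
    have "neg.half (nat (- k)) X Z" using 3 assms(1) by (simp add: grd_def)
    from neg.half_b[OF this assms(2)] show ?thesis
      using 3 unfolding neg.lower_target_def n grd_def by (auto split: if_splits)
  qed
qed

lemma grd_f: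
  assumes "grd k X Z" "i \<in> {1..r}"
  shows "grd (k - 1) (lie_bracket (f i) X) (obr (opF r i) Z)"
proof -
  consider "k < 0" | "k = 0" | "k > 0" by linarith
  then show ?thesis
  proof cases
    case 1
    then have "nat (- (k - 1)) = Suc (nat (- k))" by simp
    then show ?thesis using 1 assms neg.half.step[OF assms(2)] by (simp add: grd_def)
  next
    case 2
    then show ?thesis using assms neg.cartan_part_a by (simp add: grd_def)
  next
    case 3
    then have n: "nat k - 1 = nat (k - 1)" by simp
    have "pos.half (nat k) X Z" using 3 assms(1) by (simp add: grd_def)
    from pos.half_b[OF this assms(2)] show ?thesis
      using 3 unfolding pos.lower_target_def n grd_def by (auto split: if_splits)
  qed
qed

lemma grd_scale: "grd k X Z \<Longrightarrow> grd k (cscale c X) (oscale c Z)"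
  by (cases "k > 0"; cases "k < 0") (simp_all add: grd_def pos.half.scale neg.half.scale pos.cartan_part_scale)

lemma grd_zero: "grd k 0 ozero"
  using pos.half.zero[of "nat k - 1"] neg.half.zero[of "nat (- k) - 1"] pos.cartan_part_zero
  by (cases "k > 0"; cases "k < 0") (simp_all add: grd_def)

lemma grd_add: "grd k X Z \<Longrightarrow> grd k Y W \<Longrightarrow> grd k (X + Y) (oadd Z W)"
  by (cases "k > 0"; cases "k < 0") (simp_all add: grd_def pos.half.add neg.half.add pos.cartan_part_add)

lemma cartan_part_olin: "pos.cartan_part X Z \<Longrightarrow> olin (2 * r + 1) Z"
proof -
  assume "pos.cartan_part X Z"
  then obtain c where Z: "Z = (\<lambda>x k. \<Sum>i\<in>{1..r}. c i * opH r i x k)" unfolding pos.cartan_part_def by blast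
  have "olin (2 * r + 1) (\<lambda>x k. \<Sum>i\<in>I. c i * opH r i x k)" if "finite I" "I \<subseteq> {1..r}" for I
    using that
  proof (induction I rule: finite_induct)
    case empty
    then show ?case using olin_ozero by (simp add: ozero_def)
  next
    case (insert i I)
    then show ?case using olin_oadd[OF olin_oscale[OF olin_opH]] by (auto simp: oadd_def oscale_def)
  qed
  then show ?thesis unfolding Z by simp
qed

lemma grd_olin: "grd k X Z \<Longrightarrow> olin (2 * r + 1) Z"
  using pos.half_olin[of "nat k" X Z] neg.half_olin[of "nat (- k)" X Z] cartan_part_olin[of X Z]
  by (cases "k > 0"; cases "k < 0") (simp_all add: grd_def)

lemma grd_eigen: "grd k X Z \<Longrightarrow> lie_bracket rho X = cscale (of_int k) X"
proof -
  assume g: "grd k X Z"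
  consider "k > 0" | "k = 0" | "k < 0" by linarith
  then show ?thesis
  proof cases
    case 1
    then show ?thesis using g pos.half_eigen[OF rho_bracket(1)] by (simp add: grd_def)
  next
    case 2
    then obtain c where X: "X = (\<Sum>i\<in>{1..r}. cscale (c i) (h i))"
      using g by (auto simp: grd_def pos.cartan_part_def)
    have "lie_bracket rho (\<Sum>i\<in>I. cscale (c i) (h i)) = 0" if "I \<subseteq> {1..r}" for I
      using that rho_bracket(3)
      by (induction I rule: infinite_finite_induct) (auto simp: lie_bracket_add_right lie_bracket_cscale_right)
    then show ?thesis using 2 X by simp
  next
    case 3
    then have "neg.half (nat (- k)) X Z" using g by (simp add: grd_def)
    then have "lie_bracket rho X = cscale (of_nat (nat (- k)) * (- 1)) X"
      by (rule neg.half_eigen[rotated]) (use rho_bracket(2) in simp)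
    then show ?thesis using 3 by simp
  qed
qed

inductive pair :: "complex^'n^'n \<Rightarrow> (vect \<Rightarrow> vect) \<Rightarrow> bool" where
  hom: "grd k X Z \<Longrightarrow> pair X Z"
| add: "pair X Z \<Longrightarrow> pair Y W \<Longrightarrow> pair (X + Y) (oadd Z W)"

lemma pair_olin: "pair X Z \<Longrightarrow> olin (2 * r + 1) Z"
  by (induction rule: pair.induct) (blast intro: grd_olin olin_oadd)+

lemma pair_scale: "pair X Z \<Longrightarrow> pair (cscale c X) (oscale c Z)"
proof (induction rule: pair.induct)
  case (add X Z Y W)
  have "oscale c (oadd Z W) = oadd (oscale c Z) (oscale c W)"
    by (simp add: oscale_def oadd_def algebra_simps)
  then show ?case using pair.add[OF add.IH] by (simp add: cscale_add)
qed (blast intro: pair.hom grd_scale)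

lemma pair_e: "pair X Z \<Longrightarrow> i \<in> {1..r} \<Longrightarrow> pair (lie_bracket (e i) X) (obr (opE r i) Z)"
proof (induction rule: pair.induct)
  case (add X Z Y W)
  then show ?case unfolding lie_bracket_add_right obr_oadd[OF olin_opE[OF add.prems]] by (blast intro: pair.add)
qed (blast intro: pair.hom grd_e)

lemma pair_f: "pair X Z \<Longrightarrow> i \<in> {1..r} \<Longrightarrow> pair (lie_bracket (f i) X) (obr (opF r i) Z)"
proof (induction rule: pair.induct)
  case (add X Z Y W)
  then show ?case unfolding lie_bracket_add_right obr_oadd[OF olin_opF[OF add.prems]] by (blast intro: pair.add)
qed (blast intro: pair.hom grd_f)

lemma pair_h:
  assumes "pair X Z" "i \<in> {1..r}"
  shows "pair (lie_bracket (h i) X) (obr (opH r i) Z)"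
proof -
  have 1: "pair (lie_bracket (e i) (lie_bracket (f i) X)) (obr (opE r i) (obr (opF r i) Z))"
    and 2: "pair (lie_bracket (f i) (lie_bracket (e i) X)) (obr (opF r i) (obr (opE r i) Z))"
    using assms pair_e pair_f by blast+
  have "lie_bracket (e i) (lie_bracket (f i) X) + cscale (- 1) (lie_bracket (f i) (lie_bracket (e i) X)) = lie_bracket (h i) X"
    unfolding lie_bracket_jacobi_right[of "e i"] ef[OF assms(2,2)] by (simp add: vec_eq_iff)
  moreover have "oadd (obr (opE r i) (obr (opF r i) Z)) (oscale (- 1) (obr (opF r i) (obr (opE r i) Z))) = obr (opH r i) Z"
    unfolding obr_jacobi[OF olin_opE[OF assms(2)] olin_opF[OF assms(2)] pair_olin[OF assms(1)]] opEF[OF assms(2,2)]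
    by (simp add: oadd_def oscale_def)
  ultimately show ?thesis using pair.add[OF 1 pair_scale[OF 2, of "- 1"]] by simp
qed

lemma pair_generators:
  assumes "i \<in> {1..r}"
  shows "pair (e i) (opE r i)" "pair (f i) (opF r i)" "pair (h i) (opH r i)"
proof -
  have "grd 1 (e i) (opE r i)" "grd (- 1) (f i) (opF r i)" "grd 0 (h i) (opH r i)"
    using pos.half.base[OF assms] neg.half.base[OF assms] pos.cartan_part_h[OF assms] by (simp_all add: grd_def)
  then show "pair (e i) (opE r i)" "pair (f i) (opF r i)" "pair (h i) (opH r i)" by (blast intro: pair.hom)+
qed

lemma pair_total:
  assumes "X \<in> lie_generated (e ` {1..r} \<union> f ` {1..r})"
  shows "\<exists>Z. pair X Z"
proof -
  have zero: "pair 0 ozero" using pair.hom[OF grd_zero] .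
  have "(\<exists>Z. pair X Z) \<and> (\<forall>Y W. pair Y W \<longrightarrow> (\<exists>V. pair (lie_bracket X Y) V))"
    using assms
  proof (induction rule: lie_generated.induct)
    case zero
    have "lie_bracket 0 Y = 0" for Y :: "complex^'n^'n" by (simp add: lie_bracket_def)
    then show ?case using pair.hom[OF grd_zero] by (auto simp del: One_nat_def)
  next
    case (base X)
    then show ?case using pair_generators pair_e pair_f by (elim UnE imageE) blast+
  next
    case (add X Z)
    then show ?case unfolding lie_bracket_add_left using pair.add by blast
  next
    case (scale X c)
    then show ?case unfolding lie_bracket_cscale_left using pair_scale by blast
  next
    case (bracket X Z)
    have "\<exists>V. pair (lie_bracket (lie_bracket X Z) Y) V" if YW: "pair Y W" for Y W
    proof -
      obtain V1 V2 where "pair (lie_bracket X (lie_bracket Z Y)) V1" "pair (lie_bracket Z (lie_bracket X Y)) V2"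
        using bracket.IH YW by blast
      moreover have "lie_bracket (lie_bracket X Z) Y =
          lie_bracket X (lie_bracket Z Y) + cscale (- 1) (lie_bracket Z (lie_bracket X Y))"
        unfolding lie_bracket_jacobi by (simp add: vec_eq_iff)
      ultimately show ?thesis using pair.add[OF _ pair_scale] by metis
    qed
    then show ?case using bracket.IH by blast
  qed
  then show ?thesis by blast
qed

text \<open>A pair is a graded sum; if its matrix component vanishes then so do the matrix components of
  its homogeneous parts, and the vector representation has no nonzero homogeneous operator that
  could be paired with \<open>0\<close>. Hence the second component is a function of the first.\<close>

definition graded_sum where
  "graded_sum I Xs Zs X Z \<longleftrightarrow> finite I \<and> (\<forall>k. grd k (Xs k) (Zs k)) \<and>
     (\<forall>k. k \<notin> I \<longrightarrow> Xs k = 0 \<and> Zs k = ozero) \<and>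
     X = (\<Sum>k\<in>I. Xs k) \<and> Z = (\<lambda>x j. \<Sum>k\<in>I. Zs k x j)"

lemma pair_decompose:
  assumes "pair X Z"
  shows "\<exists>I Xs Zs. graded_sum I Xs Zs X Z"
  using assms
proof (induction rule: pair.induct)
  case (hom k X Z)
  define Xs Zs where "Xs j = (if j = k then X else 0)" and "Zs j = (if j = k then Z else ozero)" for j
  have "finite {k}" by simp
  moreover have "\<forall>j. grd j (Xs j) (Zs j)"
    using hom grd_zero by (simp add: Xs_def Zs_def)
  moreover have "\<forall>j. j \<notin> {k} \<longrightarrow> Xs j = 0 \<and> Zs j = ozero"
    by (simp add: Xs_def Zs_def)
  moreover have "X = (\<Sum>j\<in>{k}. Xs j)" "Z = (\<lambda>x i. \<Sum>j\<in>{k}. Zs j x i)"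
    by (simp_all add: Xs_def Zs_def)
  ultimately have "graded_sum {k} Xs Zs X Z" unfolding graded_sum_def by (intro conjI)
  then show ?case by blast
next
  case (add X Z Y W)
  then obtain I Xs Zs J Ys Ws where g: "graded_sum I Xs Zs X Z" "graded_sum J Ys Ws Y W" by blast
  have 1: "finite I" "\<forall>k. grd k (Xs k) (Zs k)" "\<forall>k. k \<notin> I \<longrightarrow> Xs k = 0 \<and> Zs k = ozero"
      "X = (\<Sum>k\<in>I. Xs k)" "Z = (\<lambda>x j. \<Sum>k\<in>I. Zs k x j)"
    using g(1)[unfolded graded_sum_def] by - (elim conjE, assumption)+
  have 2: "finite J" "\<forall>k. grd k (Ys k) (Ws k)" "\<forall>k. k \<notin> J \<longrightarrow> Ys k = 0 \<and> Ws k = ozero"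
      "Y = (\<Sum>k\<in>J. Ys k)" "W = (\<lambda>x j. \<Sum>k\<in>J. Ws k x j)"
    using g(2)[unfolded graded_sum_def] by - (elim conjE, assumption)+
  have "X = (\<Sum>k\<in>I \<union> J. Xs k)" "Y = (\<Sum>k\<in>I \<union> J. Ys k)"
    unfolding 1(4) 2(4) using 1(1,3) 2(1,3) by (intro sum.mono_neutral_left; simp)+
  moreover have "Z = (\<lambda>x j. \<Sum>k\<in>I \<union> J. Zs k x j)" "W = (\<lambda>x j. \<Sum>k\<in>I \<union> J. Ws k x j)"
    unfolding 1(5) 2(5) using 1(1,3) 2(1,3)
    by (intro ext sum.mono_neutral_left; simp add: ozero_def)+
  ultimately have "X + Y = (\<Sum>k\<in>I \<union> J. Xs k + Ys k)" "oadd Z W = (\<lambda>x j. \<Sum>k\<in>I \<union> J. oadd (Zs k) (Ws k) x j)"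
    by (simp_all add: sum.distrib oadd_def)
  moreover have "finite (I \<union> J)" using 1(1) 2(1) by simp
  moreover have "\<forall>k. grd k (Xs k + Ys k) (oadd (Zs k) (Ws k))" using 1(2) 2(2) grd_add by blast
  moreover have "\<forall>k. k \<notin> I \<union> J \<longrightarrow> Xs k + Ys k = 0 \<and> oadd (Zs k) (Ws k) = ozero"
    using 1(3) 2(3) by (simp add: oadd_def ozero_def)
  ultimately have "graded_sum (I \<union> J) (\<lambda>k. Xs k + Ys k) (\<lambda>k. oadd (Zs k) (Ws k)) (X + Y) (oadd Z W)"
    unfolding graded_sum_def by (intro conjI)
  then show ?case by blast
qed

end

locale chevalley_group = chevalley_matrices r e f h for r e f and h :: "nat \<Rightarrow> complex^'n^'n" +
  fixes G :: "(complex^'n^'n) set"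
  assumes alg: "linear_algebraic_group G" and conn: "connected G"
    and Lie_eq: "Lie G = lie_generated (e ` {1..r} \<union> f ` {1..r})"
    and gens_Lie: "i \<in> {1..r} \<Longrightarrow> e i \<in> Lie G" "i \<in> {1..r} \<Longrightarrow> f i \<in> Lie G" "i \<in> {1..r} \<Longrightarrow> h i \<in> Lie G"
    and e_nonzero: "i \<in> {1..r} \<Longrightarrow> e i \<noteq> 0"
begin

lemma subgroup_G: "subgroup G GL"
  using alg by (simp add: linear_algebraic_group_def)

text \<open>The bracket of \<open>\<Sum> c\<^sub>i h\<^sub>i\<close> with \<open>e\<^sub>j\<close> is
  \<open>\<Sum> c\<^sub>i a\<^sub>i\<^sub>j\<close> times the nonzero element \<open>e\<^sub>j\<close>, and
  the Cartan matrix is invertible.\<close>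

lemma cartan_part_zero_unique:
  assumes "pos.cartan_part 0 Z"
  shows "Z = ozero"
proof -
  obtain c where c': "0 = (\<Sum>i\<in>{1..r}. cscale (c i) (h i))" "Z = (\<lambda>x k. \<Sum>i\<in>{1..r}. c i * opH r i x k)"
    using assms unfolding pos.cartan_part_def by blast
  note c = c'(1)[symmetric] c'(2)
  have "c i = 0" if "i \<in> {1..r}" for i
  proof (rule cartan_B_kernel[OF rank _ that])
    fix j assume j: "j \<in> {1..r}"
    have "cscale (\<Sum>i\<in>{1..r}. c i * of_int (cartan_B r i j)) (e j) = 0"
      unfolding weight_bracket(1)[OF j, of c, symmetric] c by (simp add: lie_bracket_def)
    then show "(\<Sum>i\<in>{1..r}. c i * of_int (cartan_B r i j)) = 0"
      using e_nonzero[OF j] by (auto simp: vec_eq_iff)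
  qed
  then show ?thesis unfolding c ozero_def by simp
qed

lemma grd_zero_unique: "grd k 0 Z \<Longrightarrow> Z = ozero"
  using pos.half_zero_unique[OF cartan_part_zero_unique, of "nat k" Z]
    neg.half_zero_unique[OF cartan_part_zero_unique, of "nat (- k)" Z] cartan_part_zero_unique[of Z]
  by (cases "k > 0"; cases "k < 0") (simp_all add: grd_def)

lemma pair_zero_unique:
  assumes "pair 0 Z"
  shows "Z = ozero"
proof -
  obtain I Xs Zs where g: "graded_sum I Xs Zs 0 Z" using pair_decompose[OF assms] by blast
  have I: "finite I" "\<And>k. grd k (Xs k) (Zs k)" "0 = (\<Sum>k\<in>I. Xs k)" "Z = (\<lambda>x j. \<Sum>k\<in>I. Zs k x j)"
    using g[unfolded graded_sum_def] by - (elim conjE allE, assumption)+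
  have "\<forall>k\<in>I. Xs k = 0" using eigen_separation[OF I(1) grd_eigen[OF I(2)]] I(3) by simp
  then have "\<forall>k\<in>I. Zs k = ozero" using grd_zero_unique[of _ "Zs _"] I(2) by metis
  then show ?thesis unfolding I(4) by (simp add: ozero_def)
qed

lemma pair_unique:
  assumes "pair X Z" "pair X W"
  shows "Z = W"
proof -
  have "pair (X + cscale (- 1) X) (oadd Z (oscale (- 1) W))" using assms pair.add pair_scale by blast
  moreover have "X + cscale (- 1) X = 0" by (simp add: vec_eq_iff)
  ultimately have "oadd Z (oscale (- 1) W) = ozero" by (intro pair_zero_unique) (simp only:)
  then show ?thesis by (simp add: oadd_def oscale_def ozero_def fun_eq_iff)
qed

text \<open>The differential of the homomorphism to the special orthogonal group.\<close>

definition theta :: "complex^'n^'n \<Rightarrow> vect \<Rightarrow> vect" where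
  "theta X = (THE Z. pair X Z)"

lemma theta_eq: "pair X Z \<Longrightarrow> theta X = Z"
  unfolding theta_def by (rule the_equality) (assumption, rule pair_unique)

lemma pair_theta: "X \<in> Lie G \<Longrightarrow> pair X (theta X)"
proof -
  assume "X \<in> Lie G"
  then obtain Z where "pair X Z" using pair_total[of X] unfolding Lie_eq by blast
  then show ?thesis using theta_eq[of X Z] by simp
qed

lemma theta_olin: "X \<in> Lie G \<Longrightarrow> olin (2 * r + 1) (theta X)"
  using pair_theta pair_olin by blast

lemma Lie_add: "X \<in> Lie G \<Longrightarrow> Y \<in> Lie G \<Longrightarrow> X + Y \<in> Lie G"
  and Lie_scale: "X \<in> Lie G \<Longrightarrow> cscale c X \<in> Lie G"
  and Lie_bracket: "X \<in> Lie G \<Longrightarrow> Y \<in> Lie G \<Longrightarrow> lie_bracket X Y \<in> Lie G"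
  unfolding Lie_eq by (blast intro: lie_generated.intros)+

lemma theta_add: "X \<in> Lie G \<Longrightarrow> Y \<in> Lie G \<Longrightarrow> theta (X + Y) = oadd (theta X) (theta Y)"
  by (intro theta_eq pair.add pair_theta)

lemma theta_scale: "X \<in> Lie G \<Longrightarrow> theta (cscale c X) = oscale c (theta X)"
  by (intro theta_eq pair_scale pair_theta)

lemma theta_h: "i \<in> {1..r} \<Longrightarrow> theta (h i) = opH r i"
  by (intro theta_eq pair_generators)

lemma theta_bracket:
  assumes "X \<in> Lie G" "i \<in> {1..r}"
  shows "theta (lie_bracket (e i) X) = obr (opE r i) (theta X)"
    "theta (lie_bracket (f i) X) = obr (opF r i) (theta X)"
    "theta (lie_bracket (h i) X) = obr (opH r i) (theta X)"
  by (intro theta_eq pair_e pair_f pair_h pair_theta assms)+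

text \<open>The real linear map \<open>g\<close> extends \<open>theta\<close> to all matrices; averaging \<open>g\<close> over multiplication
  by \<open>\<i>\<close> makes it complex linear.\<close>

lemma theta_coordinates:
  "\<exists>c. \<forall>X\<in>Lie G. theta X x k = (\<Sum>a\<in>UNIV. \<Sum>b\<in>UNIV. c a b * X $ a $ b)"
proof -
  obtain B where B: "B \<subseteq> Lie G" "independent B" "Lie G \<subseteq> span B"
    by (rule maximal_independent_subset[of "Lie G"])
  obtain g where g: "linear g" "\<forall>b\<in>B. g b = theta b x k"
    using linear_independent_extend[OF B(2), of "\<lambda>b. theta b x k"] by blast
  have gt: "X \<in> Lie G \<and> g X = theta X x k" if "X \<in> span B" for X
    using that
  proof (induction rule: span_induct_alt)
    case base
    have z: "0 \<in> Lie G" unfolding Lie_eq by (rule lie_generated.zero)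
    have "theta 0 = ozero" by (rule theta_eq[OF pair.hom[OF grd_zero]])
    then show ?case using z linear_0[OF g(1)] by (simp add: ozero_def)
  next
    case (step c b Y)
    then have b: "b \<in> Lie G" "cscale (of_real c) b \<in> Lie G" using B(1) Lie_scale by blast+
    then have "theta (c *\<^sub>R b + Y) = oadd (oscale (of_real c) (theta b)) (theta Y)"
      using step theta_add[of "cscale (of_real c) b" Y] theta_scale[of b "of_real c"] by (simp add: cscale_of_real)
    moreover have "g (c *\<^sub>R b + Y) = c *\<^sub>R theta b x k + theta Y x k"
      using step g by (simp add: linear_add linear_scale)
    ultimately show ?case using step b Lie_add
      by (auto simp: oadd_def oscale_def scaleR_conv_of_real[where 'a=complex] cscale_of_real)
  qed
  define g' where "g' Y = (g Y - \<i> * g (cscale \<i> Y)) / 2" for Y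
  have g'_add: "g' (X + Y) = g' X + g' Y" for X Y
    by (simp add: g'_def linear_add[OF g(1)] cscale_add algebra_simps add_divide_distrib diff_divide_distrib)
  have g'_scale: "g' (cscale c Y) = c * g' Y" for c Y
  proof -
    have gs: "g (cscale (of_real t) Z) = of_real t * g Z" for t Z
      by (simp only: cscale_of_real linear_scale[OF g(1)] scaleR_conv_of_real[where 'a = complex])
    have cc: "of_real (Re c) + \<i> * of_real (Im c) = c" "of_real (Re c) + of_real (Im c) * \<i> = c"
      by (simp_all add: complex_eq_iff)
    have c: "cscale c Z = cscale (of_real (Re c)) Z + cscale (of_real (Im c)) (cscale \<i> Z)" for Z
      unfolding cscale_cscale cscale_add_left[symmetric] cc ..
    have gc: "g (cscale c Z) = of_real (Re c) * g Z + of_real (Im c) * g (cscale \<i> Z)" for Z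
      by (subst c) (simp only: linear_add[OF g(1)] gs)
    have ii: "g (cscale \<i> (cscale \<i> Y)) = - g Y" using gs[of "- 1" Y] by simp
    have comm: "cscale \<i> (cscale c Y) = cscale c (cscale \<i> Y)" by (simp add: mult.commute)
    have "g' (cscale c Y) = (of_real (Re c) * g Y + of_real (Im c) * g (cscale \<i> Y) -
        \<i> * (of_real (Re c) * g (cscale \<i> Y) + of_real (Im c) * (- g Y))) / 2"
      unfolding g'_def comm gc ii ..
    also have "\<dots> = (of_real (Re c) + \<i> * of_real (Im c)) * g' Y"
    proof -
      have "\<i> * \<i> = (-1::complex)" by simp
      then show ?thesis unfolding g'_def by algebra
    qed
    finally show ?thesis unfolding cc .
  qed
  define U where "U a b = (\<chi> i j. if i = a \<and> j = b then (1::complex) else 0)" for a b :: 'n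
  have g'_sum: "g' (\<Sum>i\<in>I. F i) = (\<Sum>i\<in>I. g' (F i))" for I and F :: "'n \<Rightarrow> complex^'n^'n"
    using g'_scale[of 0 0] by (induction I rule: infinite_finite_induct) (simp_all add: g'_add)
  have "theta X x k = (\<Sum>a\<in>UNIV. \<Sum>b\<in>UNIV. g' (U a b) * X $ a $ b)" if X: "X \<in> Lie G" for X
  proof -
    have "g X = theta X x k" "g (cscale \<i> X) = \<i> * theta X x k"
      using gt[of X] gt[of "cscale \<i> X"] X B(3) Lie_scale[OF X, of \<i>] theta_scale[OF X, of \<i>]
      by (auto simp: oscale_def)
    then have th: "theta X x k = g' X" unfolding g'_def by simp
    have Xsum: "X = (\<Sum>a\<in>UNIV. \<Sum>b\<in>UNIV. cscale (X $ a $ b) (U a b))"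
    proof (rule matrix_eqI)
      fix i j
      have "(\<Sum>a\<in>UNIV. \<Sum>b\<in>UNIV. cscale (X $ a $ b) (U a b)) $ i $ j =
          (\<Sum>a\<in>UNIV. \<Sum>b\<in>UNIV. if i = a then (if j = b then X $ a $ b else 0) else 0)"
        unfolding U_def by (simp add: if_distrib) (intro sum.cong refl, auto)
      also have "\<dots> = (\<Sum>a\<in>UNIV. if i = a then X $ a $ j else 0)"
        by (intro sum.cong refl) simp
      finally show "X $ i $ j = (\<Sum>a\<in>UNIV. \<Sum>b\<in>UNIV. cscale (X $ a $ b) (U a b)) $ i $ j" by simp
    qed
    have "g' (\<Sum>a\<in>UNIV. \<Sum>b\<in>UNIV. cscale (X $ a $ b) (U a b)) = (\<Sum>a\<in>UNIV. \<Sum>b\<in>UNIV. g' (U a b) * X $ a $ b)"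
      by (simp add: g'_sum g'_scale mult.commute)
    then show ?thesis unfolding th arg_cong[OF Xsum, of g', symmetric] .
  qed
  then have "\<forall>X\<in>Lie G. theta X x k = (\<Sum>a\<in>UNIV. \<Sum>b\<in>UNIV. g' (U a b) * X $ a $ b)" by (rule ballI)
  then show ?thesis by (rule exI[of _ "\<lambda>a b. g' (U a b)"])
qed

end

section \<open>The action of group words on the vector representation\<close>

text \<open>The exponential of an operator whose cube vanishes.\<close>

definition uexp :: "(vect \<Rightarrow> vect) \<Rightarrow> complex \<Rightarrow> vect \<Rightarrow> vect" where
  "uexp A t x = (\<lambda>k. x k + t * A x k + (t ^ 2 / 2) * A (A x) k)"

fun vop :: "nat \<Rightarrow> gen \<Rightarrow> vect \<Rightarrow> vect" where
  "vop r (GE i t) x = uexp (opE r i) t x"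
| "vop r (GF i t) x = uexp (opF r i) t x"
| "vop r (GH i t) x = (\<lambda>k. exp (t * weight r i k) * x k)"

fun vw :: "nat \<Rightarrow> gen list \<Rightarrow> vect \<Rightarrow> vect" where
  "vw r [] x = x"
| "vw r (g # w) x = vop r g (vw r w x)"

lemma vw_append: "vw r (v @ w) x = vw r v (vw r w x)"
  by (induction v) simp_all

lemma olin3:
  assumes "olin N Z"
  shows "Z (\<lambda>k. x k + a * y k + b * z k) = (\<lambda>k. Z x k + a * Z y k + b * Z z k)"
  using olin_add[OF assms, of "\<lambda>k. x k + a * y k" "\<lambda>k. b * z k"] olin_add[OF assms, of x "\<lambda>k. a * y k"]
    olin_scale[OF assms] by simp

lemma opE_cube: "i \<in> {1..r} \<Longrightarrow> opE r i (opE r i (opE r i x)) = (\<lambda>_. 0)"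
proof (rule ext)
  fix k assume i: "i \<in> {1..r}"
  define q where "q = 2 * r + 1 - i"
  have q: "2 * r + 1 - i = q" "2 * r + 2 - i = q + 1" "q \<noteq> i" "q + 1 \<noteq> i" using i by (auto simp: q_def)
  show "opE r i (opE r i (opE r i x)) k = 0" unfolding opE_def q using q(3,4) by simp
qed

lemma opF_cube: "i \<in> {1..r} \<Longrightarrow> opF r i (opF r i (opF r i x)) = (\<lambda>_. 0)"
proof (rule ext)
  fix k assume i: "i \<in> {1..r}"
  define q where "q = 2 * r + 1 - i"
  have q: "2 * r + 1 - i = q" "2 * r + 2 - i = q + 1" "q \<noteq> i" "q + 1 \<noteq> i" using i by (auto simp: q_def)
  show "opF r i (opF r i (opF r i x)) k = 0" unfolding opF_def q using q(3,4) by simp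
qed

context
  fixes N :: nat and A :: "vect \<Rightarrow> vect"
  assumes A: "olin N A" and cube: "\<And>x. A (A (A x)) = (\<lambda>_. 0)"
begin

lemma uexp_A: "A (uexp A t x) = (\<lambda>k. A x k + t * A (A x) k)"
  unfolding uexp_def olin3[OF A] by (simp add: cube)

lemma uexp_inverse: "uexp A t (uexp A (- t) x) = x"
proof -
  have AA: "A (A (uexp A (- t) x)) = A (A x)"
    unfolding uexp_A using olin_add[OF A, of "A x" "\<lambda>k. - t * A (A x) k"] olin_scale[OF A, of "- t" "A (A x)"]
    by (simp add: cube)
  have "uexp A t (uexp A (- t) x) k = x k" for k
    unfolding uexp_def[of A t] unfolding AA unfolding uexp_A unfolding uexp_def by (simp add: field_simps power2_eq_square)
  then show ?thesis by (rule ext)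
qed

lemma uexp_conj_deriv:
  assumes Z: "olin N Z"
  shows "((\<lambda>t. uexp A t (Z (uexp A (- t) x)) k) has_field_derivative
    uexp A t (obr A Z (uexp A (- t) x)) k) (at t)"
proof -
  define y where "y a b = (A ^^ a) (Z ((A ^^ b) x)) k" for a b :: nat
  have A0: "A (\<lambda>_. 0) = (\<lambda>_. 0)" using olin_scale[OF A, of 0 "\<lambda>_. 0"] by simp
  have Z0: "Z (\<lambda>_. 0) = (\<lambda>_. 0)" using olin_scale[OF Z, of 0 "\<lambda>_. 0"] by simp
  have e: "uexp A t (Z (uexp A s x)) k =
     y 0 0 + s * y 0 1 + s^2/2 * y 0 2 + t * (y 1 0 + s * y 1 1 + s^2/2 * y 1 2)
      + t^2/2 * (y 2 0 + s * y 2 1 + s^2/2 * y 2 2)" for s t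
    unfolding uexp_def[of A t] uexp_def[of A s] olin3[OF Z] olin3[OF A]
    by (simp add: y_def numeral_2_eq_2)
  have e2: "uexp A t (obr A Z (uexp A s x)) k =
     (y 1 0 + s * y 1 1 + s^2/2 * y 1 2) - (y 0 1 + s * y 0 2)
      + t * ((y 2 0 + s * y 2 1 + s^2/2 * y 2 2) - (y 1 1 + s * y 1 2))
      + t^2/2 * (- (y 2 1 + s * y 2 2))" for s t
  proof -
    have o: "obr A Z (uexp A s x) = (\<lambda>k. A (Z (uexp A s x)) k - Z (A (uexp A s x)) k)" by (simp add: obr_def)
    have zx: "Z (uexp A s x) = (\<lambda>k. Z x k + s * Z (A x) k + s^2/2 * Z (A (A x)) k)"
      unfolding uexp_def[of A s] olin3[OF Z] ..
    have zax: "Z (A (uexp A s x)) = (\<lambda>k. Z (A x) k + s * Z (A (A x)) k)"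
      unfolding uexp_A using olin_add[OF Z, of "A x" "\<lambda>k. s * A (A x) k"] olin_scale[OF Z, of s "A (A x)"] by simp
    have A2: "A (\<lambda>k. u k + s * v k) = (\<lambda>k. A u k + s * A v k)" for u v
      using olin_add[OF A, of u "\<lambda>k. s * v k"] olin_scale[OF A, of s v] by simp
    show ?thesis
      unfolding uexp_def[of A t] o olin_diff[OF A] zx zax olin3[OF A] A2 cube
      by (simp add: y_def numeral_2_eq_2 cube)
  qed
  show ?thesis unfolding e e2
    by (auto intro!: derivative_eq_intros simp: field_simps power2_eq_square)
qed

end

lemma torus_conj_deriv:
  assumes Z: "olin N Z"
  shows "((\<lambda>t. vop r (GH i t) (Z (vop r (GH i (- t)) x)) k) has_field_derivative
    vop r (GH i t) (obr (opH r i) Z (vop r (GH i (- t)) x)) k) (at t)"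
proof -
  let ?w = "weight r i"
  have Hd: "opH r i (delta q) = (\<lambda>k. ?w q * delta q k)" for q by (auto simp: opH_def delta_def)
  have e: "vop r (GH i t) (Z (vop r (GH i s) x)) k =
      (\<Sum>q\<in>{1..N}. exp (t * ?w k) * (exp (s * ?w q) * x q * Z (delta q) k))" for s t
    using olin_expand[OF Z, of "vop r (GH i s) x" k] by (simp add: sum_distrib_left)
  have e2: "vop r (GH i t) (obr (opH r i) Z (vop r (GH i s) x)) k =
      (\<Sum>q\<in>{1..N}. exp (t * ?w k) * (exp (s * ?w q) * x q * ((?w k - ?w q) * Z (delta q) k)))" for s t
  proof -
    let ?v = "vop r (GH i s) x"
    have "Z (opH r i ?v) k = (\<Sum>q\<in>{1..N}. ?w q * ?v q * Z (delta q) k)"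
      using olin_expand[OF Z, of "opH r i ?v" k] by (simp add: opH_def)
    moreover have "obr (opH r i) Z ?v k = ?w k * Z ?v k - Z (opH r i ?v) k" by (simp only: obr_def opH_def)
    ultimately have "obr (opH r i) Z ?v k =
        ?w k * (\<Sum>q\<in>{1..N}. ?v q * Z (delta q) k) - (\<Sum>q\<in>{1..N}. ?w q * ?v q * Z (delta q) k)"
      using olin_expand[OF Z, of ?v k] by (simp only:)
    also have "\<dots> = (\<Sum>q\<in>{1..N}. ?v q * ((?w k - ?w q) * Z (delta q) k))"
      unfolding sum_distrib_left sum_subtractf[symmetric] by (intro sum.cong refl) (simp add: algebra_simps)
    finally have "obr (opH r i) Z ?v k = (\<Sum>q\<in>{1..N}. ?v q * ((?w k - ?w q) * Z (delta q) k))" .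
    then show ?thesis by (simp add: sum_distrib_left)
  qed
  show ?thesis unfolding e e2
    by (intro DERIV_sum) (auto intro!: derivative_eq_intros simp: algebra_simps)
qed

lemma vop_inverse: "gen_index g \<in> {1..r} \<Longrightarrow> vop r g (vop r (gen_inverse g) x) = x"
proof (cases g)
  case (GE i t)
  assume "gen_index g \<in> {1..r}"
  then show ?thesis using GE uexp_inverse[OF olin_opE opE_cube] by simp
next
  case (GF i t)
  assume "gen_index g \<in> {1..r}"
  then show ?thesis using GF uexp_inverse[OF olin_opF opF_cube] by simp
next
  case (GH i t)
  then show ?thesis by (simp add: fun_eq_iff mult.assoc[symmetric] flip: exp_add)
qed

text \<open>All derivatives of a member of the family are members, so its Taylor series at \<open>0\<close> is zero.\<close>

lemma flow_unique:
  assumes d: "\<And>X t. X \<in> S \<Longrightarrow> (d X has_field_derivative d (ad X) t) (at t)"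
    and ad: "\<And>X. X \<in> S \<Longrightarrow> ad X \<in> S" and z: "\<And>X. X \<in> S \<Longrightarrow> d X 0 = 0" and X: "X \<in> S"
  shows "d X t = (0::complex)"
proof -
  have S: "(ad ^^ n) X \<in> S" for n using X ad by (induction n) auto
  have D: "(deriv ^^ n) (d X) = d ((ad ^^ n) X)" for n
  proof (induction n)
    case (Suc n)
    show ?case using DERIV_imp_deriv[OF d[OF S[of n]]] by (simp add: Suc)
  qed simp
  have "d X holomorphic_on UNIV"
    using d[OF X] unfolding holomorphic_on_def field_differentiable_def by blast
  then show ?thesis
    using holomorphic_fun_eq_0_on_connected[OF _ open_UNIV connected_UNIV, of "d X" 0 t] D z[OF S] by simp
qed

subsection \<open>Polynomial functions on matrices\<close>

lemma poly_funs_sum: "(\<And>i. i \<in> I \<Longrightarrow> F i \<in> poly_funs) \<Longrightarrow> (\<lambda>A. \<Sum>i\<in>I. F i A) \<in> poly_funs"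
  by (induction I rule: infinite_finite_induct) (auto intro: poly_funs.intros)

lemma poly_funs_prod: "(\<And>i. i \<in> I \<Longrightarrow> F i \<in> poly_funs) \<Longrightarrow> (\<lambda>A. \<Prod>i\<in>I. F i A) \<in> poly_funs"
  by (induction I rule: infinite_finite_induct) (auto intro: poly_funs.intros)

lemma poly_funs_power: "p \<in> poly_funs \<Longrightarrow> (\<lambda>A. p A ^ m) \<in> poly_funs"
  by (induction m) (auto intro: poly_funs.intros)

lemma poly_funs_compose:
  assumes "p \<in> poly_funs" "\<And>i j. (\<lambda>A. F A $ i $ j) \<in> poly_funs"
  shows "(\<lambda>A. p (F A)) \<in> poly_funs"
  using assms(1)
proof (induction rule: poly_funs.induct)
  case (entry i j)
  show ?case by (rule assms(2))
next
  case (add p q)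
  then show ?case by (intro poly_funs.add)
next
  case (mult p q)
  then show ?case by (intro poly_funs.mult)
qed (rule poly_funs.const)

lemma poly_funs_det:
  assumes "\<And>i j. (\<lambda>A. F A $ i $ j) \<in> poly_funs"
  shows "(\<lambda>A. det (F A :: complex^'n^'n)) \<in> poly_funs"
  unfolding det_def
  by (intro poly_funs_sum poly_funs.mult poly_funs.const poly_funs_prod assms)

lemma poly_funs_mult_right: "p \<in> poly_funs \<Longrightarrow> (\<lambda>A. p (A ** B)) \<in> poly_funs"
  by (rule poly_funs_compose[where F = "\<lambda>A. A ** B"], assumption)
    (unfold matrix_mult_nth, intro poly_funs_sum poly_funs.mult poly_funs.const poly_funs.entry)

lemma poly_funs_mult_left: "p \<in> poly_funs \<Longrightarrow> (\<lambda>A. p (B ** A)) \<in> poly_funs"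
  by (rule poly_funs_compose[where F = "\<lambda>A. B ** A"], assumption)
    (unfold matrix_mult_nth, intro poly_funs_sum poly_funs.mult poly_funs.const poly_funs.entry)

text \<open>Cramer's rule.\<close>

lemma inverse_entry_regular:
  "\<exists>p\<in>poly_funs. \<forall>A A'. A ** A' = mat 1 \<longrightarrow> A' $ k $ b = p A / det (A :: complex^'n^'n)"
proof (intro bexI allI impI)
  let ?C = "\<lambda>A :: complex^'n^'n. (\<chi> i j. if j = k then axis b 1 $ i else A $ i $ j) :: complex^'n^'n"
  fix A A' :: "complex^'n^'n" assume inv: "A ** A' = mat 1"
  then have "det A * det A' = 1" by (simp flip: det_mul)
  then have nz: "det A \<noteq> 0" by auto
  have "A *v column b A' = axis b 1"
    using inv by (simp add: vec_eq_iff matrix_matrix_mult_def matrix_vector_mult_def column_def mat_def axis_def)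
  then have "column b A' = (\<chi> k. det (\<chi> i j. if j = k then axis b 1 $ i else A $ i $ j) / det A)"
    using cramer[OF nz] by blast
  then show "A' $ k $ b = det (?C A) / det A" by (simp add: vec_eq_iff column_def)
next
  let ?C = "\<lambda>A :: complex^'n^'n. (\<chi> i j. if j = k then axis b 1 $ i else A $ i $ j) :: complex^'n^'n"
  show "(\<lambda>A. det (?C A)) \<in> poly_funs"
  proof (rule poly_funs_det)
    fix i j
    show "(\<lambda>A. ?C A $ i $ j) \<in> poly_funs"
      by (cases "j = k") (auto intro: poly_funs.intros)
  qed
qed

context chevalley_matrices
begin

lemma vw_winv: "set w \<subseteq> all_gens r \<Longrightarrow> vw r w (vw r (winv w) x) = x"
  by (induction w arbitrary: x) (auto simp: winv_Cons vw_append vop_inverse all_gens_def, simp add: winv_def)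

lemma gmat_inverse_eq: "gen_inverse (gen_inverse g) = g"
  by (cases g) auto

lemma vw_winv': "set w \<subseteq> all_gens r \<Longrightarrow> vw r (winv w) (vw r w x) = x"
  using vw_winv[of "winv w" x] winv_in by (simp add: winv_def rev_map gmat_inverse_eq o_def)

text \<open>The condition is stated on words and not on group elements, since a function of words such as a
  matrix coefficient of the vector representation is not yet known to be a function on the group.\<close>

definition regular_word :: "(gen list \<Rightarrow> complex) \<Rightarrow> bool" where
  "regular_word \<phi> \<longleftrightarrow> (\<exists>p\<in>poly_funs. \<exists>m. \<forall>w. set w \<subseteq> all_gens r \<longrightarrow> \<phi> w = p (gw w) / det (gw w) ^ m)"

lemma det_gw: "det (gw w) \<noteq> 0"
proof -
  have "det (gw w) * det (gw (winv w)) = 1" by (simp add: gw_winv flip: det_mul)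
  then show ?thesis by auto
qed

lemma poly_det: "(\<lambda>A::complex^'n^'n. det A) \<in> poly_funs"
  by (rule poly_funs_det) (rule poly_funs.entry)

lemma regular_word_const: "regular_word (\<lambda>_. c)"
  unfolding regular_word_def by (intro bexI[of _ "\<lambda>_. c"] exI[of _ 0]) (auto intro: poly_funs.const)

lemma regular_word_cong:
  "regular_word \<phi> \<Longrightarrow> (\<And>w. set w \<subseteq> all_gens r \<Longrightarrow> \<psi> w = \<phi> w) \<Longrightarrow> regular_word \<psi>"
  unfolding regular_word_def by simp

lemma regular_word_add:
  assumes "regular_word \<phi>" "regular_word \<psi>"
  shows "regular_word (\<lambda>w. \<phi> w + \<psi> w)"
proof -
  obtain p m q l where p: "p \<in> poly_funs" "\<And>w. set w \<subseteq> all_gens r \<Longrightarrow> \<phi> w = p (gw w) / det (gw w) ^ m"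
    and q: "q \<in> poly_funs" "\<And>w. set w \<subseteq> all_gens r \<Longrightarrow> \<psi> w = q (gw w) / det (gw w) ^ l"
    using assms unfolding regular_word_def by blast
  have "(\<lambda>A. p A * det A ^ l + q A * det A ^ m) \<in> poly_funs"
    by (intro poly_funs.add poly_funs.mult p(1) q(1) poly_funs_power poly_det)
  moreover have "\<phi> w + \<psi> w = (p (gw w) * det (gw w) ^ l + q (gw w) * det (gw w) ^ m) / det (gw w) ^ (m + l)"
    if "set w \<subseteq> all_gens r" for w
    using p(2)[OF that] q(2)[OF that] det_gw[of w] by (simp add: power_add add_frac_eq)
  ultimately show ?thesis unfolding regular_word_def by (intro bexI exI allI impI)
qed

lemma regular_word_mult:
  assumes "regular_word \<phi>" "regular_word \<psi>"
  shows "regular_word (\<lambda>w. \<phi> w * \<psi> w)"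
proof -
  obtain p m q l where p: "p \<in> poly_funs" "\<And>w. set w \<subseteq> all_gens r \<Longrightarrow> \<phi> w = p (gw w) / det (gw w) ^ m"
    and q: "q \<in> poly_funs" "\<And>w. set w \<subseteq> all_gens r \<Longrightarrow> \<psi> w = q (gw w) / det (gw w) ^ l"
    using assms unfolding regular_word_def by blast
  have "(\<lambda>A. p A * q A) \<in> poly_funs" by (intro poly_funs.mult p(1) q(1))
  moreover have "\<phi> w * \<psi> w = p (gw w) * q (gw w) / det (gw w) ^ (m + l)"
    if "set w \<subseteq> all_gens r" for w
    using p(2)[OF that] q(2)[OF that] by (simp add: power_add)
  ultimately show ?thesis unfolding regular_word_def by (intro bexI exI allI impI)
qed

lemma regular_word_sum:
  "(\<And>i. i \<in> I \<Longrightarrow> regular_word (\<phi> i)) \<Longrightarrow> regular_word (\<lambda>w. \<Sum>i\<in>I. \<phi> i w)"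
  by (induction I rule: infinite_finite_induct) (auto intro: regular_word_const regular_word_add)

lemma regular_word_prod:
  "(\<And>i. i \<in> I \<Longrightarrow> regular_word (\<phi> i)) \<Longrightarrow> regular_word (\<lambda>w. \<Prod>i\<in>I. \<phi> i w)"
  by (induction I rule: infinite_finite_induct) (auto intro: regular_word_const regular_word_mult)

lemma regular_word_right:
  assumes "regular_word \<phi>" "set v \<subseteq> all_gens r"
  shows "regular_word (\<lambda>w. \<phi> (w @ v))"
proof -
  obtain p m where p: "p \<in> poly_funs" "\<And>w. set w \<subseteq> all_gens r \<Longrightarrow> \<phi> w = p (gw w) / det (gw w) ^ m"
    using assms unfolding regular_word_def by blast
  have "(\<lambda>A. (1 / det (gw v) ^ m) * p (A ** gw v)) \<in> poly_funs"
    by (intro poly_funs.mult poly_funs.const poly_funs_mult_right p(1))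
  moreover have "\<phi> (w @ v) = (1 / det (gw v) ^ m) * p (gw w ** gw v) / det (gw w) ^ m"
    if "set w \<subseteq> all_gens r" for w
    using p(2)[of "w @ v"] that assms(2) by (simp add: gw_append det_mul power_mult_distrib mult.commute)
  ultimately show ?thesis unfolding regular_word_def by (intro bexI exI allI impI)
qed

lemma regular_word_left:
  assumes "regular_word \<phi>" "set v \<subseteq> all_gens r"
  shows "regular_word (\<lambda>w. \<phi> (v @ w))"
proof -
  obtain p m where p: "p \<in> poly_funs" "\<And>w. set w \<subseteq> all_gens r \<Longrightarrow> \<phi> w = p (gw w) / det (gw w) ^ m"
    using assms unfolding regular_word_def by blast
  have "(\<lambda>A. (1 / det (gw v) ^ m) * p (gw v ** A)) \<in> poly_funs"
    by (intro poly_funs.mult poly_funs.const poly_funs_mult_left p(1))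
  moreover have "\<phi> (v @ w) = (1 / det (gw v) ^ m) * p (gw v ** gw w) / det (gw w) ^ m"
    if "set w \<subseteq> all_gens r" for w
    using p(2)[of "v @ w"] that assms(2) by (simp add: gw_append det_mul power_mult_distrib mult.commute)
  ultimately show ?thesis unfolding regular_word_def by (intro bexI exI allI impI)
qed

lemma regular_word_entry: "regular_word (\<lambda>w. gw w $ a $ b)"
  unfolding regular_word_def by (intro bexI[of _ "\<lambda>A. A $ a $ b"] exI[of _ 0]) (auto intro: poly_funs.entry)

lemma regular_word_inverse_entry: "regular_word (\<lambda>w. gw (winv w) $ a $ b)"
proof -
  obtain p where p: "p \<in> poly_funs" "\<And>A A'. A ** A' = mat 1 \<Longrightarrow> A' $ a $ b = p A / det (A :: complex^'n^'n)"
    using inverse_entry_regular[of a b] by blast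
  have "\<forall>w. set w \<subseteq> all_gens r \<longrightarrow> gw (winv w) $ a $ b = p (gw w) / det (gw w) ^ 1"
    using p(2)[OF gw_winv(1)] by simp
  then show ?thesis unfolding regular_word_def using p(1) by blast
qed

end

context chevalley_group
begin

text \<open>The adjoint action is intertwined by \<open>theta\<close> with conjugation in the vector representation:
  along a one-parameter subgroup both sides solve the same differential equation.\<close>

lemma theta_conj_flow:
  assumes a: "a \<in> Lie G"
    and th: "\<And>X. X \<in> Lie G \<Longrightarrow> theta (lie_bracket a X) = obr A (theta X)"
    and U0: "\<And>x. U 0 x = x"
    and U: "\<And>Z t. olin (2 * r + 1) Z \<Longrightarrow> ((\<lambda>t. U t (Z (U (- t) x)) k) has_field_derivative
        U t (obr A Z (U (- t) x)) k) (at t)"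
    and X: "X \<in> Lie G"
  shows "theta (expt a t ** X ** expt a (- t)) x k = U t (theta X (U (- t) x)) k"
proof -
  obtain c where c: "\<And>Y. Y \<in> Lie G \<Longrightarrow> theta Y x k = (\<Sum>i\<in>UNIV. \<Sum>j\<in>UNIV. c i j * Y $ i $ j)"
    using theta_coordinates[of x k] by blast
  have Lc: "expt a t ** Y ** expt a (- t) \<in> Lie G" if "Y \<in> Lie G" for Y t
    using a that by (intro Lie_conj[OF subgroup_G]) (simp_all add: Lie_iff)
  define d where "d Y t = theta (expt a t ** Y ** expt a (- t)) x k - U t (theta Y (U (- t) x)) k" for Y t
  have "d X t = 0"
  proof (rule flow_unique[where d = d and S = "Lie G" and ad = "lie_bracket a", OF _ _ _ X])
    fix Y t assume Y: "Y \<in> Lie G"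
    have bY: "lie_bracket a Y \<in> Lie G" using Lie_bracket a Y by blast
    have m: "has_matrix_derivative (\<lambda>t. expt a t ** Y ** expt a (- t)) (expt a t ** lie_bracket a Y ** expt a (- t)) t"
    proof -
      have 1: "has_matrix_derivative (\<lambda>t. expt a t ** Y) (a ** expt a t ** Y) t"
        using has_matrix_derivative_mult[OF has_matrix_derivative_expt[of a t] has_matrix_derivative_const[of Y]] by simp
      have 2: "has_matrix_derivative (\<lambda>t. expt a (- t)) (cscale (- 1) (a ** expt a (- t))) t"
        using has_matrix_derivative_expt_chain[OF DERIV_minus[OF DERIV_ident], of a t] by simp
      have "(a ** expt a t ** Y) ** expt a (- t) + (expt a t ** Y) ** cscale (- 1) (a ** expt a (- t)) =
          expt a t ** lie_bracket a Y ** expt a (- t)"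
        unfolding expt_commute[of a t, symmetric] lie_bracket_def
        by (simp only: matrix_ring_simps) (simp add: vec_eq_iff)
      then show ?thesis using has_matrix_derivative_mult[OF 1 2] by simp
    qed
    have "((\<lambda>t. \<Sum>i\<in>UNIV. \<Sum>j\<in>UNIV. c i j * (expt a t ** Y ** expt a (- t)) $ i $ j) has_field_derivative
        (\<Sum>i\<in>UNIV. \<Sum>j\<in>UNIV. c i j * (expt a t ** lie_bracket a Y ** expt a (- t)) $ i $ j)) (at t)"
      using m unfolding has_matrix_derivative_def by (intro DERIV_sum DERIV_cmult) blast
    then have D1: "((\<lambda>t. theta (expt a t ** Y ** expt a (- t)) x k) has_field_derivative
        theta (expt a t ** lie_bracket a Y ** expt a (- t)) x k) (at t)"
      by (simp only: c[OF Lc[OF Y]] c[OF Lc[OF bY]])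
    have D2: "((\<lambda>t. U t (theta Y (U (- t) x)) k) has_field_derivative
        U t (theta (lie_bracket a Y) (U (- t) x)) k) (at t)"
      unfolding th[OF Y] by (rule U[OF theta_olin[OF Y]])
    show "(d Y has_field_derivative d (lie_bracket a Y) t) (at t)"
      unfolding d_def[abs_def] by (rule DERIV_diff[OF D1 D2])
  next
    fix Y assume Y: "Y \<in> Lie G"
    then show "lie_bracket a Y \<in> Lie G" using Lie_bracket a by blast
    show "d Y 0 = 0" by (simp add: d_def U0)
  qed
  then show ?thesis by (simp add: d_def)
qed

lemma theta_gmat:
  assumes X: "X \<in> Lie G" and g: "g \<in> all_gens r"
  shows "theta (gmat g ** X ** gmat (gen_inverse g)) x = vop r g (theta X (vop r (gen_inverse g) x))"
proof (rule ext)
  fix k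
  show "theta (gmat g ** X ** gmat (gen_inverse g)) x k = vop r g (theta X (vop r (gen_inverse g) x)) k"
  proof (cases g)
    case (GE i t)
    then have i: "i \<in> {1..r}" using g by (simp add: all_gens_def)
    have "theta (expt (e i) t ** X ** expt (e i) (- t)) x k =
        uexp (opE r i) t (theta X (uexp (opE r i) (- t) x)) k"
    proof (rule theta_conj_flow[where A = "opE r i" and U = "uexp (opE r i)", OF gens_Lie(1)[OF i] _ _ _ X])
      show "theta (lie_bracket (e i) Y) = obr (opE r i) (theta Y)" if "Y \<in> Lie G" for Y
        by (rule theta_bracket(1)[OF that i])
      show "uexp (opE r i) 0 y = y" for y by (simp add: uexp_def)
      show "((\<lambda>t. uexp (opE r i) t (Z (uexp (opE r i) (- t) x)) k) has_field_derivative
          uexp (opE r i) s (obr (opE r i) Z (uexp (opE r i) (- s) x)) k) (at s)" if "olin (2 * r + 1) Z" for Z s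
        by (rule uexp_conj_deriv[OF olin_opE[OF i] opE_cube[OF i] that])
    qed
    then show ?thesis using GE by simp
  next
    case (GF i t)
    then have i: "i \<in> {1..r}" using g by (simp add: all_gens_def)
    have "theta (expt (f i) t ** X ** expt (f i) (- t)) x k =
        uexp (opF r i) t (theta X (uexp (opF r i) (- t) x)) k"
    proof (rule theta_conj_flow[where A = "opF r i" and U = "uexp (opF r i)", OF gens_Lie(2)[OF i] _ _ _ X])
      show "theta (lie_bracket (f i) Y) = obr (opF r i) (theta Y)" if "Y \<in> Lie G" for Y
        by (rule theta_bracket(2)[OF that i])
      show "uexp (opF r i) 0 y = y" for y by (simp add: uexp_def)
      show "((\<lambda>t. uexp (opF r i) t (Z (uexp (opF r i) (- t) x)) k) has_field_derivative
          uexp (opF r i) s (obr (opF r i) Z (uexp (opF r i) (- s) x)) k) (at s)" if "olin (2 * r + 1) Z" for Z s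
        by (rule uexp_conj_deriv[OF olin_opF[OF i] opF_cube[OF i] that])
    qed
    then show ?thesis using GF by simp
  next
    case (GH i t)
    then have i: "i \<in> {1..r}" using g by (simp add: all_gens_def)
    have "theta (expt (h i) t ** X ** expt (h i) (- t)) x k =
        vop r (GH i t) (theta X (vop r (GH i (- t)) x)) k"
    proof (rule theta_conj_flow[where A = "opH r i" and U = "\<lambda>t. vop r (GH i t)", OF gens_Lie(3)[OF i] _ _ _ X])
      show "theta (lie_bracket (h i) Y) = obr (opH r i) (theta Y)" if "Y \<in> Lie G" for Y
        by (rule theta_bracket(3)[OF that i])
      show "vop r (GH i 0) y = y" for y by simp
      show "((\<lambda>t. vop r (GH i t) (Z (vop r (GH i (- t)) x)) k) has_field_derivative
          vop r (GH i s) (obr (opH r i) Z (vop r (GH i (- s)) x)) k) (at s)" if "olin (2 * r + 1) Z" for Z s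
        by (rule torus_conj_deriv[OF that])
    qed
    then show ?thesis using GH by simp
  qed
qed

lemma gmat_in_G: "g \<in> all_gens r \<Longrightarrow> gmat g \<in> G"
  using gens_Lie by (cases g) (auto simp: all_gens_def Lie_iff)

lemma gw_in_G: "set w \<subseteq> all_gens r \<Longrightarrow> gw w \<in> G"
  by (induction w) (auto intro: subgroup_GL_one subgroup_GL_mult gmat_in_G subgroup_G)

lemma theta_gw:
  assumes "X \<in> Lie G" "set w \<subseteq> all_gens r"
  shows "theta (gw w ** X ** gw (winv w)) x = vw r w (theta X (vw r (winv w) x))"
  using assms(2)
proof (induction w arbitrary: x)
  case Nil
  then show ?case by (simp add: winv_def)
next
  case (Cons g w)
  have L: "gw w ** X ** gw (winv w) \<in> Lie G"
    using Cons.prems gw_winv gw_in_G winv_in by (intro Lie_conj[OF subgroup_G _ _ _ _ assms(1)]) auto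
  have "gw (g # w) ** X ** gw (winv (g # w)) = gmat g ** (gw w ** X ** gw (winv w)) ** gmat (gen_inverse g)"
    by (simp add: winv_Cons gw_append matrix_mul_assoc)
  then have "theta (gw (g # w) ** X ** gw (winv (g # w))) x =
      vop r g (theta (gw w ** X ** gw (winv w)) (vop r (gen_inverse g) x))"
    using theta_gmat[OF L] Cons.prems by simp
  then show ?case using Cons by (simp add: winv_Cons vw_append)
qed

text \<open>Conjugation in the group is polynomial in the entries and the inverse determinant, and
  \<open>theta\<close> is linear in the entries.\<close>

lemma regular_word_conj_H:
  assumes i: "i \<in> {1..r}"
  shows "regular_word (\<lambda>w. vw r w (opH r i (vw r (winv w) x)) k)"
proof -
  obtain c where c: "\<And>Y. Y \<in> Lie G \<Longrightarrow> theta Y x k = (\<Sum>a\<in>UNIV. \<Sum>b\<in>UNIV. c a b * Y $ a $ b)"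
    using theta_coordinates[of x k] by blast
  have "regular_word (\<lambda>w. \<Sum>a\<in>UNIV. \<Sum>b\<in>UNIV. c a b * (gw w ** h i ** gw (winv w)) $ a $ b)"
    unfolding matrix_mult_nth
    by (intro regular_word_sum regular_word_mult regular_word_const regular_word_entry regular_word_inverse_entry)
  then show ?thesis
  proof (rule regular_word_cong)
    fix w assume w: "set w \<subseteq> all_gens r"
    have L: "gw w ** h i ** gw (winv w) \<in> Lie G"
      using w gw_winv gw_in_G winv_in by (intro Lie_conj[OF subgroup_G _ _ _ _ gens_Lie(3)[OF i]]) auto
    show "vw r w (opH r i (vw r (winv w) x)) k =
        (\<Sum>a\<in>UNIV. \<Sum>b\<in>UNIV. c a b * (gw w ** h i ** gw (winv w)) $ a $ b)"
      using fun_cong[OF theta_gw[OF gens_Lie(3)[OF i] w, of x], of k] c[OF L] by (simp add: theta_h[OF i])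
  qed
qed

end

section \<open>Minors\<close>

text \<open>The minor with rows \<open>I 1, \<dots>, I d\<close> of the matrix with columns \<open>u 1, \<dots>, u d\<close>.\<close>

definition psi :: "nat \<Rightarrow> (nat \<Rightarrow> nat) \<Rightarrow> (nat \<Rightarrow> vect) \<Rightarrow> complex" where
  "psi d I u = (\<Sum>\<sigma>\<in>{\<sigma>. \<sigma> permutes {1..d}}. of_int (sign \<sigma>) * (\<Prod>i\<in>{1..d}. u i (I (\<sigma> i))))"

lemma psi_cong: "(\<And>i k. i \<in> {1..d} \<Longrightarrow> k \<in> {1..d} \<Longrightarrow> u i (I k) = v i (J k)) \<Longrightarrow> psi d I u = psi d J v"
  unfolding psi_def
proof (intro sum.cong refl arg_cong2[of _ _ _ _ "(*)"] prod.cong)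
  fix \<sigma> i assume a: "\<And>i k. i \<in> {1..d} \<Longrightarrow> k \<in> {1..d} \<Longrightarrow> u i (I k) = v i (J k)"
    "\<sigma> \<in> {\<sigma>. \<sigma> permutes {1..d}}" "i \<in> {1..d}"
  then show "u i (I (\<sigma> i)) = v i (J (\<sigma> i))" using permutes_in_image[of \<sigma> "{1..d}" i] by blast
qed

lemma finite_perms: "finite {\<sigma>. \<sigma> permutes {1..d::nat}}"
  by (rule finite_permutations) simp

lemma psi_transpose: "psi d I u = psi d id (\<lambda>k i. u i (I k))"
proof -
  have "psi d I u = (\<Sum>\<sigma>\<in>{\<sigma>. \<sigma> permutes {1..d}}. of_int (sign (inv_into UNIV \<sigma>)) * (\<Prod>i\<in>{1..d}. u i (I (inv_into UNIV \<sigma> i))))"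
    unfolding psi_def
    by (rule sum.reindex_bij_witness[of _ "inv_into UNIV" "inv_into UNIV"]) (auto simp: permutes_inv permutes_inv_inv)
  also have "\<dots> = psi d id (\<lambda>k i. u i (I k))"
    unfolding psi_def
  proof (intro sum.cong refl)
    fix \<sigma> assume "\<sigma> \<in> {\<sigma>. \<sigma> permutes {1..d}}"
    then have p: "\<sigma> permutes {1..d}" by simp
    have "(\<Prod>i\<in>{1..d}. u i (I (inv_into UNIV \<sigma> i))) = (\<Prod>i\<in>{1..d}. u (\<sigma> i) (I (inv_into UNIV \<sigma> (\<sigma> i))))"
      using prod.permute[OF p, of "\<lambda>i. u i (I (inv_into UNIV \<sigma> i))"] by (simp add: o_def)
    then show "of_int (sign (inv_into UNIV \<sigma>)) * (\<Prod>i\<in>{1..d}. u i (I (inv_into UNIV \<sigma> i))) =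
        of_int (sign \<sigma>) * (\<Prod>i\<in>{1..d}. u (id (\<sigma> i)) (I i))"
      using sign_inverse[of \<sigma>] permutes_inverses(2)[OF p] p by (auto simp: permutation_permutes simp del: One_nat_def)
  qed
  finally show ?thesis .
qed

text \<open>Reindexing by composition with the transposition changes every sign.\<close>

lemma psi_swap:
  assumes ij: "i \<in> {1..d}" "j \<in> {1..d}" "i \<noteq> j"
  shows "psi d I (\<lambda>k. u (Transposition.transpose i j k)) = - psi d I u"
proof -
  let ?\<tau> = "Transposition.transpose i j"
  have t: "?\<tau> permutes {1..d}" using ij by (simp add: permutes_swap_id)
  have "psi d I (\<lambda>k. u (?\<tau> k)) =
      (\<Sum>\<sigma>\<in>{\<sigma>. \<sigma> permutes {1..d}}. of_int (sign (\<sigma> \<circ> ?\<tau>)) * (\<Prod>k\<in>{1..d}. u (?\<tau> k) (I ((\<sigma> \<circ> ?\<tau>) k))))"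
    unfolding psi_def
    by (rule sum.reindex_bij_witness[of _ "\<lambda>\<sigma>. \<sigma> \<circ> ?\<tau>" "\<lambda>\<sigma>. \<sigma> \<circ> ?\<tau>"])
      (auto simp: permutes_compose[OF t] comp_assoc simp del: One_nat_def)
  also have "\<dots> = (\<Sum>\<sigma>\<in>{\<sigma>. \<sigma> permutes {1..d}}. - (of_int (sign \<sigma>) * (\<Prod>k\<in>{1..d}. u k (I (\<sigma> k)))))"
  proof (intro sum.cong refl)
    fix \<sigma> assume "\<sigma> \<in> {\<sigma>. \<sigma> permutes {1..d}}"
    then have p: "permutation \<sigma>" using permutation_permutes by auto
    have "sign (\<sigma> \<circ> ?\<tau>) = - sign \<sigma>"
      using sign_compose[OF p permutation_swap_id[of i j]] ij by (simp add: sign_swap_id)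
    moreover have "(\<Prod>k\<in>{1..d}. u (?\<tau> k) (I ((\<sigma> \<circ> ?\<tau>) k))) = (\<Prod>k\<in>{1..d}. u k (I (\<sigma> k)))"
      using prod.permute[OF t, of "\<lambda>k. u k (I (\<sigma> k))"] by (simp add: o_def)
    ultimately show "of_int (sign (\<sigma> \<circ> ?\<tau>)) * (\<Prod>k\<in>{1..d}. u (?\<tau> k) (I ((\<sigma> \<circ> ?\<tau>) k))) =
        - (of_int (sign \<sigma>) * (\<Prod>k\<in>{1..d}. u k (I (\<sigma> k))))" by simp
  qed
  finally show ?thesis by (simp add: psi_def sum_negf)
qed

lemma psi_alternating:
  assumes ij: "i \<in> {1..d}" "j \<in> {1..d}" "i \<noteq> j" and eq: "u i = u j"
  shows "psi d I u = 0"
proof -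
  have "(\<lambda>k. u (Transposition.transpose i j k)) = u" using eq by (auto simp: fun_eq_iff Transposition.transpose_def)
  then show ?thesis using psi_swap[OF ij, of I u] by simp
qed

lemma prod_update:
  assumes "i \<in> {1..d::nat}"
  shows "(\<Prod>k\<in>{1..d}. (u(i := x)) k (g k)) = x (g i) * (\<Prod>k\<in>{1..d} - {i}. u k (g k))"
  using assms by (subst prod.remove[of _ i]) (auto intro!: prod.cong)

lemma psi_add:
  assumes "i \<in> {1..d}"
  shows "psi d I (u(i := (\<lambda>k. x k + y k))) = psi d I (u(i := x)) + psi d I (u(i := y))"
  unfolding psi_def prod_update[OF assms] by (simp add: algebra_simps sum.distrib)

lemma psi_scale:
  assumes "i \<in> {1..d}"
  shows "psi d I (u(i := (\<lambda>k. c * x k))) = c * psi d I (u(i := x))"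
  unfolding psi_def prod_update[OF assms] sum_distrib_left by (simp add: algebra_simps)

lemma psi_column_operation:
  assumes ij: "i \<in> {1..d}" "j \<in> {1..d}" "i \<noteq> j"
  shows "psi d I (u(i := (\<lambda>k. u i k + c * u j k))) = psi d I u"
proof -
  have "psi d I (u(i := u j)) = 0" using ij by (intro psi_alternating[of i d j]) auto
  then show ?thesis
    using psi_add[OF ij(1), of I u "u i" "\<lambda>k. c * u j k"] psi_scale[OF ij(1), of I u c "u j"] by simp
qed

definition rowop :: "nat \<Rightarrow> complex \<Rightarrow> nat \<Rightarrow> vect \<Rightarrow> vect" where
  "rowop b t a x = x(b := x b + t * x a)"

lemma psi_rowop:
  assumes "a \<in> {1..d}" "b \<in> {1..d}" "a \<noteq> b"
  shows "psi d id (\<lambda>i. rowop b t a (u i)) = psi d id u"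
proof -
  let ?v = "\<lambda>k i. u i k"
  have "psi d id (\<lambda>i. rowop b t a (u i)) = psi d id (?v(b := (\<lambda>i. ?v b i + t * ?v a i)))"
    by (subst psi_transpose, rule psi_cong) (auto simp: rowop_def)
  also have "\<dots> = psi d id ?v" using assms by (intro psi_column_operation) auto
  also have "\<dots> = psi d id u" by (subst psi_transpose) simp
  finally show ?thesis .
qed

lemma psi_row_scale: "psi d id (\<lambda>i k. c k * u i k) = (\<Prod>k\<in>{1..d}. c k) * psi d id u"
  unfolding psi_def sum_distrib_left
proof (intro sum.cong refl)
  fix \<sigma> assume "\<sigma> \<in> {\<sigma>. \<sigma> permutes {1..d}}"
  then have "(\<Prod>i\<in>{1..d}. c (\<sigma> i)) = (\<Prod>k\<in>{1..d}. c k)"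
    using prod.permute[of \<sigma> "{1..d}" c] by (simp add: o_def)
  then show "of_int (sign \<sigma>) * (\<Prod>i\<in>{1..d}. c (id (\<sigma> i)) * u i (id (\<sigma> i))) =
      (\<Prod>k\<in>{1..d}. c k) * (of_int (sign \<sigma>) * (\<Prod>i\<in>{1..d}. u i (id (\<sigma> i))))"
    by (simp add: prod.distrib)
qed

text \<open>Only the identity permutation contributes: any other one has \<open>\<sigma> i > i\<close> for
  some \<open>i\<close>.\<close>

lemma psi_upper_unitriangular:
  assumes "\<And>i k. i \<in> {1..d} \<Longrightarrow> i < k \<Longrightarrow> k \<le> d \<Longrightarrow> u i k = 0" "\<And>i. i \<in> {1..d} \<Longrightarrow> u i i = 1"
  shows "psi d id u = 1"
proof -
  have "psi d id u = (\<Sum>\<sigma>\<in>{id}. of_int (sign \<sigma>) * (\<Prod>i\<in>{1..d}. u i (id (\<sigma> i))))"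
    unfolding psi_def
  proof (rule sum.mono_neutral_right[OF finite_perms])
    show "{id} \<subseteq> {\<sigma>. \<sigma> permutes {1..d}}" by (simp add: permutes_id)
    show "\<forall>\<sigma>\<in>{\<sigma>. \<sigma> permutes {1..d}} - {id}. of_int (sign \<sigma>) * (\<Prod>i\<in>{1..d}. u i (id (\<sigma> i))) = 0"
    proof
      fix \<sigma> assume s: "\<sigma> \<in> {\<sigma>. \<sigma> permutes {1..d}} - {id}"
      then obtain i where i: "i \<in> {1..d}" "\<not> \<sigma> i \<le> i"
        using permutes_natset_le[of \<sigma> "{1..d}"] by blast
      then have "\<sigma> i \<le> d" using s permutes_in_image[of \<sigma> "{1..d}" i] by auto
      then have "u i (id (\<sigma> i)) = 0" using assms(1)[of i "\<sigma> i"] i by simp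
      then have "(\<Prod>i\<in>{1..d}. u i (id (\<sigma> i))) = 0" using i(1) by (intro prod_zero) auto
      then show "of_int (sign \<sigma>) * (\<Prod>i\<in>{1..d}. u i (id (\<sigma> i))) = 0" by simp
    qed
  qed
  then show ?thesis using assms(2) by (simp add: sign_id)
qed

text \<open>Expansion of the determinant with one column different from the unit matrix.\<close>

lemma psi_delta_update:
  assumes "z \<in> {1..d}"
  shows "psi d id (delta(z := y)) = y z"
proof -
  have "psi d id (delta(z := y)) = (\<Sum>\<sigma>\<in>{id}. of_int (sign \<sigma>) * (y (id (\<sigma> z)) * (\<Prod>k\<in>{1..d} - {z}. delta k (id (\<sigma> k)))))"
    unfolding psi_def prod_update[OF assms]
  proof (rule sum.mono_neutral_right[OF finite_perms])
    show "{id} \<subseteq> {\<sigma>. \<sigma> permutes {1..d}}" by (simp add: permutes_id)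
    show "\<forall>\<sigma>\<in>{\<sigma>. \<sigma> permutes {1..d}} - {id}.
        of_int (sign \<sigma>) * (y (id (\<sigma> z)) * (\<Prod>k\<in>{1..d} - {z}. delta k (id (\<sigma> k)))) = 0"
    proof
      fix \<sigma> assume s: "\<sigma> \<in> {\<sigma>. \<sigma> permutes {1..d}} - {id}"
      then have p: "\<sigma> permutes {1..d}" by simp
      have "\<exists>k\<in>{1..d} - {z}. \<sigma> k \<noteq> k"
      proof (rule ccontr)
        assume n: "\<not> ?thesis"
        have "\<sigma> z = z"
        proof (rule ccontr)
          assume "\<sigma> z \<noteq> z"
          moreover have "\<sigma> z \<in> {1..d}" using permutes_in_image[OF p] assms by blast
          ultimately have "\<sigma> (\<sigma> z) = \<sigma> z" using n by blast
          then show False using \<open>\<sigma> z \<noteq> z\<close> permutes_inj[OF p] by (metis injD)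
        qed
        then have "\<sigma> k = k" for k using n p by (cases "k \<in> {1..d}") (auto simp: permutes_def)
        then show False using s by auto
      qed
      then obtain k where k: "k \<in> {1..d} - {z}" "\<sigma> k \<noteq> k" by blast
      then have "delta k (id (\<sigma> k)) = 0" by (simp add: delta_def)
      with k(1) have "(\<Prod>k\<in>{1..d} - {z}. delta k (id (\<sigma> k))) = 0" by (intro prod_zero) auto
      then show "of_int (sign \<sigma>) * (y (id (\<sigma> z)) * (\<Prod>k\<in>{1..d} - {z}. delta k (id (\<sigma> k)))) = 0" by simp
    qed
  qed
  then show ?thesis by (simp add: delta_def sign_id)
qed

text \<open>Laplace expansion along the pairs of columns \<open>(k, 2 r + 2 - k)\<close>: the antisymmetrization over
  the transposition of a pair multiplies the determinant by \<open>2\<close>.\<close>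

lemma pair_laplace:
  fixes m :: "nat \<Rightarrow> vect" and x :: vect
  assumes N: "N = 2 * r + 1"
  shows "2 ^ r * psi N id (m(r + 1 := x)) =
    (\<Sum>\<sigma>\<in>{\<sigma>. \<sigma> permutes {1..N}}. of_int (sign \<sigma>) *
      ((\<Prod>k\<in>{1..r}. m k (\<sigma> k) * m (2 * r + 2 - k) (\<sigma> (2 * r + 2 - k)) - m k (\<sigma> (2 * r + 2 - k)) * m (2 * r + 2 - k) (\<sigma> k))
       * x (\<sigma> (r + 1))))"
proof -
  let ?q = "\<lambda>k. 2 * r + 2 - k"
  let ?A = "\<lambda>k \<sigma>. m k (\<sigma> k) * m (?q k) (\<sigma> (?q k)) - m k (\<sigma> (?q k)) * m (?q k) (\<sigma> k)"
  let ?D = "\<lambda>k \<sigma>. m k (\<sigma> k) * m (?q k) (\<sigma> (?q k))"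
  let ?P = "{\<sigma>. \<sigma> permutes {1..N}}"
  let ?T = "\<lambda>K \<sigma>. (\<Prod>k\<in>K. ?A k \<sigma>) * (\<Prod>k\<in>{1..r} - K. ?D k \<sigma>) * x (\<sigma> (r + 1))"
  have "(\<Sum>\<sigma>\<in>?P. of_int (sign \<sigma>) * ?T K \<sigma>) = 2 ^ card K * psi N id (m(r + 1 := x))" if "K \<subseteq> {1..r}" for K
  proof -
    have "finite K" using that finite_subset by blast
    then show ?thesis using that
    proof (induction K rule: finite_induct)
      case empty
      have "(\<Prod>k\<in>{1..r}. ?D k \<sigma>) * x (\<sigma> (r + 1)) = (\<Prod>i\<in>{1..N}. (m(r + 1 := x)) i (id (\<sigma> i)))" for \<sigma>
      proof -
        have split: "{1..N} - {r + 1} = {1..r} \<union> ?q ` {1..r}"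
        proof
          show "{1..N} - {r + 1} \<subseteq> {1..r} \<union> ?q ` {1..r}"
          proof
            fix k assume "k \<in> {1..N} - {r + 1}"
            then show "k \<in> {1..r} \<union> ?q ` {1..r}"
              by (cases "k \<le> r") (auto simp: N intro!: image_eqI[of _ _ "2 * r + 2 - k"])
          qed
        qed (auto simp: N)
        have inj: "inj_on ?q {1..r}" by (auto simp: inj_on_def)
        have dis: "{1..r} \<inter> ?q ` {1..r} = {}" by auto
        have "(\<Prod>i\<in>{1..N}. (m(r + 1 := x)) i (id (\<sigma> i))) = x (\<sigma> (r + 1)) * (\<Prod>k\<in>{1..N} - {r + 1}. m k (\<sigma> k))"
          using prod_update[of "r + 1" N m x \<sigma>] by (simp add: N)
        also have "(\<Prod>k\<in>{1..N} - {r + 1}. m k (\<sigma> k)) = (\<Prod>k\<in>{1..r}. m k (\<sigma> k)) * (\<Prod>k\<in>{1..r}. m (?q k) (\<sigma> (?q k)))"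
          unfolding split using prod.union_disjoint[OF _ _ dis, of "\<lambda>k. m k (\<sigma> k)"]
            prod.reindex[OF inj, of "\<lambda>k. m k (\<sigma> k)"] by (simp only: o_def finite_atLeastAtMost finite_imageI simp_thms)
        finally show ?thesis by (simp add: prod.distrib)
      qed
      then show ?case by (simp add: psi_def)
    next
      case (insert k K)
      let ?\<tau> = "Transposition.transpose k (?q k)"
      have k: "k \<in> {1..r}" using insert by simp
      then have t: "?\<tau> permutes {1..N}" by (intro permutes_swap_id) (auto simp: N)
      let ?R = "\<lambda>\<sigma>. (\<Prod>j\<in>K. ?A j \<sigma>) * (\<Prod>j\<in>{1..r} - insert k K. ?D j \<sigma>) * x (\<sigma> (r + 1))"
      have R: "?R (\<sigma> \<circ> ?\<tau>) = ?R \<sigma>" for \<sigma>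
      proof -
        have e: "?\<tau> j = j" "?\<tau> (?q j) = ?q j" if "j \<in> {1..r}" "j \<noteq> k" for j
          using that k by (auto simp: Transposition.transpose_def)
        have z: "?\<tau> (r + 1) = r + 1" using k by (auto simp: Transposition.transpose_def)
        have "(\<Prod>j\<in>K. ?A j (\<sigma> \<circ> ?\<tau>)) = (\<Prod>j\<in>K. ?A j \<sigma>)"
        proof (intro prod.cong refl)
          fix j assume "j \<in> K"
          then have "j \<in> {1..r}" "j \<noteq> k" using insert by auto
          from e[OF this] show "?A j (\<sigma> \<circ> ?\<tau>) = ?A j \<sigma>" by (simp only: o_apply)
        qed
        moreover have "(\<Prod>j\<in>{1..r} - insert k K. ?D j (\<sigma> \<circ> ?\<tau>)) = (\<Prod>j\<in>{1..r} - insert k K. ?D j \<sigma>)"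
        proof (intro prod.cong refl)
          fix j assume "j \<in> {1..r} - insert k K"
          then have "j \<in> {1..r}" "j \<noteq> k" by auto
          from e[OF this] show "?D j (\<sigma> \<circ> ?\<tau>) = ?D j \<sigma>" by (simp only: o_apply)
        qed
        ultimately show ?thesis by (simp only: o_apply z)
      qed
      have T1: "?T (insert k K) \<sigma> = ?D k \<sigma> * ?R \<sigma> - m k (\<sigma> (?q k)) * m (?q k) (\<sigma> k) * ?R \<sigma>" for \<sigma>
        using insert.hyps by (simp add: algebra_simps)
      have T2: "?T K \<sigma> = ?D k \<sigma> * ?R \<sigma>" for \<sigma>
      proof -
        have e: "{1..r} - K = insert k ({1..r} - insert k K)" using insert.hyps k by auto
        have "(\<Prod>j\<in>insert k ({1..r} - insert k K). ?D j \<sigma>) = ?D k \<sigma> * (\<Prod>j\<in>{1..r} - insert k K. ?D j \<sigma>)"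
          by (rule prod.insert) auto
        then have "(\<Prod>j\<in>{1..r} - K. ?D j \<sigma>) = ?D k \<sigma> * (\<Prod>j\<in>{1..r} - insert k K. ?D j \<sigma>)"
          unfolding e .
        then show ?thesis by (simp only: mult_ac)
      qed
      have tt: "\<sigma> \<circ> ?\<tau> \<circ> ?\<tau> = \<sigma>" for \<sigma> :: "nat \<Rightarrow> nat" by (simp add: comp_assoc)
      have tp: "\<sigma> \<circ> ?\<tau> \<in> ?P" if "\<sigma> \<in> ?P" for \<sigma>
        using that permutes_compose[OF t, of \<sigma>] by blast
      have "(\<Sum>\<sigma>\<in>?P. of_int (sign \<sigma>) * (m k (\<sigma> (?q k)) * m (?q k) (\<sigma> k) * ?R \<sigma>)) =
          (\<Sum>\<sigma>\<in>?P. of_int (sign (\<sigma> \<circ> ?\<tau>)) * (m k ((\<sigma> \<circ> ?\<tau>) (?q k)) * m (?q k) ((\<sigma> \<circ> ?\<tau>) k) * ?R (\<sigma> \<circ> ?\<tau>)))"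
        by (rule sum.reindex_bij_witness[of _ "\<lambda>\<sigma>. \<sigma> \<circ> ?\<tau>" "\<lambda>\<sigma>. \<sigma> \<circ> ?\<tau>"])
          (simp_all only: tt tp)
      also have "\<dots> = (\<Sum>\<sigma>\<in>?P. - (of_int (sign \<sigma>) * ?T K \<sigma>))"
      proof (intro sum.cong refl)
        fix \<sigma> assume "\<sigma> \<in> ?P"
        then have p: "permutation \<sigma>" using permutation_permutes by auto
        have "k \<noteq> ?q k" using k by auto
        then have "sign (\<sigma> \<circ> ?\<tau>) = - sign \<sigma>"
          using sign_compose[OF p permutation_swap_id[of k "?q k"]] by (simp add: sign_swap_id)
        then show "of_int (sign (\<sigma> \<circ> ?\<tau>)) * (m k ((\<sigma> \<circ> ?\<tau>) (?q k)) * m (?q k) ((\<sigma> \<circ> ?\<tau>) k) * ?R (\<sigma> \<circ> ?\<tau>)) =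
            - (of_int (sign \<sigma>) * ?T K \<sigma>)"
          unfolding R T2 by (simp only: o_apply transpose_apply_first transpose_apply_second) simp
      qed
      finally have swap: "(\<Sum>\<sigma>\<in>?P. of_int (sign \<sigma>) * (m k (\<sigma> (?q k)) * m (?q k) (\<sigma> k) * ?R \<sigma>)) =
          - (\<Sum>\<sigma>\<in>?P. of_int (sign \<sigma>) * ?T K \<sigma>)" by (simp only: sum_negf)
      have "(\<Sum>\<sigma>\<in>?P. of_int (sign \<sigma>) * ?T (insert k K) \<sigma>) = 2 * (\<Sum>\<sigma>\<in>?P. of_int (sign \<sigma>) * ?T K \<sigma>)"
        unfolding T1 right_diff_distrib sum_subtractf swap T2 by simp
      also have "(\<Sum>\<sigma>\<in>?P. of_int (sign \<sigma>) * ?T K \<sigma>) = 2 ^ card K * psi N id (m(r + 1 := x))"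
        by (rule insert.IH) (use insert.prems in simp)
      also have "2 * (2 ^ card K * psi N id (m(r + 1 := x))) = 2 ^ card (insert k K) * psi N id (m(r + 1 := x))"
        unfolding card_insert_disjoint[OF insert.hyps] power_Suc mult.assoc ..
      finally show ?case .
    qed
  qed
  from this[of "{1..r}"] show ?thesis by simp
qed

section \<open>Regularity of the matrix coefficients\<close>

lemma uexp_linear: "olin N A \<Longrightarrow> uexp A t (\<lambda>k. x k + c * y k) = (\<lambda>k. uexp A t x k + c * uexp A t y k)"
proof -
  assume A: "olin N A"
  have A2: "A (\<lambda>k. u k + c * v k) = (\<lambda>k. A u k + c * A v k)" for u v
    using olin_add[OF A, of u "\<lambda>k. c * v k"] olin_scale[OF A, of c v] by simp
  show ?thesis unfolding uexp_def A2 by (simp add: algebra_simps)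
qed

lemma vop_linear: "g \<in> all_gens r \<Longrightarrow> vop r g (\<lambda>k. x k + c * y k) = (\<lambda>k. vop r g x k + c * vop r g y k)"
  using uexp_linear[OF olin_opE] uexp_linear[OF olin_opF]
  by (cases g) (simp_all add: all_gens_def algebra_simps)

lemma vw_linear: "set w \<subseteq> all_gens r \<Longrightarrow> vw r w (\<lambda>k. x k + c * y k) = (\<lambda>k. vw r w x k + c * vw r w y k)"
  by (induction w) (simp_all add: vop_linear)

text \<open>The invariant bilinear form, which pairs the positions \<open>p\<close> and \<open>2 r + 2 - p\<close>.\<close>

definition form_coeff :: "nat \<Rightarrow> nat \<Rightarrow> complex" where
  "form_coeff r p = (if p = r + 1 then 2 else 1) * (- 1) ^ p"

definition form :: "nat \<Rightarrow> vect \<Rightarrow> vect \<Rightarrow> complex" where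
  "form r x y = (\<Sum>p\<in>{1..2 * r + 1}. form_coeff r p * x p * y (2 * r + 2 - p))"

lemma form_reverse: "form r x y = form r y x"
  unfolding form_def
proof (rule sum.reindex_bij_witness[of _ "\<lambda>p. 2 * r + 2 - p" "\<lambda>p. 2 * r + 2 - p"])
  fix p assume p: "p \<in> {1..2 * r + 1}"
  define q where "q = 2 * r + 2 - p"
  have q: "p + q = 2 * (r + 1)" using p by (auto simp: q_def)
  then have "even p = even q" by presburger
  then have "(- 1 :: complex) ^ p = (- 1) ^ q" by (simp add: minus_one_power_iff)
  moreover have "p = r + 1 \<longleftrightarrow> q = r + 1" "2 * r + 2 - q = p" using q by auto
  ultimately show "form_coeff r (2 * r + 2 - p) * y (2 * r + 2 - p) * x (2 * r + 2 - (2 * r + 2 - p)) =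
      form_coeff r p * x p * y (2 * r + 2 - p)"
    unfolding q_def[symmetric] by (simp add: form_coeff_def)
qed auto

lemma form_linear: "form r x (\<lambda>k. y k + c * z k) = form r x y + c * form r x z"
  by (simp add: form_def algebra_simps sum.distrib sum_distrib_left)

lemma form_linear_left: "form r (\<lambda>k. y k + c * z k) x = form r y x + c * form r z x"
  unfolding form_reverse[of r _ x] by (rule form_linear)

lemma form_delta: "p \<in> {1..2 * r + 1} \<Longrightarrow> form r (delta p) y = form_coeff r p * y (2 * r + 2 - p)"
proof -
  assume p: "p \<in> {1..2 * r + 1}"
  have "form r (delta p) y = (\<Sum>q\<in>{1..2 * r + 1}. if q = p then form_coeff r q * y (2 * r + 2 - q) else 0)"
    unfolding form_def by (intro sum.cong refl) (auto simp: delta_def)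
  then show ?thesis using p by simp
qed

lemma form_skew_E:
  assumes i: "i \<in> {1..r}"
  shows "form r (opE r i x) y = - form r x (opE r i y)"
proof -
  define q where "q = 2 * r + 1 - i"
  have q: "2 * r + 1 - i = q" "2 * r + 2 - i = q + 1" "q \<noteq> i" "i + q = 2 * r + 1" "q \<in> {1..2 * r}" using i by (auto simp: q_def)
  have Ex: "opE r i x = (\<lambda>k. mult_B r i * x (i + 1) * delta i k + x (q + 1) * delta q k)" for x
    unfolding opE_def[abs_def] q delta_def using q(3) by (auto simp: fun_eq_iff)
  have E: "form r (opE r i x) y = mult_B r i * x (i + 1) * (form_coeff r i * y (q + 1)) + x (q + 1) * (form_coeff r q * y (i + 1))" for x y
  proof -
    have "2 * r + 2 - q = i + 1" using q(4) i by auto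
    moreover have "form r (opE r i x) y = mult_B r i * x (i + 1) * form r (delta i) y + x (q + 1) * form r (delta q) y"
      using form_linear_left[of r "\<lambda>k. 0 + mult_B r i * x (i + 1) * delta i k" "x (q + 1)" "delta q" y]
        form_linear_left[of r "\<lambda>_. 0" "mult_B r i * x (i + 1)" "delta i" y]
      unfolding Ex by (simp add: form_def)
    ultimately show ?thesis using form_delta[of i r y] form_delta[of q r y] i q by simp
  qed
  have "form_coeff r q = - mult_B r i * form_coeff r i"
  proof -
    have "even q \<longleftrightarrow> odd i" using q(4) by presburger
    then have "(- 1 :: complex) ^ q = - ((- 1) ^ i)" by (simp add: minus_one_power_iff)
    moreover have "q = r + 1 \<longleftrightarrow> i = r" "i \<noteq> r + 1" using q(4) i by auto
    ultimately show ?thesis by (simp add: form_coeff_def mult_B_def)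
  qed
  then show ?thesis unfolding form_reverse[of r x] E by (simp add: algebra_simps)
qed

lemma form_skew_F:
  assumes i: "i \<in> {1..r}"
  shows "form r (opF r i x) y = - form r x (opF r i y)"
proof -
  define q where "q = 2 * r + 1 - i"
  have q: "2 * r + 1 - i = q" "2 * r + 2 - i = q + 1" "q \<noteq> i" "i + q = 2 * r + 1" "q \<in> {1..2 * r}" using i by (auto simp: q_def)
  have Ex: "opF r i x = (\<lambda>k. x i * delta (i + 1) k + mult_B r i * x q * delta (q + 1) k)" for x
    unfolding opF_def[abs_def] q delta_def using q(3) by (auto simp: fun_eq_iff)
  have E: "form r (opF r i x) y = x i * (form_coeff r (i + 1) * y q) + mult_B r i * x q * (form_coeff r (q + 1) * y i)" for x y
  proof -
    have e: "2 * r + 2 - (i + 1) = q" "2 * r + 2 - (q + 1) = i" using q(4) i by auto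
    have "form r (opF r i x) y = x i * form r (delta (i + 1)) y + mult_B r i * x q * form r (delta (q + 1)) y"
      using form_linear_left[of r "\<lambda>k. 0 + x i * delta (i + 1) k" "mult_B r i * x q" "delta (q + 1)" y]
        form_linear_left[of r "\<lambda>_. 0" "x i" "delta (i + 1)" y]
      unfolding Ex by (simp add: form_def)
    then show ?thesis using form_delta[of "i + 1" r y] form_delta[of "q + 1" r y] i q(5) unfolding e by simp
  qed
  have "form_coeff r (i + 1) = - mult_B r i * form_coeff r (q + 1)"
  proof -
    have "even q \<longleftrightarrow> odd i" using q(4) by presburger
    then have "(- 1 :: complex) ^ (i + 1) = - ((- 1) ^ (q + 1))" by (simp add: minus_one_power_iff)
    moreover have "q + 1 \<noteq> r + 1" "i + 1 = r + 1 \<longleftrightarrow> i = r" using q(4) i by auto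
    ultimately show ?thesis by (simp add: form_coeff_def mult_B_def)
  qed
  then show ?thesis unfolding form_reverse[of r x] E by (simp add: algebra_simps)
qed

text \<open>The exponential of a skew operator is orthogonal; the series ends after the quadratic term.\<close>

lemma form_uexp:
  assumes "\<And>x y. form r (A x) y = - form r x (A y)"
  shows "form r (uexp A t x) y = form r x (uexp A (- t) y)"
  unfolding uexp_def form_linear form_linear_left assms by simp

lemma weight_reverse:
  assumes "i \<in> {1..r}" "p \<in> {1..2 * r + 1}"
  shows "weight r i (2 * r + 2 - p) = - weight r i p"
proof -
  define q p' where "q = 2 * r + 1 - i" and "p' = 2 * r + 2 - p"
  have q: "2 * r + 1 - i = q" "2 * r + 2 - i = q + 1" "i + q = 2 * r + 1" using assms by (auto simp: q_def)
  have p: "2 * r + 2 - p = p'" "p + p' = 2 * r + 2" using assms by (auto simp: p'_def)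
  have "p' = i \<longleftrightarrow> p = q + 1" "p' = i + 1 \<longleftrightarrow> p = q" "p' = q \<longleftrightarrow> p = i + 1" "p' = q + 1 \<longleftrightarrow> p = i"
    using q(3) p(2) by auto
  then show ?thesis unfolding weight_def p q by simp
qed

lemma form_vop:
  assumes "g \<in> all_gens r"
  shows "form r (vop r g x) y = form r x (vop r (gen_inverse g) y)"
proof (cases g)
  case (GE i t)
  then show ?thesis using assms form_uexp[OF form_skew_E] by (simp add: all_gens_def)
next
  case (GF i t)
  then show ?thesis using assms form_uexp[OF form_skew_F] by (simp add: all_gens_def)
next
  case (GH i t)
  then have i: "i \<in> {1..r}" using assms by (simp add: all_gens_def)
  show ?thesis unfolding GH form_def
  proof (intro sum.cong refl)
    fix p assume "p \<in> {1..2 * r + 1}"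
    from weight_reverse[OF i this]
    show "form_coeff r p * vop r (GH i t) x p * y (2 * r + 2 - p) =
        form_coeff r p * x p * vop r (gen_inverse (GH i t)) y (2 * r + 2 - p)" by simp
  qed
qed

context chevalley_matrices
begin

lemma form_vw: "set w \<subseteq> all_gens r \<Longrightarrow> form r (vw r w x) y = form r x (vw r (winv w) y)"
proof (induction w arbitrary: y)
  case (Cons g w)
  then show ?case by (simp add: form_vop winv_Cons vw_append)
qed (simp add: winv_def)

end

text \<open>Elements of the group act with determinant \<open>1\<close>: the unipotent factors by row
  operations, the torus because the weights of the vector representation add up to zero.\<close>

lemma psi_vop:
  assumes "g \<in> all_gens r"
  shows "psi (2 * r + 1) id (\<lambda>i. vop r g (u i)) = psi (2 * r + 1) id u"
proof -
  let ?N = "2 * r + 1"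
  have op: "psi ?N id (\<lambda>i. rowop b t a (u i)) = psi ?N id u" if "a \<in> {1..?N}" "b \<in> {1..?N}" "a \<noteq> b" for a b t u
    using that by (rule psi_rowop)
  show ?thesis
  proof (cases g)
    case (GE i t)
    then have i: "i \<in> {1..r}" using assms by (simp add: all_gens_def)
    define q where "q = 2 * r + 1 - i"
    have q: "2 * r + 1 - i = q" "2 * r + 2 - i = q + 1" "q \<noteq> i" "q + 1 \<noteq> i" "i + q = 2 * r + 1" using i by (auto simp: q_def)
    show ?thesis
    proof (cases "i = r")
      case False
      have "uexp (opE r i) t x = rowop q t (q + 1) (rowop i t (i + 1) x)" for x
        unfolding uexp_def opE_def[abs_def] q rowop_def mult_B_def using q False i
        by (auto simp: fun_eq_iff)
      then have "psi ?N id (\<lambda>j. vop r g (u j)) = psi ?N id (\<lambda>j. (rowop q t (q + 1) (rowop i t (i + 1) (u j))))" by (simp only: GE vop.simps)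
      also have "\<dots> = psi ?N id (\<lambda>j. (rowop i t (i + 1) (u j)))" by (rule op) (use i q in auto)
      also have "\<dots> = psi ?N id (\<lambda>j. (u j))" by (rule op) (use i q in auto)
      finally show ?thesis .
    next
      case True
      then have q': "q = r + 1" using q by auto
      have "uexp (opE r i) t x = rowop (r + 1) t (r + 2) (rowop r (t ^ 2) (r + 2) (rowop r (2 * t) (r + 1) x))" for x
        unfolding uexp_def opE_def[abs_def] q rowop_def mult_B_def using True
        by (auto simp: fun_eq_iff q')
      then have "psi ?N id (\<lambda>j. vop r g (u j)) = psi ?N id (\<lambda>j. (rowop (r + 1) t (r + 2) (rowop r (t ^ 2) (r + 2) (rowop r (2 * t) (r + 1) (u j)))))" by (simp only: GE vop.simps)
      also have "\<dots> = psi ?N id (\<lambda>j. (rowop r (t ^ 2) (r + 2) (rowop r (2 * t) (r + 1) (u j))))" by (rule op) (use i q in auto)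
      also have "\<dots> = psi ?N id (\<lambda>j. (rowop r (2 * t) (r + 1) (u j)))" by (rule op) (use i q in auto)
      also have "\<dots> = psi ?N id (\<lambda>j. (u j))" by (rule op) (use i q in auto)
      finally show ?thesis .
    qed
  next
    case (GF i t)
    then have i: "i \<in> {1..r}" using assms by (simp add: all_gens_def)
    define q where "q = 2 * r + 1 - i"
    have q: "2 * r + 1 - i = q" "2 * r + 2 - i = q + 1" "q \<noteq> i" "q + 1 \<noteq> i" "i + q = 2 * r + 1" using i by (auto simp: q_def)
    show ?thesis
    proof (cases "i = r")
      case False
      have "uexp (opF r i) t x = rowop (q + 1) t q (rowop (i + 1) t i x)" for x
        unfolding uexp_def opF_def[abs_def] q rowop_def mult_B_def using q False i
        by (auto simp: fun_eq_iff)
      then have "psi ?N id (\<lambda>j. vop r g (u j)) = psi ?N id (\<lambda>j. (rowop (q + 1) t q (rowop (i + 1) t i (u j))))" by (simp only: GF vop.simps)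
      also have "\<dots> = psi ?N id (\<lambda>j. (rowop (i + 1) t i (u j)))" by (rule op) (use i q in auto)
      also have "\<dots> = psi ?N id (\<lambda>j. (u j))" by (rule op) (use i q in auto)
      finally show ?thesis .
    next
      case True
      then have q': "q = r + 1" using q by auto
      have "uexp (opF r i) t x = rowop (r + 1) t r (rowop (r + 2) (t ^ 2) r (rowop (r + 2) (2 * t) (r + 1) x))" for x
        unfolding uexp_def opF_def[abs_def] q rowop_def mult_B_def using True
        by (auto simp: fun_eq_iff q')
      then have "psi ?N id (\<lambda>j. vop r g (u j)) = psi ?N id (\<lambda>j. (rowop (r + 1) t r (rowop (r + 2) (t ^ 2) r (rowop (r + 2) (2 * t) (r + 1) (u j)))))" by (simp only: GF vop.simps)
      also have "\<dots> = psi ?N id (\<lambda>j. (rowop (r + 2) (t ^ 2) r (rowop (r + 2) (2 * t) (r + 1) (u j))))" by (rule op) (use i q in auto)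
      also have "\<dots> = psi ?N id (\<lambda>j. (rowop (r + 2) (2 * t) (r + 1) (u j)))" by (rule op) (use i q in auto)
      also have "\<dots> = psi ?N id (\<lambda>j. (u j))" by (rule op) (use i q in auto)
      finally show ?thesis .
    qed
  next
    case (GH i t)
    then have i: "i \<in> {1..r}" using assms by (simp add: all_gens_def)
    define q where "q = 2 * r + 1 - i"
    have q: "2 * r + 1 - i = q" "2 * r + 2 - i = q + 1" using i by (auto simp: q_def)
    have mem: "i \<in> {1..?N}" "i + 1 \<in> {1..?N}" "q \<in> {1..?N}" "q + 1 \<in> {1..?N}" using i by (auto simp: q_def)
    have "(\<Sum>k\<in>{1..?N}. weight r i k) = 0"
      unfolding weight_def q sum_distrib_left[symmetric] sum.distrib sum_subtractf
      by (simp only: sum.delta finite_atLeastAtMost mem if_True) simp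
    then have "(\<Prod>k\<in>{1..?N}. exp (t * weight r i k)) = 1"
      by (simp only: exp_sum[OF finite_atLeastAtMost, symmetric] sum_distrib_left[symmetric] mult_zero_right exp_zero)
    then show ?thesis using GH psi_row_scale[of ?N "\<lambda>k. exp (t * weight r i k)" u] by simp
  qed
qed

lemma psi_vw: "set w \<subseteq> all_gens r \<Longrightarrow> psi (2 * r + 1) id (\<lambda>i. vw r w (u i)) = psi (2 * r + 1) id u"
proof (induction w)
  case (Cons g w)
  have "psi (2 * r + 1) id (\<lambda>i. vw r (g # w) (u i)) = psi (2 * r + 1) id (\<lambda>i. vw r w (u i))"
    using psi_vop[of g r "\<lambda>i. vw r w (u i)"] Cons.prems by (simp only: vw.simps set_simps insert_subset)
  also have "\<dots> = psi (2 * r + 1) id u" by (rule Cons.IH) (use Cons.prems in simp)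
  finally show ?case .
qed simp

context chevalley_group
begin

text \<open>The element of the Cartan subalgebra with eigenvalues \<open>1\<close> and \<open>-1\<close> at
  the dual positions \<open>k\<close> and \<open>2 r + 2 - k\<close>.\<close>

definition opeps :: "nat \<Rightarrow> vect \<Rightarrow> vect" where
  "opeps k x = (\<lambda>p. (if p = k then x p else 0) - (if p = 2 * r + 2 - k then x p else 0))"

text \<open>The coroot \<open>h\<^sub>k\<close> is the difference of two consecutive such elements, and
  \<open>h\<^sub>r\<close> is twice the last one.\<close>

lemma regular_word_conj_eps:
  assumes "k \<in> {1..r}"
  shows "regular_word (\<lambda>w. vw r w (opeps k (vw r (winv w) x)) p)"
proof -
  have "1 \<le> k" "k \<le> r" using assms by auto
  from this(2,1) show ?thesis
  proof (induction k rule: inc_induct)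
    case base
    have r: "r \<in> {1..r}" using rank by simp
    have H: "opeps r y = (\<lambda>p. 0 + (1 / 2) * opH r r y p)" for y
    proof -
      have "2 * r + 1 - r = r + 1" "2 * r + 2 - r = r + 2" by simp_all
      then show ?thesis by (auto simp: opeps_def opH_def weight_def mult_B_def fun_eq_iff)
    qed
    have z: "vw r w (\<lambda>_. 0) = (\<lambda>_. 0)" if "set w \<subseteq> all_gens r" for w
      using vw_linear[OF that, of "\<lambda>_. 0" "- 1" "\<lambda>_. 0"] by (simp add: fun_eq_iff)
    have "regular_word (\<lambda>w. (1 / 2) * vw r w (opH r r (vw r (winv w) x)) p)"
      by (intro regular_word_mult regular_word_const regular_word_conj_H r)
    then show ?case
    proof (rule regular_word_cong)
      fix w assume w: "set w \<subseteq> all_gens r"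
      show "vw r w (opeps r (vw r (winv w) x)) p = (1 / 2) * vw r w (opH r r (vw r (winv w) x)) p"
        unfolding H[of "vw r (winv w) x"] vw_linear[OF w, of "\<lambda>_. 0"] z[OF w] by simp
    qed
  next
    case (step k)
    have k: "k \<in> {1..r}" using step by simp
    have H: "opeps k y = (\<lambda>p. opH r k y p + 1 * opeps (Suc k) y p)" for y
    proof -
      define q where "q = 2 * r + 1 - k"
      have q: "2 * r + 1 - k = q" "2 * r + 2 - k = q + 1" "2 * r + 2 - Suc k = q" "k + 1 \<noteq> q"
        using step(1,2) by (auto simp: q_def)
      show ?thesis unfolding opeps_def opH_def weight_def mult_B_def q using step(2) q(4)
        by (auto simp: fun_eq_iff)
    qed
    have "regular_word (\<lambda>w. vw r w (opH r k (vw r (winv w) x)) p + vw r w (opeps (Suc k) (vw r (winv w) x)) p)"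
      using step by (intro regular_word_add regular_word_conj_H k) simp
    then show ?case
    proof (rule regular_word_cong)
      fix w assume "set w \<subseteq> all_gens r"
      then show "vw r w (opeps k (vw r (winv w) x)) p =
          vw r w (opH r k (vw r (winv w) x)) p + vw r w (opeps (Suc k) (vw r (winv w) x)) p"
        unfolding H[of "vw r (winv w) x"] by (simp only: vw_linear) simp
    qed
  qed
qed

lemma form_coeff_nonzero: "form_coeff r p \<noteq> 0"
  by (simp add: form_coeff_def)

lemma vw_inverse_coefficient:
  assumes "set w \<subseteq> all_gens r" "p \<in> {1..2 * r + 1}"
  shows "form_coeff r p * vw r (winv w) x (2 * r + 2 - p) = form r (vw r w (delta p)) x"
  using form_vw[OF assms(1), of "delta p" x] form_delta[OF assms(2), of "vw r (winv w) x"] by simp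

text \<open>The \<open>2 \<times> 2\<close> minors in the columns \<open>k\<close> and \<open>2 r + 2 - k\<close> are matrix coefficients of the adjoint
  representation.\<close>

lemma regular_word_pair_minor:
  assumes k: "k \<in> {1..r}" and ab: "a \<in> {1..2 * r + 1}" "b \<in> {1..2 * r + 1}"
  shows "regular_word (\<lambda>w. vw r w (delta k) a * vw r w (delta (2 * r + 2 - k)) b -
    vw r w (delta k) b * vw r w (delta (2 * r + 2 - k)) a)"
proof -
  define q where "q = 2 * r + 2 - k"
  define b' where "b' = 2 * r + 2 - b"
  have q: "2 * r + 2 - k = q" "2 * r + 2 - q = k" "q \<in> {1..2 * r + 1}" "k \<in> {1..2 * r + 1}" "q \<noteq> k"
    using k by (auto simp: q_def)
  have b': "2 * r + 2 - b' = b" "b' \<in> {1..2 * r + 1}" using ab(2) by (auto simp: b'_def)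
  have sq: "form_coeff r q = form_coeff r k"
  proof -
    have "k + q = 2 * (r + 1)" using k by (auto simp: q_def)
    then have "even k = even q" by presburger
    then have "(- 1 :: complex) ^ k = (- 1) ^ q" by (simp add: minus_one_power_iff)
    then show ?thesis using k by (auto simp: form_coeff_def q_def)
  qed
  let ?s = "form_coeff r k" and ?sb = "form_coeff r b'"
  have "regular_word (\<lambda>w. (?s / ?sb) * vw r w (opeps k (vw r (winv w) (delta b'))) a)"
    by (intro regular_word_mult regular_word_const regular_word_conj_eps k)
  then show ?thesis
  proof (rule regular_word_cong)
    fix w assume w: "set w \<subseteq> all_gens r"
    let ?y = "vw r (winv w) (delta b')"
    have y: "?s * ?y k = ?sb * vw r w (delta q) b" "?s * ?y q = ?sb * vw r w (delta k) b"
      using vw_inverse_coefficient[OF w q(3), of "delta b'"] vw_inverse_coefficient[OF w q(4), of "delta b'"]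
        form_delta[OF b'(2)] form_reverse[of r _ "delta b'"] unfolding q sq b' by simp_all
    have "opeps k ?y = (\<lambda>p. (0 + ?y k * delta k p) + (- ?y q) * delta q p)"
      unfolding opeps_def q delta_def using q(5) by (auto simp: fun_eq_iff)
    then have "vw r w (opeps k ?y) a = vw r w (\<lambda>p. 0 + ?y k * delta k p) a - ?y q * vw r w (delta q) a"
      using vw_linear[OF w, of "\<lambda>p. 0 + ?y k * delta k p" "- ?y q" "delta q"] by simp
    also have "vw r w (\<lambda>p. 0 + ?y k * delta k p) a = vw r w (\<lambda>_. 0) a + ?y k * vw r w (delta k) a"
      unfolding vw_linear[OF w, of "\<lambda>_. 0"] ..
    also have "vw r w (\<lambda>_. 0) a = 0"
      using vw_linear[OF w, of "\<lambda>_. 0" "- 1" "\<lambda>_. 0"] by (simp add: fun_eq_iff)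
    finally have f: "vw r w (opeps k ?y) a = 0 + ?y k * vw r w (delta k) a - ?y q * vw r w (delta q) a" .
    have "?s * vw r w (opeps k ?y) a =
        (?s * ?y k) * vw r w (delta k) a - (?s * ?y q) * vw r w (delta q) a" unfolding f by (simp add: algebra_simps)
    also have "\<dots> = ?sb * (vw r w (delta k) a * vw r w (delta q) b - vw r w (delta k) b * vw r w (delta q) a)"
      unfolding y by (simp add: algebra_simps)
    finally show "vw r w (delta k) a * vw r w (delta (2 * r + 2 - k)) b -
        vw r w (delta k) b * vw r w (delta (2 * r + 2 - k)) a = (?s / ?sb) * vw r w (opeps k ?y) a"
      unfolding q using form_coeff_nonzero[of b'] by (simp add: field_simps)
  qed
qed

text \<open>The entries of the central row of the inverse are, by Cramer's rule, determinants with the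
  central column replaced; in the Laplace expansion along pairs of dual columns the remaining factors are
  the regular pair minors.\<close>

lemma regular_word_inverse_center: "regular_word (\<lambda>w. vw r (winv w) x (r + 1))"
proof -
  let ?N = "2 * r + 1" and ?q = "\<lambda>k. 2 * r + 2 - k"
  let ?S = "\<lambda>w. \<Sum>\<sigma>\<in>{\<sigma>. \<sigma> permutes {1..?N}}. of_int (sign \<sigma>) *
      ((\<Prod>k\<in>{1..r}. vw r w (delta k) (\<sigma> k) * vw r w (delta (?q k)) (\<sigma> (?q k)) -
         vw r w (delta k) (\<sigma> (?q k)) * vw r w (delta (?q k)) (\<sigma> k)) * x (\<sigma> (r + 1)))"
  have "regular_word ?S"
  proof (intro regular_word_sum regular_word_mult regular_word_const regular_word_prod regular_word_pair_minor)
    fix \<sigma> k assume s: "\<sigma> \<in> {\<sigma>. \<sigma> permutes {1..?N}}" and k: "k \<in> {1..r}"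
    have "k \<in> {1..?N}" "?q k \<in> {1..?N}" using k by auto
    then show "\<sigma> k \<in> {1..?N}" "\<sigma> (?q k) \<in> {1..?N}" 
      using s permutes_in_image[of \<sigma> "{1..?N}" k] permutes_in_image[of \<sigma> "{1..?N}" "?q k"] by blast+
  qed
  then have "regular_word (\<lambda>w. (1 / 2 ^ r) * ?S w)" by (intro regular_word_mult regular_word_const)
  then show ?thesis
  proof (rule regular_word_cong)
    fix w assume w: "set w \<subseteq> all_gens r"
    let ?y = "vw r (winv w) x" and ?m = "\<lambda>p. vw r w (delta p)"
    have "?y (r + 1) = psi ?N id (delta(r + 1 := ?y))" by (rule psi_delta_update[symmetric]) simp
    also have "\<dots> = psi ?N id (\<lambda>i. vw r w ((delta(r + 1 := ?y)) i))" by (rule psi_vw[OF w, symmetric])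
    also have "(\<lambda>i. vw r w ((delta(r + 1 := ?y)) i)) = ?m(r + 1 := x)"
      using vw_winv[OF w] by (auto simp: fun_eq_iff)
    finally have "2 ^ r * ?y (r + 1) = 2 ^ r * psi ?N id (?m(r + 1 := x))" by (rule arg_cong)
    also have "\<dots> = ?S w" by (rule pair_laplace[OF refl])
    finally show "?y (r + 1) = (1 / 2 ^ r) * ?S w" by (simp add: field_simps)
  qed
qed

text \<open>The invariant form turns the central row of the inverse into the central column.\<close>

lemma regular_word_center_column:
  assumes a: "a \<in> {1..2 * r + 1}"
  shows "regular_word (\<lambda>w. vw r w (delta (r + 1)) a)"
proof -
  define a' where "a' = 2 * r + 2 - a"
  have a': "2 * r + 2 - a' = a" "a' \<in> {1..2 * r + 1}" using a by (auto simp: a'_def)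
  have z: "r + 1 \<in> {1..2 * r + 1}" "2 * r + 2 - (r + 1) = r + 1" by auto
  have "regular_word (\<lambda>w. (form_coeff r (r + 1) / form_coeff r a') * vw r (winv w) (delta a') (r + 1))"
    by (intro regular_word_mult regular_word_const regular_word_inverse_center)
  then show ?thesis
  proof (rule regular_word_cong)
    fix w assume w: "set w \<subseteq> all_gens r"
    have "form_coeff r (r + 1) * vw r (winv w) (delta a') (r + 1) = form_coeff r a' * vw r w (delta (r + 1)) a"
      using vw_inverse_coefficient[OF w z(1), of "delta a'"] form_delta[OF a'(2)] form_reverse[of r _ "delta a'"]
      unfolding z(2) a' by simp
    then show "vw r w (delta (r + 1)) a = (form_coeff r (r + 1) / form_coeff r a') * vw r (winv w) (delta a') (r + 1)"
      using form_coeff_nonzero[of a'] by (simp add: field_simps)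
  qed
qed

text \<open>Right translation by simple root elements carries the central column to the others.\<close>

lemma regular_word_column:
  assumes a: "a \<in> {1..2 * r + 1}" and p: "p \<in> {1..r}"
  shows "regular_word (\<lambda>w. vw r w (delta p) a)"
proof -
  have "1 \<le> p" "p \<le> r" using p by auto
  from this(2,1) show ?thesis
  proof (induction p rule: inc_induct)
    case base
    have g: "set [GE r 1] \<subseteq> all_gens r" using rank by (simp add: all_gens_def)
    have "vop r (GE r 1) (delta (r + 1)) = (\<lambda>k. delta (r + 1) k + 2 * delta r k)"
    proof -
      have "2 * r + 1 - r = r + 1" "2 * r + 2 - r = r + 2" by simp_all
      then show ?thesis by (auto simp: uexp_def opE_def delta_def mult_B_def fun_eq_iff)
    qed
    then have e: "vw r (w @ [GE r 1]) (delta (r + 1)) a = vw r w (delta (r + 1)) a + 2 * vw r w (delta r) a"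
      if "set w \<subseteq> all_gens r" for w using vw_linear[OF that] by (simp add: vw_append)
    have "regular_word (\<lambda>w. (1 / 2) * vw r (w @ [GE r 1]) (delta (r + 1)) a + (- 1 / 2) * vw r w (delta (r + 1)) a)"
      by (intro regular_word_add regular_word_mult regular_word_const
          regular_word_right[OF _ g, of "\<lambda>w. vw r w (delta (r + 1)) a"] regular_word_center_column a)
    then show ?case by (rule regular_word_cong) (simp only: e, simp add: field_simps)
  next
    case (step p)
    have g: "set [GE p 1] \<subseteq> all_gens r" using step by (simp add: all_gens_def)
    have "vop r (GE p 1) (delta (Suc p)) = (\<lambda>k. delta (Suc p) k + 1 * delta p k)"
    proof -
      define q where "q = 2 * r + 1 - p"
      have q: "2 * r + 1 - p = q" "2 * r + 2 - p = q + 1" "q > p + 1" using step by (auto simp: q_def)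
      show ?thesis unfolding vop.simps uexp_def opE_def[abs_def] q delta_def mult_B_def using q(3) step(2)
        by (auto simp: fun_eq_iff)
    qed
    then have e: "vw r (w @ [GE p 1]) (delta (Suc p)) a = vw r w (delta (Suc p)) a + 1 * vw r w (delta p) a"
      if "set w \<subseteq> all_gens r" for w
      using vw_linear[OF that, of "delta (Suc p)" 1 "delta p"] by (simp add: vw_append)
    have R: "regular_word (\<lambda>w. vw r w (delta (Suc p)) a)" using step by simp
    have "regular_word (\<lambda>w. vw r (w @ [GE p 1]) (delta (Suc p)) a + (- 1) * vw r w (delta (Suc p)) a)"
      by (intro regular_word_add regular_word_mult regular_word_const
          regular_word_right[OF _ g, of "\<lambda>w. vw r w (delta (Suc p)) a"] R)
    then show ?case by (rule regular_word_cong) (simp only: e, simp)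
  qed
qed

text \<open>A minor is a polynomial in entries of the first \<open>r\<close> columns.\<close>

lemma regular_word_psi:
  assumes "d \<le> r" "\<And>i. i \<in> {1..d} \<Longrightarrow> I i \<in> {1..2 * r + 1}"
  shows "regular_word (\<lambda>w. psi d I (\<lambda>i. vw r w (delta i)))"
  unfolding psi_def
proof (intro regular_word_sum regular_word_mult regular_word_const regular_word_prod regular_word_column)
  fix \<sigma> i assume "\<sigma> \<in> {\<sigma>. \<sigma> permutes {1..d}}" "i \<in> {1..d}"
  then have "\<sigma> i \<in> {1..d}" using permutes_in_image[of \<sigma> "{1..d}" i] by blast
  then show "I (\<sigma> i) \<in> {1..2 * r + 1}" using assms(2) by blast
  show "i \<in> {1..r}" using \<open>i \<in> {1..d}\<close> assms(1) by auto
qed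

end

section \<open>Evaluation of generalized minors\<close>

definition lift_word :: "nat list \<Rightarrow> gen list" where
  "lift_word js = concat (map (\<lambda>i. [GE i (- 1), GF i 1, GE i (- 1)]) js)"

lemma lift_word_in: "set js \<subseteq> {1..r} \<Longrightarrow> set (lift_word js) \<subseteq> Egens r \<union> Fgens r"
  by (auto simp: lift_word_def Egens_def Fgens_def)

lemma one_param_expt: "one_param E i t = expt (E i) t"
  by (simp add: one_param_def expt_def)

lemma coroot_hom_expt: "coroot_hom h i t = expt (h i) (Ln t)"
  by (simp add: coroot_hom_def expt_def)

lemma inv_GL_expt: "inv\<^bsub>GL\<^esub> (expt X t) = expt X (- t)"
  by (rule group.inv_equality[OF group_GL]) (simp_all add: GL_def invertible_expt)

text \<open>On the first \<open>d < r\<close> rows, lower unitriangular factors act by row operations within these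
  rows, and the torus acts by the fundamental weight.\<close>

lemma psi_vop_F:
  assumes "d < r" "j \<in> {1..r}"
  shows "psi d id (\<lambda>i. vop r (GF j t) (u i)) = psi d id u"
proof (cases "j < d")
  case True
  have z: "2 * r + 2 - j > d" "j \<noteq> 2 * r + 2 - j" using assms True by auto
  have "vop r (GF j t) x k = rowop (j + 1) t j x k" if "k \<le> d" for x k
    using that z True by (auto simp: uexp_def opF_def rowop_def)
  then have "psi d id (\<lambda>i. vop r (GF j t) (u i)) = psi d id (\<lambda>i. rowop (j + 1) t j (u i))"
    by (intro psi_cong) simp
  also have "\<dots> = psi d id u" by (rule psi_rowop) (use True assms in auto)
  finally show ?thesis .
next
  case False
  have z: "2 * r + 2 - j > d" "d < j + 1" using assms False by auto
  have "vop r (GF j t) x k = x k" if "k \<le> d" for x k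
    using that z by (auto simp: uexp_def opF_def)
  then show ?thesis by (intro psi_cong) simp
qed

lemma psi_vw_F:
  assumes "d < r" "set w \<subseteq> Fgens r"
  shows "psi d id (\<lambda>i. vw r w (u i)) = psi d id u"
  using assms(2)
proof (induction w)
  case (Cons g w)
  then obtain j t where g: "g = GF j t" "j \<in> {1..r}" by (auto simp: Fgens_def)
  have "psi d id (\<lambda>i. vw r (g # w) (u i)) = psi d id (\<lambda>i. vw r w (u i))"
    using psi_vop_F[OF assms(1) g(2), of t "\<lambda>i. vw r w (u i)"] by (simp only: g vw.simps)
  also have "\<dots> = psi d id u" by (rule Cons.IH) (use Cons.prems in simp)
  finally show ?case .
qed simp

lemma psi_vop_H:
  assumes "d < r" "1 \<le> d" "j \<in> {1..r}"
  shows "psi d id (\<lambda>i. vop r (GH j t) (u i)) = (if j = d then exp t else 1) * psi d id u"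
proof -
  have "(\<Sum>k\<in>{1..d}. weight r j k) = (\<Sum>k\<in>{1..d}. (if k = j then mult_B r j else 0) - (if k = j + 1 then mult_B r j else 0))"
    using assms by (intro sum.cong refl) (auto simp: weight_def)
  also have "\<dots> = (if j \<in> {1..d} then mult_B r j else 0) - (if j + 1 \<in> {1..d} then mult_B r j else 0)"
    by (simp only: sum_subtractf sum.delta finite_atLeastAtMost)
  also have "\<dots> = (if j = d then 1 else 0)" using assms by (auto simp: mult_B_def)
  finally have w: "(\<Sum>k\<in>{1..d}. weight r j k) = (if j = d then 1 else 0)" .
  have "psi d id (\<lambda>i. vop r (GH j t) (u i)) = (\<Prod>k\<in>{1..d}. exp (t * weight r j k)) * psi d id u"
    by (simp only: vop.simps psi_row_scale)
  also have "(\<Prod>k\<in>{1..d}. exp (t * weight r j k)) = exp (t * (if j = d then 1 else 0))"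
    unfolding w[symmetric] sum_distrib_left by (rule exp_sum[symmetric]) simp
  finally have e: "psi d id (\<lambda>i. vop r (GH j t) (u i)) = exp (t * (if j = d then 1 else 0)) * psi d id u" .
  have "exp (t * (if j = d then 1 else 0)) = (if j = d then exp t else 1)" by simp
  then show ?thesis unfolding e by (rule arg_cong)
qed

definition torus_word :: "(nat \<Rightarrow> complex) \<Rightarrow> nat list \<Rightarrow> gen list" where
  "torus_word t l = map (\<lambda>j. GH j (Ln (t j))) l"

lemma torus_word_Cons: "torus_word t (j # l) = GH j (Ln (t j)) # torus_word t l"
  by (simp add: torus_word_def)

text \<open>The first \<open>d\<close> positions together have weight \<open>\<Lambda>\<^sub>d\<close>.\<close>

lemma psi_torus_word:
  assumes "d < r" "1 \<le> d" "distinct l" "set l \<subseteq> {1..r}" "\<And>j. j \<in> set l \<Longrightarrow> t j \<noteq> 0"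
  shows "psi d id (\<lambda>i. vw r (torus_word t l) (u i)) = (if d \<in> set l then t d else 1) * psi d id u"
  using assms(3-)
proof (induction l)
  case Nil
  then show ?case by (simp add: torus_word_def)
next
  case (Cons j l)
  have "psi d id (\<lambda>i. vw r (torus_word t (j # l)) (u i)) =
      psi d id (\<lambda>i. vop r (GH j (Ln (t j))) (vw r (torus_word t l) (u i)))"
    by (simp only: torus_word_def list.map vw.simps)
  also have "\<dots> = (if j = d then t j else 1) * psi d id (\<lambda>i. vw r (torus_word t l) (u i))"
  proof -
    have j: "j \<in> {1..r}" "exp (Ln (t j)) = t j" using Cons.prems by auto
    show ?thesis unfolding psi_vop_H[OF assms(1,2) j(1)] j(2) ..
  qed
  also have "psi d id (\<lambda>i. vw r (torus_word t l) (u i)) = (if d \<in> set l then t d else 1) * psi d id u"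
    by (rule Cons.IH) (use Cons.prems in auto)
  finally have e: "psi d id (\<lambda>i. vw r (torus_word t (j # l)) (u i)) =
      (if j = d then t j else 1) * ((if d \<in> set l then t d else 1) * psi d id u)" .
  have "(if j = d then t j else 1) * (if d \<in> set l then t d else 1) = (if d \<in> set (j # l) then t d else 1)"
    using Cons.prems by auto
  then show ?case unfolding e mult.assoc[symmetric] by (rule arg_cong)
qed

lemma vw_E_unitriangular:
  assumes "set w \<subseteq> Egens r" "\<And>q. q > p \<Longrightarrow> x q = 0"
  shows "vw r w x p = x p"
  using assms
proof (induction w arbitrary: p)
  case (Cons g w)
  then obtain j t where g: "g = GE j t" "j \<in> {1..r}" by (auto simp: Egens_def)
  let ?y = "vw r w x"
  have y: "?y q = x q" if "q \<ge> p" for q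
    using Cons.IH[of q] Cons.prems that by simp
  have su: "z p' = 0" if "z = opE r j x'" "\<forall>q>p'. x' q = 0" for x' z :: vect and p'
    using strictly_upper_opE[OF g(2)] that unfolding strictly_upper_def by blast
  have A: "opE r j ?y q = 0" if q: "q \<ge> p" for q
    by (rule su[OF refl]) (use y Cons.prems(2) q in simp)
  have "opE r j (opE r j ?y) p = 0"
    by (rule su[OF refl]) (use A in simp)
  then show ?case using y[of p] A[of p] by (simp add: g uexp_def)
qed simp

text \<open>Raising operators act by unitriangular matrices.\<close>

lemma psi_vw_E:
  assumes "set w \<subseteq> Egens r"
  shows "psi d id (\<lambda>i. vw r w (delta i)) = 1"
proof (rule psi_upper_unitriangular)
  fix i k assume "i < (k::nat)"
  then show "vw r w (delta i) k = 0" using vw_E_unitriangular[OF assms, of k "delta i"] by (simp add: delta_def)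
next
  fix i
  show "vw r w (delta i) i = 1" using vw_E_unitriangular[OF assms, of i "delta i"] by (simp add: delta_def)
qed

context chevalley_matrices
begin

lemma weyl_lift_gw: "weyl_lift e f js = gw (lift_word js)"
  by (induction js)
    (simp_all add: weyl_lift_def lift_word_def simple_lift_def one_param_expt matrix_mul_assoc)

text \<open>The set of one-parameter elements is closed under inverses, so the subgroup generated by it
  consists of products.\<close>

lemma unipotent_words:
  assumes S: "S = {gw_letter i t | i t. i \<in> {1..r}}"
    and letter: "\<And>i t. gmat (gw_letter i t) = expt (E i) t"
    and inv: "\<And>i t. gen_inverse (gw_letter i t) = gw_letter i (- t)"
  shows "unipotent_part r E = gw ` {u. set u \<subseteq> S}"
proof
  have S': "gw_letter i t \<in> S" if "i \<in> {1..r}" for i t using that S by blast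
  show "unipotent_part r E \<subseteq> gw ` {u. set u \<subseteq> S}"
  proof
    fix x assume "x \<in> unipotent_part r E"
    then have "x \<in> generate GL {one_param E i t | i t. i \<in> {1..r}}" by (simp only: unipotent_part_def)
    then show "x \<in> gw ` {u. set u \<subseteq> S}"
    proof (induction rule: generate.induct)
      case one
      show ?case by (intro image_eqI[of _ _ "[]"]) (simp_all add: GL_def)
    next
      case (incl x)
      then obtain i t where "x = expt (E i) t" "i \<in> {1..r}" by (auto simp: one_param_expt)
      then show ?case using letter S' by (intro image_eqI[of _ _ "[gw_letter i t]"]) simp_all
    next
      case (inv x)
      then obtain i t where "x = expt (E i) t" "i \<in> {1..r}" by (auto simp: one_param_expt)
      then show ?case using letter S' by (intro image_eqI[of _ _ "[gw_letter i (- t)]"]) (simp_all add: inv_GL_expt)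
    next
      case (eng x y)
      then obtain u v where "x = gw u" "y = gw v" "set u \<subseteq> S" "set v \<subseteq> S" by blast
      then show ?case by (intro image_eqI[of _ _ "u @ v"]) (simp_all add: gw_append GL_def)
    qed
  qed
  show "gw ` {u. set u \<subseteq> S} \<subseteq> unipotent_part r E"
  proof (rule image_subsetI)
    fix u assume "u \<in> {u. set u \<subseteq> S}"
    then have "set u \<subseteq> S" by simp
    then have "gw u \<in> generate GL {one_param E i t | i t. i \<in> {1..r}}"
    proof (induction u)
      case Nil
      show ?case using generate.one[of GL] by (simp add: GL_def)
    next
      case (Cons g u)
      then obtain i t where g: "g = gw_letter i t" "i \<in> {1..r}" using S by auto
      then have "gmat g \<in> generate GL {one_param E i t | i t. i \<in> {1..r}}"
        using letter by (intro generate.incl) (auto simp: one_param_expt)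
      from generate.eng[OF this Cons.IH] show ?case using Cons.prems by (simp add: GL_def)
    qed
    then show "gw u \<in> unipotent_part r E" by (simp only: unipotent_part_def)
  qed
qed

lemma unipotent_E: "unipotent_part r e = gw ` {u. set u \<subseteq> Egens r}"
  by (rule unipotent_words[of _ GE]) (simp_all add: Egens_def)

lemma unipotent_F: "unipotent_part r f = gw ` {u. set u \<subseteq> Fgens r}"
  by (rule unipotent_words[of _ GF]) (simp_all add: Fgens_def)

lemma torus_elt_gw: "torus_elt r h t = gw (torus_word t [1..<r + 1])"
  by (simp add: torus_elt_def gw_def torus_word_def coroot_hom_expt[abs_def] o_def)

lemma torus_word_in: "set l \<subseteq> {1..r} \<Longrightarrow> set (torus_word t l) \<subseteq> Hgens r"
  by (auto simp: torus_word_def Hgens_def)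

lemma upt_in: "set [1..<r + 1] \<subseteq> {1..r}"
  by auto

lemma expt_h_commute: "i \<in> {1..r} \<Longrightarrow> j \<in> {1..r} \<Longrightarrow> expt (h i) s ** expt (h j) t = expt (h j) t ** expt (h i) s"
  using hh by (intro expt_commuting) (simp add: lie_bracket_def)

text \<open>The logarithm of \<open>exp s * t\<close> may differ from \<open>s + Ln t\<close> by a period,
  which does not matter by \<open>sl2_torus_periodic\<close>.\<close>

lemma torus_word_absorb:
  assumes "distinct l" "set l \<subseteq> {1..r}" "i \<in> set l" "t i \<noteq> 0"
  shows "expt (h i) s ** gw (torus_word t l) = gw (torus_word (t(i := exp s * t i)) l)"
  using assms
proof (induction l)
  case (Cons j l)
  show ?case
  proof (cases "j = i")
    case True
    then have i: "i \<in> {1..r}" and n: "i \<notin> set l" using Cons.prems by auto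
    have "expt (h i) (s + Ln (t i)) = expt (h i) (Ln (exp s * t i))"
      using Cons.prems by (intro sl2_torus_periodic[OF sl2_relations[OF i]]) (simp add: exp_add)
    then have A: "expt (h i) s ** expt (h i) (Ln (t i)) = expt (h i) (Ln (exp s * t i))" by (simp add: expt_add)
    have B: "torus_word (t(i := exp s * t i)) l = torus_word t l"
      using n by (auto simp: torus_word_def)
    have "expt (h i) s ** gw (torus_word t (j # l)) = expt (h i) s ** expt (h i) (Ln (t i)) ** gw (torus_word t l)"
      by (simp add: torus_word_Cons True matrix_mul_assoc)
    also have "\<dots> = gw (torus_word (t(i := exp s * t i)) (j # l))"
      unfolding A torus_word_Cons B by (simp add: True)
    finally show ?thesis .
  next
    case False
    then have ij: "i \<in> {1..r}" "j \<in> {1..r}" "i \<in> set l" using Cons.prems by auto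
    have "expt (h i) s ** gw (torus_word t (j # l)) = expt (h j) (Ln (t j)) ** (expt (h i) s ** gw (torus_word t l))"
      using expt_h_commute[OF ij(1,2), of s "Ln (t j)"] by (simp add: torus_word_def matrix_mul_assoc)
    also have "expt (h i) s ** gw (torus_word t l) = gw (torus_word (t(i := exp s * t i)) l)"
      by (rule Cons.IH) (use Cons.prems ij in auto)
    finally have *: "expt (h i) s ** gw (torus_word t (j # l)) =
        expt (h j) (Ln (t j)) ** gw (torus_word (t(i := exp s * t i)) l)" .
    show ?thesis unfolding * unfolding torus_word_Cons using False by simp
  qed
qed simp

text \<open>An arbitrary product of torus elements can be collected into one factor for each coroot.\<close>

lemma torus_words: "torus r h = gw ` {w. set w \<subseteq> Hgens r}"
proof
  show "torus r h \<subseteq> gw ` {w. set w \<subseteq> Hgens r}"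
    unfolding torus_def using torus_elt_gw torus_word_in[OF upt_in] by blast
  show "gw ` {w. set w \<subseteq> Hgens r} \<subseteq> torus r h"
  proof (rule image_subsetI)
    fix w assume "w \<in> {w. set w \<subseteq> Hgens r}"
    then have "set w \<subseteq> Hgens r" by simp
    then have "\<exists>t. (\<forall>j\<in>{1..r}. t j \<noteq> 0) \<and> gw w = torus_elt r h t"
    proof (induction w)
      case Nil
      have "gw (torus_word (\<lambda>_. 1) l) = mat 1" for l
        by (induction l) (simp_all add: torus_word_def)
      then show ?case unfolding torus_elt_gw by (intro exI[of _ "\<lambda>_. 1"]) simp
    next
      case (Cons g w)
      then obtain i s where g: "g = GH i s" "i \<in> {1..r}" by (auto simp: Hgens_def)
      obtain t where t: "\<forall>j\<in>{1..r}. t j \<noteq> 0" "gw w = torus_elt r h t" using Cons by auto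
      have i: "i \<in> set [1..<r + 1]" "t i \<noteq> 0" using g t(1) by auto
      have "gw (g # w) = expt (h i) s ** gw (torus_word t [1..<r + 1])"
        unfolding gw_Cons t(2) torus_elt_gw g(1) by simp
      also have "\<dots> = torus_elt r h (t(i := exp s * t i))"
        unfolding torus_elt_gw by (rule torus_word_absorb) (use upt_in i in auto)
      finally have "gw (g # w) = torus_elt r h (t(i := exp s * t i))" .
      moreover have "\<forall>j\<in>{1..r}. (t(i := exp s * t i)) j \<noteq> 0" using t(1) g(2) by simp
      ultimately show ?case by blast
    qed
    then show "gw w \<in> torus r h" unfolding torus_def by blast
  qed
qed

lemma G0_big_cell: "G0 r e f h = big_cell"
  unfolding G0_def big_cell_def unipotent_E unipotent_F torus_words by blast

lemma torus_component_eq: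
  assumes "set u \<subseteq> Fgens r" "a \<in> torus r h" "set v \<subseteq> Egens r"
  shows "torus_component r e f h (gw u ** a ** gw v) = a"
  unfolding torus_component_def
proof (rule the_equality)
  have "gw u \<in> unipotent_part r f" "gw v \<in> unipotent_part r e"
    using assms unfolding unipotent_E unipotent_F by blast+
  then show "a \<in> torus r h \<and> (\<exists>n\<in>unipotent_part r f. \<exists>n'\<in>unipotent_part r e. gw u ** a ** gw v = n ** a ** n')"
    using assms(2) by blast
next
  fix b assume "b \<in> torus r h \<and> (\<exists>n\<in>unipotent_part r f. \<exists>n'\<in>unipotent_part r e. gw u ** a ** gw v = n ** b ** n')"
  then obtain u' w' v' where b: "set u' \<subseteq> Fgens r" "set w' \<subseteq> Hgens r" "set v' \<subseteq> Egens r" "b = gw w'"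
    "gw u ** a ** gw v = gw u' ** gw w' ** gw v'"
    unfolding unipotent_E unipotent_F torus_words by blast
  obtain w where w: "set w \<subseteq> Hgens r" "a = gw w" using assms(2) unfolding torus_words by blast
  show "b = a" unfolding b(4) w(2)
    by (rule sym, rule torus_part_unique[OF assms(1) w(1) assms(3) b(1-3)]) (use b(5) w(2) in simp)
qed

end

context chevalley_group
begin

text \<open>The words form a subgroup that contains the one-parameter subgroups of the generators of the Lie
  algebra.\<close>

lemma G_words: "G = {gw z | z. set z \<subseteq> Egens r \<union> Fgens r}"
proof -
  let ?K = "{gw z | z. set z \<subseteq> Egens r \<union> Fgens r}" and ?E = "e ` {1..r} \<union> f ` {1..r}"
  have all: "set z \<subseteq> all_gens r" if "set z \<subseteq> Egens r \<union> Fgens r" for z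
    using that gens_subset by blast
  have "?K = G"
  proof (rule connected_group_generated[OF alg conn, where E = ?E])
    show "?K \<subseteq> G" using all gw_in_G by blast
    show "?E \<subseteq> Lie G" using gens_Lie by blast
    show "mat 1 \<in> ?K" by (intro CollectI exI[of _ "[]"]) simp
    show "Lie G \<subseteq> lie_generated ?E" using Lie_eq by simp
  next
    fix a b assume "a \<in> ?K" "b \<in> ?K"
    then obtain y z where "a = gw y" "b = gw z" "set y \<subseteq> Egens r \<union> Fgens r" "set z \<subseteq> Egens r \<union> Fgens r" by blast
    then show "a ** b \<in> ?K" by (intro CollectI exI[of _ "y @ z"]) (simp add: gw_append)
  next
    fix a b assume "a \<in> ?K" "b ** a = mat 1"
    then obtain z where z: "b = gw (winv z)" "set z \<subseteq> Egens r \<union> Fgens r" using gw_inverse_unique by blast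
    have "set (winv z) \<subseteq> Egens r \<union> Fgens r"
      using z(2) by (auto simp: winv_def gen_inverse_in subset_eq)
    then show "b \<in> ?K" using z(1) by blast
  next
    fix X t assume "X \<in> ?E"
    then obtain i where "i \<in> {1..r}" "X = e i \<or> X = f i" by blast
    then have "\<exists>g\<in>Egens r \<union> Fgens r. expt X t = gmat g"
      by (auto simp: Egens_def Fgens_def intro: bexI[of _ "GE i t"] bexI[of _ "GF i t"])
    then obtain g where "g \<in> Egens r \<union> Fgens r" "expt X t = gmat g" by blast
    then show "expt X t \<in> ?K" by (intro CollectI exI[of _ "[g]"]) simp
  qed
  then show ?thesis by simp
qed

text \<open>A regular function of the word only depends on the matrix of the word.\<close>

lemma regular_word_well_defined:
  assumes "regular_word \<phi>" "set v \<subseteq> all_gens r" "set w \<subseteq> all_gens r" "gw v = gw w"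
  shows "\<phi> v = \<phi> w"
proof -
  obtain p m where "\<And>w. set w \<subseteq> all_gens r \<Longrightarrow> \<phi> w = p (gw w) / det (gw w) ^ m"
    using assms(1) unfolding regular_word_def by blast
  then show ?thesis using assms by simp
qed

lemma id_rows: "d < r \<Longrightarrow> i \<in> {1..d} \<Longrightarrow> id i \<in> {1..2 * r + 1}"
  by simp

text \<open>The value of the character is recovered from the action on the first \<open>d\<close> positions,
  so it does not depend on the chosen parameters of the torus element.\<close>

lemma fund_char_eq:
  assumes d: "1 \<le> d" "d < r" and t: "\<forall>j\<in>{1..r}. t j \<noteq> 0"
  shows "fund_char r h d (torus_elt r h t) = t d"
proof -
  have reg: "regular_word (\<lambda>w. psi d id (\<lambda>i. vw r w (delta i)))"
    using d by (intro regular_word_psi id_rows) auto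
  have val: "psi d id (\<lambda>i. vw r (torus_word t [1..<r + 1]) (delta i)) = t d" if "\<forall>j\<in>{1..r}. t j \<noteq> 0" for t
  proof -
    have m: "d \<in> set [1..<r + 1]" using d by simp
    have "psi d id (\<lambda>i. vw r [] (delta i)) = 1" by (rule psi_vw_E) simp
    then have one: "psi d id (\<lambda>i. delta i) = 1" by (simp only: vw.simps)
    have "psi d id (\<lambda>i. vw r (torus_word t [1..<r + 1]) (delta i)) =
        (if d \<in> set [1..<r + 1] then t d else 1) * psi d id (\<lambda>i. delta i)"
      by (rule psi_torus_word) (use d that in auto)
    then show ?thesis using m by (simp only: one if_True mult_1_right)
  qed
  have all: "set (torus_word t [1..<r + 1]) \<subseteq> all_gens r" for t
    using torus_word_in[OF upt_in] gens_subset(3) by blast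
  show ?thesis unfolding fund_char_def
  proof (rule the_equality)
    show "\<exists>t'. (\<forall>j\<in>{1..r}. t' j \<noteq> 0) \<and> torus_elt r h t = torus_elt r h t' \<and> t d = t' d"
      using t by blast
  next
    fix c assume "\<exists>t'. (\<forall>j\<in>{1..r}. t' j \<noteq> 0) \<and> torus_elt r h t = torus_elt r h t' \<and> c = t' d"
    then obtain t' where t': "\<forall>j\<in>{1..r}. t' j \<noteq> 0" "torus_elt r h t = torus_elt r h t'" "c = t' d" by blast
    have "gw (torus_word t' [1..<r + 1]) = gw (torus_word t [1..<r + 1])" using t'(2) unfolding torus_elt_gw ..
    from regular_word_well_defined[OF reg all all this] show "c = t d"
      unfolding val[OF t] val[OF t'(1)] t'(3) .
  qed
qed

text \<open>The generalized minor is the matrix minor in the vector representation: the latter is a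
  regular function with the prescribed values on the translated big cell, and the translated big
  cell is dense.\<close>

theorem gen_minor_eq:
  assumes d: "1 \<le> d" "d < r" and js: "set js \<subseteq> {1..r}" and w: "set w \<subseteq> all_gens r"
  shows "gen_minor r G e f h js d (gw w) =
    psi d id (\<lambda>i. vw r (winv (lift_word js)) (vw r w (delta i)))"
proof -
  let ?w0 = "lift_word js"
  let ?A = "gw ?w0"
  let ?\<phi> = "\<lambda>w. psi d id (\<lambda>i. vw r (winv ?w0) (vw r w (delta i)))"
  have w0: "set ?w0 \<subseteq> all_gens r" using lift_word_in[OF js] gens_subset by blast
  have w0': "set (winv ?w0) \<subseteq> all_gens r" using w0 winv_in by blast
  have "regular_word (\<lambda>w. psi d id (\<lambda>i. vw r w (delta i)))"
    using d by (intro regular_word_psi id_rows) auto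
  from regular_word_left[OF this w0'] have "regular_word ?\<phi>" by (simp only: vw_append)
  then obtain p m where p: "p \<in> poly_funs" "\<And>w. set w \<subseteq> all_gens r \<Longrightarrow> ?\<phi> w = p (gw w) / det (gw w) ^ m"
    unfolding regular_word_def by blast
  define F where "F = restrict (\<lambda>g. p g / det g ^ m) G"
  have F_word: "F (gw w) = ?\<phi> w" if "set w \<subseteq> all_gens r" for w
    using p(2)[OF that] gw_in_G[OF that] by (simp add: F_def)
  have detG: "det g \<noteq> 0" if "g \<in> G" for g using that det_gw G_words by auto
  let ?val = "\<lambda>x. fund_char r h d (torus_component r e f h (matrix_inv (weyl_lift e f js) ** x))"
  have vals: "F x = ?val x" if x: "x \<in> (**) (weyl_lift e f js) ` G0 r e f h" for x
  proof -
    obtain u t v where u: "set u \<subseteq> Fgens r" and t: "\<forall>j\<in>{1..r}. t j \<noteq> 0" and v: "set v \<subseteq> Egens r"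
      and x: "x = ?A ** (gw u ** torus_elt r h t ** gw v)"
      using x unfolding weyl_lift_gw G0_def unipotent_E unipotent_F torus_def by blast
    let ?T = "torus_word t [1..<r + 1]"
    have inv: "matrix_inv ?A ** ?A = mat 1"
    proof -
      have "?A ** matrix_inv ?A = mat 1 \<and> matrix_inv ?A ** ?A = mat 1"
        unfolding matrix_inv_def by (rule someI[of _ "gw (winv ?w0)"]) (simp add: gw_winv)
      then show ?thesis by blast
    qed
    have "matrix_inv (weyl_lift e f js) ** x = matrix_inv ?A ** ?A ** (gw u ** torus_elt r h t ** gw v)"
      unfolding weyl_lift_gw x by (simp only: matrix_mul_assoc)
    then have y: "matrix_inv (weyl_lift e f js) ** x = gw u ** torus_elt r h t ** gw v" unfolding inv by simp
    have "torus_elt r h t \<in> torus r h" using t unfolding torus_def by blast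
    from torus_component_eq[OF u this v] have val: "?val x = t d" unfolding y by (simp only: fund_char_eq[OF d t])
    have all: "set (?w0 @ u @ ?T @ v) \<subseteq> all_gens r"
      unfolding set_append Un_subset_iff
      using w0 order_trans[OF u gens_subset(2)] order_trans[OF v gens_subset(1)]
        order_trans[OF torus_word_in[OF upt_in] gens_subset(3)] by blast
    have "x = gw (?w0 @ u @ ?T @ v)" unfolding x torus_elt_gw by (simp add: gw_append matrix_mul_assoc)
    then have "F x = ?\<phi> (?w0 @ u @ ?T @ v)" using F_word[OF all] by simp
    also have "\<dots> = psi d id (\<lambda>i. vw r u (vw r ?T (vw r v (delta i))))"
      by (simp only: vw_append vw_winv'[OF w0])
    also have "\<dots> = psi d id (\<lambda>i. vw r ?T (vw r v (delta i)))" by (rule psi_vw_F[OF d(2) u])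
    also have "\<dots> = t d * psi d id (\<lambda>i. vw r v (delta i))"
    proof -
      have m: "d \<in> set [1..<r + 1]" using d by simp
      have "psi d id (\<lambda>i. vw r ?T (vw r v (delta i))) =
          (if d \<in> set [1..<r + 1] then t d else 1) * psi d id (\<lambda>i. vw r v (delta i))"
        by (rule psi_torus_word) (use d t in auto)
      then show ?thesis using m by (simp only: if_True)
    qed
    also have "\<dots> = t d" by (simp only: psi_vw_E[OF v] mult_1_right)
    finally show ?thesis using val by simp
  qed
  have "gen_minor r G e f h js d = F"
    unfolding gen_minor_def
  proof (rule the_equality)
    show "F \<in> regular_functions G \<and> (\<forall>x\<in>(**) (weyl_lift e f js) ` G0 r e f h. F x = ?val x)"
      using vals p(1) unfolding regular_functions_def F_def by blast
  next
    fix F' assume F': "F' \<in> regular_functions G \<and> (\<forall>x\<in>(**) (weyl_lift e f js) ` G0 r e f h. F' x = ?val x)"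
    then obtain q l where q: "q \<in> poly_funs" "F' = restrict (\<lambda>g. q g / det g ^ l) G"
      unfolding regular_functions_def by blast
    let ?P = "\<lambda>g. q g * det g ^ m + (- 1) * (p g * det g ^ l)"
    have P: "?P \<in> poly_funs"
      by (intro poly_funs.add poly_funs.mult poly_funs.const p(1) q(1) poly_funs_power poly_det)
    have iff: "F' g = F g \<longleftrightarrow> ?P g = 0" if "g \<in> G" for g
      using detG[OF that] that by (simp add: q(2) F_def frac_eq_eq)
    have AG: "?A \<in> G" "gw (winv ?w0) \<in> G" using gw_in_G w0 w0' by blast+
    have "?P (?A ** x) = 0" if x: "x \<in> big_cell" for x
    proof -
      have "x \<in> G"
      proof -
        obtain u w v where *: "x = gw u ** gw w ** gw v" "set u \<subseteq> Fgens r" "set w \<subseteq> Hgens r" "set v \<subseteq> Egens r"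
          using x unfolding big_cell_def by blast
        show ?thesis unfolding *(1)
          by (intro subgroup_GL_mult[OF subgroup_G] gw_in_G order_trans[OF *(2) gens_subset(2)]
              order_trans[OF *(3) gens_subset(3)] order_trans[OF *(4) gens_subset(1)])
      qed
      then have "?A ** x \<in> G" using AG subgroup_GL_mult[OF subgroup_G] by blast
      moreover have "?A ** x \<in> (**) (weyl_lift e f js) ` G0 r e f h"
        using x unfolding weyl_lift_gw G0_big_cell by blast
      from vals[OF this] bspec[OF conjunct2[OF F'] this] have "F' (?A ** x) = F (?A ** x)" by (simp only:)
      ultimately show ?thesis using iff by blast
    qed
    then have zero: "?P (?A ** gw z) = 0" if "set z \<subseteq> Egens r \<union> Fgens r" for z
      using big_cell_dense[OF P] that by blast
    show "F' = F"
    proof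
      fix g
      show "F' g = F g"
      proof (cases "g \<in> G")
        case True
        then have "gw (winv ?w0) ** g \<in> G" using AG subgroup_GL_mult[OF subgroup_G] by blast
        then obtain z where z: "gw (winv ?w0) ** g = gw z" "set z \<subseteq> Egens r \<union> Fgens r" using G_words by auto
        have "?A ** gw z = g" unfolding z(1)[symmetric] by (simp add: matrix_mul_assoc gw_winv)
        then show ?thesis using iff[OF True] zero[OF z(2)] by simp
      next
        case False
        then show ?thesis by (simp add: q(2) F_def)
      qed
    qed
  qed
  then show ?thesis using F_word[OF w] by simp
qed

end

subsection \<open>The hypotheses on the group\<close>

text \<open>If one \<open>e\<^sub>i\<close> were zero, then by connectedness of the Dynkin diagram all
  generators would vanish and the group would be trivial, hence commutative.\<close>

lemma chevalley_groupI:
  fixes G :: "(complex^'n^'n) set"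
  assumes G: "simple_algebraic_group G" and gens: "chevalley_generators_B r G e f h" and r: "2 \<le> r"
  shows "chevalley_group r e f h G"
proof -
  have rel: "lie_bracket (h i) (h j) = 0" "lie_bracket (h i) (e j) = cscale (of_int (cartan_B r i j)) (e j)"
    "lie_bracket (h i) (f j) = cscale (- of_int (cartan_B r i j)) (f j)"
    "lie_bracket (e i) (f j) = (if i = j then h i else 0)"
    if "i \<in> {1..r}" "j \<in> {1..r}" for i j
    using gens that unfolding chevalley_generators_B_def by blast+
  have alg: "linear_algebraic_group G" "connected G" "\<not> comm_group (GL\<lparr>carrier := G\<rparr>)"
    using G unfolding simple_algebraic_group_def by blast+
  have Lie: "Lie G = lie_generated (e ` {1..r} \<union> f ` {1..r})"
    and gL: "\<And>i. i \<in> {1..r} \<Longrightarrow> e i \<in> Lie G" "\<And>i. i \<in> {1..r} \<Longrightarrow> f i \<in> Lie G" "\<And>i. i \<in> {1..r} \<Longrightarrow> h i \<in> Lie G"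
    using gens unfolding chevalley_generators_B_def by blast+
  have zero_br: "lie_bracket 0 X = 0" for X :: "complex^'n^'n" by (simp add: lie_bracket_def)
  have nz: "e i \<noteq> 0" if i: "i \<in> {1..r}" for i
  proof
    assume "e i = 0"
    have nb: "e k = 0" if "e j = 0" "j \<in> {1..r}" "k \<in> {1..r}" "cartan_B r j k \<noteq> 0" for j k
    proof -
      have "h j = 0" using rel(4)[OF that(2,2)] that(1) by (simp add: zero_br)
      then have "cscale (of_int (cartan_B r j k)) (e k) = 0" using rel(2)[OF that(2,3)] by (simp add: zero_br)
      then show ?thesis using that(4) by (auto simp: vec_eq_iff)
    qed
    have up: "e k = 0" if "i \<le> k" "k \<le> r" for k
      using that
    proof (induction k rule: dec_induct)
      case base
      show ?case by (rule \<open>e i = 0\<close>)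
    next
      case (step k)
      then show ?case using nb[of k "Suc k"] i by (auto simp: cartan_B_def)
    qed
    have down: "e k = 0" if "k \<le> i" "1 \<le> k" for k
      using that
    proof (induction k rule: inc_induct)
      case base
      show ?case by (rule \<open>e i = 0\<close>)
    next
      case (step k)
      then show ?case using nb[of "Suc k" k] i by (auto simp: cartan_B_def)
    qed
    have e0: "e k = 0" if "k \<in> {1..r}" for k using up[of k] down[of k] that by (cases "i \<le> k") auto
    have f0: "f k = 0" if k: "k \<in> {1..r}" for k
    proof -
      have "h k = 0" using rel(4)[OF k k] e0[OF k] by (simp add: zero_br)
      then have "cscale (- of_int (cartan_B r k k)) (f k) = 0" using rel(3)[OF k k] by (simp add: zero_br)
      then show ?thesis by (auto simp: vec_eq_iff cartan_B_def)
    qed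
    have "{mat 1} = G"
    proof (rule connected_group_generated[OF alg(1,2), where E = "e ` {1..r} \<union> f ` {1..r}"])
      show "{mat 1} \<subseteq> G" using alg(1) subgroup_GL_one by (auto simp: linear_algebraic_group_def)
      show "e ` {1..r} \<union> f ` {1..r} \<subseteq> Lie G" using gL by blast
      show "Lie G \<subseteq> lie_generated (e ` {1..r} \<union> f ` {1..r})" using Lie by simp
      show "expt X t \<in> {mat 1}" if "X \<in> e ` {1..r} \<union> f ` {1..r}" for X t
        using that e0 f0 by (auto simp: expt_def)
    qed auto
    moreover have "comm_group (GL\<lparr>carrier := {mat 1 :: complex^'n^'n}\<rparr>)"
      by (rule comm_groupI) (auto simp: GL_def)
    ultimately show False using alg(3) by metis
  qed
  show ?thesis
    by unfold_locales (use r rel alg Lie gL nz in \<open>blast+\<close>)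
qed

section \<open>Weyl group lifts acting on minors\<close>

text \<open>The lift of a transposition of adjacent positions in the general linear group.\<close>

definition sg :: "nat \<Rightarrow> vect \<Rightarrow> vect" where
  "sg a x = (\<lambda>k. if k = a then - x (a + 1) else if k = a + 1 then x a else x k)"

lemma lift_vw_short:
  assumes j: "1 \<le> j" "j < r"
  shows "vw r (lift_word [j]) x = sg j (sg (2 * r + 1 - j) x)"
proof -
  define q where "q = 2 * r + 1 - j"
  have q: "2 * r + 1 - j = q" "2 * r + 2 - j = q + 1" "q > j + 1" using j by (auto simp: q_def)
  have E: "vop r (GE j t) x = (\<lambda>k. if k = j then x j + t * x (j + 1) else if k = q then x q + t * x (q + 1) else x k)" for t x
    unfolding vop.simps uexp_def opE_def[abs_def] q mult_B_def using q(3) j(2) by (auto simp: fun_eq_iff)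
  have F: "vop r (GF j t) x = (\<lambda>k. if k = j + 1 then x (j + 1) + t * x j else if k = q + 1 then x (q + 1) + t * x q else x k)" for t x
    unfolding vop.simps uexp_def opF_def[abs_def] q mult_B_def using q(3) j(2) by (auto simp: fun_eq_iff)
  have l: "lift_word [j] = [GE j (- 1), GF j 1, GE j (- 1)]" by (simp add: lift_word_def)
  show ?thesis
    unfolding l vw.simps(2) vw.simps(1) E F sg_def q using q(3) by (auto simp: fun_eq_iff)
qed

lemma lift_vw_long:
  assumes r: "1 \<le> r"
  shows "vw r (lift_word [r]) x = (\<lambda>k. if k = r then x (r + 2) else if k = r + 1 then - x (r + 1) else if k = r + 2 then x r else x k)"
proof -
  have q: "2 * r + 1 - r = r + 1" "2 * r + 2 - r = r + 2" by auto
  have E: "vop r (GE r t) x = (\<lambda>k. if k = r then x r + 2 * t * x (r + 1) + t ^ 2 * x (r + 2) else if k = r + 1 then x (r + 1) + t * x (r + 2) else x k)" for t x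
    unfolding vop.simps uexp_def opE_def[abs_def] q mult_B_def by (auto simp: fun_eq_iff)
  have F: "vop r (GF r t) x = (\<lambda>k. if k = r + 1 then x (r + 1) + t * x r else if k = r + 2 then x (r + 2) + 2 * t * x (r + 1) + t ^ 2 * x r else x k)" for t x
    unfolding vop.simps uexp_def opF_def[abs_def] q mult_B_def by (auto simp: fun_eq_iff)
  have l: "lift_word [r] = [GE r (- 1), GF r 1, GE r (- 1)]" by (simp add: lift_word_def)
  show ?thesis
    unfolding l vw.simps(2) vw.simps(1) E F by (auto simp: fun_eq_iff algebra_simps)
qed

text \<open>The three possible effects of a transposition lift on a set of rows: it is disjoint from them,
  it moves one row, or it permutes two rows with determinant \<open>1\<close>.\<close>

lemma psi_sg_none:
  assumes "\<And>p. p \<in> {1..d} \<Longrightarrow> I p \<noteq> a \<and> I p \<noteq> a + 1"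
  shows "psi d I (\<lambda>i. sg a (u i)) = psi d I u"
  by (rule psi_cong) (use assms in \<open>auto simp: sg_def\<close>)

lemma psi_sg_one:
  assumes "p \<in> {1..d}" "I p = a + 1" "\<And>q. q \<in> {1..d} \<Longrightarrow> q \<noteq> p \<Longrightarrow> I q \<noteq> a \<and> I q \<noteq> a + 1"
    and "J p = a" "\<And>q. q \<in> {1..d} \<Longrightarrow> q \<noteq> p \<Longrightarrow> J q = I q"
  shows "psi d I (\<lambda>i. sg a (u i)) = psi d J u"
proof (rule psi_cong)
  fix i k assume "k \<in> {1..d}"
  then show "sg a (u i) (I k) = u i (J k)" using assms by (cases "k = p") (auto simp: sg_def)
qed

lemma psi_sg_both:
  assumes p: "p \<in> {1..d}" "q \<in> {1..d}" "I p = a" "I q = a + 1"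
    and other: "\<And>k. k \<in> {1..d} \<Longrightarrow> k \<noteq> p \<Longrightarrow> k \<noteq> q \<Longrightarrow> I k \<noteq> a \<and> I k \<noteq> a + 1"
  shows "psi d I (\<lambda>i. sg a (u i)) = psi d I u"
proof -
  let ?v = "\<lambda>k i. u i (I k)"
  let ?s = "\<lambda>k. ?v (Transposition.transpose p q k)"
  have pq: "p \<noteq> q" using p by auto
  have "psi d I (\<lambda>i. sg a (u i)) = psi d id (?s(p := (\<lambda>i. (- 1) * ?s p i)))"
    by (subst psi_transpose, rule psi_cong) (use p other pq in \<open>auto simp: sg_def Transposition.transpose_def\<close>)
  also have "\<dots> = - 1 * psi d id (?s(p := ?s p))" by (rule psi_scale[OF p(1)])
  also have "?s(p := ?s p) = ?s" by (rule fun_upd_triv)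
  also have "psi d id ?s = - psi d id ?v" by (rule psi_swap[OF p(1,2) pq])
  also have "psi d id ?v = psi d I u" by (rule psi_transpose[symmetric])
  finally show ?thesis by simp
qed

text \<open>The positions of the extremal weight vectors \<open>(s\<^sub>1 \<dots> s\<^sub>r)\<^sup>a\<close> applied to \<open>{1, \<dots>, d}\<close>, and the
  intermediate positions inside one more cycle.\<close>

definition ext_rows :: "nat \<Rightarrow> nat \<Rightarrow> nat \<Rightarrow> nat \<Rightarrow> nat" where
  "ext_rows r d a i = (if a + i \<le> r then a + i else 2 * r + 1 - d + i)"

text \<open>The row sets during the cycle after the letter \<open>j\<close> has been processed: the unbarred
  row at \<open>j + 1\<close> has moved to \<open>j\<close>, and the row that crosses from the barred to the
  unbarred side is at position \<open>2 r + 1 - j\<close> until the last letter takes it across.\<close>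

definition mid_rows :: "nat \<Rightarrow> nat \<Rightarrow> nat \<Rightarrow> nat \<Rightarrow> nat \<Rightarrow> nat" where
  "mid_rows r d a j i = (if a + i \<le> r then (if a + i \<le> j + 1 then a + i - 1 else a + i)
     else if a + i = r + 1 \<and> a + d \<le> r + j then 2 * r + 1 - j else 2 * r + 1 - d + i)"

lemma psi_lift_step:
  assumes a: "1 \<le> a" "a \<le> r" and d: "1 \<le> d" "d < r" and j: "1 \<le> j" "j < r"
  shows "psi d (mid_rows r d a (j - 1)) (\<lambda>i. vw r (lift_word [j]) (u i)) = psi d (mid_rows r d a j) u"
proof -
  define q where "q = 2 * r + 1 - j"
  have q: "2 * r + 1 - j = q" "q + j = 2 * r + 1" using j by (auto simp: q_def)
  define J where "J i = (if a + i \<le> r then mid_rows r d a j i else mid_rows r d a (j - 1) i)" for i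
  let ?I = "mid_rows r d a (j - 1)"
  have "psi d ?I (\<lambda>i. sg j (sg q (u i))) = psi d J (\<lambda>i. sg q (u i))"
  proof (cases "j + 1 > a \<and> j + 1 \<le> a + d")
    case True
    show ?thesis
      by (rule psi_sg_one[of "j + 1 - a"]) (use True a d j in \<open>auto simp: mid_rows_def J_def\<close>)
  next
    case False
    have "psi d ?I (\<lambda>i. sg j (sg q (u i))) = psi d ?I (\<lambda>i. sg q (u i))"
      by (rule psi_sg_none) (use False a d j in \<open>auto simp: mid_rows_def\<close>)
    also have "\<dots> = psi d J (\<lambda>i. sg q (u i))"
      by (rule psi_cong) (use False a d j in \<open>auto simp: mid_rows_def J_def\<close>)
    finally show ?thesis .
  qed
  also have "\<dots> = psi d (mid_rows r d a j) u"
  proof (cases "a + d \<le> r")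
    case True
    have "psi d J (\<lambda>i. sg q (u i)) = psi d J u"
      by (rule psi_sg_none) (use True a d j q in \<open>auto simp: mid_rows_def J_def\<close>)
    also have "\<dots> = psi d (mid_rows r d a j) u"
      by (rule psi_cong) (use True in \<open>auto simp: J_def\<close>)
    finally show ?thesis .
  next
    case False
    show ?thesis
    proof (cases "a + d \<le> r + j")
      case True
      show ?thesis
        by (rule psi_sg_one[of "r + 1 - a"]) (use True False a d j q in \<open>auto simp: mid_rows_def J_def\<close>)
    next
      case F2: False
      have "psi d J (\<lambda>i. sg q (u i)) = psi d J u"
        by (rule psi_sg_both[of "d - j" _ "d + 1 - j"]) (use F2 False a d j q in \<open>auto simp: mid_rows_def J_def\<close>)
      also have "\<dots> = psi d (mid_rows r d a j) u"
        by (rule psi_cong) (use F2 False in \<open>auto simp: J_def mid_rows_def\<close>)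
      finally show ?thesis .
    qed
  qed
  finally show ?thesis unfolding lift_vw_short[OF j] q .
qed

lemma lift_word_append: "lift_word (v @ w) = lift_word v @ lift_word w"
  by (simp add: lift_word_def)

lemma psi_lift_initial:
  assumes a: "1 \<le> a" "a \<le> r" and d: "1 \<le> d" "d < r" and j: "j < r"
  shows "psi d (ext_rows r d a) (\<lambda>i. vw r (lift_word [1..<j + 1]) (u i)) = psi d (mid_rows r d a j) u"
  using j
proof (induction j arbitrary: u)
  case 0
  have "psi d (ext_rows r d a) u = psi d (mid_rows r d a 0) u"
    by (rule psi_cong) (use a d in \<open>auto simp: ext_rows_def mid_rows_def\<close>)
  then show ?case by (simp add: lift_word_def)
next
  case (Suc j)
  have w: "lift_word [1..<Suc j + 1] = lift_word [1..<j + 1] @ lift_word [Suc j]"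
    by (simp add: lift_word_append[symmetric])
  have "psi d (ext_rows r d a) (\<lambda>i. vw r (lift_word [1..<Suc j + 1]) (u i)) =
      psi d (mid_rows r d a j) (\<lambda>i. vw r (lift_word [Suc j]) (u i))"
    unfolding w vw_append by (rule Suc.IH) (use Suc.prems in simp)
  also have "\<dots> = psi d (mid_rows r d a (Suc j)) u"
    using psi_lift_step[OF a d, of "Suc j" u] Suc.prems by simp
  finally show ?case .
qed

text \<open>The last letter exchanges the positions \<open>r\<close> and \<open>r + 2\<close> and completes
  the passage of one row.\<close>

lemma psi_lift_cycle:
  assumes a: "1 \<le> a" "a \<le> r" and d: "1 \<le> d" "d < r"
  shows "psi d (ext_rows r d a) (\<lambda>i. vw r (lift_word [1..<r + 1]) (u i)) = psi d (ext_rows r d (a - 1)) u"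
proof -
  have w: "lift_word [1..<r + 1] = lift_word [1..<r - 1 + 1] @ lift_word [r]"
    using a by (simp add: lift_word_append[symmetric])
  have "psi d (ext_rows r d a) (\<lambda>i. vw r (lift_word [1..<r + 1]) (u i)) =
      psi d (mid_rows r d a (r - 1)) (\<lambda>i. vw r (lift_word [r]) (u i))"
    unfolding w vw_append by (rule psi_lift_initial[OF a d]) (use d in simp)
  also have "\<dots> = psi d (ext_rows r d (a - 1)) u"
  proof (rule psi_cong)
    fix i k assume "k \<in> {1..d}"
    then show "vw r (lift_word [r]) (u i) (mid_rows r d a (r - 1) k) = u i (ext_rows r d (a - 1) k)"
      using a d by (subst lift_vw_long) (auto simp: mid_rows_def ext_rows_def)
  qed
  finally show ?thesis .
qed

lemma psi_lift_cyc_word: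
  assumes m: "1 \<le> m" "m \<le> r" and d: "1 \<le> d" "d < r"
  shows "psi d (ext_rows r d m) (\<lambda>i. vw r (lift_word (cyc_word r m d)) (u i)) = psi d id u"
  using m
proof (induction m rule: dec_induct)
  case base
  have "psi d (ext_rows r d 1) (\<lambda>i. vw r (lift_word [1..<d + 1]) (u i)) = psi d (mid_rows r d 1 d) u"
    by (rule psi_lift_initial) (use d base in auto)
  also have "\<dots> = psi d id u"
    by (rule psi_cong) (use d in \<open>auto simp: mid_rows_def\<close>)
  finally have e: "psi d (ext_rows r d 1) (\<lambda>i. vw r (lift_word [1..<d + 1]) (u i)) = psi d id u" .
  have w: "cyc_word r 1 d = [1..<d + 1]" by (simp add: cyc_word_def)
  show ?case unfolding w by (rule e)
next
  case (step m)
  have w: "cyc_word r (Suc m) d = [1..<r + 1] @ cyc_word r m d"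
  proof -
    obtain n where "m = Suc n" using step by (cases m) auto
    then show ?thesis by (simp add: cyc_word_def)
  qed
  have "psi d (ext_rows r d (Suc m)) (\<lambda>i. vw r (lift_word (cyc_word r (Suc m) d)) (u i)) =
      psi d (ext_rows r d (Suc m - 1)) (\<lambda>i. vw r (lift_word (cyc_word r m d)) (u i))"
    unfolding w lift_word_append vw_append by (rule psi_lift_cycle) (use step d in auto)
  also have "\<dots> = psi d id u" unfolding diff_Suc_1 by (rule step.IH) (use step.prems in simp)
  finally show ?case .
qed

section \<open>Elementary factors\<close>

text \<open>The matrix of \<open>x\<^bsub>-a\<^esub>(t)\<close> for the general linear group.\<close>

definition chip :: "nat \<Rightarrow> complex \<Rightarrow> vect \<Rightarrow> vect" where
  "chip a t x = (\<lambda>k. if k = a then x a / t else if k = a + 1 then t * x (a + 1) + x a else x k)"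

text \<open>The matrix of \<open>x\<^bsub>-r\<^esub>(t)\<close> in the three positions that it involves.\<close>

definition midop :: "nat \<Rightarrow> complex \<Rightarrow> vect \<Rightarrow> vect" where
  "midop r t x = (\<lambda>k. if k = r then x r / t ^ 2 else if k = r + 1 then x (r + 1) + x r / t
     else if k = r + 2 then t ^ 2 * x (r + 2) + 2 * t * x (r + 1) + x r else x k)"

definition minus_word :: "nat \<Rightarrow> complex \<Rightarrow> gen list" where
  "minus_word i t = [GF i t, GH i (Ln (inverse t))]"

lemma vw_minus_short:
  assumes i: "1 \<le> i" "i < r" and t: "t \<noteq> 0"
  shows "vw r (minus_word i t) x = chip i t (chip (2 * r + 1 - i) t x)"
proof -
  define q where "q = 2 * r + 1 - i"
  have q: "2 * r + 1 - i = q" "2 * r + 2 - i = q + 1" "q > i + 1" using i by (auto simp: q_def)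
  have e: "exp (Ln (inverse t)) = 1 / t" "exp (- Ln (inverse t)) = t" using t by (simp_all add: exp_minus divide_inverse)
  have H: "vop r (GH i (Ln (inverse t))) x = (\<lambda>k. if k = i \<or> k = q then x k / t else if k = i + 1 \<or> k = q + 1 then t * x k else x k)"
    unfolding vop.simps weight_def q mult_B_def using q(3) i(2) e by (auto simp: fun_eq_iff)
  have F: "vop r (GF i t) x = (\<lambda>k. if k = i + 1 then x (i + 1) + t * x i else if k = q + 1 then x (q + 1) + t * x q else x k)" for x
    unfolding vop.simps uexp_def opF_def[abs_def] q mult_B_def using q(3) i(2) by (auto simp: fun_eq_iff)
  show ?thesis unfolding minus_word_def vw.simps(2) vw.simps(1) H F chip_def q
    using q(3) t by (auto simp: fun_eq_iff)
qed

lemma vw_minus_long: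
  assumes r: "1 \<le> r" and t: "t \<noteq> 0"
  shows "vw r (minus_word r t) x = midop r t x"
proof -
  have q: "2 * r + 1 - r = r + 1" "2 * r + 2 - r = r + 2" by auto
  have e: "exp (Ln (inverse t)) = 1 / t" using t by (simp add: divide_inverse)
  have e2: "exp (Ln (inverse t) * 2) = 1 / t ^ 2" "exp (- (Ln (inverse t) * 2)) = t ^ 2"
    using t e by (simp_all add: exp_double mult.commute exp_minus power_divide)
  have H: "vop r (GH r (Ln (inverse t))) x = (\<lambda>k. if k = r then x r / t ^ 2 else if k = r + 2 then t ^ 2 * x (r + 2) else x k)"
    unfolding vop.simps weight_def q mult_B_def using e2 by (auto simp: fun_eq_iff)
  have F: "vop r (GF r t) x = (\<lambda>k. if k = r + 1 then x (r + 1) + t * x r else if k = r + 2 then x (r + 2) + 2 * t * x (r + 1) + t ^ 2 * x r else x k)" for x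
    unfolding vop.simps uexp_def opF_def[abs_def] q mult_B_def by (auto simp: fun_eq_iff)
  show ?thesis unfolding minus_word_def vw.simps(2) vw.simps(1) H F midop_def
    using t by (auto simp: fun_eq_iff power2_eq_square)
qed

lemma chip_commute: "a + 2 \<le> b \<Longrightarrow> chip a s (chip b t x) = chip b t (chip a s x)"
  by (auto simp: chip_def fun_eq_iff)

lemma chip_midop_commute: "a + 2 \<le> r \<Longrightarrow> chip a s (midop r t x) = midop r t (chip a s x)"
  by (auto simp: chip_def midop_def fun_eq_iff)

section \<open>Rearranging the word into antidiagonals\<close>

lemma foldr_commute:
  "(\<And>y x. y \<in> set ys \<Longrightarrow> f (g y x) = g y (f x)) \<Longrightarrow> f (foldr g ys x) = foldr g ys (f x)"
  by (induction ys) auto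

locale cyclic_minor =
  fixes r m m' d :: nat and Y :: "int \<Rightarrow> nat \<Rightarrow> complex"
  assumes m'_pos: "1 \<le> m'" and m'_le: "m' \<le> m" and m_le: "m \<le> r" and d_pos: "1 \<le> d" and d_less: "d < r"
    and nonzero: "\<And>l j. 1 \<le> l \<Longrightarrow> l \<le> m \<Longrightarrow> 1 \<le> j \<Longrightarrow> j \<le> r \<Longrightarrow> (l = m \<Longrightarrow> j \<le> d) \<Longrightarrow> Y (int l) j \<noteq> 0"
begin

definition yv :: "nat \<Rightarrow> nat \<Rightarrow> complex" where
  "yv l j = Yv Y (int l) j"

lemma yv_zero [simp]: "yv l 0 = 1"
  by (simp add: yv_def Yv_def)

lemma yv_nonzero: "1 \<le> l \<Longrightarrow> l \<le> m \<Longrightarrow> j \<le> r \<Longrightarrow> (l = m \<Longrightarrow> j \<le> d) \<Longrightarrow> yv l j \<noteq> 0"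
  using nonzero[of l j] by (auto simp: yv_def Yv_def)

definition bars :: "nat \<Rightarrow> vect \<Rightarrow> vect" where
  "bars l = foldr (\<lambda>j. chip (2 * r + 1 - j) (yv l j)) [1..<r]"

text \<open>The factors of one cycle that act on the barred positions all commute with those acting on the
  unbarred ones, so they can be collected next to the factor of the last letter.\<close>

definition letter_op :: "nat \<times> nat \<Rightarrow> vect \<Rightarrow> vect" where
  "letter_op = (\<lambda>(l, j). if j < r then chip j (yv l j) else (\<lambda>x. bars l (midop r (yv l r) x)))"

abbreviation ev :: "(nat \<times> nat) list \<Rightarrow> vect \<Rightarrow> vect" where
  "ev \<equiv> foldr letter_op"

definition minus_factors :: "(nat \<times> nat) list \<Rightarrow> gen list" where
  "minus_factors ls = concat (map (\<lambda>(l, j). minus_word j (yv l j)) ls)"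

definition cyc_letters :: "nat \<Rightarrow> nat \<Rightarrow> (nat \<times> nat) list" where
  "cyc_letters l n = concat (map (\<lambda>l. map (Pair l) [1..<r + 1]) [1..<l]) @ map (Pair l) [1..<n + 1]"

lemma minus_factors_append: "minus_factors (v @ w) = minus_factors v @ minus_factors w"
  by (simp add: minus_factors_def)

lemma vw_partial_cycle:
  assumes "1 \<le> l" "l \<le> m" "n < r" "l = m \<Longrightarrow> n \<le> d"
  shows "vw r (minus_factors (map (Pair l) [1..<n + 1])) x =
    foldr (\<lambda>j. chip j (yv l j)) [1..<n + 1] (foldr (\<lambda>j. chip (2 * r + 1 - j) (yv l j)) [1..<n + 1] x)"
  using assms(3,4)
proof (induction n arbitrary: x)
  case 0
  then show ?case by (simp add: minus_factors_def)
next
  case (Suc n)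
  have w: "[1..<Suc n + 1] = [1..<n + 1] @ [Suc n]" by simp
  have nz: "yv l (Suc n) \<noteq> 0" by (rule yv_nonzero) (use assms Suc.prems in auto)
  have 1: "vw r (minus_factors (map (Pair l) [Suc n])) x =
      chip (Suc n) (yv l (Suc n)) (chip (2 * r + 1 - Suc n) (yv l (Suc n)) x)"
    using vw_minus_short[OF _ _ nz] Suc.prems by (simp add: minus_factors_def)
  have 2: "chip (Suc n) (yv l (Suc n)) (foldr (\<lambda>j. chip (2 * r + 1 - j) (yv l j)) [1..<n + 1] x) =
      foldr (\<lambda>j. chip (2 * r + 1 - j) (yv l j)) [1..<n + 1] (chip (Suc n) (yv l (Suc n)) x)" for x
    by (rule foldr_commute, rule chip_commute) (use Suc.prems in auto)
  show ?case
    unfolding w map_append minus_factors_append vw_append 1 foldr_append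
    by (subst Suc.IH) (use Suc.prems 2 in simp_all)
qed

lemma letter_op_short: "j < r \<Longrightarrow> letter_op (l, j) = chip j (yv l j)"
  by (simp add: letter_op_def)

lemma vw_full_cycle:
  assumes "1 \<le> l" "l < m"
  shows "vw r (minus_factors (map (Pair l) [1..<r + 1])) x = ev (map (Pair l) [1..<r + 1]) x"
proof -
  have r: "1 \<le> r" using d_less by simp
  then have w: "[1..<r + 1] = [1..<r - 1 + 1] @ [r]" by simp
  have nz: "yv l r \<noteq> 0" by (rule yv_nonzero) (use assms in auto)
  have 1: "vw r (minus_factors (map (Pair l) [r])) x = midop r (yv l r) x"
    using vw_minus_long[OF r nz] by (simp add: minus_factors_def)
  have 2: "ev (map (Pair l) [1..<r - 1 + 1]) y = foldr (\<lambda>j. chip j (yv l j)) [1..<r - 1 + 1] y" for y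
    unfolding foldr_map o_def by (rule foldr_cong) (use r in \<open>auto simp: letter_op_short\<close>)
  have 3: "letter_op (l, r) y = foldr (\<lambda>j. chip (2 * r + 1 - j) (yv l j)) [1..<r - 1 + 1] (midop r (yv l r) y)" for y
    using r by (simp add: letter_op_def bars_def)
  show ?thesis
    unfolding w map_append minus_factors_append vw_append 1 foldr_append 2
    by (subst vw_partial_cycle) (use assms r 3 in auto)
qed

lemma chip_delta: "k \<noteq> a \<Longrightarrow> k \<noteq> a + 1 \<Longrightarrow> chip a t (delta k) = delta k"
  by (auto simp: chip_def delta_def fun_eq_iff)

lemma foldr_fixed: "(\<And>y. y \<in> set ys \<Longrightarrow> g y x = x) \<Longrightarrow> foldr g ys x = x"
  by (induction ys) auto

lemma ev_append: "ev (v @ w) x = ev v (ev w x)"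
  by simp

lemma vw_cyc_letters:
  assumes a: "1 \<le> a" "a \<le> d"
  shows "vw r (minus_factors (cyc_letters m d)) (delta a) = ev (cyc_letters m d) (delta a)"
proof -
  have 1: "vw r (minus_factors (concat (map (\<lambda>l. map (Pair l) [1..<r + 1]) [1..<l]))) x =
      ev (concat (map (\<lambda>l. map (Pair l) [1..<r + 1]) [1..<l])) x" if "1 \<le> l" "l \<le> m" for l x
    using that
  proof (induction l arbitrary: x rule: dec_induct)
    case base
    then show ?case by (simp add: minus_factors_def)
  next
    case (step l)
    have w: "[1..<Suc l] = [1..<l] @ [l]" using step by simp
    have u: "concat (map (\<lambda>l. map (Pair l) [1..<r + 1]) [1..<Suc l]) =
        concat (map (\<lambda>l. map (Pair l) [1..<r + 1]) [1..<l]) @ map (Pair l) [1..<r + 1]"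
      unfolding w by simp
    show ?case unfolding u minus_factors_append vw_append ev_append
      by (subst vw_full_cycle) (use step in auto)
  qed
  have 2: "vw r (minus_factors (map (Pair m) [1..<d + 1])) (delta a) = ev (map (Pair m) [1..<d + 1]) (delta a)"
  proof -
    have "foldr (\<lambda>j. chip (2 * r + 1 - j) (yv m j)) [1..<d + 1] (delta a) = delta a"
      by (rule foldr_fixed, rule chip_delta) (use a d_less in auto)
    moreover have "ev (map (Pair m) [1..<d + 1]) (delta a) = foldr (\<lambda>j. chip j (yv m j)) [1..<d + 1] (delta a)"
      unfolding foldr_map o_def by (rule foldr_cong) (use d_less in \<open>auto simp: letter_op_short\<close>)
    moreover have "1 \<le> m" using m'_pos m'_le by simp
    ultimately show ?thesis using vw_partial_cycle[of m d "delta a"] d_less by simp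
  qed
  have "1 \<le> m" using m'_pos m'_le by simp
  then show ?thesis unfolding cyc_letters_def minus_factors_append vw_append ev_append 2 by (intro 1) auto
qed

text \<open>The antidiagonal \<open>l + j = c\<close> of the letters \<open>(l, j)\<close> with \<open>l \<le> w j\<close>.\<close>

definition antidiag :: "(nat \<Rightarrow> nat) \<Rightarrow> nat \<Rightarrow> (nat \<times> nat) list" where
  "antidiag w c = map (\<lambda>j. (c - j, j)) (filter (\<lambda>j. j < c \<and> c - j \<le> w j) (rev [1..<r + 1]))"

definition antidiags :: "(nat \<Rightarrow> nat) \<Rightarrow> nat \<Rightarrow> nat \<Rightarrow> (nat \<times> nat) list" where
  "antidiags w b c = concat (map (antidiag w) [b..<c])"

lemma set_antidiag: "set (antidiag w c) = {(c - j, j) | j. 1 \<le> j \<and> j \<le> r \<and> j < c \<and> c - j \<le> w j}"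
  by (auto simp: antidiag_def)

lemma antidiag_cong: "(\<And>j. 1 \<le> j \<Longrightarrow> j \<le> r \<Longrightarrow> j < c \<Longrightarrow> c - j \<le> w j \<longleftrightarrow> c - j \<le> w' j) \<Longrightarrow> antidiag w c = antidiag w' c"
  unfolding antidiag_def by (intro arg_cong[of _ _ "map _"] filter_cong) auto

lemma antidiags_split: "b \<le> c \<Longrightarrow> c \<le> e \<Longrightarrow> antidiags w b e = antidiags w b c @ antidiags w c e"
  unfolding antidiags_def using upt_add_eq_append[of b c "e - c"] by simp

lemma letter_op_commute:
  assumes "j + 2 \<le> j'" "j' \<le> r"
  shows "letter_op (l, j) (letter_op (l', j') x) = letter_op (l', j') (letter_op (l, j) x)"
proof (cases "j' < r")
  case True
  then show ?thesis using assms by (simp add: letter_op_short chip_commute[OF assms(1)])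
next
  case False
  then have j': "j' = r" using assms by simp
  have 1: "chip j t (bars l' y) = bars l' (chip j t y)" for t y
    unfolding bars_def by (rule foldr_commute, rule chip_commute) (use assms j' in auto)
  have "j < r" "j + 2 \<le> r" using assms by auto
  then show ?thesis unfolding letter_op_short[OF \<open>j < r\<close>] by (simp add: letter_op_def j' 1 chip_midop_commute)
qed

text \<open>The new letter belongs to the antidiagonal \<open>w j + 1 + j\<close>, at its right end because
  the letters \<open>i < j\<close> are missing there; every letter of a later antidiagonal exceeds \<open>j
  + 1\<close> and commutes with it.\<close>

lemma antidiags_add_letter:
  assumes j: "1 \<le> j" "j \<le> r" and left: "\<And>i. 1 \<le> i \<Longrightarrow> i < j \<Longrightarrow> w i \<le> Suc (w j)"
    and right: "\<And>i. j < i \<Longrightarrow> i \<le> r \<Longrightarrow> w i \<le> w j" and c: "Suc (w j) + j < e"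
  shows "ev (antidiags (w(j := Suc (w j))) 2 e) x = ev (antidiags w 2 e) (letter_op (Suc (w j), j) x)"
proof -
  let ?v = "w(j := Suc (w j))" and ?c = "Suc (w j) + j"
  have same: "antidiag ?v b = antidiag w b" if "b \<noteq> ?c" for b
    by (rule antidiag_cong) (use that in auto)
  have new: "antidiag ?v ?c = antidiag w ?c @ [(Suc (w j), j)]"
  proof -
    have s: "[1..<r + 1] = [1..<j] @ j # [j + 1..<r + 1]"
      using j upt_add_eq_append[of 1 j "r + 1 - j"] by (simp add: upt_conv_Cons)
    have f: "filter (\<lambda>i. i < ?c \<and> ?c - i \<le> w i) (rev [1..<j]) = []"
      "filter (\<lambda>i. i < ?c \<and> ?c - i \<le> ?v i) (rev [1..<j]) = []"
      using left by (force simp: filter_empty_conv)+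
    have g: "filter (\<lambda>i. i < ?c \<and> ?c - i \<le> ?v i) (rev [j + 1..<r + 1]) =
        filter (\<lambda>i. i < ?c \<and> ?c - i \<le> w i) (rev [j + 1..<r + 1])"
      by (rule filter_cong) auto
    show ?thesis unfolding antidiag_def s rev_append rev.simps filter_append f g by simp
  qed
  have sp: "antidiags u 2 e = antidiags u 2 ?c @ antidiag u ?c @ antidiags u (Suc ?c) e" for u
  proof -
    have "antidiags u ?c e = antidiag u ?c @ antidiags u (Suc ?c) e"
      unfolding antidiags_def using c by (simp add: upt_conv_Cons)
    moreover have "antidiags u 2 e = antidiags u 2 ?c @ antidiags u ?c e"
      by (rule antidiags_split) (use j c in auto)
    ultimately show ?thesis by simp
  qed
  have lo: "antidiags ?v 2 ?c = antidiags w 2 ?c"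
    unfolding antidiags_def by (intro arg_cong[of _ _ concat] map_cong refl same) auto
  have hi: "antidiags ?v (Suc ?c) e = antidiags w (Suc ?c) e"
    unfolding antidiags_def by (intro arg_cong[of _ _ concat] map_cong refl same) auto
  have com: "letter_op (Suc (w j), j) (ev (antidiags w (Suc ?c) e) x) = ev (antidiags w (Suc ?c) e) (letter_op (Suc (w j), j) x)"
  proof (rule foldr_commute)
    fix p x assume "p \<in> set (antidiags w (Suc ?c) e)"
    then obtain b i where b: "Suc ?c \<le> b" "p = (b - i, i)" "1 \<le> i" "i \<le> r" "i < b" "b - i \<le> w i"
      by (auto simp: antidiags_def set_antidiag)
    have "j + 2 \<le> i"
    proof -
      have "\<not> i < j" using left[of i] b by auto
      moreover have "i \<noteq> j" using b by auto
      ultimately have "w i \<le> w j" using right[of i] b by auto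
      then show ?thesis using b by auto
    qed
    then show "letter_op (Suc (w j), j) (letter_op p x) = letter_op p (letter_op (Suc (w j), j) x)"
      unfolding b(2) by (rule letter_op_commute) (rule b)
  qed
  show ?thesis unfolding sp lo hi new by (simp only: foldr_append o_apply foldr.simps id_apply com)
qed

text \<open>The number of occurrences of the letter \<open>j\<close> in the first \<open>l - 1\<close>
  cycles followed by the letters up to \<open>n\<close>.\<close>

definition profile :: "nat \<Rightarrow> nat \<Rightarrow> nat \<Rightarrow> nat" where
  "profile l n j = (if j \<le> n then l else l - 1)"

text \<open>Letters \<open>(l, j)\<close> and \<open>(l', j')\<close> with \<open>\<bar>j - j'\<bar> \<ge> 2\<close> commute, and the remaining pairs occur in the
  same order in both arrangements.\<close>

lemma ev_cyc_letters:
  assumes "1 \<le> l" "l \<le> m" "n \<le> r" "m + r + 1 < e"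
  shows "ev (cyc_letters l n) x = ev (antidiags (profile l n) 2 e) x"
  using assms(1-3)
proof (induction l arbitrary: n x rule: dec_induct)
  case base
  have zero: "ev (cyc_letters 1 0) x = ev (antidiags (profile 1 0) 2 e) x" for x
  proof -
    have "antidiag (profile 1 0) c = []" for c
      by (auto simp: antidiag_def profile_def filter_empty_conv)
    then have "antidiags (profile 1 0) 2 e = []" by (simp only: antidiags_def concat_eq_Nil_conv) auto
    then show ?thesis by (simp add: cyc_letters_def)
  qed
  from base(2) show ?case
  proof (induction n arbitrary: x)
    case 0
    show ?case by (rule zero)
  next
    case (Suc n)
    have c: "cyc_letters 1 (Suc n) = cyc_letters 1 n @ [(1, Suc n)]" by (simp add: cyc_letters_def)
    have p: "profile 1 (Suc n) = (profile 1 n)(Suc n := Suc (profile 1 n (Suc n)))" by (auto simp: profile_def fun_eq_iff)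
    have q: "Suc (profile 1 n (Suc n)) = 1" by (simp add: profile_def)
    have "ev (cyc_letters 1 (Suc n)) x = ev (cyc_letters 1 n) (letter_op (1, Suc n) x)" unfolding c ev_append by simp
    also have "\<dots> = ev (antidiags (profile 1 n) 2 e) (letter_op (1, Suc n) x)" by (rule Suc.IH) (use Suc in simp)
    also have "\<dots> = ev (antidiags (profile 1 (Suc n)) 2 e) x"
      unfolding p by (subst antidiags_add_letter) (use Suc assms in \<open>auto simp only: q, auto simp: profile_def\<close>)
    finally show ?case .
  qed
next
  case (step l)
  have zero: "ev (cyc_letters (Suc l) 0) x = ev (antidiags (profile (Suc l) 0) 2 e) x" for x
  proof -
    have "cyc_letters (Suc l) 0 = cyc_letters l r" using step by (simp add: cyc_letters_def)
    moreover have "antidiags (profile (Suc l) 0) 2 e = antidiags (profile l r) 2 e"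
      unfolding antidiags_def by (intro arg_cong[of _ _ concat] map_cong refl antidiag_cong) (auto simp: profile_def)
    ultimately show ?thesis using step by simp
  qed
  from step(5) show ?case
  proof (induction n arbitrary: x)
    case 0
    show ?case by (rule zero)
  next
    case (Suc n)
    have c: "cyc_letters (Suc l) (Suc n) = cyc_letters (Suc l) n @ [(Suc l, Suc n)]" by (simp add: cyc_letters_def)
    have p: "profile (Suc l) (Suc n) = (profile (Suc l) n)(Suc n := Suc (profile (Suc l) n (Suc n)))"
      using step by (auto simp: profile_def fun_eq_iff)
    have q: "Suc (profile (Suc l) n (Suc n)) = Suc l" using step by (simp add: profile_def)
    have "ev (cyc_letters (Suc l) (Suc n)) x = ev (cyc_letters (Suc l) n) (letter_op (Suc l, Suc n) x)" by (simp add: c)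
    also have "\<dots> = ev (antidiags (profile (Suc l) n) 2 e) (letter_op (Suc l, Suc n) x)" by (rule Suc.IH) (use Suc in simp)
    also have "\<dots> = ev (antidiags (profile (Suc l) (Suc n)) 2 e) x"
      unfolding p by (subst antidiags_add_letter) (use Suc step assms in \<open>auto simp only: q, auto simp: profile_def\<close>)
    finally show ?case .
  qed
qed

end

section \<open>The matrix of an antidiagonal\<close>

definition linear_op :: "(vect \<Rightarrow> vect) \<Rightarrow> bool" where
  "linear_op X \<longleftrightarrow> (\<forall>x y c. X (\<lambda>k. x k + c * y k) = (\<lambda>k. X x k + c * X y k))"

lemma linear_op_chip: "linear_op (chip a t)"
  by (auto simp: linear_op_def chip_def fun_eq_iff algebra_simps add_divide_distrib)

lemma linear_op_midop: "linear_op (midop r t)"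
  by (auto simp: linear_op_def midop_def fun_eq_iff algebra_simps add_divide_distrib)

lemma linear_op_foldr: "(\<And>y. y \<in> set ys \<Longrightarrow> linear_op (g y)) \<Longrightarrow> linear_op (foldr g ys)"
  by (induction ys) (simp_all add: linear_op_def)

lemma linear_op_sum:
  assumes X: "linear_op X" and "finite S"
  shows "X (\<lambda>k. \<Sum>b\<in>S. g b * x b k) = (\<lambda>k. \<Sum>b\<in>S. g b * X (x b) k)"
  using assms(2)
proof (induction S rule: finite_induct)
  case empty
  have "X (\<lambda>k. 0 + (- 1) * 0) = (\<lambda>k. X (\<lambda>_. 0) k + (- 1) * X (\<lambda>_. 0) k)"
    using X[unfolded linear_op_def, rule_format, of "\<lambda>_. 0" "- 1" "\<lambda>_. 0"] .
  then show ?case by simp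
next
  case (insert s S)
  have "X (\<lambda>k. (\<Sum>b\<in>S. g b * x b k) + g s * x s k) = (\<lambda>k. X (\<lambda>k. \<Sum>b\<in>S. g b * x b k) k + g s * X (x s) k)"
    using X[unfolded linear_op_def, rule_format, of "\<lambda>k. \<Sum>b\<in>S. g b * x b k" "g s" "x s"] .
  then show ?case unfolding sum.insert[OF insert.hyps(1,2)] insert.IH by (simp add: add.commute)
qed

context cyclic_minor
begin

text \<open>The positions on which the antidiagonal \<open>c\<close> acts; they reach the barred ones as
  soon as it contains the letter \<open>r\<close>.\<close>

definition lowest :: "nat \<Rightarrow> nat" where
  "lowest c = max 1 (c - m)"

definition highest :: "nat \<Rightarrow> nat" where
  "highest c = (if c \<le> r then c else 2 * r + 1)"

definition param :: "nat \<Rightarrow> nat \<Rightarrow> complex" where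
  "param c a = (if a < r then yv (c - a) a else if a \<le> r + 1 then yv (c - r) r else yv (c - r) (2 * r + 1 - a))"

text \<open>Position \<open>r + 1\<close> is passed together with position \<open>r\<close>.\<close>

definition slice_step :: "nat \<Rightarrow> nat \<Rightarrow> vect \<Rightarrow> vect" where
  "slice_step c a = (if a = r then midop r (param c r) else if a = r + 1 then (\<lambda>x. x) else chip a (param c a))"

definition slice :: "nat \<Rightarrow> vect \<Rightarrow> vect" where
  "slice c = foldr (slice_step c) (rev [lowest c..<highest c])"

lemma linear_op_slice: "linear_op (slice c)"
  unfolding slice_def
  by (rule linear_op_foldr) (simp add: slice_step_def linear_op_chip linear_op_midop, simp add: linear_op_def)

lemma lowest_bounds: "1 \<le> lowest c" "c \<le> m + d \<Longrightarrow> lowest c \<le> d"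
  using d_pos by (auto simp: lowest_def)

text \<open>Applied from right to left, the letters of an antidiagonal increase; the barred factors, which
  belong to the letter \<open>r\<close>, come last and continue the sequence of positions from \<open>r +
  2\<close> to \<open>2 r\<close>.\<close>

lemma antidiag_slice:
  assumes c: "2 \<le> c" "c \<le> m + d"
  shows "ev (antidiag (profile m d) c) x = slice c x"
proof -
  let ?w = "profile m d"
  have lo: "1 \<le> lowest c" "lowest c \<le> d" "lowest c < c" using lowest_bounds c m'_pos m'_le by (auto simp: lowest_def)
  have f: "filter (\<lambda>j. j < c \<and> c - j \<le> ?w j) [1..<r + 1] = [lowest c..<min c (r + 1)]"
  proof (rule sorted_distinct_set_unique)
    show "set (filter (\<lambda>j. j < c \<and> c - j \<le> ?w j) [1..<r + 1]) = set [lowest c..<min c (r + 1)]"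
      using c m'_pos m'_le d_less by (auto simp: profile_def lowest_def split: if_splits)
  qed (auto intro!: sorted_wrt_filter simp del: upt_Suc)
  have a: "antidiag ?w c = map (\<lambda>j. (c - j, j)) (rev [lowest c..<min c (r + 1)])"
    unfolding antidiag_def rev_filter[symmetric] f ..
  have short: "letter_op (c - j, j) = slice_step c j" if "j < r" for j
    using that by (simp add: letter_op_short slice_step_def param_def)
  show ?thesis
  proof (cases "c \<le> r")
    case True
    then have "ev (antidiag ?w c) x = foldr (\<lambda>j. letter_op (c - j, j)) (rev [lowest c..<c]) x"
      unfolding a by (simp add: foldr_map o_def min_def)
    also have "\<dots> = slice c x"
      unfolding slice_def highest_def if_P[OF True] by (intro foldr_cong refl) (use True in \<open>auto simp: short\<close>)
    finally show ?thesis .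
  next
    case False
    have m1: "min c (r + 1) = r + 1" using False by auto
    have s: "[lowest c..<r + 1] = [lowest c..<r] @ [r]" using lo d_less by simp
    have h: "[lowest c..<highest c] = [lowest c..<r] @ [r, r + 1] @ [r + 2..<2 * r + 1]"
    proof -
      have "[lowest c..<highest c] = [lowest c..<r] @ [r..<2 * r + 1]"
        using False lo d_less upt_add_eq_append[of "lowest c" r "r + 1"] by (simp add: highest_def mult_2)
      moreover have "[r..<2 * r + 1] = [r, r + 1] @ [r + 2..<2 * r + 1]"
        using d_less by (simp add: upt_conv_Cons del: upt_Suc)
      ultimately show ?thesis by simp
    qed
    have b: "rev [r + 2..<2 * r + 1] = map (\<lambda>j. 2 * r + 1 - j) [1..<r]"
      by (rule nth_equalityI) (auto simp: rev_nth simp del: upt_Suc)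
    have bar: "foldr (slice_step c) (rev [r + 2..<2 * r + 1]) y = bars (c - r) y" for y
      unfolding b foldr_map bars_def
    proof (rule foldr_cong[OF refl refl])
      fix z :: vect and j assume "j \<in> set [1..<r]"
      then have "1 \<le> j" "j < r" by auto
      moreover define q where "q = 2 * r + 1 - j"
      ultimately have "r + 1 < q" "2 * r + 1 - q = j" by auto
      then have "slice_step c q = chip q (yv (c - r) j)" by (simp add: slice_step_def param_def)
      then show "(slice_step c \<circ> (\<lambda>j. 2 * r + 1 - j)) j z = chip (2 * r + 1 - j) (yv (c - r) j) z"
        by (simp only: o_apply q_def)
    qed
    have e: "ev (antidiag ?w c) x = letter_op (c - r, r) (foldr (\<lambda>j. letter_op (c - j, j)) (rev [lowest c..<r]) x)"
      unfolding a m1 s by (simp add: foldr_map o_def)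
    have i: "foldr (\<lambda>j. letter_op (c - j, j)) (rev [lowest c..<r]) x = foldr (slice_step c) (rev [lowest c..<r]) x"
      by (intro foldr_cong refl) (auto simp: short)
    have l: "letter_op (c - r, r) y = bars (c - r) (midop r (yv (c - r) r) y)" for y by (simp add: letter_op_def)
    have t: "slice_step c (r + 1) y = y" "slice_step c r y = midop r (yv (c - r) r) y" for y
      by (simp_all add: slice_step_def param_def)
    show ?thesis unfolding e i l slice_def h rev_append foldr_append by (simp only: o_apply bar rev.simps foldr.simps append.simps id_apply t)
  qed
qed

lemma ev_concat: "ev (concat (map f cs)) x = foldr (\<lambda>c. ev (f c)) cs x"
  by (induction cs) auto

lemma midop_delta: "a < r \<Longrightarrow> midop r t (delta a) = delta a"
  by (auto simp: midop_def delta_def fun_eq_iff)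

lemma letter_op_delta: "a < j \<Longrightarrow> j \<le> r \<Longrightarrow> letter_op (l, j) (delta a) = delta a"
proof (cases "j < r")
  case False
  moreover assume "a < j" "j \<le> r"
  ultimately have j: "j = r" "a < r" by auto
  have "bars l (delta a) = delta a"
    unfolding bars_def by (rule foldr_fixed, rule chip_delta) (use j in auto)
  then show ?thesis using j by (simp add: letter_op_def midop_delta)
qed (simp add: letter_op_short chip_delta)

text \<open>The antidiagonals beyond \<open>m + d\<close> only contain letters exceeding \<open>d + 1\<close>.\<close>

lemma vw_slices:
  assumes a: "1 \<le> a" "a \<le> d"
  shows "vw r (minus_factors (cyc_letters m d)) (delta a) = foldr slice [2..<m + d + 1] (delta a)"
proof -
  let ?w = "profile m d" and ?e = "m + r + 2"
  have m: "1 \<le> m" using m'_pos m'_le by simp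
  have "vw r (minus_factors (cyc_letters m d)) (delta a) = ev (cyc_letters m d) (delta a)"
    by (rule vw_cyc_letters[OF a])
  also have "\<dots> = ev (antidiags ?w 2 ?e) (delta a)"
    by (rule ev_cyc_letters) (use m d_less in auto)
  also have "\<dots> = ev (antidiags ?w 2 (m + d + 1)) (ev (antidiags ?w (m + d + 1) ?e) (delta a))"
    by (subst antidiags_split[of 2 "m + d + 1" ?e]) (use m d_less in auto)
  also have "ev (antidiags ?w (m + d + 1) ?e) (delta a) = delta a"
  proof (rule foldr_fixed)
    fix p assume "p \<in> set (antidiags ?w (m + d + 1) ?e)"
    then obtain b where b0: "m + d + 1 \<le> b" "p \<in> set (antidiag ?w b)"
      unfolding antidiags_def set_concat set_map set_upt by auto
    then obtain j where b: "m + d + 1 \<le> b" "p = (b - j, j)" "j \<le> r" "j < b" "b - j \<le> ?w j"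
      unfolding set_antidiag by auto
    then have "d < j" by (auto simp: profile_def split: if_splits)
    then show "letter_op p (delta a) = delta a" unfolding b(2) by (intro letter_op_delta) (use a b in auto)
  qed
  also have "ev (antidiags ?w 2 (m + d + 1)) (delta a) = foldr slice [2..<m + d + 1] (delta a)"
    unfolding antidiags_def ev_concat
    by (rule foldr_cong) (auto simp: fun_eq_iff antidiag_slice simp del: upt_Suc)
  finally show ?thesis .
qed

definition leave_raw :: "nat \<Rightarrow> nat \<Rightarrow> complex" where
  "leave_raw c p = (if p \<le> r then yv (c + 1 - p) (p - 1) else if p = r + 1 then yv (c - r) r
     else if p = r + 2 then yv (c - r) r ^ 2 else yv (c - r) (2 * r + 2 - p))"

definition arrive_raw :: "nat \<Rightarrow> nat \<Rightarrow> complex" where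
  "arrive_raw c p = (if p < r then 1 / yv (c - p) p else if p = r then 1 / yv (c - r) r ^ 2
     else if p = r + 1 then 1 / yv (c - r) r else 1 / yv (c - r) (2 * r + 1 - p))"

text \<open>Each factor splits the coefficient at the end of the support between this position and the next
  one. The end is \<open>r + 2\<close> right after the letter \<open>r\<close>.\<close>

lemma slice_stage:
  assumes lo: "1 \<le> lowest c" "lowest c < r" and n: "lowest c \<le> n" "n \<le> 2 * r + 1"
    and nz: "r < n \<Longrightarrow> yv (c - r) r \<noteq> 0"
  defines "E \<equiv> (\<lambda>n. if n = r + 1 then r + 2 else n)"
  shows "foldr (slice_step c) (rev [lowest c..<n]) (delta a) =
    (if a < lowest c \<or> E n < a then delta a else (\<lambda>k. (if a = lowest c then 1 else leave_raw c a) *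
      (if a \<le> k \<and> k \<le> E n then (if k = E n then 1 else arrive_raw c k) * (if a = r + 1 \<and> k \<noteq> r + 1 then 2 else 1) else 0)))"
  using n nz
proof (induction n rule: dec_induct)
  case base
  then show ?case using lo by (auto simp: E_def delta_def fun_eq_iff)
next
  case (step n)
  let ?F = "\<lambda>n k. (if a = lowest c then 1 else leave_raw c a) *
      (if a \<le> k \<and> k \<le> E n then (if k = E n then 1 else arrive_raw c k) * (if a = r + 1 \<and> k \<noteq> r + 1 then 2 else 1) else 0)"
  have s: "rev [lowest c..<Suc n] = n # rev [lowest c..<n]" using step by simp
  have IH: "foldr (slice_step c) (rev [lowest c..<n]) (delta a) =
      (if a < lowest c \<or> E n < a then delta a else ?F n)"
    by (rule step.IH) (use step in auto)
  have chip: "chip n t (if a < lowest c \<or> E n < a then delta a else ?F n) = (if a < lowest c \<or> E (Suc n) < a then delta a else ?F (Suc n))"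
    if t: "arrive_raw c n = 1 / t" "leave_raw c (Suc n) = t" and E: "E n = n" "E (Suc n) = Suc n" "n \<noteq> r + 1" "n \<noteq> r" for t
    using step(1) E(3,4) unfolding E(1,2)
    by (cases "a = Suc n") (auto simp: chip_def delta_def fun_eq_iff t)
  consider "n < r" | "n = r" | "n = r + 1" | "n \<ge> r + 2" by linarith
  then show ?case
  proof cases
    case 1
    then have E: "E n = n" "E (Suc n) = Suc n" by (auto simp: E_def)
    have S: "slice_step c n = chip n (yv (c - n) n)" using 1 by (simp add: slice_step_def param_def)
    show ?thesis
      unfolding s foldr.simps o_apply IH S by (rule chip) (use 1 E in \<open>auto simp: arrive_raw_def leave_raw_def\<close>)
  next
    case 2
    have E: "E n = r" "E (Suc n) = r + 2" using 2 by (auto simp: E_def)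
    have S: "slice_step c n = midop r (yv (c - r) r)" using 2 by (simp add: slice_step_def param_def)
    have nz': "yv (c - r) r \<noteq> 0" using step 2 by simp
    have v: "arrive_raw c r = 1 / yv (c - r) r ^ 2" "arrive_raw c (r + 1) = 1 / yv (c - r) r"
      "leave_raw c (r + 1) = yv (c - r) r" "leave_raw c (r + 2) = yv (c - r) r ^ 2"
      by (simp_all add: arrive_raw_def leave_raw_def)
    show ?thesis
      unfolding s foldr.simps o_apply IH S unfolding E
    proof (rule ext)
      fix k
      consider "a < lowest c" | "a > r + 2" | "a = r + 2" | "a = r + 1" | "lowest c \<le> a" "a \<le> r" by linarith
      then show "midop r (yv (c - r) r) (if a < lowest c \<or> r < a then delta a else (\<lambda>k. (if a = lowest c then 1 else leave_raw c a) *
          (if a \<le> k \<and> k \<le> r then (if k = r then 1 else arrive_raw c k) * (if a = r + 1 \<and> k \<noteq> r + 1 then 2 else 1) else 0))) k =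
        (if a < lowest c \<or> r + 2 < a then delta a else (\<lambda>k. (if a = lowest c then 1 else leave_raw c a) *
          (if a \<le> k \<and> k \<le> r + 2 then (if k = r + 2 then 1 else arrive_raw c k) * (if a = r + 1 \<and> k \<noteq> r + 1 then 2 else 1) else 0))) k"
      proof cases
        case 5
        then show ?thesis using lo v by (auto simp: midop_def)
      next
        case 4
        then show ?thesis using lo v nz' by (auto simp: midop_def delta_def)
      next
        case 3
        then show ?thesis using lo v nz' by (auto simp: midop_def delta_def)
      qed (use lo in \<open>auto simp: midop_def delta_def\<close>)
    qed
  next
    case 3
    then have E: "E (Suc n) = E n" and S: "slice_step c n = (\<lambda>x. x)" by (auto simp: E_def slice_step_def)
    show ?thesis unfolding s foldr.simps o_apply IH E S ..
  next
    case 4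
    then have E: "E n = n" "E (Suc n) = Suc n" by (auto simp: E_def)
    have S: "slice_step c n = chip n (yv (c - r) (2 * r + 1 - n))" using 4 by (simp add: slice_step_def param_def)
    show ?thesis
      unfolding s foldr.simps o_apply IH S by (rule chip) (use 4 E in \<open>auto simp: arrive_raw_def leave_raw_def\<close>)
  qed
qed

text \<open>A particle at \<open>p\<close> contributes \<open>leave c p\<close> when the antidiagonal \<open>c\<close> is applied to it, and \<open>arrive c p\<close>
  when the antidiagonal \<open>c\<close> has brought it to \<open>p\<close>.\<close>

definition leave :: "nat \<Rightarrow> nat \<Rightarrow> complex" where
  "leave c p = (if p \<le> lowest c \<or> highest c < p then 1 else leave_raw c p)"

definition arrive :: "nat \<Rightarrow> nat \<Rightarrow> complex" where
  "arrive c p = (if p < lowest c \<or> highest c < p \<or> (p = highest c \<and> c \<le> r) then 1 else arrive_raw c p)"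

definition active :: "nat \<Rightarrow> nat \<Rightarrow> bool" where
  "active c p \<longleftrightarrow> lowest c \<le> p \<and> p \<le> highest c"

text \<open>Up to the factor \<open>leave c a\<close>, the image of the basis vector at \<open>a\<close>
  under the antidiagonal \<open>c\<close>. Inactive positions are fixed.\<close>

definition column :: "nat \<Rightarrow> nat \<Rightarrow> vect" where
  "column c a = (if active c a then (\<lambda>k. if a \<le> k \<and> k \<le> highest c
      then arrive c k * (if a = r + 1 \<and> k \<noteq> r + 1 then 2 else 1) else 0) else delta a)"

lemma slice_delta:
  assumes c: "2 \<le> c" "c \<le> m + d"
  shows "slice c (delta a) = (\<lambda>k. leave c a * column c a k)"
proof -
  have lo: "1 \<le> lowest c" "lowest c < r" using lowest_bounds[of c] c d_less by auto
  have h: "lowest c \<le> highest c" "highest c \<le> 2 * r + 1" using lo c by (auto simp: highest_def lowest_def)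
  have nz: "yv (c - r) r \<noteq> 0" if "r < highest c"
  proof -
    have "r < c" using that by (auto simp: highest_def split: if_splits)
    then show ?thesis using c d_less m_le by (intro yv_nonzero) auto
  qed
  have E: "(if highest c = r + 1 then r + 2 else highest c) = highest c" using lo by (auto simp: highest_def)
  have v: "(if k = highest c then 1 else arrive_raw c k) = arrive c k" if "lowest c \<le> k" "k \<le> highest c" for k
    using that d_less by (auto simp: arrive_def arrive_raw_def highest_def split: if_splits)
  have "slice c (delta a) = (if a < lowest c \<or> highest c < a then delta a else (\<lambda>k. (if a = lowest c then 1 else leave_raw c a) *
      (if a \<le> k \<and> k \<le> highest c then (if k = highest c then 1 else arrive_raw c k) * (if a = r + 1 \<and> k \<noteq> r + 1 then 2 else 1) else 0)))"
    unfolding slice_def using slice_stage[OF lo h nz, of a] unfolding E .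
  also have "\<dots> = (\<lambda>k. leave c a * column c a k)"
    by (auto simp: fun_eq_iff leave_def column_def active_def v)
  finally show ?thesis .
qed

end

section \<open>Minors as sums over non-intersecting particles\<close>

lemma psi_column_scale: "psi d I (\<lambda>i k. c i * u i k) = (\<Prod>i\<in>{1..d}. c i) * psi d I u"
  unfolding psi_def sum_distrib_left by (intro sum.cong refl) (simp add: prod.distrib)

lemma psi_expand:
  assumes "\<And>i. finite (S i)"
  shows "psi d I (\<lambda>i k. \<Sum>b\<in>S i. g i b * x b k) =
    (\<Sum>f\<in>PiE {1..d} S. (\<Prod>i\<in>{1..d}. g i (f i)) * psi d I (\<lambda>i. x (f i)))"
proof -
  have 1: "(\<Prod>i\<in>{1..d}. \<Sum>b\<in>S i. g i b * x b (I (\<sigma> i))) =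
      (\<Sum>f\<in>PiE {1..d} S. (\<Prod>i\<in>{1..d}. g i (f i)) * (\<Prod>i\<in>{1..d}. x (f i) (I (\<sigma> i))))" for \<sigma>
    by (subst prod_sum_PiE) (simp_all add: assms prod.distrib)
  show ?thesis
    unfolding psi_def 1 sum_distrib_left by (subst sum.swap) (simp add: mult_ac)
qed

text \<open>Successive column operations, starting from the first column.\<close>

lemma psi_reduce:
  assumes d: "1 \<le> d" and u: "\<And>i. 1 \<le> i \<Longrightarrow> i < d \<Longrightarrow> u i = (\<lambda>k. u' i k + c i * u (i + 1) k)" and ud: "u d = u' d"
  shows "psi d I u = psi d I u'"
proof -
  have "psi d I (\<lambda>i. if i \<le> n then u' i else u i) = psi d I u" if "n < d" for n
    using that
  proof (induction n)
    case 0
    show ?case by (rule psi_cong) auto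
  next
    case (Suc n)
    let ?v = "\<lambda>i. if i \<le> Suc n then u' i else u i"
    have e: "?v(Suc n := (\<lambda>k. ?v (Suc n) k + c (Suc n) * ?v (Suc (Suc n)) k)) = (\<lambda>i. if i \<le> n then u' i else u i)"
      using u[of "Suc n"] Suc.prems by (auto simp: fun_eq_iff)
    have "psi d I (?v(Suc n := (\<lambda>k. ?v (Suc n) k + c (Suc n) * ?v (Suc (Suc n)) k))) = psi d I ?v"
      by (rule psi_column_operation) (use Suc.prems in auto)
    then show ?case unfolding e using Suc.IH Suc.prems by simp
  qed
  then have "psi d I u = psi d I (\<lambda>i. if i \<le> d - 1 then u' i else u i)" using d by simp
  also have "\<dots> = psi d I u'"
  proof (rule psi_cong)
    fix i k assume "i \<in> {1..d}"
    then show "(if i \<le> d - 1 then u' i else u i) (I k) = u' i (I k)"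
      using ud by (cases "i = d") auto
  qed
  finally show ?thesis .
qed

lemma linear_op_scale: "linear_op X \<Longrightarrow> X (\<lambda>k. c * y k) = (\<lambda>k. c * X y k)"
  using linear_op_sum[of X "{()}" "\<lambda>_. c" "\<lambda>_. y"] by simp

lemma strict_mono_range:
  fixes a :: "nat \<Rightarrow> nat"
  assumes "\<And>i. 1 \<le> i \<Longrightarrow> i < d \<Longrightarrow> a i < a (i + 1)" "1 \<le> i" "i < j" "j \<le> d"
  shows "a i < a j"
  using Suc_leI[OF assms(3)] assms(4)
proof (induction j rule: dec_induct)
  case base
  then show ?case using assms(1)[of i] assms(2) by simp
next
  case (step j)
  then show ?case using assms(1)[of j] assms(2) by simp
qed

text \<open>If a permutation matches two strictly increasing sequences, then it is increasing and therefore
  the identity.\<close>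

lemma psi_delta:
  assumes a: "\<And>i. 1 \<le> i \<Longrightarrow> i < d \<Longrightarrow> a i < a (i + 1)" and I: "\<And>i. 1 \<le> i \<Longrightarrow> i < d \<Longrightarrow> I i < I (i + 1)"
  shows "psi d I (\<lambda>i. delta (a i)) = (if \<forall>i\<in>{1..d}. a i = I i then 1 else 0)"
proof (cases "\<forall>i\<in>{1..d}. a i = I i")
  case True
  have inj: "I i = I k \<longleftrightarrow> i = k" if "i \<in> {1..d}" "k \<in> {1..d}" for i k
    using strict_mono_range[of d I i k, OF I] strict_mono_range[of d I k i, OF I] that
    by (cases i k rule: linorder_cases) auto
  have "psi d I (\<lambda>i. delta (a i)) = psi d id delta"
    by (rule psi_cong) (use True inj in \<open>auto simp: delta_def\<close>)
  also have "\<dots> = 1" by (rule psi_upper_unitriangular) (auto simp: delta_def)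
  finally show ?thesis using True by simp
next
  case False
  have "psi d I (\<lambda>i. delta (a i)) = 0"
    unfolding psi_def
  proof (rule sum.neutral, rule ballI)
    fix \<sigma> assume "\<sigma> \<in> {\<sigma>. \<sigma> permutes {1..d}}"
    then have p: "\<sigma> permutes {1..d}" by simp
    have "\<exists>i\<in>{1..d}. delta (a i) (I (\<sigma> i)) = 0"
    proof (rule ccontr)
      assume "\<not> ?thesis"
      then have e: "I (\<sigma> i) = a i" if "i \<in> {1..d}" for i using that by (auto simp: delta_def split: if_splits)
      have s: "\<sigma> i < \<sigma> (i + 1)" if "1 \<le> i" "i < d" for i
      proof (rule ccontr)
        assume n: "\<not> ?thesis"
        have r: "\<sigma> i \<in> {1..d}" "\<sigma> (i + 1) \<in> {1..d}" using permutes_in_image[OF p] that by auto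
        have "\<sigma> i \<noteq> \<sigma> (i + 1)" using inj_eq[OF permutes_inj[OF p], of i "i + 1"] by simp
        then have "I (\<sigma> (i + 1)) < I (\<sigma> i)"
          using strict_mono_range[of d I "\<sigma> (i + 1)" "\<sigma> i", OF I] n r by auto
        then show False using a[OF that] e[of i] e[of "i + 1"] that by auto
      qed
      have le: "i \<le> \<sigma> i" if "i \<le> d" "1 \<le> i" for i
        using that(2,1)
      proof (induction i rule: dec_induct)
        case base
        then show ?case using permutes_in_image[OF p, of 1] by auto
      next
        case (step i)
        then show ?case using s[of i] by auto
      qed
      have "\<sigma> = id" by (rule permutes_natset_ge[OF p]) (use le in auto)
      then show False using False e by auto
    qed
    then have "(\<Prod>i\<in>{1..d}. delta (a i) (I (\<sigma> i))) = 0" by (auto intro: prod_zero)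
    then show "of_int (sign \<sigma>) * (\<Prod>i\<in>{1..d}. delta (a i) (I (\<sigma> i))) = 0" by simp
  qed
  then show ?thesis unfolding if_not_P[OF False] .
qed

text \<open>State \<open>s c\<close> is reached by applying step \<open>c\<close> to state \<open>s (c +
  1)\<close>; the steps are numbered downwards because the rightmost factor of the product acts first.\<close>

definition paths :: "'a set \<Rightarrow> (nat \<Rightarrow> 'a \<Rightarrow> 'a \<Rightarrow> bool) \<Rightarrow> 'a \<Rightarrow> nat \<Rightarrow> 'a \<Rightarrow> (nat \<Rightarrow> 'a) set" where
  "paths S R z n a = {s \<in> PiE {2..n + 1} (\<lambda>_. S). s (n + 1) = a \<and> s 2 = z \<and> (\<forall>c\<in>{2..n}. R c (s (c + 1)) (s c))}"

text \<open>Unfolding the recursion for \<open>F\<close>; the induction step appends the state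
  \<open>a\<close> to a path that ends one step earlier.\<close>

lemma path_sum:
  fixes w :: "nat \<Rightarrow> 'a \<Rightarrow> 'a \<Rightarrow> complex"
  assumes fin: "finite S" and z: "z \<in> S"
    and base: "\<And>a. a \<in> S \<Longrightarrow> F 1 a = (if a = z then 1 else 0)"
    and step: "\<And>c a. 2 \<le> c \<Longrightarrow> c \<le> N \<Longrightarrow> a \<in> S \<Longrightarrow> F c a = (\<Sum>b\<in>{b \<in> S. R c a b}. w c a b * F (c - 1) b)"
    and n: "1 \<le> n" "n \<le> N" "a \<in> S"
  shows "F n a = (\<Sum>s\<in>paths S R z n a. \<Prod>c\<in>{2..n}. w c (s (c + 1)) (s c))"
  using n
proof (induction n arbitrary: a rule: dec_induct)
  case base
  have "paths S R z 1 a = (if a = z then {\<lambda>i\<in>{2}. z} else {})"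
    using z by (auto simp: paths_def PiE_def extensional_def fun_eq_iff restrict_def numeral_2_eq_2)
  then show ?case using assms(3)[OF base(2)] by simp
next
  case (step n)
  have fin2: "finite (paths S R z n b)" for b
    unfolding paths_def by (rule finite_subset[OF _ finite_PiE[of "{2..n + 1}" "\<lambda>_. S"]]) (use fin in auto)
  have "F (Suc n) a = (\<Sum>b\<in>{b \<in> S. R (Suc n) a b}. w (Suc n) a b * F n b)"
    using assms(4)[of "Suc n" a] step by simp
  also have "\<dots> = (\<Sum>b\<in>{b \<in> S. R (Suc n) a b}. \<Sum>s\<in>paths S R z n b. w (Suc n) a b * (\<Prod>c\<in>{2..n}. w c (s (c + 1)) (s c)))"
    unfolding sum_distrib_left[symmetric] by (intro sum.cong refl arg_cong[of _ _ "(*) _"] step.IH) (use step in auto)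
  also have "\<dots> = (\<Sum>(b, s)\<in>(SIGMA b:{b \<in> S. R (Suc n) a b}. paths S R z n b).
      w (Suc n) a b * (\<Prod>c\<in>{2..n}. w c (s (c + 1)) (s c)))"
    by (rule sum.Sigma) (use fin fin2 in auto)
  also have "\<dots> = (\<Sum>s\<in>paths S R z (Suc n) a. \<Prod>c\<in>{2..Suc n}. w c (s (c + 1)) (s c))"
  proof (rule sum.reindex_bij_witness[of _ "\<lambda>s. (s (n + 1), restrict s {2..n + 1})" "\<lambda>(b, s). s(n + 2 := a)"])
    fix p assume p: "p \<in> (SIGMA b:{b \<in> S. R (Suc n) a b}. paths S R z n b)"
    obtain b s where bs: "p = (b, s)" by (cases p)
    have s: "s \<in> PiE {2..n + 1} (\<lambda>_. S)" "s (n + 1) = b" "s 2 = z" "\<forall>c\<in>{2..n}. R c (s (c + 1)) (s c)"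
      and b: "b \<in> S" "R (Suc n) a b" using p by (auto simp: bs paths_def)
    have "restrict (s(n + 2 := a)) {2..n + 1} = s"
      using s(1) by (auto simp: fun_eq_iff PiE_def extensional_def restrict_def)
    then show "(\<lambda>s. (s (n + 1), restrict s {2..n + 1})) ((\<lambda>(b, s). s(n + 2 := a)) p) = p"
      using s(2) by (simp add: bs)
    show "(\<lambda>(b, s). s(n + 2 := a)) p \<in> paths S R z (Suc n) a"
    proof -
      have "s(n + 2 := a) \<in> PiE {2..Suc n + 1} (\<lambda>_. S)"
        using s(1) step(4,5) by (auto simp: PiE_def extensional_def Pi_def)
      moreover have "R c ((s(n + 2 := a)) (c + 1)) ((s(n + 2 := a)) c)" if "c \<in> {2..Suc n}" for c
        using that s b by (cases "c = Suc n") auto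
      ultimately show ?thesis using s step(1) by (auto simp: bs paths_def)
    qed
    show "(\<Prod>c\<in>{2..Suc n}. w c (((\<lambda>(b, s). s(n + 2 := a)) p) (c + 1)) (((\<lambda>(b, s). s(n + 2 := a)) p) c)) =
        (case p of (b, s) \<Rightarrow> w (Suc n) a b * (\<Prod>c\<in>{2..n}. w c (s (c + 1)) (s c)))"
    proof -
      have i: "{2..Suc n} = insert (Suc n) {2..n}" using step(1) by auto
      have "(\<Prod>c\<in>{2..n}. w c ((s(n + 2 := a)) (c + 1)) ((s(n + 2 := a)) c)) = (\<Prod>c\<in>{2..n}. w c (s (c + 1)) (s c))"
        by (intro prod.cong refl) auto
      then show ?thesis using s(2) unfolding i by (simp add: bs)
    qed
  next
    fix s assume "s \<in> paths S R z (Suc n) a"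
    then have s: "s \<in> PiE {2..Suc n + 1} (\<lambda>_. S)" "s (Suc n + 1) = a" "s 2 = z" "\<forall>c\<in>{2..Suc n}. R c (s (c + 1)) (s c)"
      by (auto simp: paths_def)
    show "(\<lambda>(b, s). s(n + 2 := a)) (s (n + 1), restrict s {2..n + 1}) = s"
      using s(1,2) by (auto simp: fun_eq_iff PiE_def extensional_def restrict_def)
    have "restrict s {2..n + 1} \<in> PiE {2..n + 1} (\<lambda>_. S)" using s(1) by (auto simp: PiE_def Pi_def)
    moreover have "s (n + 1) \<in> S" "R (Suc n) a (s (n + 1))" using s step(1) by (auto simp: PiE_def Pi_def)
    ultimately show "(s (n + 1), restrict s {2..n + 1}) \<in> (SIGMA b:{b \<in> S. R (Suc n) a b}. paths S R z n b)"
      using s(3,4) step(1) by (auto simp: paths_def)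
  qed
  finally show ?case .
qed

context cyclic_minor
begin

definition states :: "(nat \<Rightarrow> nat) set" where
  "states = {a \<in> PiE {1..d} (\<lambda>_. {1..2 * r + 1}). \<forall>i\<in>{1..<d}. a i < a (i + 1)}"

definition targets :: "nat \<Rightarrow> (nat \<Rightarrow> nat) \<Rightarrow> nat \<Rightarrow> nat set" where
  "targets c a i = {b \<in> {1..2 * r + 1}. a i \<le> b \<and> (if active c (a i) then b \<le> highest c else b = a i) \<and>
     (i < d \<longrightarrow> b < a (i + 1) \<or> b = r + 1 \<and> a (i + 1) = r + 1)}"

text \<open>The factor \<open>1 / 2\<close> for pushing the next particle out of position \<open>r + 1\<close> compensates the factor \<open>2\<close>
  with which that particle then leaves.\<close>

definition zero_factor :: "(nat \<Rightarrow> nat) \<Rightarrow> nat \<Rightarrow> nat \<Rightarrow> complex" where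
  "zero_factor a i b = (if a i = r + 1 \<and> b \<noteq> r + 1 then 2 else 1) * (if b = r + 1 \<and> i < d \<and> a (i + 1) = r + 1 then 1 / 2 else 1)"

definition moves :: "nat \<Rightarrow> (nat \<Rightarrow> nat) \<Rightarrow> (nat \<Rightarrow> nat) \<Rightarrow> bool" where
  "moves c a b \<longleftrightarrow> (\<forall>i\<in>{1..d}. b i \<in> targets c a i)"

definition move_weight :: "nat \<Rightarrow> (nat \<Rightarrow> nat) \<Rightarrow> (nat \<Rightarrow> nat) \<Rightarrow> complex" where
  "move_weight c a b = (\<Prod>i\<in>{1..d}. leave c (a i) * arrive c (b i) * zero_factor a i (b i))"

lemma highest_le: "highest c \<le> 2 * r + 1"
  by (auto simp: highest_def)

text \<open>Two columns have the same coefficients from the start of the second one on, except that the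
  column at \<open>r + 1\<close> is doubled beyond \<open>r + 1\<close>. Subtracting half of it leaves half
  of the coefficient at \<open>r + 1\<close> itself.\<close>

lemma column_reduce:
  assumes x: "1 \<le> a i" "a i < a (i + 1)" "a (i + 1) \<le> 2 * r + 1" and i: "i < d"
  shows "column c (a i) k = (\<Sum>b\<in>targets c a i. arrive c b * zero_factor a i b * delta b k) +
    (if active c (a i) \<and> a (i + 1) \<le> highest c then (if a i = r + 1 then 2 else 1) * (if a (i + 1) = r + 1 then 1 / 2 else 1) else 0)
      * column c (a (i + 1)) k"
proof -
  have f: "finite (targets c a i)" by (simp add: targets_def)
  have s: "(\<Sum>b\<in>targets c a i. arrive c b * zero_factor a i b * delta b k) =
      (if k \<in> targets c a i then arrive c k * zero_factor a i k else 0)"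
    using f by (simp add: delta_def if_distrib sum.delta' cong: if_cong)
  show ?thesis
  proof (cases "active c (a i)")
    case False
    have t: "k \<in> targets c a i \<longleftrightarrow> k = a i"
      unfolding targets_def using False x by auto
    have w: "arrive c (a i) = 1" using False unfolding arrive_def active_def by auto
    have z: "zero_factor a i (a i) = 1" using x(2) by (auto simp: zero_factor_def)
    show ?thesis unfolding s t using False w z by (simp add: column_def delta_def)
  next
    case True
    then have act: "active c (a (i + 1)) \<longleftrightarrow> a (i + 1) \<le> highest c" using x by (auto simp: active_def)
    have t: "k \<in> targets c a i \<longleftrightarrow> a i \<le> k \<and> k \<le> highest c \<and> (k < a (i + 1) \<or> k = r + 1 \<and> a (i + 1) = r + 1)"
      unfolding targets_def using True x i highest_le[of c] by auto
    have col: "column c (a i) k = (if a i \<le> k \<and> k \<le> highest c then arrive c k * (if a i = r + 1 \<and> k \<noteq> r + 1 then 2 else 1) else 0)"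
      using True by (simp add: column_def)
    show ?thesis
    proof (cases "a (i + 1) \<le> highest c")
      case le: True
      have col': "column c (a (i + 1)) k = (if a (i + 1) \<le> k \<and> k \<le> highest c then arrive c k * (if a (i + 1) = r + 1 \<and> k \<noteq> r + 1 then 2 else 1) else 0)"
        using le act by (simp add: column_def)
      \<comment> \<open>\<open>p\<close> and \<open>q\<close> are the starts of the two columns, \<open>h\<close> is their common end, and \<open>w\<close> is the coefficient at \<open>k\<close>.\<close>
      have "(if p \<le> k \<and> k \<le> h then w * (if p = r + 1 \<and> k \<noteq> r + 1 then 2 else 1) else 0) =
          (if p \<le> k \<and> k \<le> h \<and> (k < q \<or> k = r + 1 \<and> q = r + 1)
            then w * ((if p = r + 1 \<and> k \<noteq> r + 1 then 2 else 1) * (if k = r + 1 \<and> q = r + 1 then 1 / 2 else 1)) else 0) +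
          (if p = r + 1 then 2 else 1) * (if q = r + 1 then 1 / 2 else 1) *
          (if q \<le> k \<and> k \<le> h then w * (if q = r + 1 \<and> k \<noteq> r + 1 then 2 else 1) else 0)"
        if "p < q" for p q h and w :: complex
      proof (cases "k < q")
        case True
        then have "\<not> (k = r + 1 \<and> q = r + 1)" "\<not> q \<le> k" by auto
        then show ?thesis using True by (simp only: simp_thms if_False mult_1_right mult_zero_right add_0_right)
      next
        case False
        then show ?thesis using that by (cases "q = r + 1"; cases "k = r + 1") auto
      qed
      from this[OF x(2)] show ?thesis
        unfolding s unfolding t col col' zero_factor_def using True le i by (simp only: simp_thms if_True)
    next
      case False
      then show ?thesis unfolding s unfolding t col zero_factor_def using x(2) i by simp
    qed
  qed
qed

lemma column_last:
  assumes x: "1 \<le> a d" "a d \<le> 2 * r + 1"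
  shows "column c (a d) k = (\<Sum>b\<in>targets c a d. arrive c b * zero_factor a d b * delta b k)"
proof -
  have f: "finite (targets c a d)" by (simp add: targets_def)
  have s: "(\<Sum>b\<in>targets c a d. arrive c b * zero_factor a d b * delta b k) =
      (if k \<in> targets c a d then arrive c k * zero_factor a d k else 0)"
    using f by (simp add: delta_def if_distrib sum.delta' cong: if_cong)
  show ?thesis
  proof (cases "active c (a d)")
    case False
    have t: "k \<in> targets c a d \<longleftrightarrow> k = a d"
      unfolding targets_def using False x by auto
    have w: "arrive c (a d) = 1" using False unfolding arrive_def active_def by auto
    show ?thesis unfolding s t using False w by (simp add: column_def delta_def zero_factor_def)
  next
    case True
    have t: "k \<in> targets c a d \<longleftrightarrow> a d \<le> k \<and> k \<le> highest c"
      unfolding targets_def using True x highest_le[of c] by auto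
    show ?thesis unfolding s t using True by (simp add: column_def zero_factor_def)
  qed
qed

lemma states_bounds: "a \<in> states \<Longrightarrow> 1 \<le> i \<Longrightarrow> i \<le> d \<Longrightarrow> 1 \<le> a i \<and> a i \<le> 2 * r + 1"
  by (auto simp: states_def PiE_def Pi_def)

lemma states_less: "a \<in> states \<Longrightarrow> 1 \<le> i \<Longrightarrow> i < d \<Longrightarrow> a i < a (i + 1)"
  by (auto simp: states_def)

text \<open>The Lindstroem-Gessel-Viennot principle for one antidiagonal.\<close>

lemma psi_slice:
  assumes X: "linear_op X" and c: "2 \<le> c" "c \<le> m + d" and a: "a \<in> states"
  shows "psi d I (\<lambda>i. X (slice c (delta (a i)))) =
    (\<Sum>b\<in>{b \<in> states. moves c a b}. move_weight c a b * psi d I (\<lambda>i. X (delta (b i))))"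
proof -
  let ?g = "\<lambda>i b. arrive c b * zero_factor a i b"
  let ?c = "\<lambda>i. if active c (a i) \<and> a (i + 1) \<le> highest c then (if a i = r + 1 then 2 else 1) * (if a (i + 1) = r + 1 then 1 / 2 else 1) else 0"
  let ?u' = "\<lambda>i k. \<Sum>b\<in>targets c a i. ?g i b * X (delta b) k"
  have fin: "finite (targets c a i)" for i by (simp add: targets_def)
  have 1: "X (slice c (delta (a i))) = (\<lambda>k. leave c (a i) * X (column c (a i)) k)" for i
    unfolding slice_delta[OF c] by (rule linear_op_scale[OF X])
  have red: "psi d I (\<lambda>i. X (column c (a i))) = psi d I ?u'"
  proof (rule psi_reduce[where c = ?c])
    fix i assume i: "1 \<le> i" "i < d"
    have "column c (a i) = (\<lambda>k. (\<Sum>b\<in>targets c a i. ?g i b * delta b k) + ?c i * column c (a (i + 1)) k)"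
      by (rule ext, rule column_reduce) (use i states_bounds[OF a, of i] states_bounds[OF a, of "i + 1"] states_less[OF a, of i] in auto)
    then have "X (column c (a i)) = (\<lambda>k. X (\<lambda>k. \<Sum>b\<in>targets c a i. ?g i b * delta b k) k + ?c i * X (column c (a (i + 1))) k)"
      using X[unfolded linear_op_def, rule_format, of "\<lambda>k. \<Sum>b\<in>targets c a i. ?g i b * delta b k" "?c i" "column c (a (i + 1))"] by (simp only:)
    then show "X (column c (a i)) = (\<lambda>k. ?u' i k + ?c i * X (column c (a (i + 1))) k)"
      unfolding linear_op_sum[OF X fin] .
  next
    have "column c (a d) = (\<lambda>k. \<Sum>b\<in>targets c a d. ?g d b * delta b k)"
      by (rule ext, rule column_last) (use d_pos states_bounds[OF a, of d] in auto)
    then show "X (column c (a d)) = ?u' d" by (simp only: linear_op_sum[OF X fin])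
  qed (rule d_pos)
  have neu: "(\<Sum>b\<in>PiE {1..d} (targets c a). (\<Prod>i\<in>{1..d}. ?g i (b i)) * psi d I (\<lambda>i. X (delta (b i)))) =
      (\<Sum>b\<in>{b \<in> states. moves c a b}. (\<Prod>i\<in>{1..d}. ?g i (b i)) * psi d I (\<lambda>i. X (delta (b i))))"
  proof (rule sum.mono_neutral_right)
    show "finite (PiE {1..d} (targets c a))" by (rule finite_PiE) (use fin in auto)
    show "{b \<in> states. moves c a b} \<subseteq> PiE {1..d} (targets c a)"
      by (auto simp: states_def moves_def PiE_def Pi_def)
    show "\<forall>b\<in>PiE {1..d} (targets c a) - {b \<in> states. moves c a b}.
        (\<Prod>i\<in>{1..d}. ?g i (b i)) * psi d I (\<lambda>i. X (delta (b i))) = 0"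
    proof
      fix b assume b: "b \<in> PiE {1..d} (targets c a) - {b \<in> states. moves c a b}"
      then have t: "b i \<in> targets c a i" if "1 \<le> i" "i \<le> d" for i using that by (auto simp: PiE_def Pi_def)
      then have "moves c a b" by (auto simp: moves_def)
      then have "b \<notin> states" using b by auto
      moreover have "b \<in> PiE {1..d} (\<lambda>_. {1..2 * r + 1})"
        using b by (auto simp: PiE_def Pi_def targets_def)
      ultimately obtain i where i: "1 \<le> i" "i < d" "\<not> b i < b (i + 1)"
        by (auto simp: states_def)
      then have "b i = b (i + 1)" using t[of i] t[of "i + 1"] by (auto simp: targets_def)
      then have "psi d I (\<lambda>i. X (delta (b i))) = 0"
        using i by (intro psi_alternating[of i d "i + 1"]) auto
      then show "(\<Prod>i\<in>{1..d}. ?g i (b i)) * psi d I (\<lambda>i. X (delta (b i))) = 0" by simp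
    qed
  qed
  have "psi d I (\<lambda>i. X (slice c (delta (a i)))) = (\<Prod>i\<in>{1..d}. leave c (a i)) * psi d I ?u'"
    unfolding 1 psi_column_scale red ..
  also have "psi d I ?u' = (\<Sum>b\<in>{b \<in> states. moves c a b}. (\<Prod>i\<in>{1..d}. ?g i (b i)) * psi d I (\<lambda>i. X (delta (b i))))"
    unfolding psi_expand[OF fin] by (rule neu)
  also have "(\<Prod>i\<in>{1..d}. leave c (a i)) * \<dots> = (\<Sum>b\<in>{b \<in> states. moves c a b}. move_weight c a b * psi d I (\<lambda>i. X (delta (b i))))"
    unfolding sum_distrib_left move_weight_def by (intro sum.cong refl) (simp add: prod.distrib mult_ac)
  finally show ?thesis .
qed

definition start :: "nat \<Rightarrow> nat" where
  "start = (\<lambda>i\<in>{1..d}. i)"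

definition finish :: "nat \<Rightarrow> nat" where
  "finish = restrict (ext_rows r d m') {1..d}"

lemma start_states: "start \<in> states"
  using d_less by (auto simp: states_def start_def)

lemma finish_states: "finish \<in> states"
  using d_less by (auto simp: states_def finish_def ext_rows_def)

lemma minor_eq_path_sum:
  "psi d (ext_rows r d m') (\<lambda>i. vw r (minus_factors (cyc_letters m d)) (delta i)) =
    (\<Sum>s\<in>paths states moves finish (m + d) start. \<Prod>c\<in>{2..m + d}. move_weight c (s (c + 1)) (s c))"
proof -
  let ?F = "\<lambda>c a. psi d (ext_rows r d m') (\<lambda>i. foldr slice [2..<c + 1] (delta (a i)))"
  have "psi d (ext_rows r d m') (\<lambda>i. vw r (minus_factors (cyc_letters m d)) (delta i)) = ?F (m + d) start"
    by (rule psi_cong) (use vw_slices in \<open>auto simp: start_def simp del: upt_Suc\<close>)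
  also have "\<dots> = (\<Sum>s\<in>paths states moves finish (m + d) start. \<Prod>c\<in>{2..m + d}. move_weight c (s (c + 1)) (s c))"
  proof (rule path_sum[where F = ?F and N = "m + d"])
    show "finite states" unfolding states_def by (rule finite_subset[OF _ finite_PiE[of "{1..d}" "\<lambda>_. {1..2 * r + 1}"]]) auto
    show "finish \<in> states" "start \<in> states" by (rule finish_states start_states)+
    fix a assume a: "a \<in> states"
    have "psi d (ext_rows r d m') (\<lambda>i. delta (a i)) = psi d finish (\<lambda>i. delta (a i))"
      by (rule psi_cong) (auto simp: finish_def)
    also have "\<dots> = (if \<forall>i\<in>{1..d}. a i = finish i then 1 else 0)"
      by (rule psi_delta) (use states_less a finish_states in auto)
    also have "(\<forall>i\<in>{1..d}. a i = finish i) \<longleftrightarrow> a = finish"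
    proof
      assume "\<forall>i\<in>{1..d}. a i = finish i"
      then show "a = finish"
        using a finish_states by (intro PiE_ext[of _ "{1..d}" "\<lambda>_. {1..2 * r + 1}"]) (auto simp: states_def)
    qed auto
    finally show "?F 1 a = (if a = finish then 1 else 0)" by (simp add: numeral_2_eq_2)
  next
    fix c a assume c: "2 \<le> c" "c \<le> m + d" and a: "a \<in> states"
    have l: "linear_op (foldr slice [2..<c])" by (rule linear_op_foldr) (rule linear_op_slice)
    have s: "[2..<c + 1] = [2..<c] @ [c]" "c - 1 + 1 = c" using c by auto
    show "?F c a = (\<Sum>b\<in>{b \<in> states. moves c a b}. move_weight c a b * ?F (c - 1) b)"
      unfolding s foldr_append using psi_slice[OF l c a, of "ext_rows r d m'"] by simp
  qed (use m'_pos m'_le in auto)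
  finally show ?thesis .
qed

end

section \<open>Families of letters and particle paths\<close>

definition letter_at :: "nat \<Rightarrow> nat \<Rightarrow> letter" where
  "letter_at r p = (if p \<le> r then Unbarred p else if p = r + 1 then Zero else Barred (2 * r + 2 - p))"

lemma pos_letter_at: "1 \<le> p \<Longrightarrow> p \<le> 2 * r + 1 \<Longrightarrow> pos r (letter_at r p) = p"
  by (auto simp: letter_at_def)

lemma letter_at_letters: "1 \<le> p \<Longrightarrow> p \<le> 2 * r + 1 \<Longrightarrow> letter_at r p \<in> letters r"
proof -
  assume p: "1 \<le> p" "p \<le> 2 * r + 1"
  then have "2 * r + 2 - p \<in> {1..r}" if "r + 1 < p" using that by auto
  then show ?thesis using p unfolding letter_at_def letters_def by (cases "p \<le> r + 1") auto
qed

lemma letter_at_pos: "l \<in> letters r \<Longrightarrow> letter_at r (pos r l) = l"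
  by (auto simp: letter_at_def letters_def)

lemma pos_bounds: "l \<in> letters r \<Longrightarrow> 1 \<le> pos r l \<and> pos r l \<le> 2 * r + 1"
  by (auto simp: letters_def)

lemma pos_eq_iff: "l \<in> letters r \<Longrightarrow> l' \<in> letters r \<Longrightarrow> pos r l = pos r l' \<longleftrightarrow> l = l'"
  using letter_at_pos by metis

lemma pos_zero_iff: "l \<in> letters r \<Longrightarrow> pos r l = r + 1 \<longleftrightarrow> l = Zero"
  by (auto simp: letters_def)

context cyclic_minor
begin

abbreviation final_row :: "nat \<Rightarrow> nat" where
  "final_row \<equiv> ext_rows r d m'"

lemma final_row_less: "i < d \<Longrightarrow> final_row i < final_row (i + 1)"
  using d_less by (auto simp: ext_rows_def)

lemma final_row_bounds: "1 \<le> i \<Longrightarrow> i \<le> d \<Longrightarrow> i < final_row i \<and> final_row i \<le> 2 * r + 1 \<and> final_row i \<noteq> r + 1"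
  using d_less m'_pos by (auto simp: ext_rows_def)

abbreviation particle_paths :: "(nat \<Rightarrow> nat \<Rightarrow> nat) set" where
  "particle_paths \<equiv> paths states moves finish (m + d) start"

text \<open>The column \<open>k\<^sub>i\<close> of a family, continued by the starting position of the \<open>i\<close>-th particle on one
  side and by its final position on the other side.\<close>

definition extended :: "(nat \<times> nat \<Rightarrow> letter) \<Rightarrow> nat \<Rightarrow> nat \<Rightarrow> nat" where
  "extended k i t = (if t = 0 then i else if m - m' < t then final_row i else pos r (k (i, t)))"

text \<open>The \<open>i\<close>-th particle enters its \<open>t\<close>-th position with the antidiagonal \<open>m + 1 + i - t\<close>.\<close>

definition path_of :: "(nat \<times> nat \<Rightarrow> letter) \<Rightarrow> nat \<Rightarrow> nat \<Rightarrow> nat" where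
  "path_of k = (\<lambda>c\<in>{2..m + d + 1}. \<lambda>i\<in>{1..d}. extended k i (m + 1 + i - c))"

definition family_of :: "(nat \<Rightarrow> nat \<Rightarrow> nat) \<Rightarrow> nat \<times> nat \<Rightarrow> letter" where
  "family_of s = (\<lambda>(i, t)\<in>{1..d} \<times> {1..m - m'}. letter_at r (s (m + 1 + i - t) i))"

context
  fixes k assumes k: "k \<in> admissible_families r m m' d"
begin

lemma family_letter: "1 \<le> i \<Longrightarrow> i \<le> d \<Longrightarrow> 1 \<le> t \<Longrightarrow> t \<le> m - m' \<Longrightarrow> k (i, t) \<in> letters r"
  using k by (auto simp: admissible_families_def PiE_def Pi_def)

lemma family_row:
  assumes "1 \<le> i" "i < d" "1 \<le> t" "t \<le> m - m'"
  shows "pos r (k (i, t)) < pos r (k (i + 1, t)) \<or> pos r (k (i, t)) = r + 1 \<and> pos r (k (i + 1, t)) = r + 1"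
proof -
  have l: "k (i, t) \<in> letters r" "k (i + 1, t) \<in> letters r" using family_letter assms by auto
  have "\<forall>s\<in>{1..m - m'}. \<forall>i\<in>{1..<d}. letter_le r (k (i, s)) (k (i + 1, s)) \<and>
      (k (i, s) = k (i + 1, s) \<longleftrightarrow> k (i, s) = Zero \<and> k (i + 1, s) = Zero)"
    using k unfolding admissible_families_def by blast
  then have le: "letter_le r (k (i, t)) (k (i + 1, t))"
    and eq: "k (i, t) = k (i + 1, t) \<longleftrightarrow> k (i, t) = Zero \<and> k (i + 1, t) = Zero" using assms by auto
  show ?thesis
  proof (cases "pos r (k (i, t)) = pos r (k (i + 1, t))")
    case True
    then have "k (i, t) = k (i + 1, t)" using pos_eq_iff[OF l] by blast
    then show ?thesis using eq by simp
  next
    case False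
    then show ?thesis using le by (auto simp: letter_le_def)
  qed
qed

lemma family_column:
  assumes "1 \<le> i" "i \<le> d" "1 \<le> t" "t < m - m'"
  shows "pos r (k (i, t)) \<le> pos r (k (i, t + 1))"
proof -
  have "\<forall>i\<in>{1..d}. i \<le> r - m' \<longrightarrow> (\<forall>s\<in>{1..<m - m'}. letter_le r (k (i, s)) (k (i, s + 1)))"
    "\<forall>i\<in>{r - m' + 1..d}. \<forall>s\<in>{1..<m - m'}. letter_le r (k (i, s)) (k (i, s + 1))"
    using k unfolding admissible_families_def by blast+
  then have "letter_le r (k (i, t)) (k (i, t + 1))" using assms by (cases "i \<le> r - m'") auto
  then show ?thesis by (simp add: letter_le_def)
qed

lemma family_diagonal:
  assumes "1 \<le> i" "i < d" "1 \<le> t" "t < m - m'"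
  shows "pos r (k (i, t)) < pos r (k (i + 1, t + 1))"
proof -
  have "\<forall>i\<in>{1..<d}. \<forall>s\<in>{1..<m - m'}. letter_less r (k (i, s)) (k (i + 1, s + 1))"
    using k unfolding admissible_families_def by blast
  then show ?thesis using assms by (auto simp: letter_less_def)
qed

text \<open>Rows are strictly increasing except for repeated zeros, and \<open>0\<close> is at position
  \<open>r + 1 > d\<close>.\<close>

lemma family_ge:
  assumes "1 \<le> i" "i \<le> d" "1 \<le> t" "t \<le> m - m'"
  shows "i \<le> pos r (k (i, t))"
  using assms(1,2)
proof (induction i rule: dec_induct)
  case base
  then show ?case using pos_bounds[OF family_letter[of 1 t]] assms by auto
next
  case (step i)
  then show ?case using family_row[of i t] assms d_less by auto
qed

text \<open>For \<open>m' + i \<le> r\<close> the bound is imposed on the last letter of the column;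
  otherwise it follows from the right end of the row by strict increase, since \<open>0\<close> lies below
  all barred final positions.\<close>

lemma family_le:
  assumes "1 \<le> i" "i \<le> d" "1 \<le> t" "t \<le> m - m'"
  shows "pos r (k (i, t)) \<le> final_row i"
proof (cases "m' + i \<le> r")
  case True
  have "\<forall>i\<in>{1..d}. i \<le> r - m' \<longrightarrow> m' < m \<longrightarrow> letter_le r (k (i, m - m')) (Unbarred (m' + i))"
    using k unfolding admissible_families_def by blast
  then have last: "pos r (k (i, m - m')) \<le> m' + i" using True assms by (auto simp: letter_le_def)
  have "pos r (k (i, t)) \<le> pos r (k (i, m - m'))"
    using assms(4,3)
  proof (induction t rule: inc_induct)
    case (step t)
    then show ?case using family_column[of i t] assms(1,2) by auto
  qed simp
  then show ?thesis using last True by (simp add: ext_rows_def)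
next
  case False
  have "pos r (k (i, t)) \<le> 2 * r + 1 - d + i"
    using assms(2,1)
  proof (induction i rule: inc_induct)
    case base
    then show ?case using pos_bounds[OF family_letter[of d t]] assms d_less by auto
  next
    case (step i)
    then show ?case using family_row[of i t] assms d_less by auto
  qed
  then show ?thesis using False by (simp add: ext_rows_def)
qed

lemma extended_bounds: "1 \<le> i \<Longrightarrow> i \<le> d \<Longrightarrow> i \<le> extended k i t \<and> extended k i t \<le> final_row i"
  using final_row_bounds[of i] family_ge[of i t] family_le[of i t] by (auto simp: extended_def)

lemma extended_diagonal:
  assumes "1 \<le> i" "i < d"
  shows "extended k i t < extended k (i + 1) (t + 1)"
proof -
  consider "t = 0" | "1 \<le> t" "t < m - m'" | "1 \<le> t" "m - m' \<le> t" by linarith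
  then show ?thesis
  proof cases
    case 1
    then show ?thesis using extended_bounds[of "i + 1" 1] assms by (simp add: extended_def)
  next
    case 2
    then show ?thesis using family_diagonal[of i t] assms by (simp add: extended_def)
  next
    case 3
    then show ?thesis using extended_bounds[of i t] final_row_less[of i] assms by (simp add: extended_def)
  qed
qed

lemma extended_column:
  assumes "1 \<le> i" "i \<le> d"
  shows "extended k i t \<le> extended k i (t + 1)"
proof -
  consider "t = 0" | "1 \<le> t" "t < m - m'" | "1 \<le> t" "m - m' \<le> t" by linarith
  then show ?thesis
  proof cases
    case 1
    then show ?thesis using extended_bounds[of i 1] assms by (simp add: extended_def)
  next
    case 2
    then show ?thesis using family_column[of i t] assms by (simp add: extended_def)
  next
    case 3
    then show ?thesis using extended_bounds[of i t] assms by (simp add: extended_def)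
  qed
qed

lemma extended_row:
  assumes "1 \<le> i" "i < d"
  shows "extended k i t < extended k (i + 1) t \<or> extended k i t = r + 1 \<and> extended k (i + 1) t = r + 1"
  using family_row[of i t] final_row_less[of i] assms by (auto simp: extended_def)

lemma path_of_apply: "2 \<le> c \<Longrightarrow> c \<le> m + d + 1 \<Longrightarrow> 1 \<le> i \<Longrightarrow> i \<le> d \<Longrightarrow> path_of k c i = extended k i (m + 1 + i - c)"
  by (simp add: path_of_def)

text \<open>The conditions on families translate as follows: rows compare a particle with its right
  neighbour before the step, diagonals give strictly increasing states, and columns say that particles move
  to the right. The bound by the highest active position comes from the bound on the last letter of a
  column.\<close>

lemma path_of_in_paths: "path_of k \<in> particle_paths"
proof -
  have st: "path_of k c \<in> states" if c: "2 \<le> c" "c \<le> m + d + 1" for c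
  proof -
    have "path_of k c i < path_of k c (i + 1)" if i: "1 \<le> i" "i < d" for i
    proof (cases "c \<le> m + i + 1")
      case True
      then have "m + 1 + (i + 1) - c = (m + 1 + i - c) + 1" by simp
      then show ?thesis using extended_diagonal[OF i, of "m + 1 + i - c"] i c by (simp add: path_of_apply)
    next
      case False
      then show ?thesis using i c by (simp add: path_of_apply extended_def)
    qed
    moreover have "path_of k c \<in> PiE {1..d} (\<lambda>_. {1..2 * r + 1})"
    proof (rule PiE_I)
      fix i assume "i \<in> {1..d}"
      then have i: "1 \<le> i" "i \<le> d" by auto
      show "path_of k c i \<in> {1..2 * r + 1}"
        unfolding path_of_apply[OF c i] using extended_bounds[OF i, of "m + 1 + i - c"] final_row_bounds[OF i] i by simp
    qed (use c in \<open>auto simp: path_of_def\<close>)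
    ultimately show ?thesis by (auto simp: states_def)
  qed
  have mv: "moves c (path_of k (c + 1)) (path_of k c)" if c: "2 \<le> c" "c \<le> m + d" for c
    unfolding moves_def
  proof
    fix i assume "i \<in> {1..d}"
    then have i: "1 \<le> i" "i \<le> d" by auto
    define t where "t = m + 1 + i - c"
    have b: "path_of k c i = extended k i t" using c i by (simp add: path_of_apply t_def)
    have a: "path_of k (c + 1) i = extended k i (t - 1)" using c i by (simp add: path_of_apply t_def)
    have a1: "path_of k (c + 1) (i + 1) = extended k (i + 1) t" if "i < d" using c i that by (simp add: path_of_apply t_def)
    have ab: "extended k i (t - 1) \<le> extended k i t"
      using extended_column[OF i, of "t - 1"] by (cases "t = 0") auto
    have range: "extended k i t \<in> {1..2 * r + 1}"
      using extended_bounds[OF i, of t] final_row_bounds[OF i] i by simp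
    have nxt: "extended k i t < extended k (i + 1) t \<or> extended k i t = r + 1 \<and> extended k (i + 1) t = r + 1" if "i < d"
      by (rule extended_row[OF i(1) that])
    have act: "if active c (extended k i (t - 1)) then extended k i t \<le> highest c else extended k i t = extended k i (t - 1)"
    proof (cases "extended k i t = extended k i (t - 1)")
      case True
      then show ?thesis by (auto simp: active_def)
    next
      case False
      then have t: "1 \<le> t" "t \<le> m - m' + 1" by (auto simp: extended_def split: if_splits)
      then have ci: "m' + i \<le> c" "c \<le> m + i" using m'_le by (auto simp: t_def)
      have low: "lowest c \<le> extended k i (t - 1)"
        using ci i extended_bounds[OF i, of "t - 1"] by (auto simp: lowest_def)
      have "extended k i t \<le> highest c"
      proof (cases "c \<le> r")
        case True
        then have "final_row i = m' + i" using ci by (simp add: ext_rows_def)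
        then show ?thesis using extended_bounds[OF i, of t] ci True by (simp add: highest_def)
      next
        case False
        then show ?thesis using range by (simp add: highest_def)
      qed
      then show ?thesis using low ab by (auto simp: active_def)
    qed
    show "path_of k c i \<in> targets c (path_of k (c + 1)) i"
      unfolding targets_def mem_Collect_eq b a using range ab act nxt a1 by auto
  qed
  have "path_of k (m + d + 1) = start"
    using m'_pos m'_le by (auto simp: path_of_def start_def extended_def fun_eq_iff)
  moreover have "path_of k 2 = finish"
    using m'_pos m'_le by (auto simp: path_of_def finish_def extended_def fun_eq_iff)
  moreover have "path_of k \<in> PiE {2..m + d + 1} (\<lambda>_. states)"
    using st by (intro PiE_I) (auto simp: path_of_def)
  ultimately show ?thesis unfolding paths_def using mv by auto
qed

lemma family_of_path_of: "family_of (path_of k) = k"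
proof
  fix p :: "nat \<times> nat"
  obtain i t where p: "p = (i, t)" by (cases p)
  show "family_of (path_of k) p = k p"
  proof (cases "(i, t) \<in> {1..d} \<times> {1..m - m'}")
    case True
    then have i: "1 \<le> i" "i \<le> d" "1 \<le> t" "t \<le> m - m'" by auto
    then have "path_of k (m + 1 + i - t) i = pos r (k (i, t))"
      using m'_pos m'_le by (simp add: path_of_apply extended_def)
    then show ?thesis using True letter_at_pos[OF family_letter[OF i]] by (simp add: p family_of_def)
  next
    case False
    then have "k (i, t) = undefined" using k by (auto simp: admissible_families_def PiE_def extensional_def)
    then show ?thesis unfolding p family_of_def restrict_apply if_not_P[OF False] by simp
  qed
qed

end

context
  fixes s assumes s: "s \<in> particle_paths"
begin

lemma path_states: "2 \<le> c \<Longrightarrow> c \<le> m + d + 1 \<Longrightarrow> s c \<in> states"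
  using s by (auto simp: paths_def PiE_def Pi_def)

lemma path_targets: "2 \<le> c \<Longrightarrow> c \<le> m + d \<Longrightarrow> 1 \<le> i \<Longrightarrow> i \<le> d \<Longrightarrow> s c i \<in> targets c (s (c + 1)) i"
  using s by (auto simp: paths_def moves_def)

lemma path_start: "1 \<le> i \<Longrightarrow> i \<le> d \<Longrightarrow> s (m + d + 1) i = i"
  using s by (simp add: paths_def start_def)

lemma path_finish: "1 \<le> i \<Longrightarrow> i \<le> d \<Longrightarrow> s 2 i = final_row i"
  using s by (simp add: paths_def finish_def)

lemma path_mono:
  assumes "2 \<le> c" "c \<le> c'" "c' \<le> m + d + 1" "1 \<le> i" "i \<le> d"
  shows "s c' i \<le> s c i"
  using assms(2,1,3)
proof (induction c rule: inc_induct)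
  case (step c)
  then show ?case using path_targets[of c i] assms(4,5) by (auto simp: targets_def)
qed simp

text \<open>The lowest active position exceeds \<open>i\<close> for \<open>c > m + i\<close>.\<close>

lemma path_early:
  assumes i: "1 \<le> i" "i \<le> d" and c: "m + i + 1 \<le> c" "c \<le> m + d + 1"
  shows "s c i = i"
  using c(2,1)
proof (induction c rule: inc_induct)
  case base
  then show ?case using path_start[OF i] by simp
next
  case (step c)
  have "\<not> active c (s (c + 1) i)" using step by (auto simp: active_def lowest_def)
  then show ?case using path_targets[of c i] i step by (auto simp: targets_def)
qed

text \<open>Steps \<open>c \<le> r\<close> only lead to positions up to \<open>c\<close>, below the final
  position, so the particle must have been there before.\<close>

lemma path_late_short:
  assumes i: "1 \<le> i" "i \<le> d" and c: "2 \<le> c" "c \<le> m' + i" "c \<le> r + 1"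
  shows "s c i = final_row i"
  using c
proof (induction c rule: dec_induct)
  case base
  then show ?case using path_finish[OF i] by simp
next
  case (step c)
  then have sc: "s c i = final_row i" by simp
  have "highest c = c" "c < final_row i" using step i d_less by (auto simp: highest_def ext_rows_def)
  then have "\<not> active c (s (c + 1) i)"
    using path_targets[of c i] i step sc m'_le by (auto simp: targets_def)
  then show ?case using path_targets[of c i] i step sc m'_le by (auto simp: targets_def)
qed

text \<open>When a particle arrives at a barred final position, its right neighbour already stands strictly beyond
  it. Since the barred final positions are consecutive, the neighbour is then at its own final position.\<close>

lemma path_late:
  assumes i: "1 \<le> i" "i \<le> d" and c: "2 \<le> c" "c \<le> m' + i"
  shows "s c i = final_row i"
proof (cases "m' + i \<le> r + 1")
  case True
  then show ?thesis using path_late_short[OF i] c by simp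
next
  case False
  have m'r: "m' \<le> r" using m'_le m_le by simp
  have "s (m' + i) i = final_row i"
    if "r + 1 - m' \<le> i" "i \<le> d" for i
    using that
  proof (induction i rule: dec_induct)
    case base
    then show ?case using path_late_short[of "r + 1 - m'" "m' + (r + 1 - m')"] m'r d_less m'_pos by auto
  next
    case (step i)
    have i1: "1 \<le> i" "i < d" using step m'r by auto
    have "s (m' + i) i = final_row i" using step by simp
    moreover have "final_row i \<noteq> r + 1" using final_row_bounds[of i] i1 by simp
    ultimately have "final_row i < s (m' + i + 1) (i + 1)"
      using path_targets[of "m' + i" i] i1 m'_pos m'_le by (auto simp: targets_def)
    moreover have "final_row (i + 1) = final_row i + 1"
      using step m'r d_less by (auto simp: ext_rows_def)
    moreover have "s (m' + i + 1) (i + 1) \<le> s 2 (i + 1)"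
      by (rule path_mono) (use i1 m'_pos m'_le in auto)
    ultimately show ?case using path_finish[of "i + 1"] i1 by simp
  qed
  then have "s (m' + i) i = final_row i" using False i by simp
  moreover have "s (m' + i) i \<le> s c i" by (rule path_mono) (use i c m'_le in auto)
  moreover have "s c i \<le> s 2 i" by (rule path_mono) (use i c m'_le in auto)
  ultimately show ?thesis using path_finish[OF i] by simp
qed

lemma family_of_apply:
  "1 \<le> i \<Longrightarrow> i \<le> d \<Longrightarrow> 1 \<le> t \<Longrightarrow> t \<le> m - m' \<Longrightarrow> family_of s (i, t) = letter_at r (s (m + 1 + i - t) i)"
  by (simp add: family_of_def)

lemma pos_family_of:
  assumes "1 \<le> i" "i \<le> d" "1 \<le> t" "t \<le> m - m'"
  shows "pos r (family_of s (i, t)) = s (m + 1 + i - t) i" "family_of s (i, t) \<in> letters r"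
proof -
  have "s (m + 1 + i - t) \<in> states" using assms m'_pos by (intro path_states) auto
  then have "1 \<le> s (m + 1 + i - t) i \<and> s (m + 1 + i - t) i \<le> 2 * r + 1" by (rule states_bounds) (use assms in auto)
  then show "pos r (family_of s (i, t)) = s (m + 1 + i - t) i" "family_of s (i, t) \<in> letters r"
    unfolding family_of_apply[OF assms] by (auto intro: pos_letter_at letter_at_letters)
qed

lemma family_of_admissible: "family_of s \<in> admissible_families r m m' d"
proof -
  let ?k = "family_of s"
  have row: "letter_le r (?k (i, t)) (?k (i + 1, t)) \<and> (?k (i, t) = ?k (i + 1, t) \<longleftrightarrow> ?k (i, t) = Zero \<and> ?k (i + 1, t) = Zero)"
    if "t \<in> {1..m - m'}" "i \<in> {1..<d}" for i t
  proof -
    have it: "1 \<le> i" "i \<le> d" "1 \<le> t" "t \<le> m - m'" "1 \<le> i + 1" "i + 1 \<le> d" using that by auto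
    note p = pos_family_of[OF it(1-4)] pos_family_of[OF it(5,6,3,4)]
    have c: "m + 1 + (i + 1) - t = (m + 1 + i - t) + 1" using it by simp
    have "s (m + 1 + i - t) i \<in> targets (m + 1 + i - t) (s (m + 1 + i - t + 1)) i"
      by (rule path_targets) (use that it m'_pos in auto)
    then have or: "s (m + 1 + i - t) i < s (m + 1 + i - t + 1) (i + 1) \<or>
        s (m + 1 + i - t) i = r + 1 \<and> s (m + 1 + i - t + 1) (i + 1) = r + 1"
      using that by (auto simp: targets_def)
    have e: "?k (i, t) = ?k (i + 1, t) \<longleftrightarrow> pos r (?k (i, t)) = pos r (?k (i + 1, t))"
      using pos_eq_iff[OF p(2) p(4)] by simp
    have z: "?k (i, t) = Zero \<longleftrightarrow> pos r (?k (i, t)) = r + 1" "?k (i + 1, t) = Zero \<longleftrightarrow> pos r (?k (i + 1, t)) = r + 1"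
      using pos_zero_iff[OF p(2)] pos_zero_iff[OF p(4)] by simp_all
    show ?thesis unfolding e z letter_le_def p(1,3) c using or by auto
  qed
  have col: "letter_le r (?k (i, t)) (?k (i, t + 1))" if "t \<in> {1..<m - m'}" "i \<in> {1..d}" for i t
  proof -
    have it: "1 \<le> i" "i \<le> d" "1 \<le> t" "t \<le> m - m'" "1 \<le> t + 1" "t + 1 \<le> m - m'" using that by auto
    have "s (m + 1 + i - t) i \<le> s (m + 1 + i - (t + 1)) i"
      by (rule path_mono) (use it m'_pos in auto)
    then show ?thesis unfolding letter_le_def pos_family_of(1)[OF it(1-4)] pos_family_of(1)[OF it(1,2,5,6)] .
  qed
  have last: "letter_le r (?k (i, m - m')) (Unbarred (m' + i))" if "i \<in> {1..d}" "i \<le> r - m'" "m' < m" for i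
  proof -
    have it: "1 \<le> i" "i \<le> d" "1 \<le> m - m'" "m - m' \<le> m - m'" using that by auto
    have "s (m + 1 + i - (m - m')) i \<le> s (m' + i) i"
      by (rule path_mono) (use it m'_pos m'_le in auto)
    also have "\<dots> = final_row i" by (rule path_late) (use it m'_pos in auto)
    also have "\<dots> = m' + i" using that m'_le m_le by (auto simp: ext_rows_def)
    finally show ?thesis unfolding letter_le_def pos_family_of(1)[OF it] by simp
  qed
  have diag: "letter_less r (?k (i, t)) (?k (i + 1, t + 1))" if "t \<in> {1..<m - m'}" "i \<in> {1..<d}" for i t
  proof -
    have it: "1 \<le> i" "i \<le> d" "1 \<le> t" "t \<le> m - m'" "1 \<le> i + 1" "i + 1 \<le> d" "1 \<le> t + 1" "t + 1 \<le> m - m'" using that by auto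
    have c: "m + 1 + (i + 1) - (t + 1) = m + 1 + i - t" by simp
    have "s (m + 1 + i - t) i < s (m + 1 + i - t) (i + 1)"
      by (rule states_less[OF path_states]) (use that it m'_pos in auto)
    then show ?thesis
      unfolding letter_less_def pos_family_of(1)[OF it(1-4)] pos_family_of(1)[OF it(5-8)] c .
  qed
  have "?k \<in> ({1..d} \<times> {1..m - m'}) \<rightarrow>\<^sub>E letters r"
    using pos_family_of(2) by (intro PiE_I) (auto simp: family_of_def)
  then show ?thesis
    unfolding admissible_families_def mem_Collect_eq using row col last diag by auto
qed

lemma path_of_family_of: "path_of (family_of s) = s"
proof
  fix c
  show "path_of (family_of s) c = s c"
  proof (cases "c \<in> {2..m + d + 1}")
    case True
    then have c: "2 \<le> c" "c \<le> m + d + 1" by auto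
    have st: "s c \<in> PiE {1..d} (\<lambda>_. {1..2 * r + 1})" using path_states[OF c] by (simp add: states_def)
    show ?thesis
    proof
      fix i
      show "path_of (family_of s) c i = s c i"
      proof (cases "i \<in> {1..d}")
        case i: True
        then have i': "1 \<le> i" "i \<le> d" by auto
        define t where "t = m + 1 + i - c"
        have "extended (family_of s) i t = s c i"
        proof -
          consider "t = 0" | "m - m' < t" | "1 \<le> t" "t \<le> m - m'" by linarith
          then show ?thesis
          proof cases
            case 1
            then show ?thesis using path_early[OF i', of c] c by (simp add: t_def extended_def)
          next
            case 2
            then have "c \<le> m' + i" by (simp add: t_def)
            then show ?thesis using path_late[OF i', of c] c 2 by (simp add: extended_def)
          next
            case 3
            then have "m + 1 + i - t = c" by (simp add: t_def)
            then show ?thesis using pos_family_of(1)[OF i' 3] 3 by (simp add: extended_def)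
          qed
        qed
        then show ?thesis using True i by (simp add: path_of_def t_def)
      next
        case False
        then show ?thesis using True st by (auto simp: path_of_def PiE_def extensional_def)
      qed
    qed
  next
    case False
    then show ?thesis using s by (auto simp: path_of_def paths_def PiE_def extensional_def)
  qed
qed

end

end

section \<open>Weights of paths\<close>

context cyclic_minor
begin

text \<open>The product of the variables that the \<open>i\<close>-th particle collects, in the denominator,
  while it rests at a barred final position; the \<open>(i + 1)\<close>-st particle collects the same
  variables in the numerator.\<close>

definition telescope :: "nat \<Rightarrow> complex" where
  "telescope i = (\<Prod>l\<in>{1..<m' + i + 1 - r}. yv l (d - i))"

lemma telescope_nonzero: "i \<le> d \<Longrightarrow> telescope i \<noteq> 0"
  unfolding telescope_def
proof (subst prod_zero_iff)
  assume i: "i \<le> d"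
  show "\<not> (\<exists>l\<in>{1..<m' + i + 1 - r}. yv l (d - i) = 0)"
  proof
    assume "\<exists>l\<in>{1..<m' + i + 1 - r}. yv l (d - i) = 0"
    then obtain l where l: "1 \<le> l" "l < m' + i + 1 - r" "yv l (d - i) = 0" by auto
    have "yv l (d - i) \<noteq> 0" by (rule yv_nonzero) (use l i d_less m'_le m_le in auto)
    then show False using l by simp
  qed
qed simp

lemma telescope_prod: "j \<le> d \<Longrightarrow> (\<Prod>i\<in>{1..j}. telescope (i - 1) / telescope i) = telescope 0 / telescope j"
proof (induction j)
  case 0
  then show ?case using telescope_nonzero[of 0] by simp
next
  case (Suc j)
  have "{1..Suc j} = insert (Suc j) {1..j}" by auto
  then show ?case using Suc telescope_nonzero[of j] by simp
qed

lemma telescope_ends: "telescope 0 / telescope d = 1"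
proof -
  have "m' + 0 + 1 - r \<le> 1" using m'_le m_le by simp
  then have "telescope 0 = 1" by (simp add: telescope_def)
  moreover have "telescope d = 1" by (simp add: telescope_def)
  ultimately show ?thesis by simp
qed

text \<open>Both products are empty as long as the antidiagonal does not reach the final position, that is
  for \<open>N \<le> r\<close>.\<close>

lemma idle_weight:
  assumes i: "1 \<le> i" "i \<le> d" and N: "1 \<le> N" "N \<le> m' + i"
  shows "(\<Prod>c\<in>{2..N}. leave (c - 1) (final_row i) * arrive c (final_row i)) =
    (\<Prod>l\<in>{1..<N - r}. yv l (d - i + 1)) / (\<Prod>l\<in>{1..<N + 1 - r}. yv l (d - i))"
  using N
proof (induction N rule: dec_induct)
  case base
  have "(1::nat) - r = 0" "1 + 1 - r \<le> 1" using d_less d_pos by auto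
  then show ?case by simp
next
  case (step N)
  let ?q = "final_row i"
  have s: "{2..Suc N} = insert (Suc N) {2..N}" using step by auto
  have IH: "(\<Prod>c\<in>{2..N}. leave (c - 1) ?q * arrive c ?q) =
      (\<Prod>l\<in>{1..<N - r}. yv l (d - i + 1)) / (\<Prod>l\<in>{1..<N + 1 - r}. yv l (d - i))"
    using step by simp
  have P: "(\<Prod>c\<in>{2..Suc N}. leave (c - 1) ?q * arrive c ?q) =
      leave N ?q * arrive (Suc N) ?q * ((\<Prod>l\<in>{1..<N - r}. yv l (d - i + 1)) / (\<Prod>l\<in>{1..<N + 1 - r}. yv l (d - i)))"
    unfolding s IH[symmetric] by simp
  have qN: "Suc N \<le> r \<Longrightarrow> Suc N \<le> ?q" using step i d_less by (auto simp: ext_rows_def)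
  consider "Suc N \<le> r" | "Suc N = r + 1" | "r + 2 \<le> Suc N" by linarith
  then show ?case
  proof cases
    case 1
    then have "arrive (Suc N) ?q = 1" "leave N ?q = 1"
      using qN by (auto simp: arrive_def leave_def highest_def)
    moreover have e: "N - r = 0" "N + 1 - r \<le> 1" "Suc N - r = 0" "Suc N + 1 - r \<le> 1" using 1 by auto
    ultimately show ?thesis unfolding P by simp
  next
    case 2
    then have q: "?q = 2 * r + 1 - d + i" using step by (auto simp: ext_rows_def)
    have "lowest (Suc N) \<le> d" by (rule lowest_bounds) (use step i m'_le in auto)
    then have "arrive (Suc N) ?q = arrive_raw (Suc N) ?q" using 2 q i d_less by (auto simp: arrive_def highest_def)
    moreover have "2 * r + 1 - ?q = d - i" "r + 1 < ?q" using q i d_less by auto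
    moreover have "leave N ?q = 1" using 2 \<open>r + 1 < ?q\<close> by (auto simp: leave_def highest_def)
    moreover have "Suc N - r = 1" "N - r = 0" "N + 1 - r = 1" "{1..<Suc N + 1 - r} = {1}" using 2 by auto
    ultimately show ?thesis unfolding P by (simp add: arrive_raw_def)
  next
    case 3
    then have q: "?q = 2 * r + 1 - d + i" using step by (auto simp: ext_rows_def)
    have "lowest (Suc N) \<le> d" "lowest N \<le> d" by (rule lowest_bounds; use step i m'_le in auto)+
    then have "arrive (Suc N) ?q = arrive_raw (Suc N) ?q" "leave N ?q = leave_raw N ?q"
      using 3 q i d_less by (auto simp: arrive_def leave_def highest_def)
    moreover have "2 * r + 1 - ?q = d - i" "2 * r + 2 - ?q = d - i + 1" "r + 2 < ?q" using q i d_less by auto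
    moreover have "{1..<Suc N - r} = insert (N - r) {1..<N - r}" "{1..<Suc N + 1 - r} = insert (Suc N - r) {1..<N + 1 - r}"
      using 3 by auto
    moreover have "N - r \<notin> {1..<N - r}" "Suc N - r \<notin> {1..<N + 1 - r}" by auto
    ultimately show ?thesis unfolding P by (simp add: arrive_raw_def leave_raw_def)
  qed
qed

lemma idle_weight_telescope:
  assumes i: "1 \<le> i" "i \<le> d"
  shows "(\<Prod>c\<in>{2..m' + i}. leave (c - 1) (final_row i) * arrive c (final_row i)) = telescope (i - 1) / telescope i"
proof -
  have e: "m' + (i - 1) + 1 - r = m' + i - r" "d - (i - 1) = d - i + 1" using i by auto
  show ?thesis unfolding telescope_def e by (rule idle_weight) (use i in auto)
qed

context
  fixes k assumes k: "k \<in> admissible_families r m m' d"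
begin

text \<open>The case distinctions in \<open>B\<close> and in the shift of its index are those of the
  parameters of the factors acting at the position of the letter.\<close>

lemma letter_weight:
  assumes i: "1 \<le> i" "i \<le> d" "1 \<le> t" "t \<le> m - m'"
  defines "c \<equiv> m + 1 + i - t" and "l \<equiv> k (i, t)"
  shows "leave (c - 1) (pos r l) * arrive c (pos r l) = Bmon r Y (int m - lshift r l i t) l"
proof -
  define p where "p = pos r l"
  have l: "l \<in> letters r" unfolding l_def by (rule family_letter[OF k i])
  have p: "i \<le> p" "p \<le> final_row i" unfolding p_def l_def using family_ge[OF k i] family_le[OF k i] by auto
  have c: "m' + 1 + i \<le> c" "c \<le> m + i" "int c = int m + 1 + int i - int t" using i m'_le by (auto simp: c_def)
  have lowc: "lowest c \<le> i" using i by (auto simp: lowest_def c_def)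
  show ?thesis
  proof (cases "p \<le> r")
    case True
    then have lp: "l = Unbarred p" "1 \<le> p" using l by (auto simp: p_def letters_def)
    have pc: "p < c" using True p c by (auto simp: ext_rows_def split: if_splits)
    have ar: "arrive c p = arrive_raw c p"
      using lowc p pc True by (auto simp: arrive_def highest_def)
    have le: "leave (c - 1) p = yv (c - p) (p - 1)"
    proof (cases "p \<le> lowest (c - 1)")
      case True
      then have "p = 1" using p(1) lp(2) i c by (auto simp: lowest_def c_def max_def split: if_splits)
      then show ?thesis using lowest_bounds(1)[of "c - 1"] by (simp add: leave_def)
    next
      case False
      have "\<not> highest (c - 1) < p" using pc True by (auto simp: highest_def)
      moreover have "c - 1 + 1 - p = c - p" using pc by simp
      ultimately show ?thesis using False True by (simp add: leave_def leave_raw_def)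
    qed
    have L: "int m - lshift r l i t = int (c - p)" using pc c by (simp add: lp(1) of_nat_diff)
    show ?thesis
      unfolding p_def[symmetric] unfolding L le ar unfolding lp(1) Bmon.simps
      using True by (auto simp: arrive_raw_def yv_def)
  next
    case False
    then have mi: "\<not> m' + i \<le> r" using p by (auto simp: ext_rows_def split: if_splits)
    then have cr: "r + 2 \<le> c" using c by simp
    have lows: "lowest c < r" "lowest (c - 1) < r" using lowc i d_less by (auto simp: lowest_def)
    have p2: "p \<le> 2 * r + 1" using pos_bounds[OF l] by (simp add: p_def)
    have ar: "arrive c p = arrive_raw c p" using lows False cr p2 by (auto simp: arrive_def highest_def)
    have le: "leave (c - 1) p = leave_raw (c - 1) p" using lows False cr p2 by (auto simp: leave_def highest_def)
    have L: "int m - (int t - int i + int r) = int (c - 1 - r)" "int (c - 1 - r) + 1 = int (c - r)" using c cr by auto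
    from l False show ?thesis
    proof (cases l)
      case (Unbarred q)
      then show ?thesis using l False by (auto simp: p_def letters_def)
    next
      case Zero
      then have "p = r + 1" by (simp add: p_def)
      then show ?thesis unfolding p_def[symmetric] le ar unfolding Zero lshift.simps L(1) Bmon.simps L(2)
        by (simp add: arrive_raw_def leave_raw_def yv_def)
    next
      case (Barred q)
      then have q: "1 \<le> q" "q \<le> r" using l by (auto simp: letters_def)
      have pq: "p = 2 * r + 2 - q" using Barred by (simp add: p_def)
      then have e: "2 * r + 1 - p = q - 1" "2 * r + 2 - p = q" "r + 1 < p" "p = r + 2 \<longleftrightarrow> q = r" using q by auto
      have "leave_raw (c - 1) p = (if q = r then yv (c - 1 - r) r ^ 2 else yv (c - 1 - r) q)"
        unfolding leave_raw_def using e by auto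
      moreover have "arrive_raw c p = 1 / yv (c - r) (q - 1)"
        unfolding arrive_raw_def e(1) using e(3) by auto
      ultimately show ?thesis unfolding p_def[symmetric] le ar unfolding Barred lshift.simps L(1) Bmon.simps L(2)
        by (simp add: yv_def)
    qed
  qed
qed

text \<open>The factor for leaving a position is moved to the step by which it was reached. The steps then
  fall into three groups: at rest at the start, moving, and at rest at the end.\<close>

lemma particle_weight:
  assumes i: "1 \<le> i" "i \<le> d"
  shows "(\<Prod>c\<in>{2..m + d}. leave c (path_of k (c + 1) i) * arrive c (path_of k c i)) =
    (\<Prod>t\<in>{1..m - m'}. Bmon r Y (int m - lshift r (k (i, t)) i t) (k (i, t))) * (telescope (i - 1) / telescope i)"
proof -
  let ?x = "\<lambda>c. path_of k c i"
  let ?g = "\<lambda>c. leave (c - 1) (?x c) * arrive c (?x c)"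
  have x: "?x c = extended k i (m + 1 + i - c)" if "2 \<le> c" "c \<le> m + d + 1" for c
    by (rule path_of_apply[OF k that i])
  have early: "?x c = i" if "m + i + 1 \<le> c" "c \<le> m + d + 1" for c using x[of c] that m'_pos m'_le by (simp add: extended_def)
  have late: "?x c = final_row i" if "2 \<le> c" "c \<le> m' + i" for c
  proof -
    have "m - m' < m + 1 + i - c" using that m'_le by linarith
    then show ?thesis using x[of c] that i m'_le by (simp add: extended_def)
  qed
  have lv: "(\<Prod>c\<in>{2..m + d}. leave c (?x (c + 1))) = (\<Prod>c\<in>{2..m + d + 1}. leave (c - 1) (?x c))"
  proof -
    have "(\<Prod>c\<in>{2..m + d}. leave c (?x (c + 1))) = (\<Prod>c\<in>{3..m + d + 1}. leave (c - 1) (?x c))"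
      using prod.shift_bounds_cl_Suc_ivl[of "\<lambda>c. leave (c - 1) (?x c)" 2 "m + d"] by (simp add: numeral_3_eq_3)
    also have "\<dots> = (\<Prod>c\<in>{2..m + d + 1}. leave (c - 1) (?x c))"
    proof (rule prod.mono_neutral_left)
      show "\<forall>c\<in>{2..m + d + 1} - {3..m + d + 1}. leave (c - 1) (?x c) = 1"
      proof
        fix c assume "c \<in> {2..m + d + 1} - {3..m + d + 1}"
        then have "c - 1 = 1" by auto
        moreover have "leave 1 p = 1" for p using d_less d_pos by (auto simp: leave_def lowest_def highest_def)
        ultimately show "leave (c - 1) (?x c) = 1" by simp
      qed
    qed auto
    finally show ?thesis .
  qed
  have ar: "(\<Prod>c\<in>{2..m + d}. arrive c (?x c)) = (\<Prod>c\<in>{2..m + d + 1}. arrive c (?x c))"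
  proof (rule prod.mono_neutral_left)
    show "\<forall>c\<in>{2..m + d + 1} - {2..m + d}. arrive c (?x c) = 1"
    proof
      fix c assume "c \<in> {2..m + d + 1} - {2..m + d}"
      then have "c = m + d + 1" by auto
      then show "arrive c (?x c) = 1" using early[of c] i by (simp add: arrive_def lowest_def)
    qed
  qed auto
  have split: "{2..m + d + 1} = {2..m' + i} \<union> ({m' + i + 1..m + i} \<union> {m + i + 1..m + d + 1})"
    using i m'_pos m'_le by auto
  have "(\<Prod>c\<in>{2..m + d}. leave c (?x (c + 1)) * arrive c (?x c)) = prod ?g {2..m + d + 1}"
    unfolding prod.distrib lv ar ..
  also have "\<dots> = prod ?g {2..m' + i} * (prod ?g {m' + i + 1..m + i} * prod ?g {m + i + 1..m + d + 1})"
    unfolding split using m'_le by (subst prod.union_disjoint, simp, simp, force, subst prod.union_disjoint) auto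
  also have "prod ?g {2..m' + i} = telescope (i - 1) / telescope i"
    unfolding idle_weight_telescope[OF i, symmetric] by (intro prod.cong refl) (simp add: late)
  also have "prod ?g {m + i + 1..m + d + 1} = 1"
  proof (rule prod.neutral, rule ballI)
    fix c assume "c \<in> {m + i + 1..m + d + 1}"
    then show "?g c = 1" using early[of c] by (auto simp: leave_def arrive_def lowest_def)
  qed
  also have "prod ?g {m' + i + 1..m + i} = (\<Prod>t\<in>{1..m - m'}. Bmon r Y (int m - lshift r (k (i, t)) i t) (k (i, t)))"
  proof (rule prod.reindex_bij_witness[of _ "\<lambda>t. m + 1 + i - t" "\<lambda>c. m + 1 + i - c"])
    fix c assume "c \<in> {m' + i + 1..m + i}"
    then have c: "m' + i + 1 \<le> c" "c \<le> m + i" by auto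
    define t where "t = m + 1 + i - c"
    have t: "1 \<le> t" "t \<le> m - m'" "m + 1 + i - t = c" using c by (auto simp: t_def)
    have "?x c = extended k i t" unfolding t_def by (rule x) (use c i m'_pos in auto)
    then have "?x c = pos r (k (i, t))" using t by (simp add: extended_def)
    then show "Bmon r Y (int m - lshift r (k (i, m + 1 + i - c)) i (m + 1 + i - c)) (k (i, m + 1 + i - c)) = ?g c"
      using letter_weight[OF i t(1,2)] unfolding t_def[symmetric] t(3) by simp
  qed (use m'_le in auto)
  finally show ?thesis by simp
qed

lemma extended_zero_iff:
  "1 \<le> i \<Longrightarrow> i \<le> d \<Longrightarrow> extended k i t = r + 1 \<longleftrightarrow> 1 \<le> t \<and> t \<le> m - m' \<and> k (i, t) = Zero"
  using final_row_bounds[of i] d_less pos_zero_iff[OF family_letter[OF k], of i t] by (auto simp: extended_def)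

text \<open>The first particle never visits the position \<open>r + 1\<close>, and every other particle leaves it at most once.\<close>

lemma zero_weight:
  "(\<Prod>c\<in>{2..m + d}. \<Prod>i\<in>{1..d}. zero_factor (path_of k (c + 1)) i (path_of k c i)) = 2 ^ C_exp m m' d k"
proof -
  let ?x = "path_of k" and ?z = "r + 1"
  \<comment> \<open>The particle \<open>j + 1\<close> leaves position \<open>r + 1\<close> in step \<open>c\<close> without being pushed out by particle \<open>j\<close>.\<close>
  let ?E = "\<lambda>c j. ?x (c + 1) (j + 1) = ?z \<and> ?x c (j + 1) \<noteq> ?z \<and> ?x c j \<noteq> ?z"
  have P: "?x \<in> particle_paths" by (rule path_of_in_paths[OF k])
  have x: "?x c i = extended k i (m + 1 + i - c)" if "2 \<le> c" "c \<le> m + d + 1" "1 \<le> i" "i \<le> d" for c i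
    by (rule path_of_apply[OF k that])
  have first: "?x c 1 \<noteq> ?z" if c: "2 \<le> c" "c \<le> m + d + 1" for c
  proof
    assume "?x c 1 = ?z"
    then have z: "extended k 1 (m + 1 + 1 - c) = ?z" using x[OF c, of 1] d_pos by simp
    then have "m' < m" using extended_zero_iff[of 1 "m + 1 + 1 - c"] d_pos by auto
    then have "final_row 1 \<le> r" using m_le by (auto simp: ext_rows_def)
    then show False using extended_bounds[OF k, of 1 "m + 1 + 1 - c"] z d_pos by simp
  qed
  have row: "(\<Prod>i\<in>{1..d}. zero_factor (?x (c + 1)) i (?x c i)) = (\<Prod>j\<in>{1..<d}. if ?E c j then 2 else 1)"
    if c: "2 \<le> c" "c \<le> m + d" for c
  proof -
    let ?lv = "\<lambda>i. (if ?x (c + 1) i = ?z \<and> ?x c i \<noteq> ?z then 2 else 1) :: complex"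
    let ?pu = "\<lambda>i. (if ?x c i = ?z \<and> i < d \<and> ?x (c + 1) (i + 1) = ?z then 1 / 2 else 1) :: complex"
    have "(\<Prod>i\<in>{1..d}. ?lv i) = ?lv 1 * (\<Prod>i\<in>{Suc 1..d}. ?lv i)"
      by (rule prod.atLeast_Suc_atMost[OF d_pos])
    also have "\<dots> = (\<Prod>i\<in>{Suc 1..<Suc d}. ?lv i)"
      using first[of "c + 1"] c by (simp add: atLeastLessThanSuc_atLeastAtMost)
    also have "\<dots> = (\<Prod>j\<in>{1..<d}. ?lv (Suc j))" by (rule prod.shift_bounds_Suc_ivl)
    finally have l: "(\<Prod>i\<in>{1..d}. ?lv i) = (\<Prod>j\<in>{1..<d}. ?lv (Suc j))" .
    have "{1..d} = insert d {1..<d}" using d_pos by auto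
    then have p: "(\<Prod>i\<in>{1..d}. ?pu i) = (\<Prod>j\<in>{1..<d}. ?pu j)" by simp
    have "(\<Prod>i\<in>{1..d}. zero_factor (?x (c + 1)) i (?x c i)) = (\<Prod>j\<in>{1..<d}. ?lv (Suc j) * ?pu j)"
      unfolding zero_factor_def prod.distrib l p ..
    also have "\<dots> = (\<Prod>j\<in>{1..<d}. if ?E c j then 2 else 1)"
    proof (intro prod.cong refl)
      fix j assume j: "j \<in> {1..<d}"
      then have "?x c j < ?x c (j + 1)" using states_less[OF path_states[OF P, of c]] c by auto
      then show "?lv (Suc j) * ?pu j = (if ?E c j then 2 else 1)" using j by auto
    qed
    finally show ?thesis .
  qed
  have col: "(\<Prod>c\<in>{2..m + d}. if ?E c j then 2 else 1 :: complex) = (if \<exists>c\<in>{2..m + d}. ?E c j then 2 else 1)"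
    if j: "j \<in> {1..<d}" for j
  proof (cases "\<exists>c\<in>{2..m + d}. ?E c j")
    case True
    then obtain c where c: "c \<in> {2..m + d}" "?E c j" by blast
    have late: "\<not> (?E b j \<and> ?E b' j)" if "2 \<le> b" "b < b'" "b' \<le> m + d" for b b'
    proof
      assume E: "?E b j \<and> ?E b' j"
      have "?x (b' + 1) (j + 1) \<le> ?x b' (j + 1)" by (rule path_mono[OF P]) (use that j in auto)
      moreover have "?x b' (j + 1) \<le> ?x (b + 1) (j + 1)" by (rule path_mono[OF P]) (use that j in auto)
      ultimately show False using E by auto
    qed
    have "\<not> ?E b j" if "b \<in> {2..m + d} - {c}" for b
      using late[of b c] late[of c b] that c by (cases b c rule: linorder_cases) auto
    then have "(\<Prod>b\<in>{2..m + d} - {c}. if ?E b j then 2 else 1 :: complex) = 1" by (intro prod.neutral) auto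
    moreover have "(\<Prod>b\<in>{2..m + d}. if ?E b j then 2 else 1 :: complex) =
        (if ?E c j then 2 else 1) * (\<Prod>b\<in>{2..m + d} - {c}. if ?E b j then 2 else 1)"
      by (rule prod.remove) (use c in auto)
    ultimately show ?thesis using c(2) True by simp
  next
    case False
    then show ?thesis by (simp add: prod.neutral)
  qed
  have ev: "(\<exists>c\<in>{2..m + d}. ?E c j) \<longleftrightarrow> (\<exists>t\<in>{1..m - m'}. k (j + 1, t) = Zero \<and>
      (t < m - m' \<longrightarrow> k (j + 1, t + 1) \<noteq> Zero) \<and> k (j, t) \<noteq> Zero)" if j: "j \<in> {1..<d}" for j
  proof -
    have E: "?E c j \<longleftrightarrow> t \<in> {1..m - m'} \<and> k (j + 1, t) = Zero \<and> (t < m - m' \<longrightarrow> k (j + 1, t + 1) \<noteq> Zero) \<and> k (j, t) \<noteq> Zero"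
      if c: "2 \<le> c" "c \<le> m + d" "t = m + 1 + j - c" for c t
    proof -
      have "?x (c + 1) (j + 1) = extended k (j + 1) t" "?x c j = extended k j t"
        using x[of "c + 1" "j + 1"] x[of c j] c j by auto
      moreover have "?x c (j + 1) = extended k (j + 1) (t + 1)" if "1 \<le> t"
      proof -
        have "m + 1 + (j + 1) - c = t + 1" using that c by auto
        then show ?thesis using x[of c "j + 1"] c j by simp
      qed
      moreover have "extended k (j + 1) t = ?z \<longleftrightarrow> 1 \<le> t \<and> t \<le> m - m' \<and> k (j + 1, t) = Zero"
        by (rule extended_zero_iff) (use j in auto)
      moreover have "extended k j t = ?z \<longleftrightarrow> 1 \<le> t \<and> t \<le> m - m' \<and> k (j, t) = Zero"
        by (rule extended_zero_iff) (use j in auto)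
      moreover have "extended k (j + 1) (t + 1) = ?z \<longleftrightarrow> t + 1 \<le> m - m' \<and> k (j + 1, t + 1) = Zero"
        using extended_zero_iff[of "j + 1" "t + 1"] j by auto
      ultimately show ?thesis by auto
    qed
    show ?thesis
    proof
      assume "\<exists>c\<in>{2..m + d}. ?E c j"
      then obtain c where "2 \<le> c" "c \<le> m + d" "?E c j" by auto
      then show "\<exists>t\<in>{1..m - m'}. k (j + 1, t) = Zero \<and> (t < m - m' \<longrightarrow> k (j + 1, t + 1) \<noteq> Zero) \<and> k (j, t) \<noteq> Zero"
        using E[of c "m + 1 + j - c"] by blast
    next
      assume "\<exists>t\<in>{1..m - m'}. k (j + 1, t) = Zero \<and> (t < m - m' \<longrightarrow> k (j + 1, t + 1) \<noteq> Zero) \<and> k (j, t) \<noteq> Zero"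
      then obtain t where t: "t \<in> {1..m - m'}" "k (j + 1, t) = Zero" "t < m - m' \<longrightarrow> k (j + 1, t + 1) \<noteq> Zero" "k (j, t) \<noteq> Zero"
        by blast
      have c: "2 \<le> m + 1 + j - t" "m + 1 + j - t \<le> m + d" "t = m + 1 + j - (m + 1 + j - t)"
        using t(1) j m'_pos m'_le by auto
      have "?E (m + 1 + j - t) j" unfolding E[OF c] using t by simp
      then show "\<exists>c\<in>{2..m + d}. ?E c j" using c(1,2) by (intro bexI[of _ "m + 1 + j - t"]) auto
    qed
  qed
  let ?S = "{j \<in> {1..d - 1}. \<exists>t\<in>{1..m - m'}. k (j + 1, t) = Zero \<and> (t < m - m' \<longrightarrow> k (j + 1, t + 1) \<noteq> Zero) \<and> k (j, t) \<noteq> Zero}"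
  have "(\<Prod>c\<in>{2..m + d}. \<Prod>i\<in>{1..d}. zero_factor (?x (c + 1)) i (?x c i)) = (\<Prod>c\<in>{2..m + d}. \<Prod>j\<in>{1..<d}. if ?E c j then 2 else 1)"
    by (intro prod.cong refl row) auto
  also have "\<dots> = (\<Prod>j\<in>{1..<d}. \<Prod>c\<in>{2..m + d}. if ?E c j then 2 else 1)" by (rule prod.swap)
  also have "\<dots> = (\<Prod>j\<in>{1..<d}. if j \<in> ?S then 2 else 1)"
  proof (intro prod.cong refl)
    fix j assume j: "j \<in> {1..<d}"
    then have "j \<in> {1..d - 1}" by auto
    then have "(\<exists>c\<in>{2..m + d}. ?E c j) \<longleftrightarrow> j \<in> ?S" unfolding ev[OF j] by blast
    then show "(\<Prod>c\<in>{2..m + d}. if ?E c j then 2 else 1 :: complex) = (if j \<in> ?S then 2 else 1)" unfolding col[OF j] by presburger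
  qed
  also have "\<dots> = (\<Prod>j\<in>?S. 2)"
    by (rule prod.mono_neutral_cong_right) auto
  also have "\<dots> = 2 ^ C_exp m m' d k" by (simp only: prod_constant C_exp_def)
  finally show ?thesis .
qed

lemma path_weight:
  "(\<Prod>c\<in>{2..m + d}. move_weight c (path_of k (c + 1)) (path_of k c)) =
    2 ^ C_exp m m' d k * (\<Prod>i = 1..d. \<Prod>t = 1..m - m'. Bmon r Y (int m - lshift r (k (i, t)) i t) (k (i, t)))"
proof -
  let ?x = "path_of k"
  have "(\<Prod>c\<in>{2..m + d}. move_weight c (?x (c + 1)) (?x c)) =
      (\<Prod>c\<in>{2..m + d}. \<Prod>i\<in>{1..d}. leave c (?x (c + 1) i) * arrive c (?x c i)) *
      (\<Prod>c\<in>{2..m + d}. \<Prod>i\<in>{1..d}. zero_factor (?x (c + 1)) i (?x c i))"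
    unfolding move_weight_def by (simp only: prod.distrib)
  also have "(\<Prod>c\<in>{2..m + d}. \<Prod>i\<in>{1..d}. leave c (?x (c + 1) i) * arrive c (?x c i)) =
      (\<Prod>i\<in>{1..d}. \<Prod>c\<in>{2..m + d}. leave c (?x (c + 1) i) * arrive c (?x c i))"
    by (rule prod.swap)
  also have "\<dots> = (\<Prod>i\<in>{1..d}. (\<Prod>t\<in>{1..m - m'}. Bmon r Y (int m - lshift r (k (i, t)) i t) (k (i, t))) * (telescope (i - 1) / telescope i))"
    by (intro prod.cong refl particle_weight) auto
  also have "\<dots> = (\<Prod>i\<in>{1..d}. \<Prod>t\<in>{1..m - m'}. Bmon r Y (int m - lshift r (k (i, t)) i t) (k (i, t)))"
    unfolding prod.distrib telescope_prod[OF order_refl] telescope_ends by (rule mult_1_right)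
  finally show ?thesis unfolding zero_weight by (simp only: mult.commute)
qed

end

lemma minor_eq_family_sum:
  "psi d (ext_rows r d m') (\<lambda>i. vw r (minus_factors (cyc_letters m d)) (delta i)) =
    (\<Sum>k \<in> admissible_families r m m' d. 2 ^ C_exp m m' d k *
      (\<Prod>i = 1..d. \<Prod>t = 1..m - m'. Bmon r Y (int m - lshift r (k (i, t)) i t) (k (i, t))))"
  unfolding minor_eq_path_sum
proof (rule sum.reindex_bij_witness[of _ path_of family_of])
  fix s assume s: "s \<in> particle_paths"
  have f: "family_of s \<in> admissible_families r m m' d" by (rule family_of_admissible[OF s])
  show "path_of (family_of s) = s" by (rule path_of_family_of[OF s])
  show "family_of s \<in> admissible_families r m m' d" by (rule f)
  show "2 ^ C_exp m m' d (family_of s) * (\<Prod>i = 1..d. \<Prod>t = 1..m - m'.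
      Bmon r Y (int m - lshift r (family_of s (i, t)) i t) (family_of s (i, t))) =
      (\<Prod>c\<in>{2..m + d}. move_weight c (s (c + 1)) (s c))"
    using path_weight[OF f] unfolding path_of_family_of[OF s] by (rule sym)
next
  fix k assume k: "k \<in> admissible_families r m m' d"
  show "family_of (path_of k) = k" "path_of k \<in> particle_paths"
    by (rule family_of_path_of[OF k] path_of_in_paths[OF k])+
qed

end

section \<open>The formula\<close>

lemma length_cycles: "length (concat (replicate n [1..<r + 1])) = n * r"
  by (induction n) auto

lemma take_cyc_word:
  assumes "1 \<le> m'" "m' \<le> m" "d < r"
  shows "take ((m' - 1) * r + d) (cyc_word r m d) = cyc_word r m' d"
proof (cases "m' = m")
  case True
  then show ?thesis using length_cycles[of "m - 1" r] by (simp add: cyc_word_def del: upt_Suc)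
next
  case False
  then obtain n where n: "m - 1 = (m' - 1) + Suc n" using assms by (metis Suc_diff_1 add_diff_inverse_nat diff_less_mono le_antisym less_imp_add_positive linorder_not_le One_nat_def not_le add_Suc_right less_eq_Suc_le zero_less_diff)
  have "take d [1..<r + 1] = [1..<d + 1]" using assms by (subst take_upt) auto
  then show ?thesis
    unfolding cyc_word_def n replicate_add using length_cycles[of "m' - 1" r] assms by (simp del: upt_Suc)
qed

theorem theorem5p6:
  fixes G :: "(complex^'n^'n) set"
    and e f h :: "nat \<Rightarrow> complex^'n^'n"
    and r m m' d :: nat
    and Y :: "int \<Rightarrow> nat \<Rightarrow> complex"
  assumes "simple_algebraic_group G"
    and "simply_connected G"
    and "chevalley_generators_B r G e f h"
    and "1 \<le> m'" and "m' \<le> m" and "m \<le> r"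
    and "1 \<le> d" and "d < r"
    and "\<forall>(l, j) \<in> set (Y_indices r m d). Y l j \<noteq> 0"
  shows "DeltaL r G e f h ((m' - 1) * r + d) (cyc_word r m d)
           (map (\<lambda>(l, j). Y l j) (Y_indices r m d)) =
         (\<Sum>k \<in> admissible_families r m m' d.
            2 ^ C_exp m m' d k *
            (\<Prod>i = 1..d. \<Prod>s = 1..m - m'.
               Bmon r Y (int m - lshift r (k (i, s)) i s) (k (i, s))))"
proof -
  have "2 \<le> r" using assms(7,8) by simp
  then interpret chevalley_group r e f h G by (rule chevalley_groupI[OF assms(1,3)])
  interpret cyclic_minor r m m' d Y
  proof
    fix l j assume lj: "1 \<le> l" "l \<le> m" "1 \<le> j" "j \<le> r" "l = m \<Longrightarrow> j \<le> d"
    have "(int l, j) \<in> set (Y_indices r m d)"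
      using lj by (cases "l = m") (auto simp: Y_indices_def image_iff simp del: upt_Suc)
    then show "Y (int l) j \<noteq> 0" using assms(9) by blast
  qed (use assms in auto)
  let ?L = "cyc_letters m d" and ?js = "cyc_word r m' d"
  have L: "1 \<le> j \<and> j \<le> r" if "(l, j) \<in> set ?L" for l j
    using that d_less by (auto simp: cyc_letters_def)
  have word: "cyc_word r m d = map snd ?L"
  proof -
    have snoc: "concat (replicate (Suc n) w) = concat (replicate n w) @ w" for n and w :: "nat list"
      by (induction n) auto
    have "concat (replicate n w) = map snd (concat (map (\<lambda>l. map (Pair l) w) [1..<Suc n]))" for n and w :: "nat list"
    proof (induction n)
      case (Suc n)
      have u: "[1..<Suc (Suc n)] = [1..<Suc n] @ [Suc n]" by simp
      show ?case unfolding snoc u map_append concat_append Suc.IH by (simp add: o_def)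
    qed simp
    from this[of "m - 1" "[1..<r + 1]"] show ?thesis
      using assms(4,5) by (simp add: cyc_word_def cyc_letters_def o_def del: upt_Suc)
  qed
  have idx: "Y_indices r m d = map (\<lambda>(l, j). (int l, j)) ?L"
    by (simp add: Y_indices_def cyc_letters_def map_concat o_def del: upt_Suc)
  have js: "set ?js \<subseteq> {1..r}" using d_less by (auto simp: cyc_word_def)
  have "xL f h (cyc_word r m d) (map (\<lambda>(l, j). Y l j) (Y_indices r m d)) = gw (minus_factors ?L)"
  proof -
    have "map2 (x_minus f h) (map snd L) (map (\<lambda>(l, j). Y l j) (map (\<lambda>(l, j). (int l, j)) L)) =
        map (\<lambda>(l, j). x_minus f h j (Y (int l) j)) L" for L
      by (induction L) auto
    moreover have "mprod (map (\<lambda>(l, j). x_minus f h j (Y (int l) j)) L) = gw (minus_factors L)"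
      if "\<And>l j. (l, j) \<in> set L \<Longrightarrow> 1 \<le> j" for L
      using that
    proof (induction L)
      case Nil
      then show ?case by (simp add: minus_factors_def gw_def)
    next
      case (Cons p L)
      obtain l j where p: "p = (l, j)" by (cases p)
      have "yv l j = Y (int l) j" using Cons.prems[of l j] p by (simp add: yv_def Yv_def)
      then have "gw (minus_factors (p # L)) = x_minus f h j (Y (int l) j) ** gw (minus_factors L)"
        by (simp add: p minus_factors_def minus_word_def x_minus_def one_param_expt coroot_hom_expt matrix_mul_assoc)
      moreover have "mprod (map (\<lambda>(l, j). x_minus f h j (Y (int l) j)) L) = gw (minus_factors L)"
        by (rule Cons.IH) (use Cons.prems in auto)
      ultimately show ?case by (simp add: p mprod_def)
    qed
    ultimately show ?thesis using L unfolding xL_def word idx by simp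
  qed
  then have "DeltaL r G e f h ((m' - 1) * r + d) (cyc_word r m d) (map (\<lambda>(l, j). Y l j) (Y_indices r m d)) =
      gen_minor r G e f h ?js (cyc_word r m d ! ((m' - 1) * r + d - 1)) (gw (minus_factors ?L))"
    unfolding DeltaL_def Delta_def take_cyc_word[OF assms(4,5,8)] by simp
  also have "cyc_word r m d ! ((m' - 1) * r + d - 1) = d"
  proof -
    have "cyc_word r m d ! ((m' - 1) * r + d - 1) = take ((m' - 1) * r + d) (cyc_word r m d) ! ((m' - 1) * r + (d - 1))"
      using d_pos by simp
    also have "\<dots> = [1..<d + 1] ! (d - 1)"
      unfolding take_cyc_word[OF assms(4,5,8)] unfolding cyc_word_def
      by (simp only: nth_append length_cycles) simp
    also have "\<dots> = d" using d_pos by (subst nth_upt) auto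
    finally show ?thesis .
  qed
  also have "gen_minor r G e f h ?js d (gw (minus_factors ?L)) =
      psi d id (\<lambda>i. vw r (winv (lift_word ?js)) (vw r (minus_factors ?L) (delta i)))"
  proof (rule gen_minor_eq[OF d_pos d_less js])
    show "set (minus_factors ?L) \<subseteq> all_gens r"
      using L by (force simp: minus_factors_def minus_word_def all_gens_def)
  qed
  also have "\<dots> = psi d (ext_rows r d m') (\<lambda>i. vw r (minus_factors ?L) (delta i))"
  proof -
    have "set (lift_word ?js) \<subseteq> all_gens r" using lift_word_in[OF js] gens_subset by blast
    then have "vw r (lift_word ?js) (vw r (winv (lift_word ?js)) x) = x" for x by (rule vw_winv)
    then show ?thesis
      using psi_lift_cyc_word[of m' r d "\<lambda>i. vw r (winv (lift_word ?js)) (vw r (minus_factors ?L) (delta i))"]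
        m'_pos m'_le m_le d_pos d_less by simp
  qed
  also have "\<dots> = (\<Sum>k \<in> admissible_families r m m' d. 2 ^ C_exp m m' d k *
      (\<Prod>i = 1..d. \<Prod>s = 1..m - m'. Bmon r Y (int m - lshift r (k (i, s)) i s) (k (i, s))))"
    by (rule minor_eq_family_sum)
  finally show ?thesis .
qed

end
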